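(* Let $M$ be a matroid on a finite ground set. The following are equivalent. (i) $M$ is fully modular extendable. (ii) There exist finitely many projective spaces $\mathbb{P}_1,\dots,\mathbb{P}_q$ and a finite subset $S'$ of the ground set of the finitary matroid $M_{\mathbb{P}_1}\oplus\dots\oplus M_{\mathbb{P}_q}$ such that $\mathrm{si}(M)\cong (M_{\mathbb{P}_1}\oplus\dots\oplus M_{\mathbb{P}_q})|S'$. (iii) Each connected component of $M$ is either of rank $3$ or skew-representable (different components may be represented over different skew fields).
   Context: "Matroid" means a matroid on a finite ground set, written $M=(S,r)$ with rank function $r$. The simplification $\mathrm{si}(M)$ is obtained by deleting all loops and keeping exactly one element of each parallel class. The components of $M$ are the restrictions of $M$ to the classes of the relation "equal or contained in a common circuit". Modular extendability: for a matroid $M=(S,r)$ and $A,B\subseteq S$, a one-step extension of $M$ with respect to $A$ and $B$ is a matroid $M'=(S',r')$ with $S\subseteq S'$, $r'(X)=r(X)$ for all $X\subseteq S$, for which there is $Z\subseteq S'$ with $r'(A\cup Z)=r(A)$, $r'(B\cup Z)=r(B)$ and $r'(Z)=r(A)+r(B)-r(A\cup B)$. Every matroid is $0$-modular extendable. For $k\ge 1$, $M$ is $k$-modular extendable if for all $A,B\subseteq S$ there is a one-step extension of $M$ with respect to $A$ and $B$ that is $(k-1)$-modular extendable. $M$ is fully modular extendable if it is $k$-modular extendable for every positive integer $k$. Skew-representability: a matroid is representable over a skew field (division ring) $\mathbb{F}$ if there is a family of vectors in a right vector space over $\mathbb{F}$, indexed by the ground set, whose linear independence relation is the independence relation of the matroid.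 It is skew-representable if it is representable over some skew field. Projective spaces: a projective space is a pair $\mathbb{P}=(\mathcal{P},\mathcal{L})$, where $\mathcal{P}$ is a (possibly infinite) set of points and $\mathcal{L}\subseteq 2^{\mathcal{P}}$ is a set of lines, such that: (P1) any two distinct lines have at most one common point; (P2) any two distinct points $p,q$ lie on exactly one line, denoted $\overline{pq}$; (P3) if $a,b,c,d$ are distinct points and the lines $\overline{ab}$ and $\overline{cd}$ intersect, then so do $\overline{ac}$ and $\overline{bd}$; (P4) every line contains at least three points. The degenerate case of a single point and no lines is allowed. A subspace is a set $W\subseteq \mathcal{P}$ containing $\overline{pq}$ for all distinct $p,q\in W$; $\langle T\rangle$ denotes the smallest subspace containing $T$. A finitary matroid is a matroid on a possibly infinite ground set in which a set is independent if and only if all its finite subsets are. $M_{\mathbb{P}}$ is the finitary matroid on $\mathcal{P}$ whose flats are exactly the subspaces of $\mathbb{P}$; its rank function is $T\mapsto \dim\langle T\rangle+1$, and $I\subseteq \mathcal{P}$ is independent iff $p\notin\langle I\setminus\{p\}\rangle$ for every $p\in I$. $\oplus$ denotes the direct sum of (finitary) matroids and $|S'$ the restriction to $S'$. *)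

theory Defs
  imports "HOL-Algebra.Module" "HOL-Library.Infinite_Typeclass"
begin

section \<open>Finite matroids given by rank functions\<close>

(* The rank function is only constrained on subsets of the ground set. *)
locale matroid =
  fixes S :: "'a set" and r :: "'a set \<Rightarrow> nat"
  assumes finite_ground: "finite S"
    and rank_le_card: "X \<subseteq> S \<Longrightarrow> r X \<le> card X"
    and rank_mono: "X \<subseteq> Y \<Longrightarrow> Y \<subseteq> S \<Longrightarrow> r X \<le> r Y"
    and rank_submodular:
      "X \<subseteq> S \<Longrightarrow> Y \<subseteq> S \<Longrightarrow> r (X \<union> Y) + r (X \<inter> Y) \<le> r X + r Y"

definition indep :: "'a set \<Rightarrow> ('a set \<Rightarrow> nat) \<Rightarrow> 'a set \<Rightarrow> bool" where
  "indep S r X \<longleftrightarrow> X \<subseteq> S \<and> r X = card X"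

definition circuit :: "'a set \<Rightarrow> ('a set \<Rightarrow> nat) \<Rightarrow> 'a set \<Rightarrow> bool" where
  "circuit S r C \<longleftrightarrow> C \<subseteq> S \<and> \<not> indep S r C \<and> (\<forall>D. D \<subset> C \<longrightarrow> indep S r D)"

(* The ground sets of the components; the component itself is the restriction (K, r). *)
definition components :: "'a set \<Rightarrow> ('a set \<Rightarrow> nat) \<Rightarrow> 'a set set" where
  "components S r =
     S // {(x, y) \<in> S \<times> S. x = y \<or> (\<exists>C. circuit S r C \<and> x \<in> C \<and> y \<in> C)}"

definition nonloops :: "'a set \<Rightarrow> ('a set \<Rightarrow> nat) \<Rightarrow> 'a set" where
  "nonloops S r = {x \<in> S. r {x} \<noteq> 0}"

definition parallel_classes :: "'a set \<Rightarrow> ('a set \<Rightarrow> nat) \<Rightarrow> 'a set set" where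
  "parallel_classes S r =
     nonloops S r // {(x, y) \<in> nonloops S r \<times> nonloops S r. r {x, y} = 1}"

(* The ground set of the simplification: one chosen representative of each parallel class.
   The simplification is the restriction (si_ground S r, r). *)
definition si_ground :: "'a set \<Rightarrow> ('a set \<Rightarrow> nat) \<Rightarrow> 'a set" where
  "si_ground S r = (\<lambda>C. SOME x. x \<in> C) ` parallel_classes S r"

section \<open>Modular extendability\<close>

(* The equation for the rank of Z is r'(Z) = r(A) + r(B) - r(A \<union> B), written without
   subtraction. *)
definition one_step_extension ::
    "'a set \<Rightarrow> ('a set \<Rightarrow> nat) \<Rightarrow> 'a set \<Rightarrow> 'a set \<Rightarrow> 'a set \<Rightarrow> ('a set \<Rightarrow> nat) \<Rightarrow> bool" where
  "one_step_extension S r A B S' r' \<longleftrightarrow>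
     matroid S' r' \<and> S \<subseteq> S' \<and> (\<forall>X\<subseteq>S. r' X = r X) \<and>
     (\<exists>Z\<subseteq>S'. r' (A \<union> Z) = r A \<and> r' (B \<union> Z) = r B \<and> r' Z + r (A \<union> B) = r A + r B)"

(* The type 'a serves as the universe from which the new elements of an extension are drawn.
   It has to be infinite: over a finite type a matroid might lack an extension merely for want
   of elements. As ground sets are finite, every infinite type is large enough. *)
primrec modular_extendable ::
    "nat \<Rightarrow> 'a::infinite set \<Rightarrow> ('a set \<Rightarrow> nat) \<Rightarrow> bool" where
  "modular_extendable 0 S r \<longleftrightarrow> True"
| "modular_extendable (Suc k) S r \<longleftrightarrow>
     (\<forall>A B. A \<subseteq> S \<longrightarrow> B \<subseteq> S \<longrightarrow>
       (\<exists>S' r'. one_step_extension S r A B S' r' \<and> modular_extendable k S' r'))"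

definition fully_modular_extendable :: "'a::infinite set \<Rightarrow> ('a set \<Rightarrow> nat) \<Rightarrow> bool" where
  "fully_modular_extendable S r \<longleftrightarrow> (\<forall>k\<ge>1. modular_extendable k S r)"

section \<open>Skew-representability\<close>

(* The zero ring is excluded, since zero is a unit there. *)
locale skew_field = ring R for R (structure) +
  assumes skew_field_Units: "Units R = carrier R - {\<zero>}"

(* Of V only the additive group is used; act v a is the product of the vector v by the
   scalar a on its right. *)
locale right_vector_space = R?: skew_field R + V?: abelian_group V
  for R (structure) and V (structure) +
  fixes act :: "'c \<Rightarrow> 'a \<Rightarrow> 'c"
  assumes act_closed: "\<lbrakk>v \<in> carrier V; a \<in> carrier R\<rbrakk> \<Longrightarrow> act v a \<in> carrier V"
    and act_add_scalar: "\<lbrakk>v \<in> carrier V; a \<in> carrier R; b \<in> carrier R\<rbrakk>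
      \<Longrightarrow> act v (a \<oplus>\<^bsub>R\<^esub> b) = act v a \<oplus>\<^bsub>V\<^esub> act v b"
    and act_add_vector: "\<lbrakk>v \<in> carrier V; w \<in> carrier V; a \<in> carrier R\<rbrakk>
      \<Longrightarrow> act (v \<oplus>\<^bsub>V\<^esub> w) a = act v a \<oplus>\<^bsub>V\<^esub> act w a"
    and act_assoc: "\<lbrakk>v \<in> carrier V; a \<in> carrier R; b \<in> carrier R\<rbrakk>
      \<Longrightarrow> act v (a \<otimes>\<^bsub>R\<^esub> b) = act (act v a) b"
    and act_one: "v \<in> carrier V \<Longrightarrow> act v \<one>\<^bsub>R\<^esub> = v"

(* Linear independence of the subfamily of f with finite index set X. *)
definition lin_indep_family ::
    "'f ring \<Rightarrow> 'v ring \<Rightarrow> ('v \<Rightarrow> 'f \<Rightarrow> 'v) \<Rightarrow> ('a \<Rightarrow> 'v) \<Rightarrow> 'a set \<Rightarrow> bool" where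
  "lin_indep_family R V act f X \<longleftrightarrow>
     (\<forall>c \<in> X \<rightarrow> carrier R.
        finsum V (\<lambda>x. act (f x) (c x)) X = \<zero>\<^bsub>V\<^esub> \<longrightarrow> (\<forall>x\<in>X. c x = \<zero>\<^bsub>R\<^esub>))"

definition representation_of ::
    "'f ring \<Rightarrow> 'v ring \<Rightarrow> ('v \<Rightarrow> 'f \<Rightarrow> 'v) \<Rightarrow> ('a \<Rightarrow> 'v) \<Rightarrow> 'a set \<Rightarrow> ('a set \<Rightarrow> nat) \<Rightarrow> bool" where
  "representation_of R V act f S r \<longleftrightarrow>
     f \<in> S \<rightarrow> carrier V \<and> (\<forall>X\<subseteq>S. indep S r X \<longleftrightarrow> lin_indep_family R V act f X)"

(* Scalars and vectors form carrier sets inside the types 'f and 'v, which serve as universes.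
   For a finite matroid every infinite type is large enough: the entries of a representation
   in coordinates generate a countable skew field. *)
definition representable_over ::
    "'v::infinite itself \<Rightarrow> 'f ring \<Rightarrow> 'a set \<Rightarrow> ('a set \<Rightarrow> nat) \<Rightarrow> bool" where
  "representable_over _ R S r \<longleftrightarrow>
     (\<exists>(V :: 'v ring) act f. right_vector_space R V act \<and> representation_of R V act f S r)"

definition skew_representable ::
    "'f::infinite itself \<Rightarrow> 'v::infinite itself \<Rightarrow> 'a set \<Rightarrow> ('a set \<Rightarrow> nat) \<Rightarrow> bool" where
  "skew_representable _ _ S r \<longleftrightarrow>
     (\<exists>R :: 'f ring. skew_field R \<and> representable_over TYPE('v) R S r)"

section \<open>Projective spaces\<close>

definition line_through :: "'p set set \<Rightarrow> 'p \<Rightarrow> 'p \<Rightarrow> 'p set" where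
  "line_through L p q = (THE l. l \<in> L \<and> p \<in> l \<and> q \<in> l)"

locale projective_space =
  fixes P :: "'p set" and L :: "'p set set"
  assumes lines_subset: "l \<in> L \<Longrightarrow> l \<subseteq> P"
    and P1: "\<lbrakk>l \<in> L; m \<in> L; l \<noteq> m; p \<in> l \<inter> m; q \<in> l \<inter> m\<rbrakk> \<Longrightarrow> p = q"
    and P2: "\<lbrakk>p \<in> P; q \<in> P; p \<noteq> q\<rbrakk> \<Longrightarrow> \<exists>!l. l \<in> L \<and> p \<in> l \<and> q \<in> l"
    and P3: "\<lbrakk>{a, b, c, d} \<subseteq> P; distinct [a, b, c, d];
              line_through L a b \<inter> line_through L c d \<noteq> {}\<rbrakk>
             \<Longrightarrow> line_through L a c \<inter> line_through L b d \<noteq> {}"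
    and P4: "l \<in> L \<Longrightarrow> \<exists>x y z. {x, y, z} \<subseteq> l \<and> distinct [x, y, z]"

definition proj_subspace :: "'p set \<Rightarrow> 'p set set \<Rightarrow> 'p set \<Rightarrow> bool" where
  "proj_subspace P L W \<longleftrightarrow>
     W \<subseteq> P \<and> (\<forall>p\<in>W. \<forall>q\<in>W. p \<noteq> q \<longrightarrow> line_through L p q \<subseteq> W)"

definition proj_span :: "'p set \<Rightarrow> 'p set set \<Rightarrow> 'p set \<Rightarrow> 'p set" where
  "proj_span P L T = \<Inter>{W. proj_subspace P L W \<and> T \<subseteq> W}"

section \<open>Finitary matroids\<close>

(* A finitary matroid is given by its ground set and its family of independent sets. *)
type_synonym 'a indep_matroid = "'a set \<times> 'a set set"

definition of_rank :: "'a set \<Rightarrow> ('a set \<Rightarrow> nat) \<Rightarrow> 'a indep_matroid" where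
  "of_rank S r = (S, {X. indep S r X})"

definition proj_matroid :: "'p set \<Rightarrow> 'p set set \<Rightarrow> 'p indep_matroid" where
  "proj_matroid P L = (P, {I. I \<subseteq> P \<and> (\<forall>p\<in>I. p \<notin> proj_span P L (I - {p}))})"

(* The ground sets are made disjoint by tagging elements with the index of their summand. *)
definition direct_sum :: "'i set \<Rightarrow> ('i \<Rightarrow> 'p indep_matroid) \<Rightarrow> ('i \<times> 'p) indep_matroid" where
  "direct_sum J N =
     (SIGMA i:J. fst (N i),
      {I. I \<subseteq> (SIGMA i:J. fst (N i)) \<and> (\<forall>i\<in>J. {p. (i, p) \<in> I} \<in> snd (N i))})"

definition restrict_to :: "'a indep_matroid \<Rightarrow> 'a set \<Rightarrow> 'a indep_matroid" where
  "restrict_to N T = (T, {I \<in> snd N. I \<subseteq> T})"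

definition isomorphic :: "'a indep_matroid \<Rightarrow> 'b indep_matroid \<Rightarrow> bool" where
  "isomorphic N N' \<longleftrightarrow>
     (\<exists>f. bij_betw f (fst N) (fst N') \<and>
          (\<forall>X\<subseteq>fst N. X \<in> snd N \<longleftrightarrow> f ` X \<in> snd N'))"

(* The point sets lie inside the type 'p, which serves as universe. They may be infinite; since
   only finitely many points matter, and these lie in a countable projective subgeometry,
   every infinite type is large enough. *)
definition projectively_embeddable ::
    "'p::infinite itself \<Rightarrow> 'a set \<Rightarrow> ('a set \<Rightarrow> nat) \<Rightarrow> bool" where
  "projectively_embeddable _ S r \<longleftrightarrow>
     (\<exists>(q::nat) (P :: nat \<Rightarrow> 'p set) L S'.
        (\<forall>i\<in>{1..q}. projective_space (P i) (L i)) \<and>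
        finite S' \<and> S' \<subseteq> fst (direct_sum {1..q} (\<lambda>i. proj_matroid (P i) (L i))) \<and>
        isomorphic (of_rank (si_ground S r) r)
          (restrict_to (direct_sum {1..q} (\<lambda>i. proj_matroid (P i) (L i))) S'))"

end

theory Submission
  imports "HOL-Combinatorics.Permutations" "HOL-Library.Countable_Set" Defs
begin

text \<open>
  From (i) to (ii): a minimal one-step extension adds at most as many elements as the rank, so up to renaming there are
  finitely many of them. Hence a fully modular extendable matroid has, for all \<open>A\<close> and \<open>B\<close>, a one-step
  extension that is again fully modular extendable, and a sequence of such extensions has as its union
  a countable matroid of the same rank in which every pair of flats is modular. Calling two points
  linked if they are equal or their line has a third point is an equivalence relation there; its
  classes are projective spaces, and every circuit of the simplification lies in one class.

  From (ii) to (iii): a component of rank at least four of a matroid embedded in projective spaces lies in a single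
  space of dimension at least three. Such a space is coordinatized following Artin: after removing
  a hyperplane \<open>H\<close>, the translations form an abelian group that is simply transitive on the remaining
  points, and the endomorphisms of this group that preserve all directions form a skew field.
  Desargues' theorem for non-coplanar triangles yields enough translations and homotheties.

  From (iii) to (i): modular extendability passes from the components to their direct sum, and the classes
  of matroids of rank at most three and of matroids representable over a given skew field are closed
  under suitable one-step extensions.
\<close>

section \<open>Matroids given by rank functions\<close>

text \<open>Rank three is exceptional because a projective plane need not satisfy Desargues'
  theorem: two lines of a rank three matroid can always be given a common point, and nothing forces
  coordinates. From rank four on, a component supplies four independent points, so the projective
  space that contains it has points outside every plane, and this makes Desargues' theorem a
  consequence of the axioms. Rank at most two is settled by hand with rational coordinates.

  The definition of modular extendability allows a different extension at every depth
  \<open>k\<close>, so an infinite sequence of extensions does not come for free; this is what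
  counting the extensions achieves. Keeping the rank constant along the sequence gives the limit a
  finite rank, and this bounds the number of its projective spaces.

  All objects live in prescribed infinite types. The points of the limit fit because the limit is
  countable. Coordinates arise as functions on points, so they are cut down to the countable skew
  field generated by finitely many coefficients before they are moved.\<close>

context matroid
begin

lemma finite_subset_ground: "X \<subseteq> S \<Longrightarrow> finite X"
  using finite_ground finite_subset by blast

lemma rank_empty [simp]: "r {} = 0"
  using rank_le_card[of "{}"] by simp

lemma rank_insert_le: "\<lbrakk>X \<subseteq> S; x \<in> S\<rbrakk> \<Longrightarrow> r (insert x X) \<le> Suc (r X)"
  using rank_submodular[of "{x}" X] rank_le_card[of "{x}"] by simp

text \<open>Diminishing returns: by submodularity the gain from adding \<open>x\<close> cannot grow
  with the set. Equations \<open>r (insert x X) = r X\<close> stand for membership in the closure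
  throughout the finite part.\<close>

lemma rank_insert_closure:
  assumes "X \<subseteq> Y" "Y \<subseteq> S" "x \<in> S" "r (insert x X) = r X"
  shows "r (insert x Y) = r Y"
proof (cases "x \<in> Y")
  case True then show ?thesis by (simp add: insert_absorb)
next
  case False
  then have "insert x X \<union> Y = insert x Y" "insert x X \<inter> Y = X" using assms by auto
  then have "r (insert x Y) + r X \<le> r (insert x X) + r Y"
    using rank_submodular[of "insert x X" Y] assms by auto
  moreover have "r Y \<le> r (insert x Y)" using rank_mono[of Y "insert x Y"] assms by auto
  ultimately show ?thesis using assms by simp
qed

lemma rank_Un_closure:
  assumes X: "X \<subseteq> S" and Y: "Y \<subseteq> S" and cl: "\<And>y. y \<in> Y \<Longrightarrow> r (insert y X) = r X"
  shows "r (X \<union> Y) = r X"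
proof -
  have "finite Y" using Y finite_subset_ground by blast
  then show ?thesis using Y cl
  proof (induction Y)
    case empty then show ?case by simp
  next
    case (insert y Y)
    then have "r (insert y (X \<union> Y)) = r (X \<union> Y)"
      using rank_insert_closure[of X "X \<union> Y" y] X by auto
    then show ?case using insert by simp
  qed
qed

lemma rank_insert_eq_Un: "\<lbrakk>X \<union> Y \<subseteq> S; r (X \<union> Y) = r X; y \<in> Y\<rbrakk> \<Longrightarrow> r (insert y X) = r X"
proof -
  assume a: "X \<union> Y \<subseteq> S" "r (X \<union> Y) = r X" "y \<in> Y"
  then have "r X \<le> r (insert y X)" "r (insert y X) \<le> r (X \<union> Y)"
    using rank_mono[of X "insert y X", OF subset_insertI] rank_mono[of "insert y X" "X \<union> Y"] by auto
  then show ?thesis using a by simp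
qed

lemma rank_Un_mono_closure:
  assumes "X \<subseteq> Y" "Y \<subseteq> S" "Z \<subseteq> S" "r (X \<union> Z) = r X"
  shows "r (Y \<union> Z) = r Y"
  using assms rank_insert_eq_Un[of X Z] rank_insert_closure[of X Y] by (intro rank_Un_closure) auto

text \<open>Submodularity bounds \<open>card Y\<close> by the ranks of \<open>X\<close> and
  \<open>Y - X\<close>, which are at most the cardinalities; so both bounds are attained.\<close>

lemma indep_subset:
  assumes Y: "indep S r Y" and XY: "X \<subseteq> Y"
  shows "indep S r X"
proof -
  have S: "Y \<subseteq> S" "X \<subseteq> S" "r Y = card Y" using Y XY by (auto simp: indep_def)
  have "r Y \<le> r X + r (Y - X)"
    using rank_submodular[of X "Y - X"] S XY by (auto simp: Un_absorb1 Un_Diff_cancel)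
  moreover have "r (Y - X) \<le> card (Y - X)" "r X \<le> card X" using rank_le_card[of "Y - X"] rank_le_card[of X] S by auto
  moreover have "card Y = card X + card (Y - X)"
    using card_Diff_subset[of X Y] card_mono[of Y X] finite_subset_ground[OF S(1)] finite_subset_ground[OF S(2)] XY by simp
  ultimately show ?thesis using S by (simp add: indep_def)
qed

lemma indep_insert: "\<lbrakk>indep S r X; x \<in> S; r (insert x X) \<noteq> r X\<rbrakk> \<Longrightarrow> indep S r (insert x X)"
  using rank_insert_le[of X x] rank_mono[of X "insert x X", OF subset_insertI] finite_subset_ground[of X]
  by (cases "x \<in> X") (auto simp: indep_def insert_absorb)

text \<open>A maximal independent set between \<open>I\<close> and \<open>X\<close> spans
  \<open>X\<close>, because an element that raises its rank could be added.\<close>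

lemma basis_extension:
  assumes I: "indep S r I" "I \<subseteq> X" and X: "X \<subseteq> S"
  obtains B where "I \<subseteq> B" "B \<subseteq> X" "indep S r B" "r B = r X"
proof -
  have "finite {B. I \<subseteq> B \<and> B \<subseteq> X \<and> indep S r B}" using finite_subset_ground[OF X] by simp
  then obtain B where B: "I \<subseteq> B" "B \<subseteq> X" "indep S r B"
    and max: "\<And>B'. \<lbrakk>I \<subseteq> B'; B' \<subseteq> X; indep S r B'; B \<subseteq> B'\<rbrakk> \<Longrightarrow> B' = B"
    using finite_has_maximal2[of "{B. I \<subseteq> B \<and> B \<subseteq> X \<and> indep S r B}" I] I
    by (smt (verit) mem_Collect_eq order_refl)
  have "r (insert x B) = r B" if x: "x \<in> X" for x
  proof (rule ccontr)
    assume neq: "r (insert x B) \<noteq> r B"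
    then have "insert x B = B" using indep_insert[OF B(3)] max[of "insert x B"] B X x by blast
    then show False using neq by simp
  qed
  then have "r (B \<union> X) = r B" using rank_Un_closure[of B X] B X by auto
  then show thesis using that B by (simp add: Un_absorb1)
qed

lemma basis:
  assumes "X \<subseteq> S"
  obtains B where "B \<subseteq> X" "indep S r B" "r B = r X" "card B = r X"
  using basis_extension[of "{}" X] assms by (metis empty_subsetI card.empty indep_def rank_empty)

section \<open>Circuits and circuit elimination\<close>

lemma circuit_subset:
  assumes "X \<subseteq> S" "\<not> indep S r X"
  obtains C where "circuit S r C" "C \<subseteq> X"
proof -
  have "finite {D. D \<subseteq> X \<and> \<not> indep S r D}" using finite_subset_ground[OF assms(1)] by simp
  then obtain C where C: "C \<subseteq> X" "\<not> indep S r C"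
    and min: "\<And>D. \<lbrakk>D \<subseteq> X; \<not> indep S r D; D \<subseteq> C\<rbrakk> \<Longrightarrow> D = C"
    using finite_has_minimal2[of "{D. D \<subseteq> X \<and> \<not> indep S r D}" X] assms
    by (smt (verit) mem_Collect_eq order_refl)
  then have "circuit S r C" using assms unfolding circuit_def by (metis order.trans psubsetE)
  then show thesis using that C by blast
qed

lemma circuit_ground: "circuit S r C \<Longrightarrow> C \<subseteq> S"
  by (simp add: circuit_def)

lemma circuit_nonempty: "circuit S r C \<Longrightarrow> C \<noteq> {}"
  by (auto simp: circuit_def indep_def)

lemma circuit_not_psubset: "\<lbrakk>circuit S r C; circuit S r D; D \<subseteq> C\<rbrakk> \<Longrightarrow> D = C"
  unfolding circuit_def by blast

lemma circuit_closure:
  assumes "circuit S r C" "x \<in> C"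
  shows "r C = r (C - {x})"
proof -
  have C: "C \<subseteq> S" "\<not> indep S r C" "indep S r (C - {x})" using assms unfolding circuit_def by auto
  then show ?thesis using indep_insert[OF C(3), of x] assms by (auto simp: insert_absorb)
qed

text \<open>A basis \<open>B\<close> of \<open>Y\<close> contains no circuit, so the circuit inside
  \<open>insert x B\<close> has to pass through \<open>x\<close>.\<close>

lemma closure_circuit:
  assumes Y: "Y \<subseteq> S" and x: "x \<in> S" "x \<notin> Y" "r (insert x Y) = r Y"
  obtains C where "circuit S r C" "x \<in> C" "C \<subseteq> insert x Y"
proof -
  obtain B where B: "B \<subseteq> Y" "indep S r B" "r B = r Y" "card B = r Y" using basis Y by blast
  have "r (insert x B) \<le> r Y" using rank_mono[of "insert x B" "insert x Y"] B Y x by auto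
  moreover have "x \<notin> B" "finite B" using B x Y finite_subset_ground[of B] by auto
  then have "card (insert x B) = Suc (r Y)" using B by simp
  ultimately have "\<not> indep S r (insert x B)" by (simp add: indep_def)
  then obtain C where C: "circuit S r C" "C \<subseteq> insert x B" using circuit_subset[of "insert x B"] B Y x by blast
  have "x \<in> C"
  proof (rule ccontr)
    assume "x \<notin> C"
    then have "indep S r C" using indep_subset B C by blast
    then show False using C by (simp add: circuit_def)
  qed
  then show thesis using that C B by blast
qed

text \<open>In the union of the circuits, \<open>x\<close> is spanned by the rest of
  \<open>C1\<close>, and then \<open>e\<close> by the rest of \<open>C2\<close>, which avoids
  \<open>x\<close>. So deleting both leaves the rank unchanged, and \<open>x\<close> is in the
  closure of what remains.\<close>

lemma strong_circuit_elimination: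
  assumes C: "circuit S r C1" "circuit S r C2" and e: "e \<in> C1" "e \<in> C2" and x: "x \<in> C1" "x \<notin> C2"
  obtains C3 where "circuit S r C3" "x \<in> C3" "C3 \<subseteq> C1 \<union> C2 - {e}"
proof -
  let ?D = "C1 \<union> C2"
  have D: "?D \<subseteq> S" using C circuit_ground by blast
  have xe: "x \<noteq> e" using x e by blast
  have "r (insert e (C2 - {e})) = r (C2 - {e})" using circuit_closure[OF C(2) e(2)] e by (simp add: insert_absorb)
  then have "r (insert e (?D - {x, e})) = r (?D - {x, e})"
    using rank_insert_closure[of "C2 - {e}" "?D - {x, e}" e] D x e by auto
  moreover have "insert e (?D - {x, e}) = ?D - {x}" using xe e by auto
  moreover have "r (insert x (C1 - {x})) = r (C1 - {x})" using circuit_closure[OF C(1) x(1)] x by (simp add: insert_absorb)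
  then have "r (insert x (?D - {x})) = r (?D - {x})"
    using rank_insert_closure[of "C1 - {x}" "?D - {x}" x] D x by auto
  moreover have "insert x (?D - {x}) = ?D" using x by auto
  ultimately have eq: "r ?D = r (?D - {x, e})" by simp
  have sub: "insert x (?D - {x, e}) \<subseteq> ?D" using x by auto
  then have "r (insert x (?D - {x, e})) \<le> r ?D" using rank_mono D by blast
  moreover have "r (?D - {x, e}) \<le> r (insert x (?D - {x, e}))" using rank_mono[OF subset_insertI] D sub by blast
  ultimately have "r (insert x (?D - {x, e})) = r (?D - {x, e})" using eq by simp
  then obtain C3 where "circuit S r C3" "x \<in> C3" "C3 \<subseteq> insert x (?D - {x, e})"
    using closure_circuit[of "?D - {x, e}" x] D x by auto
  then show thesis using that xe x by blast
qed

text \<open>Elimination from a pair with \<open>C1 \<union> C2\<close> minimal yields a smaller such pair.\<close>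

lemma common_circuit:
  assumes "circuit S r C1" "circuit S r C2" "x \<in> C1" "z \<in> C2" "C1 \<inter> C2 \<noteq> {}"
  shows "\<exists>C. circuit S r C \<and> x \<in> C \<and> z \<in> C"
  using assms
proof (induction "card (C1 \<union> C2)" arbitrary: C1 C2 rule: less_induct)
  case less
  let ?D = "C1 \<union> C2"
  have fin: "finite ?D" using finite_subset_ground circuit_ground less.prems(1,2) by auto
  have IH: "\<exists>C. circuit S r C \<and> x \<in> C \<and> z \<in> C"
    if "circuit S r C1'" "circuit S r C2'" "x \<in> C1'" "z \<in> C2'" "C1' \<inter> C2' \<noteq> {}" "C1' \<union> C2' \<subset> ?D" for C1' C2'
    using less.hyps[OF psubset_card_mono[OF fin that(6)]] that by blast
  show ?case
  proof (cases "x \<in> C2 \<or> z \<in> C1")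
    case True then show ?thesis using less.prems by blast
  next
    case False
    obtain e where e: "e \<in> C1" "e \<in> C2" using less.prems by blast
    obtain C3 where C3: "circuit S r C3" "x \<in> C3" "C3 \<subseteq> ?D - {e}"
      using strong_circuit_elimination[OF less.prems(1,2) e less.prems(3)] False by blast
    obtain C4 where C4: "circuit S r C4" "z \<in> C4" "C4 \<subseteq> ?D - {e}"
      using strong_circuit_elimination[OF less.prems(2,1) e(2,1) less.prems(4)] False by (metis Un_commute)
    \<comment> \<open>A circuit inside \<open>C1\<close> equals \<open>C1\<close>, but
      \<open>e\<close> is missing from \<open>C3\<close>.\<close>
    have n3: "\<not> C3 \<subseteq> C1" using circuit_not_psubset[OF less.prems(1) C3(1)] C3 e by blast
    have n4: "\<not> C4 \<subseteq> C2" using circuit_not_psubset[OF less.prems(2) C4(1)] C4 e by blast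
    show ?thesis
    proof (cases "C3 \<union> C2 = ?D \<and> C1 \<union> C4 = ?D")
      case False
      then show ?thesis
      proof (cases "C3 \<union> C2 = ?D")
        case False
        then show ?thesis using IH[OF C3(1) less.prems(2) C3(2) less.prems(4)] C3(3) n3 by blast
      next
        case True
        then show ?thesis using IH[OF less.prems(1) C4(1) less.prems(3) C4(2)] C4(3) n4 False by blast
      qed
    next
      case True
      \<comment> \<open>An element of \<open>C3\<close> outside \<open>C1\<close> lies in
        \<open>C4\<close>. The union of \<open>C3\<close> and \<open>C4\<close> misses
        \<open>e\<close>, so this pair is smaller.\<close>
      then have "C3 \<inter> C4 \<noteq> {}" using n3 C3(3) by blast
      then show ?thesis using IH[OF C3(1) C4(1) C3(2) C4(2)] C3(3) C4(3) e by blast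
    qed
  qed
qed

section \<open>Connected components\<close>

definition connected_rel :: "('a \<times> 'a) set" where
  "connected_rel = {(x, y) \<in> S \<times> S. x = y \<or> (\<exists>C. circuit S r C \<and> x \<in> C \<and> y \<in> C)}"

lemma components_eq: "components S r = S // connected_rel"
  by (simp add: components_def connected_rel_def)

lemma equiv_connected_rel: "equiv S connected_rel"
proof (rule equivI)
  show "connected_rel \<subseteq> S \<times> S" by (auto simp: connected_rel_def)
  show "refl_on S connected_rel" by (auto simp: refl_on_def connected_rel_def)
  show "sym connected_rel" by (auto simp: sym_def connected_rel_def)
  show "trans connected_rel"
  proof (rule transI)
    fix x y z assume xy: "(x, y) \<in> connected_rel" and yz: "(y, z) \<in> connected_rel"
    show "(x, z) \<in> connected_rel"
    proof (cases "x = y \<or> y = z")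
      case True then show ?thesis using xy yz by auto
    next
      case False
      then obtain C1 C2 where "circuit S r C1" "x \<in> C1" "y \<in> C1" "circuit S r C2" "y \<in> C2" "z \<in> C2"
        using xy yz by (auto simp: connected_rel_def)
      then have "\<exists>C. circuit S r C \<and> x \<in> C \<and> z \<in> C" using common_circuit[of C1 C2 x z] by blast
      then show ?thesis using xy yz by (auto simp: connected_rel_def)
    qed
  qed
qed

lemma components_ground: "K \<in> components S r \<Longrightarrow> K \<subseteq> S"
  unfolding components_eq using equiv_connected_rel by (metis in_quotient_imp_subset)

lemma Union_components: "\<Union> (components S r) = S"
  unfolding components_eq using Union_quotient[OF equiv_connected_rel] .

lemma components_disjoint: "\<lbrakk>K \<in> components S r; K' \<in> components S r; K \<noteq> K'\<rbrakk> \<Longrightarrow> K \<inter> K' = {}"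
  unfolding components_eq using quotient_disj[OF equiv_connected_rel] by blast

lemma finite_components: "finite (components S r)"
  using finite_ground Union_components finite_UnionD by metis

lemma circuit_in_component:
  assumes C: "circuit S r C" and K: "K \<in> components S r" and x: "x \<in> C" "x \<in> K"
  shows "C \<subseteq> K"
proof
  fix y assume y: "y \<in> C"
  have "(x, y) \<in> connected_rel" using C x y circuit_ground by (auto simp: connected_rel_def)
  then show "y \<in> K" using K x in_quotient_imp_closed[OF equiv_connected_rel] unfolding components_eq by metis
qed

lemma matroid_restrict: "T \<subseteq> S \<Longrightarrow> matroid T r"
  using finite_subset_ground rank_le_card rank_mono rank_submodular
  by unfold_locales auto

lemma indep_restrict: "T \<subseteq> S \<Longrightarrow> X \<subseteq> T \<Longrightarrow> indep T r X \<longleftrightarrow> indep S r X"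
  by (auto simp: indep_def)

lemma rank_Union_le:
  assumes "finite F" "\<And>X. X \<in> F \<Longrightarrow> g X \<subseteq> S"
  shows "r (\<Union> (g ` F)) \<le> (\<Sum>X\<in>F. r (g X))"
  using assms
proof (induction F)
  case empty then show ?case by simp
next
  case (insert X F)
  then have "r (g X \<union> \<Union> (g ` F)) \<le> r (g X) + r (\<Union> (g ` F))"
    using rank_submodular[of "g X" "\<Union> (g ` F)"] by (auto simp: UN_subset_iff)
  then show ?case using insert by auto
qed

text \<open>A circuit stays inside one component, so the union of bases of the pieces
  \<open>X \<inter> K\<close> contains no circuit. This gives one inequality, submodularity the
  other. Modular extendability is reduced to components through this formula.\<close>

lemma rank_components:
  assumes X: "X \<subseteq> S"
  shows "r X = (\<Sum>K\<in>components S r. r (X \<inter> K))"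
proof -
  let ?F = "components S r"
  have XF: "X = \<Union> ((\<lambda>K. X \<inter> K) ` ?F)" using Union_components X by auto
  have "\<exists>B. B \<subseteq> X \<inter> K \<and> indep S r B \<and> card B = r (X \<inter> K)" for K
  proof -
    have "X \<inter> K \<subseteq> S" using X by blast
    then show ?thesis using basis[of "X \<inter> K"] by metis
  qed
  then obtain B where B: "\<And>K. B K \<subseteq> X \<inter> K \<and> indep S r (B K) \<and> card (B K) = r (X \<inter> K)" by metis
  let ?I = "\<Union> (B ` ?F)"
  have IX: "?I \<subseteq> X" using B by blast
  have "indep S r ?I"
  proof (rule ccontr)
    assume "\<not> indep S r ?I"
    then obtain C where C: "circuit S r C" "C \<subseteq> ?I" using circuit_subset IX X by blast
    obtain x K where x: "x \<in> C" "K \<in> ?F" "x \<in> B K" using circuit_nonempty[OF C(1)] C(2) by blast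
    have CK: "C \<subseteq> K" using circuit_in_component[OF C(1) x(2,1)] x B by blast
    have "C \<subseteq> B K"
    proof
      fix y assume "y \<in> C"
      then obtain K' where "K' \<in> ?F" "y \<in> B K'" using C by blast
      then show "y \<in> B K" using \<open>y \<in> C\<close> CK B components_disjoint x by blast
    qed
    then have "indep S r C" using indep_subset B by blast
    then show False using C by (simp add: circuit_def)
  qed
  moreover have "card ?I = (\<Sum>K\<in>?F. card (B K))"
  proof (rule card_UN_disjoint[OF finite_components]; intro ballI impI)
    show "finite (B K)" for K using B finite_subset_ground unfolding indep_def by blast
    show "B K \<inter> B K' = {}" if "K \<in> ?F" "K' \<in> ?F" "K \<noteq> K'" for K K'
      using components_disjoint[OF that] B by blast
  qed
  ultimately have "r ?I = (\<Sum>K\<in>?F. r (X \<inter> K))" using B by (simp add: indep_def)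
  moreover have "r ?I \<le> r X" using rank_mono IX X by blast
  moreover have "r X \<le> (\<Sum>K\<in>?F. r (X \<inter> K))"
    using rank_Union_le[OF finite_components, of "\<lambda>K. X \<inter> K"] XF X by auto
  ultimately show ?thesis by simp
qed

text \<open>The single-element extension of Crapo: the predicate \<open>\<M>\<close> says which sets are to span the new element.\<close>

lemma single_element_extension:
  assumes z: "z \<notin> S"
    and up: "\<And>X Y. \<lbrakk>\<M> X; X \<subseteq> Y; Y \<subseteq> S\<rbrakk> \<Longrightarrow> \<M> Y"
    and cl: "\<And>X Y. \<lbrakk>\<M> Y; X \<subseteq> Y; Y \<subseteq> S; r X = r Y\<rbrakk> \<Longrightarrow> \<M> X"
    and modular: "\<And>X Y. \<lbrakk>\<M> X; \<M> Y; X \<subseteq> S; Y \<subseteq> S; r X + r Y = r (X \<union> Y) + r (X \<inter> Y)\<rbrakk> \<Longrightarrow> \<M> (X \<inter> Y)"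
  shows "\<exists>r'. matroid (insert z S) r' \<and>
    (\<forall>X\<subseteq>S. r' X = r X \<and> r' (insert z X) = (if \<M> X then r X else Suc (r X)))"
proof -
  \<comment> \<open>The conditions on \<open>\<M>\<close> make it a modular cut: \<open>z\<close> is
    placed in the closure of exactly the sets in \<open>\<M>\<close> and raises the rank of every
    other set by one.\<close>
  define r' where "r' X = (if z \<in> X \<and> \<not> \<M> (X - {z}) then Suc (r (X - {z})) else r (X - {z}))" for X
  have r'S: "r' X = r X" if "X \<subseteq> S" for X
  proof -
    have "z \<notin> X" using that z by blast
    then show ?thesis by (simp add: r'_def)
  qed
  have r'z: "r' (insert z X) = (if \<M> X then r X else Suc (r X))" if "X \<subseteq> S" for X
  proof -
    have "insert z X - {z} = X" using that z by blast
    then show ?thesis by (simp add: r'_def)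
  qed
  have "matroid (insert z S) r'"
  proof
    show "finite (insert z S)" using finite_ground by simp
  next
    fix X assume X: "X \<subseteq> insert z S"
    then have "r (X - {z}) \<le> card (X - {z})" using rank_le_card by blast
    moreover have "finite X" using X finite_ground finite_subset by blast
    then have "card (X - {z}) \<le> card X" "z \<in> X \<Longrightarrow> Suc (card (X - {z})) = card X"
      using card_Diff1_le card_Suc_Diff1 by metis+
    ultimately show "r' X \<le> card X" by (auto simp: r'_def)
  next
    fix X Y assume XY: "X \<subseteq> Y" "Y \<subseteq> insert z S"
    let ?X = "X - {z}" and ?Y = "Y - {z}"
    have S: "?X \<subseteq> ?Y" "?Y \<subseteq> S" using XY by auto
    have le: "r ?X \<le> r ?Y" using rank_mono[OF S] .
    show "r' X \<le> r' Y"
    proof (cases "z \<in> X \<and> \<not> \<M> ?X \<and> \<M> ?Y")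
      case True
      then have "r ?X \<noteq> r ?Y" using cl[of ?Y ?X] S by blast
      then show ?thesis using le True by (simp add: r'_def)
    next
      case False
      then show ?thesis using le XY up[of ?X ?Y] S by (auto simp: r'_def)
    qed
  next
    fix X Y assume XY: "X \<subseteq> insert z S" "Y \<subseteq> insert z S"
    define X0 Y0 where "X0 = X - {z}" and "Y0 = Y - {z}"
    have S: "X0 \<subseteq> S" "Y0 \<subseteq> S" using XY by (auto simp: X0_def Y0_def)
    have eq: "X \<union> Y - {z} = X0 \<union> Y0" "X \<inter> Y - {z} = X0 \<inter> Y0" by (auto simp: X0_def Y0_def)
    have sub: "r (X0 \<union> Y0) + r (X0 \<inter> Y0) \<le> r X0 + r Y0" using rank_submodular S by blast
    have upX: "\<M> X0 \<Longrightarrow> \<M> (X0 \<union> Y0)" and upY: "\<M> Y0 \<Longrightarrow> \<M> (X0 \<union> Y0)"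
      using up[of X0 "X0 \<union> Y0"] up[of Y0 "X0 \<union> Y0"] S by auto
    have upI: "\<M> (X0 \<inter> Y0) \<Longrightarrow> \<M> X0 \<and> \<M> Y0"
      using up[of "X0 \<inter> Y0" X0] up[of "X0 \<inter> Y0" Y0] S by auto
    \<comment> \<open>The critical case: both sets span \<open>z\<close> but their intersection does
      not. The extra unit on the left is paid for by strict submodularity, since modular pairs are
      closed under intersection in \<open>\<M>\<close>.\<close>
    have strict: "r (X0 \<union> Y0) + r (X0 \<inter> Y0) < r X0 + r Y0" if "\<M> X0" "\<M> Y0" "\<not> \<M> (X0 \<inter> Y0)"
    proof -
      have "r (X0 \<union> Y0) + r (X0 \<inter> Y0) \<noteq> r X0 + r Y0" using modular[of X0 Y0] S that by metis
      then show ?thesis using sub by simp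
    qed
    show "r' (X \<union> Y) + r' (X \<inter> Y) \<le> r' X + r' Y"
      unfolding r'_def eq X0_def[symmetric] Y0_def[symmetric]
      using sub upX upY upI strict
      by (cases "z \<in> X"; cases "z \<in> Y"; cases "\<M> X0"; cases "\<M> Y0"; cases "\<M> (X0 \<inter> Y0)"; cases "\<M> (X0 \<union> Y0)") simp_all
  qed
  then show ?thesis using r'S r'z by blast
qed

section \<open>Loops, parallel classes and the simplification\<close>

lemma nonloops_rank: "x \<in> nonloops S r \<longleftrightarrow> x \<in> S \<and> r {x} = 1"
  using rank_le_card[of "{x}"] by (auto simp: nonloops_def)

lemma parallel_closure: "\<lbrakk>x \<in> S; y \<in> S; r {x, y} = 1; r {x} = 1; x \<in> X; X \<subseteq> S\<rbrakk> \<Longrightarrow> r (insert y X) = r X"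
  using rank_insert_closure[of "{x}" X y] by (simp add: insert_commute)

lemma parallel_trans:
  assumes "x \<in> S" "y \<in> S" "z \<in> S" "r {x} = 1" "r {y} = 1" "r {x, y} = 1" "r {y, z} = 1"
  shows "r {x, z} = 1"
proof -
  have "r {z, x, y} = 1" using parallel_closure[of y z "{x, y}"] assms by auto
  then show ?thesis using rank_mono[of "{x, z}" "{z, x, y}"] rank_mono[of "{x}" "{x, z}"] assms by auto
qed

definition parallel_rel :: "('a \<times> 'a) set" where
  "parallel_rel = {(x, y) \<in> nonloops S r \<times> nonloops S r. r {x, y} = 1}"

lemma equiv_parallel_rel: "equiv (nonloops S r) parallel_rel"
proof (rule equivI)
  show "parallel_rel \<subseteq> nonloops S r \<times> nonloops S r" by (auto simp: parallel_rel_def)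
  show "refl_on (nonloops S r) parallel_rel" by (auto simp: refl_on_def parallel_rel_def nonloops_rank)
  show "sym parallel_rel" by (auto simp: sym_def parallel_rel_def insert_commute)
  show "trans parallel_rel"
    using parallel_trans by (auto simp: trans_def parallel_rel_def nonloops_rank)
qed

lemma parallel_classes_eq: "parallel_classes S r = nonloops S r // parallel_rel"
  by (simp add: parallel_classes_def parallel_rel_def)

lemma si_choice: "C \<in> parallel_classes S r \<Longrightarrow> (SOME x. x \<in> C) \<in> C"
  unfolding parallel_classes_eq using equiv_parallel_rel by (metis in_quotient_imp_non_empty some_in_eq)

lemma si_ground_nonloops: "si_ground S r \<subseteq> nonloops S r"
proof
  fix x assume "x \<in> si_ground S r"
  then obtain C where C: "C \<in> parallel_classes S r" "x = (SOME x. x \<in> C)" by (auto simp: si_ground_def)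
  then have "x \<in> C" "C \<subseteq> nonloops S r"
    using si_choice in_quotient_imp_subset[OF equiv_parallel_rel] by (auto simp: parallel_classes_eq)
  then show "x \<in> nonloops S r" by blast
qed

lemma si_ground_ex:
  assumes x: "x \<in> nonloops S r"
  shows "\<exists>y\<in>si_ground S r. r {x, y} = 1"
proof -
  let ?C = "parallel_rel `` {x}"
  have C: "?C \<in> parallel_classes S r" using x by (auto simp: parallel_classes_eq quotient_def)
  then have "(SOME y. y \<in> ?C) \<in> ?C" by (rule si_choice)
  moreover have "r {x, y} = 1" if "y \<in> ?C" for y using that by (simp add: parallel_rel_def)
  ultimately have "r {x, SOME y. y \<in> ?C} = 1" by blast
  then show ?thesis using C unfolding si_ground_def by blast
qed

lemma si_ground_parallel:
  assumes "x \<in> si_ground S r" "y \<in> si_ground S r" "r {x, y} = 1"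
  shows "x = y"
proof -
  obtain C D where C: "C \<in> parallel_classes S r" "x = (SOME z. z \<in> C)" and D: "D \<in> parallel_classes S r" "y = (SOME z. z \<in> D)"
    using assms by (auto simp: si_ground_def)
  have "x \<in> C" "y \<in> D" using si_choice C D by auto
  moreover have "(x, y) \<in> parallel_rel" using assms si_ground_nonloops by (auto simp: parallel_rel_def)
  ultimately have "C = D" using quotient_eqI[OF equiv_parallel_rel] C D unfolding parallel_classes_eq by metis
  then show ?thesis using C D by simp
qed

text \<open>Each of \<open>X\<close> and its image spans the other. Elements of \<open>X\<close>
  that are parallel to each other may share an image.\<close>

lemma rank_parallel_image:
  assumes X: "X \<subseteq> nonloops S r" and \<rho>: "\<And>x. x \<in> X \<Longrightarrow> \<rho> x \<in> nonloops S r \<and> r {x, \<rho> x} = 1"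
  shows "r (\<rho> ` X) = r X"
proof -
  have S: "X \<subseteq> S" "\<rho> ` X \<subseteq> S" and n: "\<And>x. x \<in> X \<Longrightarrow> r {x} = 1 \<and> r {\<rho> x} = 1"
    using X \<rho> by (auto simp: nonloops_rank)
  have "r (X \<union> \<rho> ` X) = r X"
    using S n \<rho> by (intro rank_Un_closure) (auto intro!: parallel_closure)
  moreover have "r (\<rho> ` X \<union> X) = r (\<rho> ` X)"
  proof (rule rank_Un_closure[OF S(2,1)])
    fix x assume "x \<in> X"
    then show "r (insert x (\<rho> ` X)) = r (\<rho> ` X)"
      using parallel_closure[of "\<rho> x" x "\<rho> ` X"] S n \<rho> by (auto simp: insert_commute)
  qed
  ultimately show ?thesis by (simp add: Un_commute)
qed

end

section \<open>Linear algebra over a skew field\<close>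

text \<open>Narrows the record types of \<open>right_vector_space\<close> to \<open>'f ring\<close>
  and \<open>'v ring\<close>, the types on which \<open>lin_indep_family\<close> is defined.\<close>

locale concrete_right_vector_space = right_vector_space R V act
  for R :: "'f ring" (structure) and V :: "'v ring" (structure) and act
begin

lemma act_zero_scalar: "v \<in> carrier V \<Longrightarrow> act v \<zero>\<^bsub>R\<^esub> = \<zero>\<^bsub>V\<^esub>"
  using act_add_scalar[of v "\<zero>\<^bsub>R\<^esub>" "\<zero>\<^bsub>R\<^esub>"] V.add.r_cancel_one'[of "act v \<zero>\<^bsub>R\<^esub>" "act v \<zero>\<^bsub>R\<^esub>"] act_closed by simp

lemma act_zero_vector: "a \<in> carrier R \<Longrightarrow> act \<zero>\<^bsub>V\<^esub> a = \<zero>\<^bsub>V\<^esub>"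
  using act_add_vector[of "\<zero>\<^bsub>V\<^esub>" "\<zero>\<^bsub>V\<^esub>" a] V.add.r_cancel_one'[of "act \<zero>\<^bsub>V\<^esub> a" "act \<zero>\<^bsub>V\<^esub> a"] act_closed by simp

lemma act_uminus:
  assumes "v \<in> carrier V" "a \<in> carrier R"
  shows "act v (\<ominus>\<^bsub>R\<^esub> a) = \<ominus>\<^bsub>V\<^esub> act v a"
proof -
  have "act v (\<ominus>\<^bsub>R\<^esub> a) \<oplus>\<^bsub>V\<^esub> act v a = \<zero>\<^bsub>V\<^esub>"
    using act_add_scalar[of v "\<ominus>\<^bsub>R\<^esub> a" a] assms act_zero_scalar by (simp add: R.l_neg)
  then show ?thesis using V.minus_equality act_closed assms by simp
qed

lemma one_not_zero: "\<one>\<^bsub>R\<^esub> \<noteq> \<zero>\<^bsub>R\<^esub>"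
  using R.Units_one_closed R.skew_field_Units by auto

lemma inverse:
  assumes "a \<in> carrier R" "a \<noteq> \<zero>\<^bsub>R\<^esub>"
  obtains b where "b \<in> carrier R" "a \<otimes>\<^bsub>R\<^esub> b = \<one>\<^bsub>R\<^esub>" "b \<otimes>\<^bsub>R\<^esub> a = \<one>\<^bsub>R\<^esub>"
  using assms R.skew_field_Units unfolding Units_def by blast

definition lc :: "('a \<Rightarrow> 'v) \<Rightarrow> ('a \<Rightarrow> 'f) \<Rightarrow> 'a set \<Rightarrow> 'v" where
  "lc f c X = finsum V (\<lambda>x. act (f x) (c x)) X"

lemma lin_indep_iff: "lin_indep_family R V act f X \<longleftrightarrow>
    (\<forall>c \<in> X \<rightarrow> carrier R. lc f c X = \<zero>\<^bsub>V\<^esub> \<longrightarrow> (\<forall>x\<in>X. c x = \<zero>\<^bsub>R\<^esub>))"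
  by (simp add: lin_indep_family_def lc_def)

lemma lc_closed [simp]: "\<lbrakk>f \<in> X \<rightarrow> carrier V; c \<in> X \<rightarrow> carrier R\<rbrakk> \<Longrightarrow> lc f c X \<in> carrier V"
  unfolding lc_def by (rule V.finsum_closed) (auto simp: act_closed Pi_iff)

lemma lc_cong:
  assumes "f \<in> X \<rightarrow> carrier V" "c \<in> X \<rightarrow> carrier R" "\<And>x. x \<in> X \<Longrightarrow> c x = c' x"
  shows "lc f c X = lc f c' X"
  unfolding lc_def using assms by (intro V.finsum_cong') (auto simp: act_closed Pi_iff)

lemma lc_empty [simp]: "lc f c {} = \<zero>\<^bsub>V\<^esub>"
  by (simp add: lc_def)

lemma lc_insert:
  "\<lbrakk>finite X; x \<notin> X; f \<in> insert x X \<rightarrow> carrier V; c \<in> insert x X \<rightarrow> carrier R\<rbrakk>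
    \<Longrightarrow> lc f c (insert x X) = act (f x) (c x) \<oplus>\<^bsub>V\<^esub> lc f c X"
  unfolding lc_def by (rule V.finsum_insert) (auto simp: act_closed Pi_iff)

lemma lc_remove:
  "\<lbrakk>finite X; x \<in> X; f \<in> X \<rightarrow> carrier V; c \<in> X \<rightarrow> carrier R\<rbrakk>
    \<Longrightarrow> lc f c X = act (f x) (c x) \<oplus>\<^bsub>V\<^esub> lc f c (X - {x})"
  using lc_insert[of "X - {x}" x f c] by (simp add: insert_absorb)

lemma lc_add:
  assumes "f \<in> X \<rightarrow> carrier V" "c \<in> X \<rightarrow> carrier R" "c' \<in> X \<rightarrow> carrier R"
  shows "lc f (\<lambda>x. c x \<oplus>\<^bsub>R\<^esub> c' x) X = lc f c X \<oplus>\<^bsub>V\<^esub> lc f c' X"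
proof -
  have "lc f (\<lambda>x. c x \<oplus>\<^bsub>R\<^esub> c' x) X = finsum V (\<lambda>x. act (f x) (c x) \<oplus>\<^bsub>V\<^esub> act (f x) (c' x)) X"
    unfolding lc_def using assms by (intro V.finsum_cong') (auto simp: act_closed act_add_scalar Pi_iff)
  then show ?thesis unfolding lc_def using assms by (subst V.finsum_addf[symmetric]) (auto simp: act_closed Pi_iff)
qed

lemma lc_scale:
  assumes "finite X" "f \<in> X \<rightarrow> carrier V" "c \<in> X \<rightarrow> carrier R" "a \<in> carrier R"
  shows "act (lc f c X) a = lc f (\<lambda>x. c x \<otimes>\<^bsub>R\<^esub> a) X"
  using assms
proof (induction X)
  case empty then show ?case by (simp add: act_zero_vector)
next
  case (insert x X)
  then have "f \<in> X \<rightarrow> carrier V" "c \<in> X \<rightarrow> carrier R" "f x \<in> carrier V" "c x \<in> carrier R"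
    "(\<lambda>x. c x \<otimes>\<^bsub>R\<^esub> a) \<in> insert x X \<rightarrow> carrier R" by auto
  then show ?case using insert by (simp add: lc_insert act_add_vector act_closed act_assoc)
qed

lemma lc_uminus:
  assumes "finite X" "f \<in> X \<rightarrow> carrier V" "c \<in> X \<rightarrow> carrier R"
  shows "lc f (\<lambda>x. \<ominus>\<^bsub>R\<^esub> c x) X = \<ominus>\<^bsub>V\<^esub> lc f c X"
  using assms
proof (induction X)
  case empty
  have "\<ominus>\<^bsub>V\<^esub> \<zero>\<^bsub>V\<^esub> = \<zero>\<^bsub>V\<^esub>" by (rule V.minus_equality) simp_all
  then show ?case by (metis lc_empty)
next
  case (insert x X)
  then have *: "f \<in> X \<rightarrow> carrier V" "c \<in> X \<rightarrow> carrier R" "f x \<in> carrier V" "c x \<in> carrier R" by auto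
  then have "(\<lambda>x. \<ominus>\<^bsub>R\<^esub> c x) \<in> insert x X \<rightarrow> carrier R" using insert by auto
  then show ?case using insert * by (simp add: lc_insert act_uminus act_closed V.minus_add V.a_comm)
qed

lemma lc_mono_neutral:
  assumes "finite Y" "X \<subseteq> Y" "f \<in> Y \<rightarrow> carrier V" "c \<in> Y \<rightarrow> carrier R" "\<And>x. x \<in> Y - X \<Longrightarrow> c x = \<zero>\<^bsub>R\<^esub>"
  shows "lc f c Y = lc f c X"
  unfolding lc_def
  using assms by (intro V.add.finprod_mono_neutral_cong_left[symmetric]) (auto simp: act_closed act_zero_scalar Pi_iff)

definition extend_zero :: "'a set \<Rightarrow> ('a \<Rightarrow> 'f) \<Rightarrow> 'a \<Rightarrow> 'f" where
  "extend_zero X c x = (if x \<in> X then c x else \<zero>\<^bsub>R\<^esub>)"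

lemma extend_zero_closed: "c \<in> X \<rightarrow> carrier R \<Longrightarrow> extend_zero X c x \<in> carrier R"
  by (auto simp: extend_zero_def)

lemma lc_extend_zero:
  assumes "finite Y" "X \<subseteq> Y" "f \<in> Y \<rightarrow> carrier V" "c \<in> X \<rightarrow> carrier R"
  shows "lc f (extend_zero X c) Y = lc f c X"
proof -
  have "lc f (extend_zero X c) Y = lc f (extend_zero X c) X"
    using assms by (intro lc_mono_neutral) (auto simp: extend_zero_def)
  also have "\<dots> = lc f c X"
    using assms by (intro lc_cong) (auto simp: extend_zero_def)
  finally show ?thesis .
qed

section \<open>Spans and linear independence of finite families\<close>

definition lspan :: "('a \<Rightarrow> 'v) \<Rightarrow> 'a set \<Rightarrow> 'v set" where
  "lspan f X = {lc f c X | c. c \<in> X \<rightarrow> carrier R}"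

lemma lspanI: "c \<in> X \<rightarrow> carrier R \<Longrightarrow> lc f c X \<in> lspan f X"
  by (auto simp: lspan_def)

lemma lspan_carrier: "f \<in> X \<rightarrow> carrier V \<Longrightarrow> lspan f X \<subseteq> carrier V"
  by (auto simp: lspan_def)

lemma lspan_mono:
  assumes "finite Y" "X \<subseteq> Y" "f \<in> Y \<rightarrow> carrier V"
  shows "lspan f X \<subseteq> lspan f Y"
proof
  fix v assume "v \<in> lspan f X"
  then obtain c where "c \<in> X \<rightarrow> carrier R" "v = lc f c X" by (auto simp: lspan_def)
  then have "v = lc f (extend_zero X c) Y" "extend_zero X c \<in> Y \<rightarrow> carrier R"
    using lc_extend_zero[OF assms] extend_zero_closed[of c X] by auto
  then show "v \<in> lspan f Y" using lspanI by blast
qed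

lemma lspan_zero: "f \<in> X \<rightarrow> carrier V \<Longrightarrow> finite X \<Longrightarrow> \<zero>\<^bsub>V\<^esub> \<in> lspan f X"
  using lspan_mono[of X "{}" f] lspanI[of "\<lambda>_. \<zero>\<^bsub>R\<^esub>" "{}" f] by auto

lemma lspan_add:
  assumes "f \<in> X \<rightarrow> carrier V" "v \<in> lspan f X" "w \<in> lspan f X"
  shows "v \<oplus>\<^bsub>V\<^esub> w \<in> lspan f X"
proof -
  obtain c c' where c: "c \<in> X \<rightarrow> carrier R" "v = lc f c X" "c' \<in> X \<rightarrow> carrier R" "w = lc f c' X"
    using assms by (auto simp: lspan_def)
  then have "v \<oplus>\<^bsub>V\<^esub> w = lc f (\<lambda>x. c x \<oplus>\<^bsub>R\<^esub> c' x) X" using lc_add[OF assms(1) c(1,3)] by simp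
  moreover have "(\<lambda>x. c x \<oplus>\<^bsub>R\<^esub> c' x) \<in> X \<rightarrow> carrier R" using c by auto
  ultimately show ?thesis using lspanI by metis
qed

lemma lspan_scale:
  assumes "finite X" "f \<in> X \<rightarrow> carrier V" "v \<in> lspan f X" "a \<in> carrier R"
  shows "act v a \<in> lspan f X"
proof -
  obtain c where c: "c \<in> X \<rightarrow> carrier R" "v = lc f c X" using assms by (auto simp: lspan_def)
  then have "act v a = lc f (\<lambda>x. c x \<otimes>\<^bsub>R\<^esub> a) X" using lc_scale assms by simp
  moreover have "(\<lambda>x. c x \<otimes>\<^bsub>R\<^esub> a) \<in> X \<rightarrow> carrier R" using c assms by auto
  ultimately show ?thesis using lspanI by metis
qed

lemma lspan_uminus:
  assumes "finite X" "f \<in> X \<rightarrow> carrier V" "v \<in> lspan f X"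
  shows "\<ominus>\<^bsub>V\<^esub> v \<in> lspan f X"
proof -
  obtain c where c: "c \<in> X \<rightarrow> carrier R" "v = lc f c X" using assms by (auto simp: lspan_def)
  then have "\<ominus>\<^bsub>V\<^esub> v = lc f (\<lambda>x. \<ominus>\<^bsub>R\<^esub> c x) X" using lc_uminus[OF assms(1,2) c(1)] by simp
  moreover have "(\<lambda>x. \<ominus>\<^bsub>R\<^esub> c x) \<in> X \<rightarrow> carrier R" using c by auto
  ultimately show ?thesis using lspanI by metis
qed

lemma lspan_base:
  assumes "finite X" "f \<in> X \<rightarrow> carrier V" "x \<in> X"
  shows "f x \<in> lspan f X"
proof -
  have fx: "f x \<in> carrier V" using assms by blast
  then have "lc f (\<lambda>_. \<one>\<^bsub>R\<^esub>) {x} = f x" using lc_insert[of "{}" x f "\<lambda>_. \<one>\<^bsub>R\<^esub>"] by (simp add: act_one)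
  then have "f x \<in> lspan f {x}" using lspanI[of "\<lambda>_. \<one>\<^bsub>R\<^esub>" "{x}" f] by simp
  then show ?thesis using lspan_mono[of X "{x}" f] assms by auto
qed

lemma lspan_least:
  assumes X: "finite X" "f \<in> X \<rightarrow> carrier V"
    and U: "\<zero>\<^bsub>V\<^esub> \<in> U" "\<And>v w. \<lbrakk>v \<in> U; w \<in> U\<rbrakk> \<Longrightarrow> v \<oplus>\<^bsub>V\<^esub> w \<in> U"
      "\<And>v a. \<lbrakk>v \<in> U; a \<in> carrier R\<rbrakk> \<Longrightarrow> act v a \<in> U" "f ` X \<subseteq> U"
  shows "lspan f X \<subseteq> U"
proof -
  have "lc f c X \<in> U" if "c \<in> X \<rightarrow> carrier R" for c
    using X U(4) that
  proof (induction X)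
    case empty then show ?case using U(1) by simp
  next
    case (insert x X)
    then have "lc f c X \<in> U" "f x \<in> U" "c x \<in> carrier R" by auto
    then show ?case using insert U(2,3) by (simp add: lc_insert)
  qed
  then show ?thesis by (auto simp: lspan_def)
qed

lemma lspan_subset_lspan:
  assumes "finite X" "f \<in> X \<rightarrow> carrier V" "finite Y" "f \<in> Y \<rightarrow> carrier V" "f ` X \<subseteq> lspan f Y"
  shows "lspan f X \<subseteq> lspan f Y"
  using assms by (intro lspan_least) (auto simp: lspan_zero lspan_add lspan_scale)

lemma lin_indep_subset:
  assumes "finite Y" "X \<subseteq> Y" "f \<in> Y \<rightarrow> carrier V" "lin_indep_family R V act f Y"
  shows "lin_indep_family R V act f X"
  unfolding lin_indep_iff
proof (intro ballI impI)
  fix c x assume c: "c \<in> X \<rightarrow> carrier R" "lc f c X = \<zero>\<^bsub>V\<^esub>" and x: "x \<in> X"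
  have "lc f (extend_zero X c) Y = \<zero>\<^bsub>V\<^esub>" using lc_extend_zero[OF assms(1-3) c(1)] c by simp
  moreover have "extend_zero X c \<in> Y \<rightarrow> carrier R" using extend_zero_closed[OF c(1)] by blast
  ultimately have "extend_zero X c x = \<zero>\<^bsub>R\<^esub>" using assms x unfolding lin_indep_iff by blast
  then show "c x = \<zero>\<^bsub>R\<^esub>" using x by (simp add: extend_zero_def)
qed

text \<open>Solve the relation for the term of \<open>x\<close> and cancel \<open>c x\<close> by an
  inverse from the right, the side on which scalars act.\<close>

lemma dependent_lspan:
  assumes X: "finite X" "f \<in> X \<rightarrow> carrier V" and c: "c \<in> X \<rightarrow> carrier R" "lc f c X = \<zero>\<^bsub>V\<^esub>"
    and x: "x \<in> X" "c x \<noteq> \<zero>\<^bsub>R\<^esub>"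
  shows "f x \<in> lspan f (X - {x})"
proof -
  have cx: "c x \<in> carrier R" "f x \<in> carrier V" using c x X by auto
  obtain b where b: "b \<in> carrier R" "c x \<otimes>\<^bsub>R\<^esub> b = \<one>\<^bsub>R\<^esub>" using inverse cx x by blast
  have f': "f \<in> X - {x} \<rightarrow> carrier V" "c \<in> X - {x} \<rightarrow> carrier R" "finite (X - {x})" using X c by auto
  let ?w = "lc f c (X - {x})"
  have w: "?w \<in> lspan f (X - {x})" using lspanI f' by blast
  have wV: "?w \<in> carrier V" using f' by simp
  have "act (f x) (c x) \<oplus>\<^bsub>V\<^esub> ?w = \<zero>\<^bsub>V\<^esub>" using lc_remove[OF X(1) x(1) X(2) c(1)] c by simp
  then have "act (f x) (c x) = \<ominus>\<^bsub>V\<^esub> ?w" using V.minus_equality wV cx act_closed by simp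
  then have "act (act (f x) (c x)) b \<in> lspan f (X - {x})"
    using lspan_scale[OF f'(3,1) _ b(1)] lspan_uminus[OF f'(3,1) w] by simp
  then show ?thesis using cx b act_assoc act_one by metis
qed

lemma lin_indep_iff_lspan:
  assumes X: "finite X" "f \<in> X \<rightarrow> carrier V"
  shows "lin_indep_family R V act f X \<longleftrightarrow> (\<forall>x\<in>X. f x \<notin> lspan f (X - {x}))"
proof
  assume L: "lin_indep_family R V act f X"
  show "\<forall>x\<in>X. f x \<notin> lspan f (X - {x})"
  proof (intro ballI notI)
    fix x assume x: "x \<in> X" and "f x \<in> lspan f (X - {x})"
    then obtain c where c: "c \<in> X - {x} \<rightarrow> carrier R" "f x = lc f c (X - {x})" by (auto simp: lspan_def)
    \<comment> \<open>The coefficient minus one at \<open>x\<close> turns the expression of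
      \<open>f x\<close> by the others into a vanishing combination.\<close>
    define c' where "c' y = (if y = x then \<ominus>\<^bsub>R\<^esub> \<one>\<^bsub>R\<^esub> else c y)" for y
    have c'X: "c' \<in> X \<rightarrow> carrier R" using c by (auto simp: c'_def)
    have fx: "f x \<in> carrier V" using X x by blast
    have "lc f c' (X - {x}) = lc f c (X - {x})"
      using c c'X X by (intro lc_cong) (auto simp: c'_def)
    then have "lc f c' X = act (f x) (\<ominus>\<^bsub>R\<^esub> \<one>\<^bsub>R\<^esub>) \<oplus>\<^bsub>V\<^esub> f x"
      using lc_remove[OF X(1) x X(2) c'X] c by (simp add: c'_def)
    also have "\<dots> = \<zero>\<^bsub>V\<^esub>" using fx by (simp add: act_uminus act_one V.l_neg)
    finally have "c' x = \<zero>\<^bsub>R\<^esub>" using L c'X x unfolding lin_indep_iff by blast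
    then have "\<ominus>\<^bsub>R\<^esub> \<one>\<^bsub>R\<^esub> = \<zero>\<^bsub>R\<^esub>" by (simp add: c'_def)
    then have "\<one>\<^bsub>R\<^esub> = \<zero>\<^bsub>R\<^esub>" using R.minus_minus[OF R.one_closed] R.minus_zero by metis
    then show False using one_not_zero by blast
  qed
next
  assume "\<forall>x\<in>X. f x \<notin> lspan f (X - {x})"
  then show "lin_indep_family R V act f X" using dependent_lspan[OF X] unfolding lin_indep_iff by blast
qed

lemma lin_indep_insert:
  assumes X: "finite X" "f \<in> insert x X \<rightarrow> carrier V" "x \<notin> X"
  shows "lin_indep_family R V act f (insert x X) \<longleftrightarrow> lin_indep_family R V act f X \<and> f x \<notin> lspan f X"
proof
  assume L: "lin_indep_family R V act f (insert x X)"
  then have "f x \<notin> lspan f (insert x X - {x})" using lin_indep_iff_lspan X by blast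
  then show "lin_indep_family R V act f X \<and> f x \<notin> lspan f X" using X L lin_indep_subset[of "insert x X" X f] by auto
next
  assume L: "lin_indep_family R V act f X \<and> f x \<notin> lspan f X"
  show "lin_indep_family R V act f (insert x X)"
    unfolding lin_indep_iff
  proof (intro ballI impI)
    fix c y assume c: "c \<in> insert x X \<rightarrow> carrier R" "lc f c (insert x X) = \<zero>\<^bsub>V\<^esub>" and y: "y \<in> insert x X"
    have cx: "c x = \<zero>\<^bsub>R\<^esub>"
      using dependent_lspan[of "insert x X" f c x] X c L by auto
    have "lc f c X = \<zero>\<^bsub>V\<^esub>"
      using c cx X by (simp add: lc_insert act_zero_scalar)
    moreover have "c \<in> X \<rightarrow> carrier R" using c by auto
    ultimately have "\<forall>z\<in>X. c z = \<zero>\<^bsub>R\<^esub>" using L unfolding lin_indep_iff by blast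
    then show "c y = \<zero>\<^bsub>R\<^esub>" using y cx by auto
  qed
qed

lemma lin_indep_coeff_unique:
  assumes X: "finite X" "f \<in> X \<rightarrow> carrier V" "lin_indep_family R V act f X"
    and c: "c \<in> X \<rightarrow> carrier R" "c' \<in> X \<rightarrow> carrier R" "lc f c X = lc f c' X" and x: "x \<in> X"
  shows "c x = c' x"
proof -
  have n: "(\<lambda>x. \<ominus>\<^bsub>R\<^esub> c' x) \<in> X \<rightarrow> carrier R" using c by auto
  have "lc f (\<lambda>x. c x \<oplus>\<^bsub>R\<^esub> \<ominus>\<^bsub>R\<^esub> c' x) X = \<zero>\<^bsub>V\<^esub>"
    using lc_add[OF X(2) c(1) n] lc_uminus[OF X(1,2) c(2)] c X V.r_neg[of "lc f c' X"] by simp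
  moreover have "(\<lambda>x. c x \<oplus>\<^bsub>R\<^esub> \<ominus>\<^bsub>R\<^esub> c' x) \<in> X \<rightarrow> carrier R" using c by auto
  ultimately have "c x \<oplus>\<^bsub>R\<^esub> \<ominus>\<^bsub>R\<^esub> c' x = \<zero>\<^bsub>R\<^esub>" using X(3) x unfolding lin_indep_iff by blast
  moreover have "c x \<in> carrier R" "c' x \<in> carrier R" using c x by auto
  ultimately have "\<ominus>\<^bsub>R\<^esub> (\<ominus>\<^bsub>R\<^esub> c' x) = c x" by (intro R.minus_equality) auto
  then show ?thesis using \<open>c' x \<in> carrier R\<close> R.minus_minus by simp
qed

text \<open>Coordinates with respect to an independent family are unique, so those of
  \<open>v\<close> vanish outside \<open>Y\<close> and outside \<open>Z\<close>.\<close>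

lemma lspan_Int:
  assumes X: "finite X" "f \<in> X \<rightarrow> carrier V" "lin_indep_family R V act f X"
    and YZ: "Y \<subseteq> X" "Z \<subseteq> X" and v: "v \<in> lspan f Y" "v \<in> lspan f Z"
  shows "v \<in> lspan f (Y \<inter> Z)"
proof -
  obtain c c' where c: "c \<in> Y \<rightarrow> carrier R" "v = lc f c Y" "c' \<in> Z \<rightarrow> carrier R" "v = lc f c' Z"
    using v by (auto simp: lspan_def)
  let ?c = "extend_zero Y c" and ?c' = "extend_zero Z c'"
  have cX: "?c \<in> X \<rightarrow> carrier R" "?c' \<in> X \<rightarrow> carrier R" using extend_zero_closed c by auto
  have "lc f ?c X = v" "lc f ?c' X = v" using lc_extend_zero[OF X(1) YZ(1) X(2) c(1)] lc_extend_zero[OF X(1) YZ(2) X(2) c(3)] c(2,4) by auto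
  then have "?c x = ?c' x" if "x \<in> X" for x using lin_indep_coeff_unique[OF X cX] that by simp
  then have "?c x = \<zero>\<^bsub>R\<^esub>" if "x \<in> X - Y \<inter> Z" for x using that unfolding extend_zero_def by (metis DiffE IntI)
  then have "lc f ?c X = lc f ?c (Y \<inter> Z)"
    using X YZ cX by (intro lc_mono_neutral) auto
  moreover have "?c \<in> Y \<inter> Z \<rightarrow> carrier R" using cX YZ by auto
  ultimately show ?thesis using \<open>lc f ?c X = v\<close> lspanI by metis
qed

text \<open>If the two spans met only in the span of \<open>Z\<close>, the union would be independent.\<close>

lemma lspan_Int_larger:
  assumes fin: "finite Z" "finite A" "finite B" and dis: "Z \<inter> A = {}" "Z \<inter> B = {}" "A \<inter> B = {}"
    and f: "f \<in> Z \<union> A \<union> B \<rightarrow> carrier V"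
    and ZA: "lin_indep_family R V act f (Z \<union> A)" and ZB: "lin_indep_family R V act f (Z \<union> B)"
    and dep: "\<not> lin_indep_family R V act f (Z \<union> A \<union> B)"
  shows "\<exists>v. v \<in> lspan f A \<and> v \<in> lspan f (Z \<union> B) \<and> v \<notin> lspan f Z"
proof -
  let ?X = "Z \<union> A \<union> B"
  have X: "finite ?X" using fin by blast
  obtain c x where c: "c \<in> ?X \<rightarrow> carrier R" "lc f c ?X = \<zero>\<^bsub>V\<^esub>" "x \<in> ?X" "c x \<noteq> \<zero>\<^bsub>R\<^esub>"
    using dep unfolding lin_indep_iff by blast
  \<comment> \<open>The common vector is the part over \<open>A\<close> of a nontrivial relation; up
    to sign it is the part over \<open>Z \<union> B\<close>.\<close>
  let ?v = "lc f c A" and ?w = "lc f c (Z \<union> B)"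
  have split: "lc f c ?X = ?v \<oplus>\<^bsub>V\<^esub> ?w"
  proof -
    have "?X = A \<union> (Z \<union> B)" by blast
    then show ?thesis unfolding lc_def using fin dis f c
      by (simp only:, intro V.finsum_Un_disjoint) (auto simp: act_closed Pi_iff)
  qed
  have V: "?v \<in> carrier V" "?w \<in> carrier V" using f c by (auto intro!: lc_closed)
  have vw: "?v = \<ominus>\<^bsub>V\<^esub> ?w" using split c V V.minus_equality by simp
  have 1: "?v \<in> lspan f A" using c by (intro lspanI) auto
  have "?w \<in> lspan f (Z \<union> B)" using c by (intro lspanI) auto
  then have 2: "?v \<in> lspan f (Z \<union> B)" using vw lspan_uminus[of "Z \<union> B" f ?w] fin f by auto
  have "?v \<notin> lspan f Z"
  proof
    assume "?v \<in> lspan f Z"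
    then have "?v \<in> lspan f (A \<inter> Z)"
      using lspan_Int[OF _ _ ZA, of A Z] 1 fin f by auto
    then have "?v \<in> lspan f {}" using dis by (simp add: Int_commute)
    then have v0: "?v = \<zero>\<^bsub>V\<^esub>" by (simp add: lspan_def)
    have "lin_indep_family R V act f A" using lin_indep_subset[OF _ _ _ ZA, of A] fin f by auto
    then have cA: "\<forall>y\<in>A. c y = \<zero>\<^bsub>R\<^esub>" using v0 c unfolding lin_indep_iff by auto
    have "?w = \<zero>\<^bsub>V\<^esub>" using split c v0 V by simp
    then have "\<forall>y\<in>Z \<union> B. c y = \<zero>\<^bsub>R\<^esub>" using ZB c unfolding lin_indep_iff by auto
    then show False using cA c by auto
  qed
  then show ?thesis using 1 2 by blast
qed

end

section \<open>Affine geometry in terms of directions\<close>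

text \<open>\<open>A\<close> is the set of affine points, \<open>H\<close> the hyperplane at infinity, \<open>d x y\<close> the point at infinity of
  the line through \<open>x\<close> and \<open>y\<close> (for \<open>x \<noteq> y\<close> only), and \<open>C\<close> is collinearity in \<open>H\<close>.\<close>

locale dir_space =
  fixes A H :: "'p set" and d :: "'p \<Rightarrow> 'p \<Rightarrow> 'p" and C :: "'p \<Rightarrow> 'p \<Rightarrow> 'p \<Rightarrow> bool"
  assumes d_in: "\<lbrakk>x \<in> A; y \<in> A; x \<noteq> y\<rbrakk> \<Longrightarrow> d x y \<in> H"
    and d_sym: "\<lbrakk>x \<in> A; y \<in> A; x \<noteq> y\<rbrakk> \<Longrightarrow> d x y = d y x"
    and d_tr: "\<lbrakk>x \<in> A; y \<in> A; z \<in> A; x \<noteq> y; x \<noteq> z; y \<noteq> z; d x y = d x z\<rbrakk> \<Longrightarrow> d y z = d x y"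
    and d_ex: "\<lbrakk>x \<in> A; h \<in> H\<rbrakk> \<Longrightarrow> \<exists>y\<in>A. y \<noteq> x \<and> d x y = h"
    and d_col: "\<lbrakk>x \<in> A; y \<in> A; z \<in> A; x \<noteq> y; x \<noteq> z; y \<noteq> z\<rbrakk> \<Longrightarrow> C (d x y) (d y z) (d x z)"
    and d_meet: "\<lbrakk>x \<in> A; y \<in> A; x \<noteq> y; h \<in> H; k \<in> H; h \<noteq> k; d x y \<noteq> h; d x y \<noteq> k; C (d x y) h k\<rbrakk>
      \<Longrightarrow> \<exists>z\<in>A. z \<noteq> x \<and> z \<noteq> y \<and> d x z = h \<and> d y z = k"
    and C_swap: "C h k l \<Longrightarrow> C k h l"
    and C_rot: "C h k l \<Longrightarrow> C h l k"
    and C_refl: "C h h k"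
    and C_trans: "\<lbrakk>h \<noteq> k; C h k l; C h k m\<rbrakk> \<Longrightarrow> C h l m"
    and dim: "\<lbrakk>h \<in> H; k \<in> H; h \<noteq> k\<rbrakk> \<Longrightarrow> \<exists>l\<in>H. \<not> C h k l"
    and nontriv: "\<exists>h\<in>H. \<exists>k\<in>H. h \<noteq> k"
begin

lemma d_tr': "\<lbrakk>x \<in> A; y \<in> A; z \<in> A; x \<noteq> y; x \<noteq> z; y \<noteq> z; d x y = d y z\<rbrakk> \<Longrightarrow> d x z = d x y"
  using d_tr[of y x z] d_sym by metis

lemma other_dir: "h \<in> H \<Longrightarrow> \<exists>k\<in>H. k \<noteq> h"
  using nontriv by metis

text \<open>The point \<open>y\<close> lies on the line through \<open>x\<close> with direction
  \<open>h\<close>. The case \<open>y = x\<close> is separate because \<open>d x x\<close> carries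
  no information.\<close>

definition on :: "'p \<Rightarrow> 'p \<Rightarrow> 'p \<Rightarrow> bool" where
  "on x h y \<longleftrightarrow> y = x \<or> d x y = h"

lemma on_refl [simp]: "on x h x"
  by (simp add: on_def)

lemma on_sym: "\<lbrakk>x \<in> A; y \<in> A; on x h y\<rbrakk> \<Longrightarrow> on y h x"
  using d_sym unfolding on_def by metis

lemma on_trans: "\<lbrakk>x \<in> A; y \<in> A; z \<in> A; on x h y; on y h z\<rbrakk> \<Longrightarrow> on x h z"
  using d_tr' unfolding on_def by metis

lemma on_unique: "\<lbrakk>x \<in> A; y \<in> A; z \<in> A; w \<in> A; on x h z; on x h w; on y k z; on y k w; h \<noteq> k\<rbrakk> \<Longrightarrow> z = w"
  by (metis on_def on_sym on_trans)

end

text \<open>Here \<open>\<kappa> x\<close> encodes the line joining \<open>x\<close> to a fixed center, and \<open>N p q x\<close> says that \<open>p\<close>, \<open>q\<close>, \<open>x\<close>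
  and the center are not coplanar. The center is a point of \<open>H\<close> for translations and of \<open>A\<close> for
  homotheties, which are treated simultaneously in this way.\<close>

locale perspective = dir_space +
  fixes A0 :: "'a set" and \<kappa> :: "'a \<Rightarrow> 'a set" and N :: "'a \<Rightarrow> 'a \<Rightarrow> 'a \<Rightarrow> bool"
  assumes A0: "A0 \<subseteq> A"
    and image_ex: "\<lbrakk>p \<in> A0; p' \<in> A0; x \<in> A0; \<kappa> p = \<kappa> p'; \<kappa> x \<noteq> \<kappa> p\<rbrakk> \<Longrightarrow> \<exists>x'\<in>A0. \<kappa> x = \<kappa> x' \<and> d p x = d p' x'"
    and image_unique: "\<lbrakk>p' \<in> A0; x' \<in> A0; x'' \<in> A0; \<kappa> x' = \<kappa> x''; \<kappa> x' \<noteq> \<kappa> p'; d p' x' = d p' x''\<rbrakk> \<Longrightarrow> x' = x''"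
    and N_swap: "\<lbrakk>p \<in> A0; q \<in> A0; x \<in> A0; N p q x\<rbrakk> \<Longrightarrow> N q p x"
    and N_rot: "\<lbrakk>p \<in> A0; q \<in> A0; x \<in> A0; N p q x\<rbrakk> \<Longrightarrow> N p x q"
    and N_distinct: "\<lbrakk>p \<in> A0; q \<in> A0; x \<in> A0; N p q x\<rbrakk> \<Longrightarrow> \<kappa> p \<noteq> \<kappa> q"
    and N_ex: "\<lbrakk>p \<in> A0; q \<in> A0; \<kappa> p \<noteq> \<kappa> q\<rbrakk> \<Longrightarrow> \<exists>r\<in>A0. N p q r"
    and N_exchange: "\<lbrakk>p \<in> A0; q \<in> A0; x \<in> A0; r \<in> A0; \<kappa> p \<noteq> \<kappa> q; \<kappa> p \<noteq> \<kappa> x; \<kappa> q \<noteq> \<kappa> x; \<not> N p q x; N p q r\<rbrakk>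
      \<Longrightarrow> N p x r"
    and desargues: "\<lbrakk>p \<in> A0; q \<in> A0; x \<in> A0; p' \<in> A0; q' \<in> A0; x' \<in> A0; N p q x;
      \<kappa> p = \<kappa> p'; \<kappa> q = \<kappa> q'; \<kappa> x = \<kappa> x'; d p q = d p' q'; d p x = d p' x'\<rbrakk> \<Longrightarrow> d q x = d q' x'"
    and class_ex: "p \<in> A0 \<Longrightarrow> \<exists>q\<in>A0. \<kappa> q \<noteq> \<kappa> p"
begin

text \<open>The dilatation with the given center that takes \<open>p\<close> to \<open>p'\<close>
  must take \<open>x\<close> to \<open>x'\<close>: the point \<open>x'\<close> is on the line
  joining \<open>x\<close> to the center, and \<open>p' x'\<close> is parallel to
  \<open>p x\<close>. This determines \<open>x'\<close> only for \<open>x\<close> off the line of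
  \<open>p\<close>.\<close>

definition D :: "'a \<Rightarrow> 'a \<Rightarrow> 'a \<Rightarrow> 'a \<Rightarrow> bool" where
  "D p p' x x' \<longleftrightarrow> p \<in> A0 \<and> p' \<in> A0 \<and> x \<in> A0 \<and> x' \<in> A0 \<and> \<kappa> p = \<kappa> p' \<and> \<kappa> x = \<kappa> x' \<and> \<kappa> p \<noteq> \<kappa> x \<and> d p x = d p' x'"

lemma D_sym: "D p p' x x' \<Longrightarrow> D x x' p p'"
  unfolding D_def using A0 d_sym by (metis subsetD)

lemma D_inv: "D p p' x x' \<Longrightarrow> D p' p x' x"
  unfolding D_def by metis

lemma D_unique: "\<lbrakk>D p p' x x'; D p p' x x''\<rbrakk> \<Longrightarrow> x' = x''"
  unfolding D_def using image_unique[of p' x' x''] by metis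

lemma D_ex: "\<lbrakk>p \<in> A0; p' \<in> A0; x \<in> A0; \<kappa> p = \<kappa> p'; \<kappa> x \<noteq> \<kappa> p\<rbrakk> \<Longrightarrow> \<exists>x'. D p p' x x'"
  unfolding D_def using image_ex[of p p' x] by metis

lemma D_trans_generic: "\<lbrakk>D p p' q q'; D p p' x x'; N p q x\<rbrakk> \<Longrightarrow> D q q' x x'"
  using desargues[of p q x p' q' x'] N_distinct[of q x p] N_rot N_swap unfolding D_def by metis

text \<open>Desargues is available only for triangles not coplanar with the center. In the coplanar
  case a point \<open>r\<close> off the plane helps: the triangles \<open>p q r\<close>,
  \<open>p r x\<close> and \<open>r q x\<close> are all in general position, and three applications
  lead from \<open>p\<close> to \<open>q\<close> by way of \<open>r\<close>.\<close>

lemma D_trans: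
  assumes q: "D p p' q q'" and x: "D p p' x x'" and qx: "\<kappa> q \<noteq> \<kappa> x"
  shows "D q q' x x'"
proof (cases "N p q x")
  case True
  then show ?thesis using D_trans_generic q x by blast
next
  case False
  have A: "p \<in> A0" "p' \<in> A0" "q \<in> A0" "x \<in> A0" "\<kappa> p \<noteq> \<kappa> q" "\<kappa> p \<noteq> \<kappa> x" "\<kappa> p = \<kappa> p'"
    using q x by (auto simp: D_def)
  obtain r where r: "r \<in> A0" "N p q r" using N_ex A by metis
  have pxr: "N p x r" using N_exchange[of p q x r] A r qx False by blast
  have "\<not> N q p x" using False N_swap A by blast
  then have qxr: "N q x r" using N_exchange[of q p x r] N_swap A r qx by metis
  obtain r' where r': "D p p' r r'"
    using D_ex[of p p' r] A r N_distinct[of p r q] N_rot by metis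
  have 1: "D q q' r r'" using D_trans_generic[OF q r' r(2)] .
  have "N p r x" using pxr N_rot A r by blast
  then have 2: "D r r' x x'" using D_trans_generic[OF r' x] by blast
  have "N r q x" using qxr N_rot N_swap A r by blast
  then show ?thesis using D_trans_generic[OF D_sym[OF 1] 2] by blast
qed

text \<open>Images of points off the line of \<open>p\<close> come from the pair \<open>p\<close>,
  \<open>p'\<close>. Points on that line get theirs from a second pair \<open>q\<close>,
  \<open>q'\<close>, where \<open>q\<close> is off the line. The fact \<open>mixed\<close> says that
  the two halves of the definition fit together.\<close>

lemma extend:
  assumes p: "p \<in> A0" "p' \<in> A0" "\<kappa> p = \<kappa> p'"
  obtains f where "f p = p'" "\<And>x. x \<notin> A0 \<Longrightarrow> f x = x" "\<And>x. x \<in> A0 \<Longrightarrow> f x \<in> A0 \<and> \<kappa> (f x) = \<kappa> x"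
    "\<And>x y. \<lbrakk>x \<in> A0; y \<in> A0; \<kappa> x \<noteq> \<kappa> y\<rbrakk> \<Longrightarrow> d (f x) (f y) = d x y" "A0 \<subseteq> f ` A0"
proof -
  obtain q where q: "q \<in> A0" "\<kappa> q \<noteq> \<kappa> p" using class_ex p by blast
  obtain q' where q': "D p p' q q'" using D_ex[of p p' q] p q by blast
  then have qA: "q' \<in> A0" "\<kappa> q = \<kappa> q'" by (auto simp: D_def)
  define F where "F x x' \<longleftrightarrow> (if \<kappa> x \<noteq> \<kappa> p then D p p' x x' else D q q' x x')" for x x'
  have F_ex: "\<exists>x'. F x x'" if "x \<in> A0" for x
    using D_ex[of p p' x] D_ex[of q q' x] p q qA that unfolding F_def by metis
  have F_unique: "F x x' \<Longrightarrow> F x x'' \<Longrightarrow> x' = x''" for x x' x''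
    unfolding F_def using D_unique by metis
  have F_A0: "F x x' \<Longrightarrow> x \<in> A0 \<and> x' \<in> A0 \<and> \<kappa> x' = \<kappa> x" for x x'
    unfolding F_def D_def by (auto split: if_splits)
  have mixed: "D x x' y y'" if "F x x'" "F y y'" "\<kappa> x = \<kappa> p" "\<kappa> y \<noteq> \<kappa> p" for x x' y y'
  proof -
    have x: "D q q' x x'" and y: "D p p' y y'" using that by (auto simp: F_def)
    show ?thesis
    proof (cases "\<kappa> y = \<kappa> q")
      case False
      then have "D q q' y y'" using D_trans q' y by metis
      then show ?thesis using D_trans[OF x] that by metis
    next
      case True
      \<comment> \<open>Here \<open>x\<close> is on the line of \<open>p\<close> and
        \<open>y\<close> on the line of \<open>q\<close>, so neither base pair determines both
        images. A third base \<open>s\<close> off both lines does.\<close>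
      obtain s where s: "s \<in> A0" "N p q s" using N_ex p q by metis
      then have sp: "\<kappa> s \<noteq> \<kappa> p" "\<kappa> s \<noteq> \<kappa> q" using N_distinct N_rot N_swap p q by metis+
      obtain s' where s': "D p p' s s'" using D_ex p s sp by metis
      have "D q q' s s'" using D_trans[OF q' s'] sp by metis
      then have 1: "D s s' x x'" using D_trans[OF _ x] sp that by metis
      have "D s s' y y'" using D_trans[OF s' y] sp True by metis
      then show ?thesis using D_trans[OF 1] that by metis
    qed
  qed
  have F_D: "D x x' y y'" if "F x x'" "F y y'" "\<kappa> x \<noteq> \<kappa> y" for x x' y y'
  proof (cases "\<kappa> x = \<kappa> p")
    case True then show ?thesis using mixed that by metis
  next
    case False
    show ?thesis
    proof (cases "\<kappa> y = \<kappa> p")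
      case True then show ?thesis using mixed D_sym that by metis
    next
      case False with \<open>\<kappa> x \<noteq> \<kappa> p\<close> show ?thesis using D_trans that unfolding F_def by metis
    qed
  qed
  define f where "f x = (if x \<in> A0 then THE x'. F x x' else x)" for x
  have fF: "F x (f x)" if "x \<in> A0" for x
    unfolding f_def using that F_ex[OF that] F_unique by (auto intro: theI2)
  have f_eq: "f x = x'" if "F x x'" for x x'
    using F_unique fF F_A0 that by metis
  show thesis
  proof
    have "F p p'" unfolding F_def using D_sym[OF q'] by simp
    then show "f p = p'" by (rule f_eq)
    show "f x = x" if "x \<notin> A0" for x using that by (simp add: f_def)
    show "f x \<in> A0 \<and> \<kappa> (f x) = \<kappa> x" if "x \<in> A0" for x
      using fF F_A0 that by blast
    show "d (f x) (f y) = d x y" if "x \<in> A0" "y \<in> A0" "\<kappa> x \<noteq> \<kappa> y" for x y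
      using F_D[OF fF fF] that unfolding D_def by metis
    show "A0 \<subseteq> f ` A0"
    proof
      fix y assume y: "y \<in> A0"
      show "y \<in> f ` A0"
      proof (cases "\<kappa> y = \<kappa> p")
        case False
        then obtain x where "D p' p y x" using D_ex[of p' p y] p y by metis
        then have "F x y" unfolding F_def using D_inv False by (metis D_def)
        then show ?thesis using f_eq F_A0 by blast
      next
        case True
        then obtain x where x: "D q' q y x" using D_ex[of q' q y] qA q y by metis
        then have "F x y" unfolding F_def using D_inv True by (metis D_def)
        then show ?thesis using f_eq F_A0 by blast
      qed
    qed
  qed
qed

end

context dir_space
begin

lemma C_fst_eq: "C h k l \<Longrightarrow> C k l h"
  using C_swap C_rot by blast

lemma C_trans2: "\<lbrakk>h \<noteq> k; C h k l; C h k m\<rbrakk> \<Longrightarrow> C k l m"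
  using C_trans C_swap C_rot by metis

text \<open>The center is the point \<open>c\<close> at infinity, so the lines through it are the
  parallels of direction \<open>c\<close>. A plane contains \<open>c\<close> iff \<open>c\<close> is
  on its line at infinity; this is the last condition on \<open>p\<close>, \<open>q\<close>,
  \<open>x\<close>.\<close>

lemma translation_perspective:
  assumes c: "c \<in> H" and \<kappa>: "\<And>x y. \<lbrakk>x \<in> A; y \<in> A\<rbrakk> \<Longrightarrow> \<kappa> x = \<kappa> y \<longleftrightarrow> on x c y"
  shows "perspective A H d C A \<kappa>
    (\<lambda>p q x. \<not> on p c q \<and> \<not> on p c x \<and> \<not> on q c x \<and> \<not> C c (d p q) (d p x))"
proof -
  have sym: "on x c y \<longleftrightarrow> on y c x" if "x \<in> A" "y \<in> A" for x y
    using that on_sym by blast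
  have ond: "\<not> on x c y \<longleftrightarrow> x \<noteq> y \<and> d x y \<noteq> c" for x y
    by (auto simp: on_def)
  show ?thesis
  proof (unfold_locales, goal_cases)
    case 1 show ?case by simp
  next
    case (2 p p' x)
    then have n: "\<not> on p c x" "on p c p'" and n': "\<not> on x c p" "\<not> on p' c x" "\<not> on x c p'"
      using \<kappa>[of p p'] \<kappa>[of x p] \<kappa>[of x p'] sym[of x p] sym[of x p'] by metis+
    show ?case
    proof (cases "p = p'")
      case True then show ?thesis using 2 by blast
    next
      case False
      then have pp: "d p p' = c" using n by (auto simp: on_def)
      have ne: "x \<noteq> p" "x \<noteq> p'" "d p x \<noteq> c" "d p' x \<noteq> c" "d x p' \<noteq> c"
        using n n' by (auto simp: on_def)
      have k: "d p x \<in> H" "d x p' \<in> H" using d_in 2 ne by auto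
      have "d x p' \<noteq> d p x"
        using d_tr[of x p p'] d_sym 2 False ne pp by metis
      moreover have "C (d x p') c (d p x)"
        using d_col[of p p' x] d_sym 2 False ne pp C_swap C_rot by metis
      ultimately obtain z where z: "z \<in> A" "z \<noteq> x" "z \<noteq> p'" "d x z = c" "d p' z = d p x"
        using d_meet[of x p' c "d p x"] 2 ne k c by metis
      then show ?thesis using \<kappa>[of x z] 2 by (auto simp: on_def)
    qed
  next
    case (3 p' x' x'')
    then have "on x' c x''" "\<not> on p' c x'" using \<kappa> sym by metis+
    then show ?case using 3 d_tr[of p' x' x''] d_sym on_def on_sym by metis
  next
    case (4 p q x)
    then have ne: "p \<noteq> q" "p \<noteq> x" "q \<noteq> x" "d p q \<noteq> c" "d p x \<noteq> c" "d q x \<noteq> c" by (auto simp: on_def)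
    have "C (d p q) (d q x) (d p x)" using d_col 4 ne by blast
    moreover have "d p q = d q x \<Longrightarrow> d p x = d p q" using d_tr' 4 ne by blast
    ultimately have "\<not> C c (d q p) (d q x)"
      using 4(4) d_sym[of p q] 4(1,2) ne C_trans[of "d p q" "d q x" "d p x" c] C_swap C_rot C_refl by metis
    then show ?case using 4 sym by blast
  next
    case (5 p q x) then show ?case using sym C_rot by blast
  next
    case (6 p q x) then show ?case using \<kappa> by blast
  next
    case (7 p q)
    then have n: "\<not> on p c q" using \<kappa> by blast
    then have ne: "p \<noteq> q" "d p q \<noteq> c" by (auto simp: on_def)
    obtain l where l: "l \<in> H" "\<not> C c (d p q) l" using dim[of c "d p q"] c d_in 7 ne by metis
    obtain r where r: "r \<in> A" "r \<noteq> p" "d p r = l" using d_ex 7 l by metis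
    have lc: "l \<noteq> c" "l \<noteq> d p q" using l C_refl C_swap C_rot by metis+
    have "q \<noteq> r" using r lc by auto
    moreover have "d q r \<noteq> c"
      using d_col[of p q r] l r 7 ne \<open>q \<noteq> r\<close> C_swap C_rot by metis
    ultimately show ?case using n r l lc by (auto simp: on_def)
  next
    case (8 p q x r)
    then have n: "\<not> on p c q" "\<not> on p c x" "\<not> on q c x" using \<kappa> by metis+
    then have C1: "C c (d p q) (d p x)" using 8 by blast
    have ne: "p \<noteq> x" "d p x \<noteq> c" "p \<noteq> r" "d p r \<noteq> c" using n 8 by (auto simp: on_def)
    have C2: "\<not> C c (d p x) (d p r)"
    proof
      assume "C c (d p x) (d p r)"
      then have "C c (d p q) (d p r)" using C1 C_trans[of c "d p x" "d p q" "d p r"] C_rot ne by metis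
      then show False using 8 by blast
    qed
    have "\<not> on x c r"
    proof
      assume "on x c r"
      moreover have "x \<noteq> r" using C2 C_refl C_swap C_rot by metis
      ultimately have "d x r = c" by (auto simp: on_def)
      then show False using d_col[of p x r] C2 8 ne \<open>x \<noteq> r\<close> C_swap C_rot by metis
    qed
    then show ?case using n 8 C2 by blast
  next
    case (9 p q x p' q' x')
    then have u: "on p c p'" "on q c q'" "on x c x'" using \<kappa> by metis+
    have n: "\<not> on p c q" "\<not> on p c x" "\<not> on q c x" using 9 by auto
    have n': "\<not> on p' c q'" "\<not> on p' c x'" "\<not> on q' c x'" "\<not> on q c x'"
      using u n 9 on_sym on_trans by metis+
    have ne: "p \<noteq> q" "p \<noteq> x" "q \<noteq> x" "p' \<noteq> q'" "p' \<noteq> x'" "q' \<noteq> x'" "q \<noteq> x'"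
      "d q x \<noteq> c" "d q' x' \<noteq> c" "d q x' \<noteq> c"
      using n n' by (auto simp: on_def)
    let ?k = "d p q" and ?l = "d p x"
    have kl: "?k \<noteq> ?l" using 9 C_refl C_swap C_rot by metis
    have 1: "C ?k ?l (d q x)" using d_col[of p q x] 9 ne C_rot by metis
    have 2: "C ?k ?l (d q' x')" using d_col[of p' q' x'] 9 ne C_rot by metis
    have 3: "C c (d q x') (d q x)"
    proof (cases "x = x'")
      case True then show ?thesis using C_refl C_swap C_rot by metis
    next
      case False
      then have "d x x' = c" using u by (auto simp: on_def)
      then show ?thesis using d_col[of q x x'] 9 ne False C_swap C_rot by metis
    qed
    have 4: "C c (d q x') (d q' x')"
    proof (cases "q = q'")
      case True then show ?thesis using C_refl C_swap C_rot by metis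
    next
      case False
      then have "d q q' = c" using u by (auto simp: on_def)
      then show ?thesis using d_col[of q q' x'] 9 ne False C_swap C_rot by metis
    qed
    show ?case
    proof (rule ccontr)
      \<comment> \<open>Both directions lie on the line at infinity of the plane of the triangle,
        which joins \<open>?k\<close> and \<open>?l\<close>, and on that of the plane through the
        parallels of \<open>q\<close> and \<open>x\<close>, which passes through \<open>c\<close>.
        If they differ, the two lines coincide and \<open>c\<close> is coplanar with the
        triangle.\<close>
      assume ne2: "d q x \<noteq> d q' x'"
      have "C (d q x) (d q' x') ?k" "C (d q x) (d q' x') ?l"
        using C_trans[OF kl 1 2] C_trans2[OF kl 1 2] C_swap C_rot by metis+
      moreover have "C (d q x) (d q' x') c"
        using C_trans[of c "d q x'" "d q x" "d q' x'"] 3 4 ne C_swap C_rot by metis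
      ultimately have "C c ?k ?l" using ne2 C_trans C_trans2 C_swap C_rot by metis
      then show False using 9 by blast
    qed
  next
    case (10 p)
    obtain k where "k \<in> H" "k \<noteq> c" using other_dir c by blast
    then obtain q where "q \<in> A" "q \<noteq> p" "d p q = k" using d_ex 10 by metis
    then show ?case using \<kappa>[of q p] sym[of p q] 10 \<open>k \<noteq> c\<close> unfolding on_def by blast
  qed
qed

text \<open>With an affine center \<open>u\<close> the line joining \<open>x\<close> to the center
  is named by the direction \<open>d u x\<close>, and non-coplanarity is that of three directions.
  Desargues holds as for translations: two different directions of the third sides would span both
  the line at infinity of the triangle's plane and that of the plane of \<open>u\<close>,
  \<open>q\<close>, \<open>x\<close>.\<close>

lemma homothety_perspective:
  assumes u: "u \<in> A" and \<kappa>: "\<And>x y. \<kappa> x = \<kappa> y \<longleftrightarrow> d u x = d u y"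
  shows "perspective A H d C (A - {u}) \<kappa> (\<lambda>p q x. \<not> C (d u p) (d u q) (d u x))"
proof (unfold_locales, goal_cases)
  case 1 show ?case by blast
next
  case (2 p p' x)
  show ?case
  proof (cases "p = p'")
    case True then show ?thesis using 2 by blast
  next
    case False
    let ?a = "d u p" and ?e = "d u x"
    have ne: "?a \<noteq> ?e" "p \<noteq> x" "p' \<noteq> x" "u \<noteq> p" "u \<noteq> p'" "u \<noteq> x" "?a = d u p'" using 2 \<kappa> by (auto simp: \<kappa>)
    have k: "d p x \<noteq> ?a" "d p x \<noteq> ?e"
      using d_tr'[of u p x] d_tr'[of u x p] d_sym[of p x] ne 2 u by (metis DiffD1)+
    have "C ?a ?e (d p x)" using d_col[of u p x] C_rot 2 ne u by blast
    then obtain z where z: "z \<in> A" "z \<noteq> u" "z \<noteq> p'" "d u z = ?e" "d p' z = d p x"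
      using d_meet[of u p' ?e "d p x"] ne k 2 u d_in by (metis DiffD1)
    then show ?thesis using \<kappa> by (intro bexI[of _ z]) auto
  qed
next
  case (3 p' x' x'')
  then have eq: "d u x' = d u x''" "d u x' \<noteq> d u p'" and A: "p' \<in> A" "x' \<in> A" "x'' \<in> A" "p' \<noteq> u" "x' \<noteq> u" "x'' \<noteq> u"
    by (auto simp: \<kappa>)
  then have ne: "x' \<noteq> p'" "x'' \<noteq> p'" by auto
  show ?case
  proof (rule ccontr)
    assume neq: "x' \<noteq> x''"
    have "d x' x'' = d p' x'" using d_tr[of p' x' x''] A ne neq 3(6) by metis
    moreover have "d x' x'' = d u x'" using d_tr[of u x' x''] A u neq eq by metis
    ultimately have "d u x' = d x' p'" using d_sym[of p' x'] A ne by metis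
    then show False using d_tr'[of u x' p'] A u ne eq by metis
  qed
next
  case 4 then show ?case using C_swap by blast
next
  case 5 then show ?case using C_rot by blast
next
  case 6 then show ?case using C_refl by (force simp: \<kappa>)
next
  case (7 p q)
  then obtain l where "l \<in> H" "\<not> C (d u p) (d u q) l" using dim[of "d u p" "d u q"] d_in u by (auto simp: \<kappa>)
  then show ?case using d_ex[OF u] by (force simp: \<kappa>)
next
  case (8 p q x r)
  then show ?case using C_trans C_rot by (metis \<kappa>)
next
  case (9 p q x p' q' x')
  let ?a = "d u p" and ?b = "d u q" and ?e = "d u x" and ?k = "d p q" and ?l = "d p x"
  have eq: "d u p' = ?a" "d u q' = ?b" "d u x' = ?e" using 9 by (auto simp: \<kappa>)
  have ne: "?a \<noteq> ?b" "?a \<noteq> ?e" "?b \<noteq> ?e" using 9(7) C_refl C_swap C_rot by metis+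
  have ne2: "p \<noteq> q" "p \<noteq> x" "q \<noteq> x" "p' \<noteq> q'" "p' \<noteq> x'" "q' \<noteq> x'" using ne eq by (auto simp: \<kappa>)
  have A: "p \<in> A" "q \<in> A" "x \<in> A" "p' \<in> A" "q' \<in> A" "x' \<in> A" "u \<noteq> p" "u \<noteq> q" "u \<noteq> x" "u \<noteq> p'" "u \<noteq> q'" "u \<noteq> x'"
    using 9 by (auto simp: \<kappa>)
  have k: "C ?a ?b ?k" using d_col[of u p q] A u ne2 C_rot by metis
  have k': "?k \<noteq> ?b" using d_tr'[of u q p] d_sym[of p q] A u ne2 ne by metis
  have k'': "?k \<noteq> ?a" using d_tr'[of u p q] A u ne2 ne by metis
  have l: "C ?a ?e ?l" using d_col[of u p x] A u ne2 C_rot by metis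
  have m: "C ?b ?e (d q x)" "C ?b ?e (d q' x')"
    using d_col[of u q x] d_col[of u q' x'] A u ne2 eq C_rot by metis+
  have kl: "?k \<noteq> ?l"
  proof
    assume "?k = ?l"
    then have "C ?a ?k ?b" "C ?a ?k ?e" using k l C_rot by metis+
    then show False using C_trans[of ?a ?k ?b ?e] k'' 9(7) by metis
  qed
  have n: "C ?k ?l (d q x)" "C ?k ?l (d q' x')"
    using d_col[of p q x] d_col[of p' q' x'] A ne2 9 C_rot by metis+
  show ?case
  proof (rule ccontr)
    assume neq: "d q x \<noteq> d q' x'"
    have "C (d q x) (d q' x') ?k" using C_trans[OF kl n] C_swap C_rot by metis
    moreover have "C (d q x) (d q' x') ?b" "C (d q x) (d q' x') ?e"
      using C_trans[OF ne(3) m] C_trans2[OF ne(3) m] C_swap C_rot by metis+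
    ultimately have "C ?b ?e ?k" using neq C_trans C_trans2 C_swap C_rot by metis
    moreover have "C ?b ?k ?a" using k C_swap C_rot by metis
    ultimately have "C ?b ?e ?a" using k' C_trans[of ?b ?k ?e ?a] C_swap C_rot by metis
    then show False using 9(7) C_swap C_rot by metis
  qed
next
  case (10 p)
  obtain k where "k \<in> H" "k \<noteq> d u p" using other_dir[of "d u p"] d_in u 10 by blast
  then obtain q where "q \<in> A" "q \<noteq> u" "d u q = k" using d_ex u by metis
  then show ?case using \<open>k \<noteq> d u p\<close> by (intro bexI[of _ q]) (auto simp: \<kappa>)
qed

text \<open>The dilatations. As permutations of the whole type that fix everything outside
  \<open>A\<close>, they compose and invert as plain functions.\<close>

definition Dil :: "('p \<Rightarrow> 'p) set" where
  "Dil = {f. f permutes A \<and> (\<forall>x\<in>A. \<forall>y\<in>A. x \<noteq> y \<longrightarrow> d (f x) (f y) = d x y)}"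

definition Trans :: "('p \<Rightarrow> 'p) set" where
  "Trans = {f \<in> Dil. f = id \<or> (\<forall>x\<in>A. f x \<noteq> x)}"

lemma DilI:
  assumes "f permutes A" "\<And>x y. \<lbrakk>x \<in> A; y \<in> A; x \<noteq> y\<rbrakk> \<Longrightarrow> d (f x) (f y) = d x y"
  shows "f \<in> Dil"
  using assms by (simp add: Dil_def)

lemma Dil_d: "\<lbrakk>f \<in> Dil; x \<in> A; y \<in> A; x \<noteq> y\<rbrakk> \<Longrightarrow> d (f x) (f y) = d x y"
  by (simp add: Dil_def)

lemma Dil_permutes: "f \<in> Dil \<Longrightarrow> f permutes A"
  by (simp add: Dil_def)

lemma Dil_A: "f \<in> Dil \<Longrightarrow> f x \<in> A \<longleftrightarrow> x \<in> A"
  using Dil_permutes permutes_in_image by metis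

lemma Dil_inj: "f \<in> Dil \<Longrightarrow> f x = f y \<longleftrightarrow> x = y"
  using Dil_permutes permutes_inj inj_eq by metis

lemma Dil_outside: "f \<in> Dil \<Longrightarrow> x \<notin> A \<Longrightarrow> f x = x"
  using Dil_permutes permutes_not_in by metis

lemma Dil_id: "id \<in> Dil"
  by (simp add: Dil_def permutes_id)

lemma Dil_comp: "f \<in> Dil \<Longrightarrow> g \<in> Dil \<Longrightarrow> f \<circ> g \<in> Dil"
  by (rule DilI) (auto simp: permutes_compose Dil_permutes Dil_d Dil_A Dil_inj)

lemma Dil_inv:
  assumes f: "f \<in> Dil"
  shows "Hilbert_Choice.inv f \<in> Dil"
proof (rule DilI)
  have p: "f permutes A" using Dil_permutes f .
  show ip: "Hilbert_Choice.inv f permutes A" using permutes_inv[OF p] .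
  fix x y assume A: "x \<in> A" "y \<in> A" "x \<noteq> y"
  have "Hilbert_Choice.inv f x \<in> A" "Hilbert_Choice.inv f y \<in> A" using ip A permutes_in_image by metis+
  then show "d (Hilbert_Choice.inv f x) (Hilbert_Choice.inv f y) = d x y"
    using Dil_d[OF f, of "Hilbert_Choice.inv f x" "Hilbert_Choice.inv f y"] permutes_inverses(1)[OF p] A by metis
qed

lemma Dil_on: "\<lbrakk>f \<in> Dil; x \<in> A; y \<in> A; on x h y\<rbrakk> \<Longrightarrow> on (f x) h (f y)"
  unfolding on_def using Dil_d by metis

text \<open>A point off the line \<open>a b\<close> goes to the intersection of two lines with known
  point and direction. Points on \<open>a b\<close> are treated with a third point \<open>c\<close>
  off it, whose image is already known.\<close>

lemma Dil_unique:
  assumes f: "f \<in> Dil" and g: "g \<in> Dil" and a: "a \<in> A" and b: "b \<in> A" and ab: "a \<noteq> b"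
    and fa: "f a = g a" and fb: "f b = g b"
  shows "f = g"
proof -
  have off: "f x = g x" if x: "x \<in> A" and p: "p \<in> A" "q \<in> A" "f p = g p" "f q = g q" "p \<noteq> q" "\<not> on p (d p q) x" for x p q
  proof -
    have ne: "x \<noteq> p" "d p x \<noteq> d p q" using p by (auto simp: on_def)
    have qx: "q \<noteq> x" using ne by auto
    have "d p x \<noteq> d q x" using d_tr'[of p x q] d_sym[of q x] p x ne qx by metis
    moreover have "on (f p) (d p x) (f x)" "on (f q) (d q x) (f x)" "on (f p) (d p x) (g x)" "on (f q) (d q x) (g x)"
      using Dil_on[OF f p(1) x, of "d p x"] Dil_on[OF f p(2) x, of "d q x"]
        Dil_on[OF g p(1) x, of "d p x"] Dil_on[OF g p(2) x, of "d q x"] p by (auto simp: on_def)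
    ultimately show ?thesis
      using on_unique[of "f p" "f q" "f x" "g x" "d p x" "d q x"] Dil_A f g p x by metis
  qed
  have "f x = g x" for x
  proof (cases "x \<in> A")
    case True
    obtain k where k: "k \<in> H" "k \<noteq> d a b" using other_dir d_in a b ab by metis
    obtain c where c: "c \<in> A" "c \<noteq> a" "d a c = k" using d_ex a k by metis
    then have fc: "f c = g c" using off[OF c(1) a b fa fb ab] k by (auto simp: on_def)
    show ?thesis
    proof (cases "on a (d a b) x \<and> x \<noteq> a")
      case True
      then have "\<not> on a (d a c) x" using c k by (auto simp: on_def)
      then show ?thesis using off[of x a c] fc fa a c \<open>x \<in> A\<close> by metis
    next
      case False
      then show ?thesis using off[of x a b] a b ab fa fb \<open>x \<in> A\<close> by metis
    qed
  next
    case False then show ?thesis using Dil_outside f g by metis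
  qed
  then show ?thesis by blast
qed

text \<open>The map from \<open>extend\<close> preserves directions only between different lines
  through \<open>u\<close>. For two points on one such line the directions agree with that of the
  line, and injectivity follows by viewing both points from some \<open>z\<close> off the
  line.\<close>

lemma homothety_ex:
  assumes u: "u \<in> A" and p: "p \<in> A" "p' \<in> A" "p \<noteq> u" "p' \<noteq> u" "d u p = d u p'"
  shows "\<exists>f\<in>Dil. f u = u \<and> f p = p'"
proof -
  interpret perspective A H d C "A - {u}" "\<lambda>x. {d u x}" "\<lambda>p q x. \<not> C (d u p) (d u q) (d u x)"
    by (rule homothety_perspective[OF u]) simp
  obtain f where f: "f p = p'" "\<And>x. x \<notin> A - {u} \<Longrightarrow> f x = x"
    "\<And>x. x \<in> A - {u} \<Longrightarrow> f x \<in> A - {u} \<and> {d u (f x)} = {d u x}"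
    "\<And>x y. \<lbrakk>x \<in> A - {u}; y \<in> A - {u}; {d u x} \<noteq> {d u y}\<rbrakk> \<Longrightarrow> d (f x) (f y) = d x y" "A - {u} \<subseteq> f ` (A - {u})"
    using extend[of p p'] p by auto
  have fo: "f u = u" using f(2) by blast
  have fd: "d u (f x) = d u x" if "x \<in> A" "x \<noteq> u" for x using f(3)[of x] that by auto
  have fA: "f x \<in> A" "x \<noteq> u \<Longrightarrow> f x \<noteq> u" if "x \<in> A" for x
    using f(2)[of x] f(3)[of x] that by (cases "x = u"; auto)+
  have inj: "x = y" if x: "x \<in> A" and y: "y \<in> A" and eq: "f x = f y" for x y
  proof (rule ccontr)
    assume xy: "x \<noteq> y"
    then have xo: "x \<noteq> u" "y \<noteq> u" using fA(2) fo x y eq by metis+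
    then have dd: "d u x = d u y" using fd x y eq by metis
    obtain k where k: "k \<in> H" "k \<noteq> d u x" using other_dir d_in u x xo by metis
    obtain z where z: "z \<in> A" "z \<noteq> u" "d u z = k" using d_ex u k by metis
    then have "z \<noteq> x" "z \<noteq> y" using k dd by auto
    have "d z x = d (f z) (f x)" "d z y = d (f z) (f y)"
      using f(4)[of z x] f(4)[of z y] z k x y xo dd by auto
    then have "d z x = d z y" using eq by simp
    then have "d x y = d z x" using d_tr[of z x y] z x y xy \<open>z \<noteq> x\<close> \<open>z \<noteq> y\<close> by metis
    moreover have "d x y = d u x" using d_tr[of u x y] u x y xo dd xy by metis
    ultimately have "d u z = d u x" using d_tr'[of u x z] d_sym[of x z] u x z xo \<open>z \<noteq> x\<close> by metis
    then show False using z k by simp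
  qed
  have "f permutes A"
  proof (rule bij_imp_permutes)
    have "f ` A = A" using f(5) fA fo u by (metis (no_types, lifting) image_insert insert_Diff insert_mono subset_antisym image_subsetI)
    then show "bij_betw f A A" using inj by (simp add: bij_betw_def inj_on_def)
    show "f x = x" if "x \<notin> A" for x using f(2) that by blast
  qed
  moreover have "d (f x) (f y) = d x y" if x: "x \<in> A" and y: "y \<in> A" and xy: "x \<noteq> y" for x y
  proof (cases "x = u \<or> y = u")
    case True then show ?thesis using fo fd fA d_sym x y xy by metis
  next
    case False
    then have ne: "x \<noteq> u" "y \<noteq> u" by auto
    show ?thesis
    proof (cases "d u x = d u y")
      case True
      have "f x \<noteq> f y" using inj x y xy by blast
      then have "d (f x) (f y) = d u (f x)" using d_tr[of u "f x" "f y"] fA fd u x y ne True by metis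
      moreover have "d x y = d u x" using d_tr[of u x y] u x y ne True xy by metis
      ultimately show ?thesis using fd x ne by metis
    next
      case False then show ?thesis using f(4) x y ne by auto
    qed
  qed
  ultimately have "f \<in> Dil" by (rule DilI)
  then show ?thesis using f(1) fo by blast
qed

text \<open>As for homotheties, with parallels of direction \<open>c\<close> in place of lines
  through \<open>u\<close>; in addition the map must be shown to have no fixed points.\<close>

lemma translation_ex:
  assumes p: "p \<in> A" "p' \<in> A"
  shows "\<exists>f\<in>Trans. f p = p'"
proof (cases "p = p'")
  case True
  then show ?thesis using Dil_id by (auto simp: Trans_def)
next
  case False
  define c where "c = d p p'"
  have c: "c \<in> H" using d_in p False by (simp add: c_def)
  define \<kappa> where "\<kappa> x = {y \<in> A. on x c y}" for x
  have \<kappa>: "\<kappa> x = \<kappa> y \<longleftrightarrow> on x c y" if x: "x \<in> A" and y: "y \<in> A" for x y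
  proof
    show "\<kappa> x = \<kappa> y \<Longrightarrow> on x c y" using y on_refl[of y c] unfolding \<kappa>_def by blast
    show "on x c y \<Longrightarrow> \<kappa> x = \<kappa> y"
      unfolding \<kappa>_def using on_trans[OF x y] on_trans[OF y x] on_sym[OF x y] by blast
  qed
  interpret perspective A H d C A \<kappa>
    "\<lambda>p q x. \<not> on p c q \<and> \<not> on p c x \<and> \<not> on q c x \<and> \<not> C c (d p q) (d p x)"
    by (rule translation_perspective[OF c \<kappa>])
  have "on p c p'" by (simp add: on_def c_def)
  then obtain f where f: "f p = p'" "\<And>x. x \<notin> A \<Longrightarrow> f x = x"
    "\<And>x. x \<in> A \<Longrightarrow> f x \<in> A \<and> \<kappa> (f x) = \<kappa> x"
    "\<And>x y. \<lbrakk>x \<in> A; y \<in> A; \<kappa> x \<noteq> \<kappa> y\<rbrakk> \<Longrightarrow> d (f x) (f y) = d x y" "A \<subseteq> f ` A"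
    using extend[of p p'] p \<kappa>[of p p'] by metis
  have fA: "f x \<in> A" if "x \<in> A" for x using f(3) that by blast
  have fon: "on x c (f x)" "on (f x) c x" if "x \<in> A" for x
    using f(3)[OF that] \<kappa>[of "f x" x] \<kappa>[of x "f x"] that by auto
  have fd: "d (f x) (f y) = d x y" if "x \<in> A" "y \<in> A" "\<not> on x c y" for x y
    using f(4) \<kappa> that by metis
  have off: "\<exists>z\<in>A. \<not> on x c z" if "x \<in> A" for x
    using class_ex[OF that] \<kappa> on_sym that by metis
  have inj: "x = y" if x: "x \<in> A" and y: "y \<in> A" and eq: "f x = f y" for x y
  proof (rule ccontr)
    assume xy: "x \<noteq> y"
    have oxy: "on x c y" using fon[OF x] fon[OF y] eq on_trans fA x y by metis
    obtain z where z: "z \<in> A" "\<not> on x c z" using off x by blast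
    then have nz: "\<not> on z c x" "\<not> on z c y" using on_sym on_trans oxy x y by metis+
    then have "d z x = d z y" using fd[of z x] fd[of z y] eq x y z by metis
    moreover have "z \<noteq> x" "z \<noteq> y" using nz by auto
    ultimately have "d x y = d z x" using d_tr[of z x y] z x y xy by metis
    then show False using nz oxy xy unfolding on_def by metis
  qed
  have "f ` A = A" using fA f(5) by blast
  then have "f permutes A"
    using inj f(2) by (intro bij_imp_permutes) (auto simp: bij_betw_def inj_on_def)
  moreover have "d (f x) (f y) = d x y" if x: "x \<in> A" and y: "y \<in> A" and xy: "x \<noteq> y" for x y
  proof (cases "on x c y")
    case True
    then have "on (f x) c (f y)" using fon fA on_trans x y by metis
    then show ?thesis using True xy inj x y unfolding on_def by metis
  next
    case False then show ?thesis using fd x y by blast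
  qed
  ultimately have fD: "f \<in> Dil" by (rule DilI)
  \<comment> \<open>Fixed points are excluded first off the line of \<open>p\<close>, where a fixed
    \<open>x\<close> would see \<open>p\<close> and \<open>p'\<close> in the same direction, and
    then on that line by comparison with a moved point \<open>q\<close> off it.\<close>
  have nf: "f x \<noteq> x" if x: "x \<in> A" and px: "\<not> on p c x" for x
  proof
    assume "f x = x"
    then have "d x p = d x p'" using fd[of x p] f(1) on_sym x px p by metis
    moreover have "x \<noteq> p" "x \<noteq> p'" using px c_def by (auto simp: on_def)
    ultimately have "d p p' = d x p" using d_tr[of x p p'] x p False by metis
    then show False using px d_sym[of x p] x p \<open>x \<noteq> p\<close> by (auto simp: on_def c_def)
  qed
  have "f x \<noteq> x" if x: "x \<in> A" for x
  proof
    assume fx: "f x = x"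
    obtain q where q: "q \<in> A" "\<not> on p c q" using off p by blast
    have "on p c x" using nf x fx by blast
    then have "\<not> on x c q" using q on_trans x p by blast
    then have "d x q = d x (f q)" using fd[of x q] fx x q by metis
    moreover have "x \<noteq> q" "q \<noteq> f q" "f q \<noteq> x" using \<open>\<not> on x c q\<close> nf[OF q] fx inj[of q x] x q by auto
    ultimately have "d q (f q) = d x q" using d_tr[of x q "f q"] x q fA by metis
    then show False using \<open>\<not> on x c q\<close> fon[OF q(1)] \<open>q \<noteq> f q\<close> by (auto simp: on_def)
  qed
  then show ?thesis using fD f(1) by (auto simp: Trans_def)
qed

end

section \<open>Translations and scalars\<close>

context dir_space
begin

text \<open>A line joining a point to its image is mapped to itself. Two such lines of different
  directions are coplanar, because \<open>x y\<close> and \<open>f x f y\<close> are parallel, so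
  they meet in a point \<open>z\<close>. Its image is on both lines, so \<open>z\<close> would be
  fixed.\<close>

lemma fixed_point_free_center:
  assumes f: "f \<in> Dil" and free: "\<And>x. x \<in> A \<Longrightarrow> f x \<noteq> x" and x: "x \<in> A" and y: "y \<in> A"
  shows "d x (f x) = d y (f y)"
proof (rule ccontr)
  let ?a = "d x (f x)" and ?b = "d y (f y)" and ?k = "d x y"
  assume ab: "?a \<noteq> ?b"
  then have xy: "x \<noteq> y" by auto
  have fA: "f z \<in> A" if "z \<in> A" for z using Dil_A f that by blast
  have H: "?a \<in> H" "?b \<in> H" using d_in x y fA free by metis+
  have fk: "d (f x) (f y) = ?k" using Dil_d f x y xy by blast
  have neq: "f x \<noteq> f y" using Dil_inj f xy by blast
  have ka: "?k \<noteq> ?a"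
  proof
    assume k: "?k = ?a"
    have 1: "on x ?a (f x)" "on x ?a y" using k by (auto simp: on_def)
    moreover have "on (f x) ?a (f y)" using fk k by (auto simp: on_def)
    ultimately have "on y ?a (f y)" using on_trans on_sym x y fA by metis
    then show False using ab free[OF y] unfolding on_def by metis
  qed
  have kb: "?k \<noteq> ?b"
  proof
    assume k: "?k = ?b"
    have 1: "on y ?b (f y)" "on y ?b x" using k d_sym x y xy by (auto simp: on_def)
    moreover have "on (f y) ?b (f x)" using fk k d_sym[of "f x" "f y"] x y fA neq by (auto simp: on_def)
    ultimately have "on x ?b (f x)" using on_trans on_sym x y fA by metis
    then show False using ab free[OF x] unfolding on_def by metis
  qed
  have fxy: "f x \<noteq> y" using ka by auto
  have m: "d (f x) y \<noteq> ?k"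
    using d_tr'[of x y "f x"] d_sym[of "f x" y] free x y fA xy fxy ka by metis
  have 1: "C ?k (d (f x) y) ?a"
    using d_col[of x "f x" y] free x y fA xy fxy C_fst_eq C_swap by metis
  have 2: "C ?k (d (f x) y) ?b"
    using d_col[of "f x" y "f y"] fk free x y fA neq fxy C_swap C_fst_eq by metis
  have "C ?k ?a ?b" using C_trans m 1 2 by metis
  then obtain z where z: "z \<in> A" "z \<noteq> x" "z \<noteq> y" "d x z = ?a" "d y z = ?b"
    using d_meet[of x y ?a ?b] x y xy H ab ka kb by metis
  have "on x ?a z" "on (f x) ?a (f z)" "on x ?a (f x)"
    using Dil_on[OF f x z(1)] z by (auto simp: on_def)
  then have "on z ?a (f z)" using on_trans on_sym x z fA by metis
  moreover have "on y ?b z" "on (f y) ?b (f z)" "on y ?b (f y)"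
    using Dil_on[OF f y z(1)] z by (auto simp: on_def)
  then have "on z ?b (f z)" using on_trans on_sym y z fA by metis
  ultimately show False using ab free[OF z(1)] unfolding on_def by metis
qed

lemma Trans_Dil: "f \<in> Trans \<Longrightarrow> f \<in> Dil"
  by (simp add: Trans_def)

lemma Trans_id: "id \<in> Trans"
  by (simp add: Trans_def Dil_id)

lemma Trans_fixed: "\<lbrakk>f \<in> Trans; x \<in> A; f x = x\<rbrakk> \<Longrightarrow> f = id"
  by (auto simp: Trans_def)

lemma Trans_center: "\<lbrakk>f \<in> Trans; x \<in> A; y \<in> A; f \<noteq> id\<rbrakk> \<Longrightarrow> d x (f x) = d y (f y)"
  using fixed_point_free_center unfolding Trans_def by blast

lemma Trans_on: "\<lbrakk>f \<in> Trans; x \<in> A; y \<in> A; f \<noteq> id\<rbrakk> \<Longrightarrow> on y (d x (f x)) (f y)"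
  using Trans_center unfolding on_def by metis

text \<open>For \<open>y\<close> off the line of \<open>p\<close>, the image is where the parallel
  of that line through \<open>y\<close> meets the parallel of \<open>p y\<close> through
  \<open>f p\<close>. Two images determine a dilatation.\<close>

lemma Trans_unique:
  assumes f: "f \<in> Trans" and g: "g \<in> Trans" and p: "p \<in> A" and eq: "f p = g p"
  shows "f = g"
proof (cases "f p = p")
  case True
  then show ?thesis using Trans_fixed f g p eq by metis
next
  case False
  let ?c = "d p (f p)"
  have D: "f \<in> Dil" "g \<in> Dil" using f g Trans_Dil by auto
  have fA: "f z \<in> A" "g z \<in> A" if "z \<in> A" for z using Dil_A D that by blast+
  have "?c \<in> H" using d_in p fA False by metis
  then obtain k where k: "k \<in> H" "k \<noteq> ?c" using other_dir by blast
  obtain y where y: "y \<in> A" "y \<noteq> p" "d p y = k" using d_ex p k by metis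
  have "f \<noteq> id" "g \<noteq> id" using False eq by auto
  then have "on y ?c (f y)" "on y ?c (g y)" using Trans_on f g p y eq by metis+
  moreover have "on p k y" using y by (auto simp: on_def)
  then have "on (f p) k (f y)" "on (f p) k (g y)" using Dil_on D p y eq by metis+
  ultimately have "f y = g y" using on_unique[of y "f p"] k y p fA by metis
  then show ?thesis using Dil_unique D p y eq by metis
qed

lemma inv_eq_conv: "f \<in> Dil \<Longrightarrow> Hilbert_Choice.inv f x = y \<longleftrightarrow> f y = x"
  using permutes_inv_eq[OF Dil_permutes] by metis

lemma Trans_inv:
  assumes f: "f \<in> Trans"
  shows "Hilbert_Choice.inv f \<in> Trans"
proof (cases "f = id")
  case True then show ?thesis using f by simp
next
  case False
  then have "f x \<noteq> x" if "x \<in> A" for x using Trans_fixed f that by blast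
  then have "Hilbert_Choice.inv f x \<noteq> x" if "x \<in> A" for x
    using inv_eq_conv[OF Trans_Dil[OF f]] that by blast
  then show ?thesis using Dil_inv[OF Trans_Dil[OF f]] by (simp add: Trans_def)
qed

text \<open>If the composition fixes a point, then \<open>g\<close> and the inverse of
  \<open>f\<close> are translations that agree there, hence everywhere.\<close>

lemma Trans_comp:
  assumes f: "f \<in> Trans" and g: "g \<in> Trans"
  shows "f \<circ> g \<in> Trans"
proof -
  have D: "f \<in> Dil" "g \<in> Dil" using f g Trans_Dil by auto
  have "f \<circ> g = id" if p: "p \<in> A" "(f \<circ> g) p = p" for p
  proof -
    have "Hilbert_Choice.inv f p = g p" using inv_eq_conv D p by auto
    then have "Hilbert_Choice.inv f = g" using Trans_unique Trans_inv f g p by metis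
    then show ?thesis using permutes_inv_o(1)[OF Dil_permutes[OF D(1)]] by metis
  qed
  then show ?thesis using Dil_comp D unfolding Trans_def by blast
qed

lemma Trans_commute_generic:
  assumes f: "f \<in> Trans" "f \<noteq> id" and g: "g \<in> Trans" "g \<noteq> id" and x: "x \<in> A" and ne: "d x (f x) \<noteq> d x (g x)"
  shows "f \<circ> g = g \<circ> f"
proof -
  let ?c = "d x (f x)" and ?e = "d x (g x)"
  have D: "f \<in> Dil" "g \<in> Dil" using f g Trans_Dil by auto
  have A: "f z \<in> A" "g z \<in> A" if "z \<in> A" for z using Dil_A D that by blast+
  have "on x ?c (f x)" "on x ?e (g x)" by (auto simp: on_def)
  then have "on (g x) ?c (g (f x))" "on (f x) ?e (f (g x))" using Dil_on D x A by metis+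
  moreover have "on (g x) ?c (f (g x))" "on (f x) ?e (g (f x))" using Trans_on f g x A by metis+
  ultimately have "g (f x) = f (g x)" using on_unique[of "g x" "f x"] ne A x by metis
  then show ?thesis using Trans_unique[OF Trans_comp[OF f(1) g(1)] Trans_comp[OF g(1) f(1)] x] by simp
qed

text \<open>Translations of different directions commute by the parallelogram they span. For equal
  directions, compose \<open>f\<close> with a translation \<open>t\<close> of another direction:
  both \<open>t\<close> and \<open>t \<circ> f\<close> commute with \<open>g\<close>, and
  \<open>t\<close> cancels.\<close>

lemma Trans_commute:
  assumes f: "f \<in> Trans" and g: "g \<in> Trans"
  shows "f \<circ> g = g \<circ> f"
proof (cases "f = id \<or> g = id")
  case True then show ?thesis by auto
next
  case False
  obtain h0 x where x: "h0 \<in> H" "x \<in> A"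
    using False f Dil_permutes Trans_Dil permutes_not_in by (metis eq_id_iff nontriv)
  let ?c = "d x (f x)"
  have fx: "f x \<noteq> x" "f x \<in> A" using False Trans_fixed f x Dil_A Trans_Dil by metis+
  show ?thesis
  proof (cases "d x (g x) = ?c")
    case False
    then show ?thesis using Trans_commute_generic f g \<open>\<not> (f = id \<or> g = id)\<close> x by metis
  next
    case True
    have "?c \<in> H" using d_in x fx by metis
    then obtain k where k: "k \<in> H" "k \<noteq> ?c" using other_dir by blast
    obtain y where y: "y \<in> A" "y \<noteq> x" "d x y = k" using d_ex x k by metis
    obtain t where t: "t \<in> Trans" "t x = y" using translation_ex x y by metis
    have tid: "t \<noteq> id" using t y by auto
    have tf: "t \<circ> f \<in> Trans" using Trans_comp t f by blast
    have tfx: "t (f x) \<in> A" using Dil_A Trans_Dil t fx by metis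
    have "on (f x) k (t (f x))" using Trans_on[OF t(1) x(2) fx(2) tid] t y by simp
    have n: "\<not> on x ?c (t (f x))"
    proof
      assume "on x ?c (t (f x))"
      moreover have "on x ?c (f x)" by (simp add: on_def)
      ultimately have "on (f x) ?c (t (f x))" using on_trans on_sym x fx tfx by metis
      then have "t (f x) = f x" using \<open>on (f x) k (t (f x))\<close> k unfolding on_def by metis
      then show False using Trans_fixed t fx tid by metis
    qed
    then have "t \<circ> f \<noteq> id" "d x ((t \<circ> f) x) \<noteq> d x (g x)"
      using True by (auto simp: on_def fun_eq_iff)
    then have "(t \<circ> f) \<circ> g = g \<circ> (t \<circ> f)"
      using Trans_commute_generic[OF tf _ g] False \<open>\<not> (f = id \<or> g = id)\<close> x by metis
    moreover have "t \<circ> g = g \<circ> t"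
      using Trans_commute_generic[OF t(1) tid g] \<open>\<not> (f = id \<or> g = id)\<close> x t y True k by metis
    ultimately have "t \<circ> (f \<circ> g) = t \<circ> (g \<circ> f)" by (metis comp_assoc)
    then have "t ((f \<circ> g) z) = t ((g \<circ> f) z)" for z by (metis comp_apply)
    then show ?thesis using Dil_inj Trans_Dil t by (metis ext)
  qed
qed

text \<open>Conjugation moves fixed points to fixed points. This is why a dilatation that fixes the
  origin is additive.\<close>

lemma Trans_conj:
  assumes f: "f \<in> Dil" and g: "g \<in> Trans"
  shows "f \<circ> g \<circ> Hilbert_Choice.inv f \<in> Trans"
proof -
  have D: "g \<in> Dil" "Hilbert_Choice.inv f \<in> Dil" using f g Trans_Dil Dil_inv by auto
  have i: "f (Hilbert_Choice.inv f z) = z" for z using inv_eq_conv f by metis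
  show ?thesis
  proof (cases "g = id")
    case True
    then have "f \<circ> g \<circ> Hilbert_Choice.inv f = id" using i by auto
    then show ?thesis using Trans_id by simp
  next
    case False
    have "(f \<circ> g \<circ> Hilbert_Choice.inv f) x \<noteq> x" if "x \<in> A" for x
    proof
      assume "(f \<circ> g \<circ> Hilbert_Choice.inv f) x = x"
      then have "g (Hilbert_Choice.inv f x) = Hilbert_Choice.inv f x" using inv_eq_conv f by (metis comp_apply)
      moreover have "Hilbert_Choice.inv f x \<in> A" using D(2) Dil_A that by metis
      ultimately show False using False Trans_fixed g by metis
    qed
    then show ?thesis using f D Dil_comp by (auto simp: Trans_def)
  qed
qed

end

text \<open>An origin identifies each point with the translation that takes \<open>u\<close> to it,
  so the translation group becomes an addition on \<open>A\<close>.\<close>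

locale pointed_dir_space = dir_space +
  fixes u
  assumes u [simp]: "u \<in> A"
begin

definition tr :: "'a \<Rightarrow> 'a \<Rightarrow> 'a" where
  "tr a = (THE f. f \<in> Trans \<and> f u = a)"

lemma tr:
  assumes "a \<in> A"
  shows tr_Trans: "tr a \<in> Trans" and tr_u: "tr a u = a"
proof -
  have "\<exists>!f. f \<in> Trans \<and> f u = a" using translation_ex[OF u assms] Trans_unique[OF _ _ u] by metis
  from theI'[OF this] show "tr a \<in> Trans" "tr a u = a" unfolding tr_def by auto
qed

lemma tr_eq: "f \<in> Trans \<Longrightarrow> tr (f u) = f"
  using Trans_unique[OF _ _ u] tr Dil_A Trans_Dil u by metis

lemma tr_A [simp]: "a \<in> A \<Longrightarrow> tr a b \<in> A \<longleftrightarrow> b \<in> A"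
  using Dil_A Trans_Dil tr by metis

definition V :: "'a ring" where
  "V = \<lparr>carrier = A, mult = (\<lambda>_ _. u), one = u, zero = u, add = tr\<rparr>"

lemma V_simps [simp]: "carrier V = A" "add V = tr" "zero V = u"
  by (simp_all add: V_def)

lemma tr_tr: "\<lbrakk>a \<in> A; b \<in> A\<rbrakk> \<Longrightarrow> tr (tr a b) = tr a \<circ> tr b"
  using tr_eq[of "tr a \<circ> tr b"] tr Trans_comp by simp

lemma tr_commute: "\<lbrakk>a \<in> A; b \<in> A\<rbrakk> \<Longrightarrow> tr a b = tr b a"
  using fun_cong[OF Trans_commute[of "tr a" "tr b"], of u] tr by simp

lemma tr_zero: "tr u = id"
  using tr_eq[OF Trans_id] by simp

sublocale V: abelian_group V
proof (rule abelian_groupI, goal_cases)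
  case (3 x y z) then show ?case by (simp add: tr_tr)
next
  case (4 x y) then show ?case by (simp add: tr_commute)
next
  case (6 x)
  let ?g = "Hilbert_Choice.inv (tr x)"
  have "?g \<in> Trans" using Trans_inv tr 6 by simp
  then have "tr (?g u) = ?g" "?g u \<in> A" using tr_eq Dil_A Trans_Dil by auto
  then have "tr (?g u) x = u" using inv_eq_conv[OF Trans_Dil] tr 6 by simp
  then show ?case using \<open>?g u \<in> A\<close> by auto
qed (simp_all add: tr_zero)

lemma V_minus_zero: "\<ominus>\<^bsub>V\<^esub> u = u"
  by (rule V.minus_equality) (simp_all add: tr_zero)

lemma d_add: "\<lbrakk>a \<in> A; b \<in> A; b \<noteq> u\<rbrakk> \<Longrightarrow> d a (a \<oplus>\<^bsub>V\<^esub> b) = d u b"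
  using Dil_d[OF Trans_Dil[OF tr_Trans[of a]], of u b] tr_u[of a] by auto

lemma on_add: "\<lbrakk>a \<in> A; b \<in> A; on u h a; on u h b\<rbrakk> \<Longrightarrow> on u h (a \<oplus>\<^bsub>V\<^esub> b)"
  using d_add[of a b] on_trans[of u a "a \<oplus>\<^bsub>V\<^esub> b" h] on_def V.r_zero[of a] by (metis V.add.m_closed V_simps(1,3) u)

lemma on_minus:
  assumes a: "a \<in> A" and h: "on u h a"
  shows "on u h (\<ominus>\<^bsub>V\<^esub> a)"
proof (cases "a = u")
  case True then show ?thesis using V_minus_zero by simp
next
  case False
  let ?b = "\<ominus>\<^bsub>V\<^esub> a"
  have b: "?b \<in> A" using V.a_inv_closed a by simp
  have bu: "?b \<oplus>\<^bsub>V\<^esub> a = u" using V.l_neg a by simp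
  have "d ?b u = d u a" using d_add[OF b a False] bu by simp
  then show ?thesis using h False d_sym[of ?b u] b unfolding on_def by force
qed

text \<open>The endomorphisms of the translation group that map every line through \<open>u\<close>
  into itself; Artin calls them trace preserving. The fixed value \<open>u\<close> outside
  \<open>A\<close> makes equality of scalars equality of functions.\<close>

definition K :: "('a \<Rightarrow> 'a) set" where
  "K = {s. (\<forall>x. x \<notin> A \<longrightarrow> s x = u) \<and> (\<forall>x\<in>A. s x \<in> A \<and> on u (d u x) (s x)) \<and> s u = u \<and>
    (\<forall>x\<in>A. \<forall>y\<in>A. s (x \<oplus>\<^bsub>V\<^esub> y) = s x \<oplus>\<^bsub>V\<^esub> s y)}"

text \<open>The product is reversed because scalars act from the right.\<close>

definition R :: "('a \<Rightarrow> 'a) ring" where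
  "R = \<lparr>carrier = K, mult = (\<lambda>s t. t \<circ> s), one = (\<lambda>x. if x \<in> A then x else u),
    zero = (\<lambda>x. u), add = (\<lambda>s t x. s x \<oplus>\<^bsub>V\<^esub> t x)\<rparr>"

lemma R_simps [simp]: "carrier R = K" "mult R s t = t \<circ> s" "one R = (\<lambda>x. if x \<in> A then x else u)"
  "zero R = (\<lambda>x. u)" "add R s t = (\<lambda>x. s x \<oplus>\<^bsub>V\<^esub> t x)"
  by (simp_all add: R_def)

lemma K_A: "s \<in> K \<Longrightarrow> s x \<in> A"
  unfolding K_def by (cases "x \<in> A") auto

lemma K_on: "s \<in> K \<Longrightarrow> x \<in> A \<Longrightarrow> on u (d u x) (s x)"
  by (simp add: K_def)

lemma K_add: "\<lbrakk>s \<in> K; x \<in> A; y \<in> A\<rbrakk> \<Longrightarrow> s (x \<oplus>\<^bsub>V\<^esub> y) = s x \<oplus>\<^bsub>V\<^esub> s y"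
  by (simp add: K_def)

lemma K_u: "s \<in> K \<Longrightarrow> s u = u"
  by (simp add: K_def)

lemma K_outside: "s \<in> K \<Longrightarrow> x \<notin> A \<Longrightarrow> s x = u"
  by (simp add: K_def)

lemma KI:
  assumes "\<And>x. x \<notin> A \<Longrightarrow> s x = u" "\<And>x. x \<in> A \<Longrightarrow> s x \<in> A" "\<And>x. \<lbrakk>x \<in> A; x \<noteq> u\<rbrakk> \<Longrightarrow> on u (d u x) (s x)"
    "s u = u" "\<And>x y. \<lbrakk>x \<in> A; y \<in> A\<rbrakk> \<Longrightarrow> s (x \<oplus>\<^bsub>V\<^esub> y) = s x \<oplus>\<^bsub>V\<^esub> s y"
  shows "s \<in> K"
proof -
  have "on u (d u x) (s x)" if "x \<in> A" for x using assms(3,4) that by (cases "x = u") auto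
  then show ?thesis using assms(1,2,4,5) unfolding K_def by blast
qed

lemma V_zero: "u \<oplus>\<^bsub>V\<^esub> u = u"
  using tr_zero by simp

lemma K_plus:
  assumes s: "s \<in> K" and t: "t \<in> K"
  shows "(\<lambda>x. s x \<oplus>\<^bsub>V\<^esub> t x) \<in> K"
proof (rule KI, goal_cases)
  case (1 x) then show ?case using K_outside[OF s] K_outside[OF t] V_zero by simp
next
  case (2 x) then show ?case using K_A s t by simp
next
  case (3 x) then show ?case using on_add K_on K_A s t by metis
next
  case 4 then show ?case using K_u[OF s] K_u[OF t] V_zero by simp
next
  case (5 x y)
  then have "s x \<in> carrier V" "s y \<in> carrier V" "t x \<in> carrier V" "t y \<in> carrier V" using K_A s t by auto
  then show ?case using K_add[OF s 5] K_add[OF t 5] V.a_ac by (metis V.add.m_closed)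
qed

lemma K_uminus:
  assumes s: "s \<in> K"
  shows "(\<lambda>x. \<ominus>\<^bsub>V\<^esub> s x) \<in> K"
proof (rule KI, goal_cases)
  case (1 x) then show ?case using K_outside[OF s] V_minus_zero by simp
next
  case (2 x) then show ?case using K_A[OF s] V.a_inv_closed by simp
next
  case (3 x) then show ?case using on_minus K_on K_A s by metis
next
  case 4 then show ?case using K_u[OF s] V_minus_zero by simp
next
  case (5 x y)
  then have "s x \<in> carrier V" "s y \<in> carrier V" using K_A s by auto
  then show ?case using K_add[OF s 5] V.minus_add by metis
qed

lemma K_zero: "(\<lambda>x. u) \<in> K"
  by (rule KI) (simp_all add: V_zero del: V_simps(2))

lemma K_one: "(\<lambda>x. if x \<in> A then x else u) \<in> K"
  by (rule KI) (auto simp: on_def)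

lemma K_comp:
  assumes s: "s \<in> K" and t: "t \<in> K"
  shows "t \<circ> s \<in> K"
proof (rule KI, goal_cases)
  case (3 x)
  then show ?case using K_on[OF s, of x] K_on[OF t, of "s x"] K_A s K_u[OF t] unfolding on_def by (metis comp_apply)
qed (use K_outside[OF s] K_u[OF s] K_u[OF t] K_A[OF s] K_A[OF t] K_add[OF s] K_add[OF t]
    in \<open>auto simp del: V_simps(2)\<close>)

lemma V_assoc: "\<lbrakk>x \<in> A; y \<in> A; z \<in> A\<rbrakk> \<Longrightarrow> x \<oplus>\<^bsub>V\<^esub> y \<oplus>\<^bsub>V\<^esub> z = x \<oplus>\<^bsub>V\<^esub> (y \<oplus>\<^bsub>V\<^esub> z)"
  using V.a_assoc by simp

sublocale R: ring R
proof (rule ringI)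
  show "abelian_group R"
  proof (rule abelian_groupI, goal_cases)
    case (1 s t) then show ?case using K_plus by simp
  next
    case 2 then show ?case using K_zero by simp
  next
    case (3 x y z) then show ?case using V_assoc K_A by (auto simp del: V_simps(2))
  next
    case (4 x y) then show ?case using V.a_comm K_A by (auto simp del: V_simps(2))
  next
    case (5 x) then show ?case using V.l_zero K_A by (auto simp del: V_simps(2))
  next
    case (6 s)
    then have "(\<lambda>x. \<ominus>\<^bsub>V\<^esub> s x) \<in> K" using K_uminus by simp
    moreover have "\<ominus>\<^bsub>V\<^esub> s x \<oplus>\<^bsub>V\<^esub> s x = u" for x using V.l_neg[of "s x"] K_A[of s x] 6 by simp
    ultimately show ?case by (intro bexI[of _ "\<lambda>x. \<ominus>\<^bsub>V\<^esub> s x"]) (auto simp del: V_simps(2))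
  qed
  show "monoid R"
  proof (rule monoidI, goal_cases)
    case (5 x) then show ?case using K_outside[of x] K_u[of x] K_A[of x] by (auto simp: fun_eq_iff)
  next
    case (4 x) then show ?case using K_outside[of x] K_u[of x] K_A[of x] by (auto simp: fun_eq_iff)
  qed (use K_comp K_one K_A in \<open>auto simp: comp_assoc fun_eq_iff\<close>)
next
  fix x y z assume "x \<in> carrier R" "y \<in> carrier R" "z \<in> carrier R"
  then show "(x \<oplus>\<^bsub>R\<^esub> y) \<otimes>\<^bsub>R\<^esub> z = x \<otimes>\<^bsub>R\<^esub> z \<oplus>\<^bsub>R\<^esub> y \<otimes>\<^bsub>R\<^esub> z"
    using K_add K_A by (auto simp del: V_simps(2))
  show "z \<otimes>\<^bsub>R\<^esub> (x \<oplus>\<^bsub>R\<^esub> y) = z \<otimes>\<^bsub>R\<^esub> x \<oplus>\<^bsub>R\<^esub> z \<otimes>\<^bsub>R\<^esub> y"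
    by (auto simp del: V_simps(2))
qed

text \<open>For \<open>x\<close> off the line of \<open>a\<close>, additivity gives \<open>t\<close>
  the same value at \<open>x\<close> and at the sum of \<open>x\<close> and \<open>a\<close>. It
  lies on the lines from \<open>u\<close> to both of these points, so it is \<open>u\<close>. The
  rest of the line of \<open>a\<close> follows with a point \<open>c\<close> off it.\<close>

lemma K_kernel:
  assumes t: "t \<in> K" and a: "a \<in> A" "a \<noteq> u" "t a = u"
  shows "t = (\<lambda>x. u)"
proof -
  have off: "t x = u" if x: "x \<in> A" and b: "b \<in> A" "b \<noteq> u" "t b = u" "\<not> on u (d u b) x" for x b
  proof -
    let ?w = "x \<oplus>\<^bsub>V\<^esub> b"
    have xu: "x \<noteq> u" "d u x \<noteq> d u b" using b by (auto simp: on_def)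
    have w: "?w \<in> A" using x b by simp
    have xw: "x \<noteq> ?w" using b(1,2) x V.add.l_cancel_one'[of x b] by auto
    have dxw: "d x ?w = d u b" using d_add x b by blast
    have wu: "?w \<noteq> u" using dxw xu d_sym[of x u] x by (metis u)
    have "d u ?w \<noteq> d u x"
    proof
      assume "d u ?w = d u x"
      then have "d x ?w = d u x" using d_tr[of u x ?w] xu wu xw x w by (metis u)
      then show False using dxw xu by simp
    qed
    moreover have "t ?w = t x" using K_add[OF t x b(1)] b V.r_zero[of "t x"] K_A[OF t] by simp
    then have "on u (d u ?w) (t x)" using K_on[OF t w] by simp
    moreover have "on u (d u x) (t x)" using K_on[OF t x] .
    ultimately show ?thesis unfolding on_def by metis
  qed
  obtain k where k: "k \<in> H" "k \<noteq> d u a" using other_dir d_in a u by metis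
  obtain c where c: "c \<in> A" "c \<noteq> u" "d u c = k" using d_ex u k by metis
  have tc: "t c = u" using off[OF c(1) a] c k by (auto simp: on_def)
  have "t x = u" for x
  proof (cases "x \<in> A")
    case True
    show ?thesis
    proof (cases "on u (d u a) x \<and> x \<noteq> u")
      case True
      then have "\<not> on u (d u c) x" using c k by (auto simp: on_def)
      then show ?thesis using off[OF \<open>x \<in> A\<close> c(1,2) tc] by blast
    next
      case False
      then show ?thesis using off[OF \<open>x \<in> A\<close> a] K_u t by blast
    qed
  next
    case False then show ?thesis using K_outside t by blast
  qed
  then show ?thesis by blast
qed

text \<open>Conjugating the translation of \<open>x\<close> by \<open>f\<close> gives a translation
  that takes \<open>u\<close> to \<open>f x\<close>; evaluated at \<open>f y\<close>, this is
  additivity.\<close>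

lemma homothety_K:
  assumes f: "f \<in> Dil" and fu: "f u = u"
  shows "(\<lambda>x. if x \<in> A then f x else u) \<in> K"
proof (rule KI, goal_cases)
  case (2 x) then show ?case using Dil_A f by simp
next
  case (3 x)
  then have "d u (f x) = d u x" using Dil_d[OF f u, of x] fu by auto
  then show ?case using 3 by (simp add: on_def)
next
  case (5 x y)
  have fA: "f x \<in> A" using Dil_A f 5 by simp
  have "f \<circ> tr x \<circ> Hilbert_Choice.inv f = tr (f x)"
    using tr_eq[OF Trans_conj[OF f tr_Trans]] inv_eq_conv[OF f] fu tr_u 5
    by (metis comp_apply)
  then have "f (tr x y) = tr (f x) (f y)" using inv_eq_conv[OF f] by (metis comp_apply)
  then show ?case using 5 by simp
qed (use fu in simp_all)

lemma K_transitive: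
  assumes "a \<in> A" "b \<in> A" "a \<noteq> u" "b \<noteq> u" "d u a = d u b"
  shows "\<exists>s\<in>K. s a = b"
proof -
  obtain f where "f \<in> Dil" "f u = u" "f a = b" using homothety_ex[of u a b] assms by auto
  then show ?thesis using homothety_K[of f] assms by (intro bexI[of _ "\<lambda>x. if x \<in> A then f x else u"]) auto
qed

text \<open>A homothety \<open>t\<close> takes \<open>s a\<close> back to \<open>a\<close>. The
  product of \<open>s\<close> and \<open>t\<close> minus one then vanishes at \<open>a\<close>, so
  it is zero by \<open>K_kernel\<close>.\<close>

lemma K_right_inverse:
  assumes s: "s \<in> K" and s0: "s \<noteq> (\<lambda>x. u)"
  shows "\<exists>t\<in>K. s \<otimes>\<^bsub>R\<^esub> t = \<one>\<^bsub>R\<^esub>"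
proof -
  obtain a where sa: "s a \<noteq> u" using s0 by blast
  have a: "a \<in> A" "a \<noteq> u" using sa K_outside K_u s by metis+
  have sA: "s a \<in> A" using K_A s by blast
  have "d u (s a) = d u a" using K_on[OF s a(1)] sa by (auto simp: on_def)
  then obtain t where t: "t \<in> K" "t (s a) = a" using K_transitive[of "s a" a] sA a sa by blast
  let ?w = "(s \<otimes>\<^bsub>R\<^esub> t) \<ominus>\<^bsub>R\<^esub> \<one>\<^bsub>R\<^esub>"
  have st: "s \<otimes>\<^bsub>R\<^esub> t \<in> carrier R" using s t K_comp by simp
  have w: "?w \<in> carrier R" using st R.minus_closed R.one_closed by blast
  have "?w \<oplus>\<^bsub>R\<^esub> \<one>\<^bsub>R\<^esub> = s \<otimes>\<^bsub>R\<^esub> t"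
    using st by (simp only: R.minus_eq R.a_assoc R.l_neg R.one_closed R.a_inv_closed R.r_zero)
  then have "?w a \<oplus>\<^bsub>V\<^esub> a = a" using a t by (auto simp: fun_eq_iff dest: spec[of _ a])
  then have "?w a = u" using V.add.l_cancel_one[of a "?w a"] w K_A[of ?w a] a by (simp del: R_simps(2-) V_simps(2))
  then have "?w = \<zero>\<^bsub>R\<^esub>" using K_kernel[of ?w a] w a by simp
  then have "s \<otimes>\<^bsub>R\<^esub> t = \<one>\<^bsub>R\<^esub>" using \<open>?w \<oplus>\<^bsub>R\<^esub> \<one>\<^bsub>R\<^esub> = s \<otimes>\<^bsub>R\<^esub> t\<close> R.l_zero[OF R.one_closed] by metis
  then show ?thesis using t by blast
qed

sublocale R: skew_field R
proof
  have one: "\<one>\<^bsub>R\<^esub> \<noteq> \<zero>\<^bsub>R\<^esub>"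
  proof
    assume "\<one>\<^bsub>R\<^esub> = \<zero>\<^bsub>R\<^esub>"
    then have "x = u" if "x \<in> A" for x using that by (auto simp: fun_eq_iff) metis
    moreover obtain h where "h \<in> H" using nontriv by blast
    ultimately show False using d_ex[OF u] by metis
  qed
  have inv: "\<exists>t\<in>carrier R. s \<otimes>\<^bsub>R\<^esub> t = \<one>\<^bsub>R\<^esub>" if "s \<in> carrier R" "s \<noteq> \<zero>\<^bsub>R\<^esub>" for s
    using K_right_inverse[of s] that by simp
  show "Units R = carrier R - {\<zero>\<^bsub>R\<^esub>}"
  proof (intro equalityI subsetI)
    fix s assume "s \<in> Units R"
    then show "s \<in> carrier R - {\<zero>\<^bsub>R\<^esub>}"
      using one R.Units_closed R.Units_r_inv_ex R.l_null by (metis DiffI singletonD)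
  next
    fix s assume s: "s \<in> carrier R - {\<zero>\<^bsub>R\<^esub>}"
    then obtain t where t: "t \<in> carrier R" "s \<otimes>\<^bsub>R\<^esub> t = \<one>\<^bsub>R\<^esub>" using inv by blast
    then have "t \<noteq> \<zero>\<^bsub>R\<^esub>" using one R.r_null s by (metis DiffD1)
    \<comment> \<open>A right inverse of the right inverse \<open>t\<close> equals \<open>s\<close>,
      so \<open>t\<close> is inverse to \<open>s\<close> on both sides.\<close>
    then obtain v where v: "v \<in> carrier R" "t \<otimes>\<^bsub>R\<^esub> v = \<one>\<^bsub>R\<^esub>" using inv t by blast
    have "s = s \<otimes>\<^bsub>R\<^esub> (t \<otimes>\<^bsub>R\<^esub> v)" using v s by (metis DiffD1 R.r_one)
    also have "\<dots> = v" using R.m_assoc[of s t v] t v s R.l_one by (metis DiffD1)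
    finally have "t \<otimes>\<^bsub>R\<^esub> s = \<one>\<^bsub>R\<^esub>" using v by simp
    then show "s \<in> Units R" using t s unfolding Units_def by blast
  qed
qed

sublocale right_vector_space R V "\<lambda>v s. s v"
  by unfold_locales (auto simp: K_A K_add simp del: V_simps(2))

end

section \<open>Homogeneous coordinates\<close>

context concrete_right_vector_space
begin

text \<open>The direct sum of \<open>R\<close> and \<open>V\<close>: the extra coordinate turns
  affine subspaces into linear ones and makes room for points at infinity.\<close>

definition hom_space :: "('f \<times> 'v) ring" where
  "hom_space = \<lparr>carrier = carrier R \<times> carrier V, mult = (\<lambda>_ _. (\<zero>\<^bsub>R\<^esub>, \<zero>\<^bsub>V\<^esub>)), one = (\<zero>\<^bsub>R\<^esub>, \<zero>\<^bsub>V\<^esub>),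
    zero = (\<zero>\<^bsub>R\<^esub>, \<zero>\<^bsub>V\<^esub>), add = (\<lambda>(a, v) (b, w). (a \<oplus>\<^bsub>R\<^esub> b, v \<oplus>\<^bsub>V\<^esub> w))\<rparr>"

definition hom_act :: "'f \<times> 'v \<Rightarrow> 'f \<Rightarrow> 'f \<times> 'v" where
  "hom_act = (\<lambda>(a, v) s. (a \<otimes>\<^bsub>R\<^esub> s, act v s))"

lemma hom_space_simps [simp]: "carrier hom_space = carrier R \<times> carrier V"
  "\<zero>\<^bsub>hom_space\<^esub> = (\<zero>\<^bsub>R\<^esub>, \<zero>\<^bsub>V\<^esub>)" "(a, v) \<oplus>\<^bsub>hom_space\<^esub> (b, w) = (a \<oplus>\<^bsub>R\<^esub> b, v \<oplus>\<^bsub>V\<^esub> w)"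
  "hom_act (a, v) s = (a \<otimes>\<^bsub>R\<^esub> s, act v s)"
  by (simp_all add: hom_space_def hom_act_def)

lemma hom_space: "concrete_right_vector_space R hom_space hom_act"
proof -
  interpret W: abelian_group hom_space
  proof (rule abelian_groupI, goal_cases)
    case (6 x)
    then obtain a v where x: "x = (a, v)" "a \<in> carrier R" "v \<in> carrier V" by auto
    then have "(\<ominus>\<^bsub>R\<^esub> a, \<ominus>\<^bsub>V\<^esub> v) \<oplus>\<^bsub>hom_space\<^esub> x = \<zero>\<^bsub>hom_space\<^esub>" by (simp add: R.l_neg V.l_neg)
    then show ?case using x by (intro bexI[of _ "(\<ominus>\<^bsub>R\<^esub> a, \<ominus>\<^bsub>V\<^esub> v)"]) auto
  qed (auto simp: R.a_ac V.a_ac)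
  show ?thesis
    by unfold_locales (auto simp: act_closed R.l_distr act_add_vector R.r_distr act_add_scalar R.m_assoc act_assoc act_one)
qed

end

context pointed_dir_space
begin

text \<open>Closure under joining points, split by the position of the line: inside
  \<open>H\<close>, through an affine point and a point at infinity, or through two affine
  points.\<close>

definition subsp :: "'a set \<Rightarrow> bool" where
  "subsp T \<longleftrightarrow> T \<subseteq> A \<union> H \<and>
     (\<forall>h\<in>T \<inter> H. \<forall>k\<in>T \<inter> H. \<forall>l\<in>H. h \<noteq> k \<longrightarrow> C h k l \<longrightarrow> l \<in> T) \<and>
     (\<forall>x\<in>T \<inter> A. \<forall>y\<in>A. x \<noteq> y \<longrightarrow> d x y \<in> T \<longrightarrow> y \<in> T) \<and>
     (\<forall>x\<in>T \<inter> A. \<forall>y\<in>T \<inter> A. x \<noteq> y \<longrightarrow> d x y \<in> T)"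

lemma subsp_mem: "\<lbrakk>subsp T; x \<in> A \<inter> T; y \<in> A; x \<noteq> y; d x y \<in> T\<rbrakk> \<Longrightarrow> y \<in> T"
  unfolding subsp_def by blast

lemma subsp_dir: "\<lbrakk>subsp T; x \<in> A \<inter> T; y \<in> A \<inter> T; x \<noteq> y\<rbrakk> \<Longrightarrow> d x y \<in> T"
  unfolding subsp_def by blast

sublocale C: concrete_right_vector_space R V "\<lambda>v s. s v"
  by unfold_locales

sublocale W: concrete_right_vector_space R C.hom_space C.hom_act
  by (rule C.hom_space)

definition vec :: "'a \<Rightarrow> 'a" where
  "vec h = (SOME v. v \<in> A \<and> v \<noteq> u \<and> d u v = h)"

lemma vec: "h \<in> H \<Longrightarrow> vec h \<in> A \<and> vec h \<noteq> u \<and> d u (vec h) = h"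
  unfolding vec_def by (rule someI_ex) (use d_ex[OF u] in blast)

definition coord :: "'a \<Rightarrow> ('a \<Rightarrow> 'a) \<times> 'a" where
  "coord x = (if x \<in> A then (\<one>\<^bsub>R\<^esub>, x) else (\<zero>\<^bsub>R\<^esub>, vec x))"

lemma d_diff:
  assumes "a \<in> A" "b \<in> A" "a \<noteq> b"
  obtains e where "e \<in> A" "e \<noteq> u" "a \<oplus>\<^bsub>V\<^esub> e = b" "d u e = d a b"
proof -
  let ?e = "\<ominus>\<^bsub>V\<^esub> a \<oplus>\<^bsub>V\<^esub> b"
  have e: "?e \<in> A" using V.add.m_closed[of "\<ominus>\<^bsub>V\<^esub> a" b] V.a_inv_closed[of a] assms by simp
  have "a \<oplus>\<^bsub>V\<^esub> ?e = (a \<oplus>\<^bsub>V\<^esub> \<ominus>\<^bsub>V\<^esub> a) \<oplus>\<^bsub>V\<^esub> b"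
    using assms V.a_inv_closed[of a] by (intro V.a_assoc[symmetric]) auto
  then have eq: "a \<oplus>\<^bsub>V\<^esub> ?e = b" using assms V.r_neg[of a] V.l_zero[of b] by (simp del: V_simps(2))
  then have "?e \<noteq> u" using assms V.r_zero[of a] by (metis V_simps(1,3))
  then show thesis using that[OF e _ eq] d_add[OF assms(1) e] eq by simp
qed

lemma K_inverse:
  assumes "k \<in> K" "k \<noteq> \<zero>\<^bsub>R\<^esub>"
  obtains t where "t \<in> K" "\<And>v. v \<in> A \<Longrightarrow> k (t v) = v" "\<And>v. v \<in> A \<Longrightarrow> t (k v) = v"
proof -
  obtain t where t: "t \<in> K" "k \<otimes>\<^bsub>R\<^esub> t = \<one>\<^bsub>R\<^esub>" "t \<otimes>\<^bsub>R\<^esub> k = \<one>\<^bsub>R\<^esub>"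
    using C.inverse[of k] assms by auto
  have "k (t v) = v" "t (k v) = v" if "v \<in> A" for v
    using fun_cong[OF t(3), of v] fun_cong[OF t(2), of v] that by auto
  then show thesis using that t by blast
qed

lemma K_nonzero: "\<lbrakk>k \<in> K; k \<noteq> \<zero>\<^bsub>R\<^esub>; v \<in> A; v \<noteq> u\<rbrakk> \<Longrightarrow> k v \<noteq> u"
  by (metis K_inverse K_u)

lemma K_d: "\<lbrakk>k \<in> K; v \<in> A; v \<noteq> u; k v \<noteq> u\<rbrakk> \<Longrightarrow> d u (k v) = d u v"
  using K_on[of k v] by (auto simp: on_def)

text \<open>The vectors that represent points of \<open>T\<close>; the point of a vector \<open>(k, v)\<close> with \<open>k \<noteq> 0\<close> is the
  solution \<open>x\<close> of \<open>k x = v\<close>.\<close>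

definition cone :: "'a set \<Rightarrow> (('a \<Rightarrow> 'a) \<times> 'a) set" where
  "cone T = {(k, v). k \<in> K \<and> v \<in> A \<and>
     (if k = \<zero>\<^bsub>R\<^esub> then v = u \<or> d u v \<in> T else \<exists>x\<in>A \<inter> T. k x = v)}"

lemma cone_scale:
  assumes w: "w \<in> cone T" and s: "s \<in> K"
  shows "C.hom_act w s \<in> cone T"
proof -
  obtain k v where kv: "w = (k, v)" "k \<in> K" "v \<in> A" using w by (auto simp: cone_def)
  have sv: "s v \<in> A" "s \<circ> k \<in> K" using K_A K_comp s kv by auto
  show ?thesis
  proof (cases "s = \<zero>\<^bsub>R\<^esub>")
    case True
    then show ?thesis using kv sv by (auto simp: cone_def fun_eq_iff)
  next
    case s0: False
    show ?thesis
    proof (cases "k = \<zero>\<^bsub>R\<^esub>")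
      case True
      then have "s \<circ> k = \<zero>\<^bsub>R\<^esub>" using K_u[OF s] by auto
      moreover have "v = u \<or> d u v \<in> T" using w kv True by (simp add: cone_def)
      then have "s v = u \<or> d u (s v) \<in> T" using K_d[OF s kv(3)] K_u[OF s] by metis
      ultimately show ?thesis using kv sv by (simp add: cone_def)
    next
      case False
      then obtain x where x: "x \<in> A \<inter> T" "k x = v" using w kv by (auto simp: cone_def)
      obtain a where a: "k a \<noteq> u" "a \<in> A" using False K_outside[OF kv(2)] by (auto simp: fun_eq_iff)
      then have "(s \<circ> k) a \<noteq> u" using K_nonzero[OF s s0] K_A[OF kv(2)] by auto
      then have "s \<circ> k \<noteq> \<zero>\<^bsub>R\<^esub>" by (metis R_simps(4))
      then show ?thesis using kv sv x unfolding cone_def by auto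
    qed
  qed
qed

lemma cone_add_inf:
  assumes T: "subsp T" and v: "v \<in> A" "v = u \<or> d u v \<in> T" and w: "w \<in> A" "w = u \<or> d u w \<in> T"
    and ne: "v \<oplus>\<^bsub>V\<^esub> w \<noteq> u"
  shows "d u (v \<oplus>\<^bsub>V\<^esub> w) \<in> T"
proof (cases "v = u \<or> w = u")
  case True
  then show ?thesis using v w ne V.l_zero[of w] V.r_zero[of v] by auto
next
  case False
  let ?s = "v \<oplus>\<^bsub>V\<^esub> w"
  have s: "?s \<in> A" using v w by simp
  have ds: "d v ?s = d u w" using d_add v w False by blast
  have dT: "d u v \<in> T" "d u w \<in> T" using v w False by auto
  have dH: "d u v \<in> H" "d u w \<in> H" "d u ?s \<in> H" using d_in u v w s ne False by metis+
  show ?thesis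
  proof (cases "d u v = d u w")
    case True
    then have "on u (d u v) ?s" using on_add[of v w "d u v"] v w by (simp add: on_def)
    then show ?thesis using ne dT by (auto simp: on_def)
  next
    case neq: False
    have "v \<noteq> ?s" using False V.add.l_cancel_one'[of v w] v w by auto
    then have "C (d u v) (d u w) (d u ?s)" using d_col[of u v ?s] u v s False ne ds by metis
    then show ?thesis using T dT dH neq unfolding subsp_def by blast
  qed
qed

text \<open>With \<open>t\<close> inverse to \<open>k\<close>, adding \<open>v\<close> on the right
  moves the solution \<open>x\<close> by \<open>t v\<close>. This vector has the direction of
  \<open>v\<close>, so the solution stays in \<open>T\<close>.\<close>

lemma cone_add_mixed:
  assumes T: "subsp T" and v: "v \<in> A" "v = u \<or> d u v \<in> T" and k: "k \<in> K" "k \<noteq> \<zero>\<^bsub>R\<^esub>" and x: "x \<in> A \<inter> T"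
  shows "\<exists>y\<in>A \<inter> T. k y = k x \<oplus>\<^bsub>V\<^esub> v"
proof -
  obtain t where t: "t \<in> K" "\<And>v. v \<in> A \<Longrightarrow> k (t v) = v" using K_inverse k by metis
  let ?y = "x \<oplus>\<^bsub>V\<^esub> t v"
  have tv: "t v \<in> A" using K_A t by blast
  have y: "?y \<in> A" using tv x by simp
  have "?y \<in> T"
  proof (cases "t v = u")
    case True then show ?thesis using V.r_zero[of x] x by simp
  next
    case False
    then have vu: "v \<noteq> u" using K_u t by metis
    have "d x ?y = d u v" using d_add[of x "t v"] K_d[OF t(1) v(1) vu False] x tv False by simp
    moreover have "x \<noteq> ?y" using False V.add.l_cancel_one'[of x "t v"] x tv by auto
    ultimately show ?thesis using subsp_mem[OF T x y] v vu by simp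
  qed
  moreover have "k ?y = k x \<oplus>\<^bsub>V\<^esub> v" using K_add[OF k(1), of x "t v"] x tv t v by simp
  ultimately show ?thesis using y by blast
qed

lemma cone_add:
  assumes T: "subsp T" and w: "w \<in> cone T" and w': "w' \<in> cone T"
  shows "w \<oplus>\<^bsub>C.hom_space\<^esub> w' \<in> cone T"
proof -
  obtain k v where kv: "w = (k, v)" "k \<in> K" "v \<in> A" using w by (auto simp: cone_def)
  obtain k' v' where kv': "w' = (k', v')" "k' \<in> K" "v' \<in> A" using w' by (auto simp: cone_def)
  have kk: "k \<in> carrier R" "k' \<in> carrier R" "v \<in> carrier V" "v' \<in> carrier V" using kv kv' by simp_all
  have s: "k \<oplus>\<^bsub>R\<^esub> k' \<in> K" "v \<oplus>\<^bsub>V\<^esub> v' \<in> A" using kv kv' R.add.m_closed[OF kk(1,2)] by simp_all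
  have sum: "w \<oplus>\<^bsub>C.hom_space\<^esub> w' = (k \<oplus>\<^bsub>R\<^esub> k', v \<oplus>\<^bsub>V\<^esub> v')"
    unfolding kv(1) kv'(1) by (rule C.hom_space_simps)
  show ?thesis
  proof (cases "k = \<zero>\<^bsub>R\<^esub>")
    case k: True
    then have v: "v = u \<or> d u v \<in> T" using w kv by (auto simp: cone_def)
    have kk': "k \<oplus>\<^bsub>R\<^esub> k' = k'" using k R.l_zero[OF kk(2)] by simp
    show ?thesis
    proof (cases "k' = \<zero>\<^bsub>R\<^esub>")
      case True
      then have v': "v' = u \<or> d u v' \<in> T" using w' kv' by (auto simp: cone_def)
      have "v \<oplus>\<^bsub>V\<^esub> v' = u \<or> d u (v \<oplus>\<^bsub>V\<^esub> v') \<in> T" using cone_add_inf[OF T kv(3) v kv'(3) v'] by blast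
      then show ?thesis unfolding sum kk' using s(2) True kv'(2) unfolding cone_def by (simp del: V_simps(2))
    next
      case False
      then obtain x where x: "x \<in> A \<inter> T" "k' x = v'" using w' kv' by (auto simp: cone_def)
      obtain y where "y \<in> A \<inter> T" "k' y = v' \<oplus>\<^bsub>V\<^esub> v"
        using cone_add_mixed[OF T kv(3) v kv'(2) False x(1)] x by auto
      moreover have "v' \<oplus>\<^bsub>V\<^esub> v = v \<oplus>\<^bsub>V\<^esub> v'" using V.a_comm[of v v'] kk by simp
      ultimately show ?thesis unfolding sum kk' using s(2) False kv'(2) unfolding cone_def by (auto simp del: V_simps(2))
    qed
  next
    case k: False
    then obtain x where x: "x \<in> A \<inter> T" "k x = v" using w kv by (auto simp: cone_def)
    show ?thesis
    proof (cases "k' = \<zero>\<^bsub>R\<^esub>")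
      case True
      then have v': "v' = u \<or> d u v' \<in> T" using w' kv' by (auto simp: cone_def)
      have kk': "k \<oplus>\<^bsub>R\<^esub> k' = k" using True R.r_zero[OF kk(1)] by simp
      obtain y where "y \<in> A \<inter> T" "k y = v \<oplus>\<^bsub>V\<^esub> v'"
        using cone_add_mixed[OF T kv'(3) v' kv(2) k x(1)] x by auto
      then show ?thesis unfolding sum kk' using s(2) k kv(2) unfolding cone_def by (auto simp del: V_simps(2))
    next
      case k': False
      then obtain x' where x': "x' \<in> A \<inter> T" "k' x' = v'" using w' kv' by (auto simp: cone_def)
      show ?thesis
      proof (cases "x = x'")
        case True
        have "(k \<oplus>\<^bsub>R\<^esub> k') x = v \<oplus>\<^bsub>V\<^esub> v'" using x x' True by simp
        moreover have "\<zero>\<^bsub>R\<^esub> x = u" by simp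
        ultimately show ?thesis using s x kv kv' unfolding cone_def
          by (auto simp del: V_simps(2) R_simps(4,5))
      next
        case False
        \<comment> \<open>With \<open>x'\<close> written as \<open>x\<close> plus \<open>e\<close>,
          the sum is \<open>k + k'\<close> applied to \<open>x\<close> plus the vector
          \<open>k' e\<close> at infinity. This is the mixed case, or a point at infinity if
          \<open>k + k'\<close> vanishes.\<close>
        obtain e where e: "e \<in> A" "e \<noteq> u" "x \<oplus>\<^bsub>V\<^esub> e = x'" "d u e = d x x'"
          using d_diff[of x x'] x x' False by blast
        have eT: "d u e \<in> T" using subsp_dir[OF T x(1) x'(1) False] e by simp
        have k'e: "k' e \<in> A" "k' e \<noteq> u" "d u (k' e) \<in> T"
          using K_A K_nonzero[OF kv'(2) k' e(1,2)] K_d[OF kv'(2) e(1,2)] kv' eT by auto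
        have "v' = k' x \<oplus>\<^bsub>V\<^esub> k' e" using K_add[OF kv'(2), of x e] x x' e by simp
        then have "v \<oplus>\<^bsub>V\<^esub> v' = k x \<oplus>\<^bsub>V\<^esub> (k' x \<oplus>\<^bsub>V\<^esub> k' e)" using x by simp
        also have "\<dots> = (k \<oplus>\<^bsub>R\<^esub> k') x \<oplus>\<^bsub>V\<^esub> k' e"
          using V_assoc[of "k x" "k' x" "k' e"] K_A kv kv' by (simp del: V_simps(2))
        finally have eq: "v \<oplus>\<^bsub>V\<^esub> v' = (k \<oplus>\<^bsub>R\<^esub> k') x \<oplus>\<^bsub>V\<^esub> k' e" .
        show ?thesis
        proof (cases "k \<oplus>\<^bsub>R\<^esub> k' = \<zero>\<^bsub>R\<^esub>")
          case True
          then have "v \<oplus>\<^bsub>V\<^esub> v' = k' e" using eq V.l_zero[of "k' e"] k'e by simp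
          then show ?thesis using True s k'e kv kv' unfolding cone_def by (simp del: V_simps(2) R_simps(4,5))
        next
          case False
          obtain y where "y \<in> A \<inter> T" "(k \<oplus>\<^bsub>R\<^esub> k') y = v \<oplus>\<^bsub>V\<^esub> v'"
            using cone_add_mixed[OF T k'e(1) _ s(1) False x(1)] k'e eq by auto
          then show ?thesis using False s kv kv' unfolding cone_def by (auto simp del: V_simps(2) R_simps(4,5))
        qed
      qed
    qed
  qed
qed

lemma coord_carrier: "x \<in> A \<union> H \<Longrightarrow> coord x \<in> carrier C.hom_space"
  using vec[of x] K_one K_zero by (auto simp: coord_def)

lemma one_zero: "\<one>\<^bsub>R\<^esub> \<noteq> \<zero>\<^bsub>R\<^esub>"
  by (rule C.one_not_zero)

lemma coord_cone:
  assumes AH: "A \<inter> H = {}" and T: "T \<subseteq> A \<union> H" and x: "x \<in> A \<union> H"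
  shows "coord x \<in> cone T \<longleftrightarrow> x \<in> T"
proof (cases "x \<in> A")
  case True
  have "(\<one>\<^bsub>R\<^esub>, x) \<in> cone T \<longleftrightarrow> (\<exists>y\<in>A \<inter> T. \<one>\<^bsub>R\<^esub> y = x)"
    using one_zero True K_one unfolding cone_def by (simp del: R_simps(3,4)) simp
  then show ?thesis using True by (auto simp: coord_def)
next
  case False
  then have "vec x \<in> A" "vec x \<noteq> u" "d u (vec x) = x" using vec x by auto
  then show ?thesis using False K_zero by (auto simp: coord_def cone_def)
qed

text \<open>Linear subspaces pull back to subspaces. \<open>K_transitive\<close> provides the
  scalars between the chosen vectors \<open>vec h\<close> and other vectors of the same
  direction.\<close>

lemma subsp_coord:
  assumes AH: "A \<inter> H = {}"
    and U: "U \<subseteq> carrier C.hom_space" "\<And>v w. \<lbrakk>v \<in> U; w \<in> U\<rbrakk> \<Longrightarrow> v \<oplus>\<^bsub>C.hom_space\<^esub> w \<in> U"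
      "\<And>v a. \<lbrakk>v \<in> U; a \<in> K\<rbrakk> \<Longrightarrow> C.hom_act v a \<in> U"
  shows "subsp {x \<in> A \<union> H. coord x \<in> U}"
proof -
  have A: "coord x = (\<one>\<^bsub>R\<^esub>, x)" if "x \<in> A" for x using that by (simp add: coord_def)
  have H: "coord x = (\<zero>\<^bsub>R\<^esub>, vec x)" if "x \<in> H" for x using that AH by (auto simp: coord_def)
  have zero_s: "\<zero>\<^bsub>R\<^esub> \<otimes>\<^bsub>R\<^esub> s = \<zero>\<^bsub>R\<^esub>" if "s \<in> K" for s using R.l_null that by (metis R_simps(1))
  have scale0: "(\<zero>\<^bsub>R\<^esub>, s v) \<in> U" if "(\<zero>\<^bsub>R\<^esub>, v) \<in> U" "s \<in> K" for s v
    using U(3)[OF that] zero_s[OF that(2)] by (simp del: R_simps)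
  \<comment> \<open>The first coordinates of two affine points cancel on subtraction, which leaves
    their difference as a vector at infinity.\<close>
  have diff: "(\<zero>\<^bsub>R\<^esub>, e) \<in> U" if "(\<one>\<^bsub>R\<^esub>, x) \<in> U" "(\<one>\<^bsub>R\<^esub>, y) \<in> U" "x \<in> A" "e \<in> A" "x \<oplus>\<^bsub>V\<^esub> e = y" for x y e
  proof -
    have m: "\<ominus>\<^bsub>R\<^esub> \<one>\<^bsub>R\<^esub> \<in> K" using R.a_inv_closed[OF R.one_closed] by (simp del: R_simps(3))
    have xV: "x \<in> carrier V" "e \<in> carrier V" using that by auto
    have nx: "(\<ominus>\<^bsub>R\<^esub> \<one>\<^bsub>R\<^esub>) x = \<ominus>\<^bsub>V\<^esub> x"
      using C.act_uminus[of x "\<one>\<^bsub>R\<^esub>"] xV that R.one_closed by (simp del: R_simps(1,2,4,5))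
    have "C.hom_act (\<one>\<^bsub>R\<^esub>, x) (\<ominus>\<^bsub>R\<^esub> \<one>\<^bsub>R\<^esub>) = (\<ominus>\<^bsub>R\<^esub> \<one>\<^bsub>R\<^esub>, \<ominus>\<^bsub>V\<^esub> x)"
      using nx R.l_one[OF R.a_inv_closed[OF R.one_closed]] by (simp del: R_simps V_simps)
    then have "(\<one>\<^bsub>R\<^esub>, y) \<oplus>\<^bsub>C.hom_space\<^esub> (\<ominus>\<^bsub>R\<^esub> \<one>\<^bsub>R\<^esub>, \<ominus>\<^bsub>V\<^esub> x) \<in> U" using U(2)[OF that(2) U(3)[OF that(1) m]] by simp
    moreover have "\<one>\<^bsub>R\<^esub> \<oplus>\<^bsub>R\<^esub> \<ominus>\<^bsub>R\<^esub> \<one>\<^bsub>R\<^esub> = \<zero>\<^bsub>R\<^esub>" using R.r_neg[OF R.one_closed] .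
    moreover have "y \<oplus>\<^bsub>V\<^esub> \<ominus>\<^bsub>V\<^esub> x = e"
      using that(5) V.a_comm[OF xV] V.a_assoc[OF xV(2,1), of "\<ominus>\<^bsub>V\<^esub> x"] V.r_neg[OF xV(1)] V.r_zero[OF xV(2)] V.a_inv_closed[OF xV(1)]
      by metis
    ultimately show ?thesis by (simp del: R_simps V_simps)
  qed
  have trans: "(\<one>\<^bsub>R\<^esub>, x \<oplus>\<^bsub>V\<^esub> e) \<in> U" if "(\<one>\<^bsub>R\<^esub>, x) \<in> U" "(\<zero>\<^bsub>R\<^esub>, e) \<in> U" for x e
    using U(2)[OF that] R.r_zero[OF R.one_closed] by (simp del: R_simps V_simps)
  show ?thesis
    unfolding subsp_def
  proof (intro conjI ballI impI; (elim IntE)?)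
    show "{x \<in> A \<union> H. coord x \<in> U} \<subseteq> A \<union> H" by blast
  next
    fix h k l assume h: "h \<in> {x \<in> A \<union> H. coord x \<in> U}" "h \<in> H" and k: "k \<in> {x \<in> A \<union> H. coord x \<in> U}" "k \<in> H"
      and l: "l \<in> H" "h \<noteq> k" "C h k l"
    have hU: "(\<zero>\<^bsub>R\<^esub>, vec h) \<in> U" and kU: "(\<zero>\<^bsub>R\<^esub>, vec k) \<in> U" using h k H by auto
    show "l \<in> {x \<in> A \<union> H. coord x \<in> U}"
    proof (cases "l = h \<or> l = k")
      case True then show ?thesis using h k by blast
    next
      case False
      have vh: "vec h \<in> A" "vec h \<noteq> u" "d u (vec h) = h" and vk: "vec k \<in> A" "vec k \<noteq> u" "d u (vec k) = k"
        and vl: "vec l \<in> A" "vec l \<noteq> u" "d u (vec l) = l" using vec h k l by auto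
      have "C h l k" using l C_rot by blast
      \<comment> \<open>A direction \<open>l\<close> on the line of \<open>h\<close> and
        \<open>k\<close> is that of a sum of a vector of direction \<open>h\<close> and a vector of
        direction \<open>k\<close>.\<close>
      then obtain z where z: "z \<in> A" "z \<noteq> u" "z \<noteq> vec h" "d u z = l" "d (vec h) z = k"
        using d_meet[of u "vec h" l k] vh h k l False u by metis
      obtain e where e: "e \<in> A" "e \<noteq> u" "vec h \<oplus>\<^bsub>V\<^esub> e = z" "d u e = k" using d_diff[OF vh(1) z(1)] z by metis
      obtain s where s: "s \<in> K" "s (vec k) = e" using K_transitive[OF vk(1) e(1) vk(2) e(2)] vk e by metis
      obtain t where t: "t \<in> K" "t z = vec l" using K_transitive[OF z(1) vl(1) z(2) vl(2)] z vl by metis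
      have "(\<zero>\<^bsub>R\<^esub>, e) \<in> U" using scale0[OF kU s(1)] s by simp
      then have "(\<zero>\<^bsub>R\<^esub>, z) \<in> U" using U(2)[OF hU, of "(\<zero>\<^bsub>R\<^esub>, e)"] e R.r_zero[OF R.zero_closed] by (simp del: R_simps V_simps)
      then have "(\<zero>\<^bsub>R\<^esub>, vec l) \<in> U" using scale0[OF _ t(1)] t by metis
      then show ?thesis using l H by simp
    qed
  next
    fix x y assume x: "x \<in> {x \<in> A \<union> H. coord x \<in> U}" "x \<in> A" and y: "y \<in> A" "x \<noteq> y" "d x y \<in> {x \<in> A \<union> H. coord x \<in> U}"
    let ?h = "d x y"
    have h: "?h \<in> H" using d_in x y by blast
    have vh: "vec ?h \<in> A" "vec ?h \<noteq> u" "d u (vec ?h) = ?h" using vec h by auto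
    obtain e where e: "e \<in> A" "e \<noteq> u" "x \<oplus>\<^bsub>V\<^esub> e = y" "d u e = ?h" using d_diff x y by metis
    obtain s where s: "s \<in> K" "s (vec ?h) = e" using K_transitive[OF vh(1) e(1) vh(2) e(2)] vh e by metis
    have hU: "(\<zero>\<^bsub>R\<^esub>, vec ?h) \<in> U" using y h H by auto
    then have "(\<zero>\<^bsub>R\<^esub>, e) \<in> U" using scale0[OF hU s(1)] s by simp
    moreover have "(\<one>\<^bsub>R\<^esub>, x) \<in> U" using x A by auto
    ultimately have "(\<one>\<^bsub>R\<^esub>, y) \<in> U" using trans[of x e] e by simp
    then show "y \<in> {x \<in> A \<union> H. coord x \<in> U}" using y A by simp
  next
    fix x y assume x: "x \<in> {x \<in> A \<union> H. coord x \<in> U}" "x \<in> A" and y: "y \<in> {x \<in> A \<union> H. coord x \<in> U}" "y \<in> A" and xy: "x \<noteq> y"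
    let ?h = "d x y"
    have h: "?h \<in> H" using d_in x y xy by blast
    have vh: "vec ?h \<in> A" "vec ?h \<noteq> u" "d u (vec ?h) = ?h" using vec h by auto
    obtain e where e: "e \<in> A" "e \<noteq> u" "x \<oplus>\<^bsub>V\<^esub> e = y" "d u e = ?h" using d_diff x y xy by metis
    have "(\<one>\<^bsub>R\<^esub>, x) \<in> U" "(\<one>\<^bsub>R\<^esub>, y) \<in> U" using x y A by auto
    then have eU: "(\<zero>\<^bsub>R\<^esub>, e) \<in> U" using diff x e by blast
    obtain s where s: "s \<in> K" "s e = vec ?h" using K_transitive[OF e(1) vh(1) e(2) vh(2)] vh e by metis
    have "(\<zero>\<^bsub>R\<^esub>, vec ?h) \<in> U" using scale0[OF eU s(1)] s by simp
    then show "?h \<in> {x \<in> A \<union> H. coord x \<in> U}" using h H by simp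
  qed
qed

text \<open>Passing to \<open>cone\<close> sends subspaces to linear subspaces, and
  \<open>subsp_coord\<close> goes back, so the two notions of span agree on finite sets.\<close>

lemma coord_lspan:
  assumes AH: "A \<inter> H = {}" and Y: "finite Y" "Y \<subseteq> A \<union> H" and x: "x \<in> A \<union> H"
  shows "coord x \<in> W.lspan coord Y \<longleftrightarrow> (\<forall>T. subsp T \<and> Y \<subseteq> T \<longrightarrow> x \<in> T)"
proof
  have cY: "coord \<in> Y \<rightarrow> carrier C.hom_space" using Y coord_carrier by blast
  show "\<forall>T. subsp T \<and> Y \<subseteq> T \<longrightarrow> x \<in> T" if xY: "coord x \<in> W.lspan coord Y"
  proof (intro allI impI, elim conjE)
    fix T assume T: "subsp T" "Y \<subseteq> T"
    then have TAH: "T \<subseteq> A \<union> H" by (simp add: subsp_def)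
    have z: "\<zero>\<^bsub>C.hom_space\<^esub> \<in> cone T" using K_zero by (simp add: cone_def)
    have "coord ` Y \<subseteq> cone T" using coord_cone[OF AH TAH] T Y by blast
    then have "W.lspan coord Y \<subseteq> cone T"
      using W.lspan_least[OF Y(1) cY z, unfolded R_simps(1)] cone_add[OF T(1)] cone_scale by blast
    then show "x \<in> T" using coord_cone[OF AH TAH x] xY by blast
  qed
  show "coord x \<in> W.lspan coord Y" if all: "\<forall>T. subsp T \<and> Y \<subseteq> T \<longrightarrow> x \<in> T"
  proof -
    let ?U = "W.lspan coord Y"
    have "subsp {x \<in> A \<union> H. coord x \<in> ?U}"
      using subsp_coord[OF AH W.lspan_carrier[OF cY]] W.lspan_add[OF cY] W.lspan_scale[OF Y(1) cY, unfolded R_simps(1)] by blast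
    moreover have "Y \<subseteq> {x \<in> A \<union> H. coord x \<in> ?U}" using W.lspan_base[OF Y(1) cY] Y by blast
    ultimately show ?thesis using all by blast
  qed
qed

end

section \<open>Coordinatization of projective spaces of dimension at least three\<close>

context projective_space
begin

abbreviation join :: "'p \<Rightarrow> 'p \<Rightarrow> 'p set" where
  "join \<equiv> line_through L"

lemma join:
  assumes "p \<in> P" "q \<in> P" "p \<noteq> q"
  shows join_line: "join p q \<in> L" and join_left: "p \<in> join p q" and join_right: "q \<in> join p q"
  using theI'[OF P2[OF assms]] unfolding line_through_def by auto

lemma join_unique: "\<lbrakk>l \<in> L; p \<in> l; q \<in> l; p \<noteq> q\<rbrakk> \<Longrightarrow> join p q = l"
  using P2[of p q] join_line[of p q] join_left[of p q] join_right[of p q] lines_subset by (metis subsetD)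

lemma join_P: "\<lbrakk>p \<in> P; q \<in> P; p \<noteq> q; x \<in> join p q\<rbrakk> \<Longrightarrow> x \<in> P"
  using join_line lines_subset by blast

lemma join_commute: "\<lbrakk>p \<in> P; q \<in> P; p \<noteq> q\<rbrakk> \<Longrightarrow> join p q = join q p"
  using join_unique[of "join q p" p q] join[of q p] by metis

lemma join_eq: "\<lbrakk>p \<in> P; q \<in> P; p \<noteq> q; x \<in> join p q; y \<in> join p q; x \<noteq> y\<rbrakk> \<Longrightarrow> join x y = join p q"
  using join_unique join_line by metis

lemma pasch:
  assumes "a \<in> P" "b \<in> P" "c \<in> P" "d \<in> P" "distinct [a, b, c, d]" "e \<in> join a b" "e \<in> join c d"
  obtains v where "v \<in> join a c" "v \<in> join b d"
  using P3[of a b c d] assms by blast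

lemma subspace_join: "\<lbrakk>proj_subspace P L W; p \<in> W; q \<in> W; p \<noteq> q; x \<in> join p q\<rbrakk> \<Longrightarrow> x \<in> W"
  unfolding proj_subspace_def by blast

lemma subspace_P: "proj_subspace P L W \<Longrightarrow> W \<subseteq> P"
  unfolding proj_subspace_def by blast

definition cone_over :: "'p \<Rightarrow> 'p set \<Rightarrow> 'p set" where
  "cone_over p W = {x \<in> P. x = p \<or> (\<exists>w\<in>W. x \<in> join p w)}"

text \<open>The lines from \<open>p\<close> to \<open>W\<close> already fill the span of
  \<open>p\<close> and \<open>W\<close>. For \<open>z\<close> on the join of two points of the cone
  it suffices, by \<open>foot\<close>, that the line \<open>p z\<close> meets \<open>W\<close>,
  which repeated use of Pasch's axiom shows.\<close>

lemma cone_over_subspace: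
  assumes W: "proj_subspace P L W" and p: "p \<in> P" "p \<notin> W"
  shows "proj_subspace P L (cone_over p W)"
proof -
  have WP: "w \<in> P" "w \<noteq> p" if "w \<in> W" for w using that subspace_P[OF W] p by auto
  have foot_unique: "w = w'" if "w \<in> W" "w' \<in> W" "w' \<in> join p w" for w w'
    using that WP p join_eq[of p w w' w] join_right[of p w] join_left[of p w] subspace_join[OF W, of w' w p] by metis
  have meet_p: "x = p" if "w \<in> W" "w' \<in> W" "w \<noteq> w'" "x \<in> join p w" "x \<in> join p w'" for x w w'
    using that WP p join_eq[of p w p x] join_eq[of p w' p x] join[of p w] join[of p w'] foot_unique by metis
  have WJ: "w \<in> cone_over p W" if "w \<in> W" for w
    using that WP[OF that] join_right[of p w] p by (auto simp: cone_over_def)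
  have foot: "z \<in> cone_over p W" if "v \<in> W" "v \<in> join p z" "z \<in> P" for v z
  proof (cases "z = p")
    case True then show ?thesis using p by (simp add: cone_over_def)
  next
    case False
    then have "join p v = join p z" using that WP p join_eq[of p z p v] join_left[of p z] by metis
    then have "z \<in> join p v" using join_right[of p z] p that False by metis
    then show ?thesis using that by (auto simp: cone_over_def)
  qed
  have "z \<in> cone_over p W"
    if x: "x \<in> cone_over p W" and y: "y \<in> cone_over p W" and xy: "x \<noteq> y" and z: "z \<in> join x y" for x y z
  proof -
    have xP: "x \<in> P" "y \<in> P" using x y by (auto simp: cone_over_def)
    have zP: "z \<in> P" using join_P xP xy z by blast
    have through: "z \<in> cone_over p W" if "w \<in> W" "x \<in> join p w" "y \<in> join p w" for w
    proof -
      have "z \<in> join p w" using join_eq[of p w x y] that WP p xy z by metis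
      then show ?thesis using that zP by (auto simp: cone_over_def)
    qed
    show ?thesis
    proof (cases "x = p \<or> y = p")
      case True
      then show ?thesis using x y xy through join_left p WP by (auto simp: cone_over_def)
    next
      case xyp: False
      then obtain w1 w2 where w: "w1 \<in> W" "x \<in> join p w1" "w2 \<in> W" "y \<in> join p w2"
        using x y by (auto simp: cone_over_def)
      show ?thesis
      proof (cases "w1 = w2 \<or> z \<in> W \<or> z = p \<or> z = x \<or> z = y")
        case True then show ?thesis using through w x y zP WJ by (auto simp: cone_over_def)
      next
        case False
        then have w12: "w1 \<noteq> w2" and zW: "z \<notin> W" "z \<noteq> p" "z \<noteq> x" "z \<noteq> y" by auto
        note wP = WP[OF w(1)] WP[OF w(3)]
        have xw2: "x \<noteq> w2" "y \<noteq> w1" using foot_unique w w12 by metis+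
        have xW: "x \<in> W \<Longrightarrow> x = w1" "y \<in> W \<Longrightarrow> y = w2" using foot_unique w by metis+
        have jW: "v \<in> W" if "v \<in> join w1 w2" for v using subspace_join[OF W w(1,3) w12 that] .
        have jx: "join x w1 = join p w1" if "x \<noteq> w1" using join_eq[of p w1 x w1] join_right wP p w that by metis
        have jy: "join y w2 = join p w2" if "y \<noteq> w2" using join_eq[of p w2 y w2] join_right wP p w that by metis
        show ?thesis
        proof (cases "x = w1")
          case True
          have yw2: "y \<noteq> w2" using True jW z zW by metis
          have "join z w1 = join x y" using join_eq[of x y z x] xP xy z zW True join_left by metis
          then have "y \<in> join z w1" using join_right xP xy by metis
          then obtain v where "v \<in> join p z" "v \<in> join w2 w1"
            using pasch[of p w2 z w1 y] p wP zP w zW True w12 by (metis distinct_length_2_or_more distinct_singleton)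
          then show ?thesis using foot zP jW join_commute wP w12 by metis
        next
          case xw1: False
          show ?thesis
          proof (cases "y = w2")
            case True
            have "join z w2 = join x y" using join_eq[of x y z y] xP xy z zW True join_right by metis
            then have "x \<in> join z w2" using join_left xP xy by metis
            then obtain v where "v \<in> join p z" "v \<in> join w1 w2"
              using pasch[of p w1 z w2 x] p wP zP w zW True w12 by (metis distinct_length_2_or_more distinct_singleton)
            then show ?thesis using foot zP jW by metis
          next
            case yw2: False
            \<comment> \<open>General position. The lines \<open>x w1\<close> and
              \<open>y w2\<close> meet in \<open>p\<close>, so \<open>x y\<close> meets
              \<open>w1 w2\<close> in a point \<open>v\<close> of \<open>W\<close>. Then
              \<open>p w1\<close> and \<open>z v\<close> meet in \<open>x\<close>, so
              \<open>p z\<close> meets the line \<open>w1 v\<close> inside \<open>W\<close>.\<close>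
            have "p \<in> join x w1" "p \<in> join y w2" using jx jy xw1 yw2 join_left p wP by metis+
            then obtain v where v: "v \<in> join x y" "v \<in> join w1 w2"
              using pasch[of x w1 y w2 p] xP wP xw1 yw2 xw2 xy w12 by (metis distinct_length_2_or_more distinct_singleton)
            have vW: "v \<in> W" using jW v by blast
            have vP: "v \<in> P" using WP vW by blast
            have vx: "v \<noteq> x" using vW xW xw1 by blast
            have vw1: "v \<noteq> w1"
            proof
              assume "v = w1"
              then have "join x y = join p w1" using jx[OF xw1] join_eq[of x y x w1] v xP xy join_left xw1 by metis
              then show False using meet_p[of w1 w2 y] w w12 join_right xP xy xyp by metis
            qed
            have "join z v = join x y" using join_eq[of x y z v] xP xy z v zW vW by metis
            then have "x \<in> join z v" using join_left xP xy by metis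
            then obtain v' where v': "v' \<in> join p z" "v' \<in> join w1 v"
              using pasch[of p w1 z v x] p wP zP vP w zW vW vw1 WP[OF vW]
              by (metis distinct_length_2_or_more distinct_singleton)
            then have "v' \<in> W" using subspace_join[OF W w(1) vW] vw1 by metis
            then show ?thesis using foot zP v' by metis
          qed
        qed
      qed
    qed
  qed
  moreover have "cone_over p W \<subseteq> P" by (auto simp: cone_over_def)
  ultimately show ?thesis unfolding proj_subspace_def by blast
qed

lemma subset_cone_over: "\<lbrakk>proj_subspace P L W; p \<in> P; p \<notin> W\<rbrakk> \<Longrightarrow> insert p W \<subseteq> cone_over p W"
  using subspace_P join_right by (fastforce simp: cone_over_def)

lemma cone_over_least: "\<lbrakk>proj_subspace P L T; p \<in> T; W \<subseteq> T; p \<notin> W\<rbrakk> \<Longrightarrow> cone_over p W \<subseteq> T"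
  unfolding cone_over_def using subspace_join by blast

text \<open>The dimension may be infinite, hence Zorn: \<open>H\<close> is maximal among the
  subspaces that contain \<open>W\<close> and avoid \<open>p\<close>. Every larger subspace contains
  \<open>p\<close>, so the cone over \<open>H\<close> from any outside point contains
  \<open>p\<close> and with it all points; therefore every line meets \<open>H\<close>.\<close>

lemma hyperplane_ex:
  assumes W: "proj_subspace P L W" and p: "p \<in> P" "p \<notin> W"
  obtains H where "proj_subspace P L H" "W \<subseteq> H" "p \<notin> H"
    "\<And>x y. \<lbrakk>x \<in> P - H; y \<in> P - H; x \<noteq> y\<rbrakk> \<Longrightarrow> \<exists>h\<in>H. h \<in> join x y"
proof -
  let ?S = "{H. proj_subspace P L H \<and> W \<subseteq> H \<and> p \<notin> H}"
  have "\<exists>M\<in>?S. \<forall>X\<in>?S. M \<subseteq> X \<longrightarrow> X = M"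
  proof (rule subset_Zorn_nonempty)
    show "?S \<noteq> {}" using W p by blast
  next
    fix c assume c: "c \<noteq> {}" "subset.chain ?S c"
    then have cS: "c \<subseteq> ?S" and ch: "\<And>X Y. X \<in> c \<Longrightarrow> Y \<in> c \<Longrightarrow> X \<subseteq> Y \<or> Y \<subseteq> X"
      by (auto simp: subset_chain_def)
    have "proj_subspace P L (\<Union>c)"
      unfolding proj_subspace_def
    proof (intro conjI ballI impI)
      show "\<Union>c \<subseteq> P" using cS subspace_P by blast
    next
      fix x y assume "x \<in> \<Union>c" "y \<in> \<Union>c" and xy: "x \<noteq> y"
      then obtain X where X: "X \<in> c" "x \<in> X" "y \<in> X" using ch by (meson UnionE subsetD)
      then show "join x y \<subseteq> \<Union>c" using cS xy subspace_join by blast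
    qed
    then show "\<Union>c \<in> ?S" using c cS by blast
  qed
  then obtain H where HS: "H \<in> ?S" and HX: "\<forall>X\<in>?S. H \<subseteq> X \<longrightarrow> X = H" ..
  have H: "proj_subspace P L H" "W \<subseteq> H" "p \<notin> H" using HS by auto
  have max: "X = H" if "proj_subspace P L X" "W \<subseteq> X" "p \<notin> X" "H \<subseteq> X" for X
    using HX that by (metis (mono_tags, lifting) mem_Collect_eq)
  have inp: "p \<in> T" if "proj_subspace P L T" "H \<subseteq> T" "T \<noteq> H" for T using max H that by blast
  have p_cone: "x \<in> cone_over p H" if x: "x \<in> P" for x
  proof (cases "x \<in> H \<or> x = p")
    case True then show ?thesis using subset_cone_over[OF H(1) p(1) H(3)] by blast
  next
    case False
    then have "p \<in> cone_over x H"
      using inp[OF cone_over_subspace[OF H(1) x]] subset_cone_over[OF H(1) x] by blast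
    then obtain h where h: "h \<in> H" "p \<in> join x h" using False by (auto simp: cone_over_def)
    then have hP: "h \<in> P" "h \<noteq> x" "h \<noteq> p" using subspace_P H False by auto
    then have "join p h = join x h" using join_eq[of x h p h] join_right[of x h] h x by metis
    then show ?thesis using join_left[of x h] hP h x by (auto simp: cone_over_def)
  qed
  have "\<exists>h\<in>H. h \<in> join x y" if x: "x \<in> P - H" and y: "y \<in> P - H" and xy: "x \<noteq> y" for x y
  proof -
    have "p \<in> cone_over x H"
      using inp[OF cone_over_subspace[OF H(1)]] subset_cone_over[OF H(1), of x] x by blast
    then have "cone_over p H \<subseteq> cone_over x H"
      using cone_over_least[OF cone_over_subspace[OF H(1)]] subset_cone_over[OF H(1), of x] x H by blast
    then have "y \<in> cone_over x H" using p_cone y by blast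
    then obtain h where h: "h \<in> H" "y \<in> join x h" using xy by (auto simp: cone_over_def)
    then have hP: "h \<in> P" "h \<noteq> x" using subspace_P H x by auto
    then have "join x y = join x h" using join_eq[of x h x y] join_left[of x h] h x xy by blast
    then show ?thesis using h hP join_right[of x h] x by blast
  qed
  then show thesis using that H by blast
qed

end

text \<open>Three non-collinear points in \<open>H\<close> make \<open>H\<close> at least a plane.
  This yields the axiom \<open>dim\<close> of \<open>dir_space\<close> and is the only place where
  the dimension of the projective space enters the coordinatization.\<close>

locale affine_part = projective_space +
  fixes H :: "'a set" and u b1 b2 b3 :: 'a
  assumes H: "proj_subspace P L H"
    and meets: "\<And>x y. \<lbrakk>x \<in> P - H; y \<in> P - H; x \<noteq> y\<rbrakk> \<Longrightarrow> \<exists>h\<in>H. h \<in> join x y"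
    and uA: "u \<in> P - H"
    and b: "b1 \<in> H" "b2 \<in> H" "b3 \<in> H" "b1 \<noteq> b2" "b3 \<notin> join b1 b2"
begin

abbreviation "A \<equiv> P - H"

definition dir :: "'a \<Rightarrow> 'a \<Rightarrow> 'a" where
  "dir x y = (THE h. h \<in> H \<and> h \<in> join x y)"

definition col :: "'a \<Rightarrow> 'a \<Rightarrow> 'a \<Rightarrow> bool" where
  "col h k l \<longleftrightarrow> h = k \<or> k = l \<or> h = l \<or> (\<exists>m\<in>L. h \<in> m \<and> k \<in> m \<and> l \<in> m)"

lemma HP: "h \<in> H \<Longrightarrow> h \<in> P"
  using subspace_P[OF H] by blast

lemma dir_unique:
  assumes "x \<in> A" "y \<in> P" "x \<noteq> y" "h \<in> H" "h \<in> join x y" "k \<in> H" "k \<in> join x y"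
  shows "h = k"
  using assms subspace_join[OF H, of h k x] join_eq[of x y h k] join_left[of x y] by blast

lemma dir:
  assumes "x \<in> A" "y \<in> A" "x \<noteq> y"
  shows dir_H: "dir x y \<in> H" and dir_join: "dir x y \<in> join x y"
proof -
  have "\<exists>!h. h \<in> H \<and> h \<in> join x y" using meets[OF assms] dir_unique[of x y] assms by blast
  from theI'[OF this] show "dir x y \<in> H" "dir x y \<in> join x y" unfolding dir_def by auto
qed

lemma dir_eq: "\<lbrakk>x \<in> A; y \<in> A; x \<noteq> y; h \<in> H; h \<in> join x y\<rbrakk> \<Longrightarrow> dir x y = h"
  using dir dir_unique[of x y] by blast

lemma join_dir:
  assumes "x \<in> A" "y \<in> A" "x \<noteq> y"
  shows "join x (dir x y) = join x y"
  using join_eq[of x y x "dir x y"] assms dir[OF assms] join_left[of x y] by (metis DiffD1 DiffD2)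

lemma join_affine:
  assumes "x \<in> A" "h \<in> H" "y \<in> join x h" "y \<noteq> h"
  shows "y \<in> A"
proof -
  have "h \<in> P" "x \<noteq> h" using HP assms by auto
  then have "y \<in> P" "h \<in> join x h" using join_P[of x h y] join_right[of x h] assms by auto
  then show ?thesis using dir_unique[of x h y h] assms \<open>x \<noteq> h\<close> \<open>h \<in> P\<close> by blast
qed

lemma dir_of_join:
  assumes "x \<in> A" "h \<in> H" "y \<in> join x h" "y \<noteq> h" "y \<noteq> x"
  shows "dir x y = h"
proof (rule dir_eq)
  have hP: "h \<in> P" "x \<noteq> h" using HP assms by auto
  show "y \<in> A" using join_affine assms by blast
  have "join x y = join x h" using join_eq[of x h x y] join_left[of x h] hP assms by blast
  then show "h \<in> join x y" using join_right[of x h] hP assms by blast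
qed (use assms in auto)

sublocale dir_space A H dir col
proof
  fix x y assume x: "x \<in> A" and y: "y \<in> A" and xy: "x \<noteq> y"
  show "dir x y \<in> H" using dir[OF x y xy] by blast
  show "dir x y = dir y x" using join_commute[of x y] x y xy by (simp add: dir_def)
next
  fix x y z assume x: "x \<in> A" and y: "y \<in> A" and z: "z \<in> A" and ne: "x \<noteq> y" "x \<noteq> z" "y \<noteq> z"
  show "dir y z = dir x y" if eq: "dir x y = dir x z"
  proof -
    have "join x y = join x z" using join_dir x y z ne eq by metis
    then have "z \<in> join x y" "y \<in> join x y" using join_right x y z ne by blast+
    then have "join y z = join x y" using join_eq[of x y y z] x y ne by blast
    then show ?thesis by (simp add: dir_def)
  qed
  show "col (dir x y) (dir y z) (dir x z)"
  proof (cases "dir x y = dir y z \<or> dir y z = dir x z \<or> dir x y = dir x z")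
    case True then show ?thesis by (auto simp: col_def)
  next
    case False
    let ?h = "dir x y" and ?k = "dir y z" and ?l = "dir x z"
    have H': "?h \<in> H" "?k \<in> H" "?l \<in> H" using dir x y z ne by blast+
    have P': "x \<in> P" "y \<in> P" "z \<in> P" "?h \<in> P" "?k \<in> P" using x y z H' HP by auto
    have j: "join x ?h = join x y" "join z ?k = join y z" using join_dir[of x y] join_dir[of z y] x y z ne
        join_commute[of y z] by (auto simp: dir_def)
    then have "y \<in> join x ?h" "y \<in> join z ?k" using join_left[of y z] join_right[of x y] P' ne by auto
    moreover have "distinct [x, ?h, z, ?k]" using x y z H' False ne by auto
    \<comment> \<open>The lines \<open>x ?h\<close> and \<open>z ?k\<close> meet in
      \<open>y\<close>, so by Pasch \<open>x z\<close> meets the line \<open>?h ?k\<close>; the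
      meeting point is in \<open>H\<close> and hence is \<open>?l\<close>.\<close>
    ultimately obtain v where v: "v \<in> join x z" "v \<in> join ?h ?k"
      using pasch[of x ?h z ?k y] P' by blast
    have "v \<in> H" using subspace_join[OF H H'(1,2)] v False by blast
    then have "v = ?l" using dir_eq x z ne v by metis
    then show ?thesis using v join[of ?h ?k] P' False unfolding col_def by blast
  qed
next
  fix x h assume x: "x \<in> A" and h: "h \<in> H"
  have hP: "h \<in> P" "x \<noteq> h" "x \<in> P" using HP x h by auto
  obtain a b c where "{a, b, c} \<subseteq> join x h" "distinct [a, b, c]" using P4[OF join_line[of x h]] hP by blast
  then have "a \<in> join x h" "b \<in> join x h" "c \<in> join x h" "a \<noteq> b" "a \<noteq> c" "b \<noteq> c" by auto
  then obtain y where y: "y \<in> join x h" "y \<noteq> x" "y \<noteq> h" by metis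
  then show "\<exists>y\<in>A. y \<noteq> x \<and> dir x y = h" using dir_of_join[OF x h] join_affine[OF x h] by blast
next
  fix x y h k assume x: "x \<in> A" and y: "y \<in> A" and xy: "x \<noteq> y" and h: "h \<in> H" and k: "k \<in> H" and hk: "h \<noteq> k"
    and ne: "dir x y \<noteq> h" "dir x y \<noteq> k" and c: "col (dir x y) h k"
  let ?m = "dir x y"
  have m: "?m \<in> join x y" "?m \<in> H" using dir x y xy by blast+
  obtain l where "l \<in> L" "?m \<in> l" "h \<in> l" "k \<in> l" using c ne hk by (auto simp: col_def)
  then have mhk: "?m \<in> join h k" using join_unique hk by metis
  have P': "x \<in> P" "y \<in> P" "h \<in> P" "k \<in> P" using x y HP h k by auto
  \<comment> \<open>The lines \<open>x y\<close> and \<open>h k\<close> meet in \<open>?m\<close>,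
    so by Pasch \<open>x h\<close> and \<open>y k\<close> meet.\<close>
  obtain z where z: "z \<in> join x h" "z \<in> join y k"
    using pasch[of x y h k ?m] P' x y h k xy hk m mhk by auto
  have zh: "z \<noteq> h"
  proof
    assume "z = h"
    then have "h \<in> join y k" using z by simp
    then show False using dir_unique[of y k h k] y k P' h hk join_right[of y k] by blast
  qed
  have zk: "z \<noteq> k"
  proof
    assume "z = k"
    then have "k \<in> join x h" using z by simp
    then show False using dir_unique[of x h k h] x k P' h hk join_right[of x h] by blast
  qed
  have zA: "z \<in> A" using join_affine[OF x h z(1) zh] .
  have zx: "z \<noteq> x"
  proof
    assume "z = x"
    then have "dir y x = k" using dir_of_join[OF y k z(2) zk] xy by blast
    then show False using ne join_commute[of x y] P' xy by (simp add: dir_def)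
  qed
  have zy: "z \<noteq> y"
  proof
    assume "z = y"
    then have "dir x y = h" using dir_of_join[OF x h z(1) zh] xy by blast
    then show False using ne by simp
  qed
  show "\<exists>z\<in>A. z \<noteq> x \<and> z \<noteq> y \<and> dir x z = h \<and> dir y z = k"
    using zA zx zy dir_of_join[OF x h z(1) zh zx] dir_of_join[OF y k z(2) zk zy] by blast
next
  fix h k l m
  show "col h k l \<Longrightarrow> col k h l" "col h k l \<Longrightarrow> col h l k" "col h h k" by (auto simp: col_def)
  show "h \<noteq> k \<Longrightarrow> col h k l \<Longrightarrow> col h k m \<Longrightarrow> col h l m"
    unfolding col_def using join_unique by metis
next
  fix h k assume h: "h \<in> H" and k: "k \<in> H" and hk: "h \<noteq> k"
  have *: "x \<in> join h k" if "col h k x" for x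
    using that hk join[of h k] HP h k join_unique[of _ h k] unfolding col_def by metis
  show "\<exists>l\<in>H. \<not> col h k l"
  proof (rule ccontr)
    assume "\<not> (\<exists>l\<in>H. \<not> col h k l)"
    then have "b1 \<in> join h k" "b2 \<in> join h k" "b3 \<in> join h k" using * b by blast+
    then show False using join_eq[of h k b1 b2] b HP h k hk by blast
  qed
next
  show "\<exists>h\<in>H. \<exists>k\<in>H. h \<noteq> k" using b by blast
qed

sublocale pointed_dir_space A H dir col u
  by unfold_locales (rule uA)

lemma subsp_iff: "subsp T \<longleftrightarrow> proj_subspace P L T"
proof
  assume T: "subsp T"
  have "join x y \<subseteq> T" if x: "x \<in> T" and y: "y \<in> T" and xy: "x \<noteq> y" for x y
  proof
    fix z assume z: "z \<in> join x y"
    have TP: "T \<subseteq> P" using T HP unfolding subsp_def by blast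
    then have P': "x \<in> P" "y \<in> P" "z \<in> P" using x y join_P[of x y z] xy z by auto
    have mixed: "w \<in> T" if "x \<in> T \<inter> A" "h \<in> T \<inter> H" "w \<in> join x h" for x h w
      using dir_of_join[of x h w] join_affine[of x h w] that T unfolding subsp_def by (metis IntD1 IntD2 IntI)
    show "z \<in> T"
    proof (cases "x \<in> H")
      case xH: True
      show ?thesis
      proof (cases "y \<in> H")
        case True
        then have "z \<in> H" using subspace_join[OF H xH True xy z] by blast
        moreover have "col x y z" using join[of x y] P' xy z unfolding col_def by blast
        ultimately show ?thesis using T x y xH True xy unfolding subsp_def by blast
      next
        case False
        then show ?thesis using mixed[of y x z] join_commute[of x y] z x y P' xH xy by auto
      qed
    next
      case xA: False
      show ?thesis
      proof (cases "y \<in> H")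
        case True then show ?thesis using mixed[of x y z] x y z xA P' by auto
      next
        case False
        then have xyA: "x \<in> A \<inter> T" "y \<in> A \<inter> T" using x y xA P' by auto
        then have "dir x y \<in> T \<inter> H" "join x (dir x y) = join x y"
          using subsp_dir[OF T xyA xy] dir_H[of x y] join_dir[of x y] xy by auto
        then show ?thesis using mixed[of x "dir x y" z] x xA P' z by auto
      qed
    qed
  qed
  then show "proj_subspace P L T" using T HP unfolding proj_subspace_def subsp_def by blast
next
  assume T: "proj_subspace P L T"
  have TP: "T \<subseteq> P" using subspace_P T .
  show "subsp T"
    unfolding subsp_def
  proof (intro conjI ballI impI; (elim IntE)?)
    show "T \<subseteq> A \<union> H" using TP by blast
  next
    fix h k l assume "h \<in> T" "k \<in> T" "h \<noteq> k" "col h k l"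
    then show "l \<in> T" using subspace_join[OF T, of h k l] join_unique[of _ h k] unfolding col_def by blast
  next
    fix x y assume "x \<in> T" "x \<in> A" "y \<in> A" "x \<noteq> y" "dir x y \<in> T"
    then show "y \<in> T" using join_dir[of x y] join_right[of x y] subspace_join[OF T, of x "dir x y" y] dir_H[of x y]
      by (metis DiffD1 DiffD2)
  next
    fix x y assume "x \<in> T" "x \<in> A" "y \<in> T" "y \<in> A" "x \<noteq> y"
    then show "dir x y \<in> T" using dir_join[of x y] subspace_join[OF T, of x y] by blast
  qed
qed

lemma coord_proj_span:
  assumes "finite Y" "Y \<subseteq> P" "x \<in> P"
  shows "x \<in> proj_span P L Y \<longleftrightarrow> coord x \<in> W.lspan coord Y"
  using coord_lspan[of Y x] subsp_iff assms HP unfolding proj_span_def by auto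

lemma coord_independent:
  assumes "finite Y" "Y \<subseteq> P"
  shows "(\<forall>p\<in>Y. p \<notin> proj_span P L (Y - {p})) \<longleftrightarrow> lin_indep_family R C.hom_space C.hom_act coord Y"
proof -
  have "coord \<in> Y \<rightarrow> carrier C.hom_space" using coord_carrier assms HP by blast
  then have "lin_indep_family R C.hom_space C.hom_act coord Y \<longleftrightarrow> (\<forall>p\<in>Y. coord p \<notin> W.lspan coord (Y - {p}))"
    using W.lin_indep_iff_lspan[OF assms(1)] by blast
  moreover have "p \<in> proj_span P L (Y - {p}) \<longleftrightarrow> coord p \<in> W.lspan coord (Y - {p})" if "p \<in> Y" for p
    using coord_proj_span[of "Y - {p}" p] assms that by blast
  ultimately show ?thesis by blast
qed

end

context projective_space
begin

lemma proj_span_subspace: "T \<subseteq> P \<Longrightarrow> proj_subspace P L (proj_span P L T)"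
proof -
  assume T: "T \<subseteq> P"
  have P: "proj_subspace P L P" using join_P unfolding proj_subspace_def by blast
  show ?thesis
    unfolding proj_subspace_def[of P L "proj_span P L T"]
  proof (intro conjI ballI impI)
    show "proj_span P L T \<subseteq> P" using P T unfolding proj_span_def by blast
    fix p q assume "p \<in> proj_span P L T" "q \<in> proj_span P L T" "p \<noteq> q"
    then show "join p q \<subseteq> proj_span P L T" using subspace_join unfolding proj_span_def by blast
  qed
qed

text \<open>The first three points go into the hyperplane, the fourth becomes the origin. Scalars
  are functions on points and vectors are pairs of a scalar and a point, which explains the types;
  \<open>skew_representable_transport\<close> later replaces them.\<close>

theorem veblen_young:
  assumes b: "{b1, b2, b3, b4} \<subseteq> P" "b1 \<noteq> b2" "b3 \<notin> join b1 b2" "b4 \<notin> proj_span P L {b1, b2, b3}"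
  shows "\<exists>(R :: ('p \<Rightarrow> 'p) ring) (V :: (('p \<Rightarrow> 'p) \<times> 'p) ring) act g. right_vector_space R V act \<and>
    g \<in> P \<rightarrow> carrier V \<and> (\<forall>Y\<subseteq>P. finite Y \<longrightarrow>
      ((\<forall>p\<in>Y. p \<notin> proj_span P L (Y - {p})) \<longleftrightarrow> lin_indep_family R V act g Y))"
proof -
  have "{b1, b2, b3} \<subseteq> P" using b by blast
  then obtain H where H: "proj_subspace P L H" "proj_span P L {b1, b2, b3} \<subseteq> H" "b4 \<notin> H"
    "\<And>x y. \<lbrakk>x \<in> P - H; y \<in> P - H; x \<noteq> y\<rbrakk> \<Longrightarrow> \<exists>h\<in>H. h \<in> join x y"
    using hyperplane_ex[OF proj_span_subspace, of "{b1, b2, b3}" b4] b by auto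
  have "{b1, b2, b3} \<subseteq> proj_span P L {b1, b2, b3}" unfolding proj_span_def by blast
  then interpret affine_part P L H b4 b1 b2 b3
    using H b by unfold_locales auto
  have "right_vector_space R C.hom_space C.hom_act" by (rule W.right_vector_space_axioms)
  moreover have "coord \<in> P \<rightarrow> carrier C.hom_space" using coord_carrier by blast
  ultimately show ?thesis using coord_independent by blast
qed

end

section \<open>Modular extensions\<close>

lemma fresh_injection:
  fixes T :: "'b::infinite set"
  assumes "finite F" "finite T"
  obtains g where "inj_on g F" "g ` F \<inter> T = {}"
proof -
  obtain f :: "nat \<Rightarrow> 'b" where f: "inj f" "range f \<subseteq> UNIV - T" using arb_countable_map assms(2) by metis
  obtain h :: "'a \<Rightarrow> nat" where "inj_on h F" using finite_imp_inj_to_nat_seg assms(1) by metis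
  then have "inj_on (f \<circ> h) F" "(f \<circ> h) ` F \<inter> T = {}" using f by (auto intro: comp_inj_on inj_on_subset)
  then show thesis using that by blast
qed

lemma matroid_isomorphic:
  assumes M: "matroid S r" and \<phi>: "bij_betw \<phi> S T" and rT: "\<And>X. X \<subseteq> S \<Longrightarrow> r' (\<phi> ` X) = r X"
  shows "matroid T r'"
proof -
  interpret matroid S r by (rule M)
  have inj: "inj_on \<phi> S" and im: "\<phi> ` S = T" using \<phi> by (auto simp: bij_betw_def)
  have pre: "\<exists>Y. Y \<subseteq> S \<and> X = \<phi> ` Y" if "X \<subseteq> T" for X using that im by (metis subset_image_iff)
  show ?thesis
  proof
    show "finite T" using im finite_ground by blast
  next
    fix X assume "X \<subseteq> T"
    then obtain Y where "Y \<subseteq> S" "X = \<phi> ` Y" using pre by blast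
    then show "r' X \<le> card X" using rT rank_le_card inj by (simp add: card_image inj_on_subset)
  next
    fix X Y assume XY: "X \<subseteq> Y" "Y \<subseteq> T"
    obtain Y0 where Y0: "Y0 \<subseteq> S" "Y = \<phi> ` Y0" using pre[of Y] XY by metis
    then obtain X0 where "X0 \<subseteq> Y0" "X = \<phi> ` X0" using XY by (metis subset_image_iff)
    then show "r' X \<le> r' Y" using rT rank_mono[of X0 Y0] Y0 by auto
  next
    fix X Y assume "X \<subseteq> T" "Y \<subseteq> T"
    then obtain X0 Y0 where "X0 \<subseteq> S" "X = \<phi> ` X0" "Y0 \<subseteq> S" "Y = \<phi> ` Y0" using pre by metis
    moreover from this have "X \<union> Y = \<phi> ` (X0 \<union> Y0)" "X \<inter> Y = \<phi> ` (X0 \<inter> Y0)"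
      using inj_on_image_Int[OF inj] by auto
    ultimately show "r' (X \<union> Y) + r' (X \<inter> Y) \<le> r' X + r' Y"
      using rank_submodular[of X0 Y0] rT[of X0] rT[of Y0] rT[of "X0 \<union> Y0"] rT[of "X0 \<inter> Y0"] by (auto simp: le_infI1)
  qed
qed

lemma one_step_extension_isomorphic:
  assumes ext: "one_step_extension S r A B S' r'" and AB: "A \<subseteq> S" "B \<subseteq> S"
    and \<phi>: "bij_betw \<phi> S' T'" and rT: "\<And>X. X \<subseteq> S \<Longrightarrow> rT (\<phi> ` X) = r X" and rT': "\<And>X. X \<subseteq> S' \<Longrightarrow> rT' (\<phi> ` X) = r' X"
  shows "one_step_extension (\<phi> ` S) rT (\<phi> ` A) (\<phi> ` B) T' rT'"
proof -
  have M: "matroid S' r'" and S: "S \<subseteq> S'" and r': "\<And>X. X \<subseteq> S \<Longrightarrow> r' X = r X"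
    using ext by (auto simp: one_step_extension_def)
  obtain Z where Z: "Z \<subseteq> S'" "r' (A \<union> Z) = r A" "r' (B \<union> Z) = r B" "r' Z + r (A \<union> B) = r A + r B"
    using ext by (auto simp: one_step_extension_def)
  have im: "\<phi> ` S' = T'" using \<phi> by (auto simp: bij_betw_def)
  have "\<phi> ` S \<subseteq> T'" using im S by blast
  moreover have "rT' Y = rT Y" if Y: "Y \<subseteq> \<phi> ` S" for Y
  proof -
    obtain X where "X \<subseteq> S" "Y = \<phi> ` X" using Y by (metis subset_image_iff)
    then show ?thesis using rT[of X] rT'[of X] r' S by auto
  qed
  moreover have "\<exists>Z\<subseteq>T'. rT' (\<phi> ` A \<union> Z) = rT (\<phi> ` A) \<and> rT' (\<phi> ` B \<union> Z) = rT (\<phi> ` B) \<and>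
      rT' Z + rT (\<phi> ` A \<union> \<phi> ` B) = rT (\<phi> ` A) + rT (\<phi> ` B)"
    using Z AB S im rT[of A] rT[of B] rT[of "A \<union> B"] rT'[of "A \<union> Z"] rT'[of "B \<union> Z"] rT'[of Z]
    by (intro exI[of _ "\<phi> ` Z"]) (auto simp: image_Un)
  ultimately show ?thesis
    unfolding one_step_extension_def using matroid_isomorphic[OF M \<phi>, of rT'] rT' by blast
qed

definition pushforward :: "('a \<Rightarrow> 'b) \<Rightarrow> 'a set \<Rightarrow> ('a set \<Rightarrow> nat) \<Rightarrow> 'b set \<Rightarrow> nat" where
  "pushforward \<phi> S r Y = r (S \<inter> \<phi> -` Y)"

lemma pushforward_image: "inj_on \<phi> S \<Longrightarrow> X \<subseteq> S \<Longrightarrow> pushforward \<phi> S r (\<phi> ` X) = r X"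
  unfolding pushforward_def by (rule arg_cong[of _ _ r]) (auto simp: inj_on_def)

lemma modular_extendable_SucE:
  assumes "modular_extendable (Suc k) S r" "A \<subseteq> S" "B \<subseteq> S"
  obtains S' r' where "one_step_extension S r A B S' r'" "modular_extendable k S' r'"
  using assms(1)[unfolded modular_extendable.simps] assms(2,3) that by blast

text \<open>New elements of an extension of \<open>S\<close> may already occur in \<open>T\<close>.
  The isomorphism is therefore continued by an injection \<open>g\<close> into fresh
  elements.\<close>

lemma modular_extendable_isomorphic:
  fixes S T :: "'a::infinite set"
  assumes "finite S" "bij_betw \<phi> S T" "\<And>X. X \<subseteq> S \<Longrightarrow> rT (\<phi> ` X) = r X" "modular_extendable k S r"
  shows "modular_extendable k T rT"
  using assms
proof (induction k arbitrary: S T r rT \<phi>)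
  case 0 then show ?case by simp
next
  case (Suc k)
  have im: "\<phi> ` S = T" and inj: "inj_on \<phi> S" using Suc.prems(2) by (auto simp: bij_betw_def)
  have "\<exists>T' rT'. one_step_extension T rT A B T' rT' \<and> modular_extendable k T' rT'" if AB: "A \<subseteq> T" "B \<subseteq> T" for A B
  proof -
    obtain A0 B0 where A0: "A0 \<subseteq> S" "A = \<phi> ` A0" "B0 \<subseteq> S" "B = \<phi> ` B0" using AB im by (metis subset_image_iff)
    obtain S' r' where ext: "one_step_extension S r A0 B0 S' r'" and k: "modular_extendable k S' r'"
      using modular_extendable_SucE[OF Suc.prems(4) A0(1,3)] by blast
    have S': "finite S'" "S \<subseteq> S'" using ext matroid.finite_ground by (auto simp: one_step_extension_def)
    obtain g :: "'a \<Rightarrow> 'a" where g: "inj_on g (S' - S)" "g ` (S' - S) \<inter> T = {}"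
      using fresh_injection[of "S' - S" T] S' im Suc.prems(1) by blast
    define \<phi>' where "\<phi>' x = (if x \<in> S then \<phi> x else g x)" for x
    have "inj_on \<phi>' S'"
      using inj g im unfolding inj_on_def \<phi>'_def by (smt (verit) DiffI IntI empty_iff imageI)
    then have bij: "bij_betw \<phi>' S' (\<phi>' ` S')" by (simp add: bij_betw_def)
    have \<phi>'S: "\<phi>' ` X = \<phi> ` X" if "X \<subseteq> S" for X using that by (auto simp: \<phi>'_def intro!: image_cong)
    let ?rT' = "pushforward \<phi>' S' r'"
    have push: "?rT' (\<phi>' ` X) = r' X" if "X \<subseteq> S'" for X
      using pushforward_image \<open>inj_on \<phi>' S'\<close> that by blast
    have "one_step_extension (\<phi>' ` S) rT (\<phi>' ` A0) (\<phi>' ` B0) (\<phi>' ` S') ?rT'"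
      using one_step_extension_isomorphic[OF ext A0(1,3) bij, of rT ?rT'] push \<phi>'S Suc.prems(3) by simp
    then have "one_step_extension T rT A B (\<phi>' ` S') ?rT'" using \<phi>'S A0 im by simp
    moreover have "modular_extendable k (\<phi>' ` S') ?rT'" using Suc.IH[OF S'(1) bij push k] by blast
    ultimately show ?thesis by blast
  qed
  then show ?case by simp
qed

lemma modular_extendable_restrict:
  assumes "T \<subseteq> S" "modular_extendable k S r"
  shows "modular_extendable k T r"
  using assms
proof (induction k arbitrary: S T r)
  case 0 then show ?case by simp
next
  case (Suc k)
  have "\<exists>T' r'. one_step_extension T r A B T' r' \<and> modular_extendable k T' r'" if AB: "A \<subseteq> T" "B \<subseteq> T" for A B
  proof -
    obtain S' r' where ext: "one_step_extension S r A B S' r'" and k: "modular_extendable k S' r'"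
      using modular_extendable_SucE[OF Suc.prems(2), of A B] AB Suc.prems(1) by blast
    obtain Z where Z: "Z \<subseteq> S'" "r' (A \<union> Z) = r A" "r' (B \<union> Z) = r B" "r' Z + r (A \<union> B) = r A + r B"
      using ext by (auto simp: one_step_extension_def)
    have TZ: "T \<union> Z \<subseteq> S'" "matroid S' r'" using Z Suc.prems ext by (auto simp: one_step_extension_def)
    then have "matroid (T \<union> Z) r'" using matroid.matroid_restrict by blast
    then have "one_step_extension T r A B (T \<union> Z) r'"
      using ext Suc.prems Z unfolding one_step_extension_def by blast
    then show ?thesis using Suc.IH[OF TZ(1) k] by blast
  qed
  then show ?case by simp
qed

lemma modular_extendable_Suc: "modular_extendable (Suc k) S r \<Longrightarrow> modular_extendable k S r"
proof (induction k arbitrary: S r)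
  case 0 then show ?case by simp
next
  case (Suc k)
  have "\<exists>S' r'. one_step_extension S r A B S' r' \<and> modular_extendable k S' r'" if "A \<subseteq> S" "B \<subseteq> S" for A B
    using modular_extendable_SucE[OF Suc.prems that] Suc.IH by metis
  then show ?case by simp
qed

lemma modular_extendable_antimono: "\<lbrakk>k \<le> l; modular_extendable l S r\<rbrakk> \<Longrightarrow> modular_extendable k S r"
  by (induction l) (auto simp: le_Suc_eq simp del: modular_extendable.simps dest: modular_extendable_Suc)

lemma fully_modular_extendable_iff: "fully_modular_extendable S r \<longleftrightarrow> (\<forall>k. modular_extendable k S r)"
  unfolding fully_modular_extendable_def using modular_extendable_antimono[of _ "Suc _"] by (metis le_add1 le_SucI nat_le_linear plus_1_eq_Suc)

text \<open>A basis of the witness set still is a witness, and it has at most \<open>r A\<close>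
  elements, so the set \<open>N\<close> offers enough names. The witness is in the closure of
  \<open>A\<close>, so the rank of the whole matroid does not grow.\<close>

lemma bounded_one_step_extension:
  fixes S N :: "'a::infinite set"
  assumes M: "matroid S r" and k: "modular_extendable (Suc k) S r" and AB: "A \<subseteq> S" "B \<subseteq> S"
    and N: "finite N" "N \<inter> S = {}" "card N = card S"
  obtains T r' where "T \<subseteq> S \<union> N" "\<And>X. r' X \<le> card (S \<union> N)" "\<And>X. \<not> X \<subseteq> S \<union> N \<Longrightarrow> r' X = 0"
    "one_step_extension S r A B T r'" "r' T = r S" "modular_extendable k T r'"
proof -
  interpret matroid S r by (rule M)
  obtain S' r' where ext: "one_step_extension S r A B S' r'" and k: "modular_extendable k S' r'"
    using modular_extendable_SucE[OF k AB] by blast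
  have M': "matroid S' r'" and S': "S \<subseteq> S'" and r': "\<And>X. X \<subseteq> S \<Longrightarrow> r' X = r X"
    using ext by (auto simp: one_step_extension_def)
  interpret M': matroid S' r' by (rule M')
  obtain Z' where Z': "Z' \<subseteq> S'" "r' (A \<union> Z') = r A" "r' (B \<union> Z') = r B" "r' Z' + r (A \<union> B) = r A + r B"
    using ext by (auto simp: one_step_extension_def)
  obtain Z where Z: "Z \<subseteq> Z'" "indep S' r' Z" "r' Z = r' Z'" "card Z = r' Z'" using M'.basis[OF Z'(1)] by blast
  have between: "r' (C \<union> Z) = r C" if "C \<subseteq> S" "r' (C \<union> Z') = r C" for C
  proof -
    have "r' C \<le> r' (C \<union> Z)" "r' (C \<union> Z) \<le> r' (C \<union> Z')"
      using M'.rank_mono[of C "C \<union> Z"] M'.rank_mono[of "C \<union> Z" "C \<union> Z'"] that S' Z Z' by auto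
    then show ?thesis using that r' by simp
  qed
  let ?S' = "S \<union> Z"
  have sub: "?S' \<subseteq> S'" using S' Z Z' by blast
  have M1: "matroid ?S' r'" using M'.matroid_restrict sub by blast
  have ext1: "one_step_extension S r A B ?S' r'"
    unfolding one_step_extension_def
    using M1 r' AB Z Z' between[of A] between[of B] by auto
  have k1: "modular_extendable k ?S' r'" using modular_extendable_restrict[OF sub k] .
  have rS': "r' ?S' = r S"
    using M'.rank_Un_mono_closure[of A S Z] AB S' Z Z' between[of A] r' by auto
  have "card Z \<le> card N"
  proof -
    have "r' Z \<le> r' (A \<union> Z)" by (rule M'.rank_mono) (use Z Z' AB S' in auto)
    then have "card Z \<le> r A" using Z between[of A] AB Z' by auto
    then show ?thesis using rank_le_card[of A] card_mono[OF finite_ground, of A] AB N by simp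
  qed
  then have "card (Z - S) \<le> card N" using card_mono[of Z "Z - S"] finite_subset[of Z S'] M'.finite_ground Z Z'
    by (meson Diff_subset finite_subset le_trans)
  then obtain g where g: "inj_on g (Z - S)" "g ` (Z - S) \<subseteq> N"
    using card_le_inj[of "Z - S" N] N finite_subset[of "Z - S" S'] M'.finite_ground Z Z' by (metis Diff_subset order_trans)
  define \<phi> where "\<phi> x = (if x \<in> S then x else g x)" for x
  have inj: "inj_on \<phi> ?S'"
    using g N(2) unfolding inj_on_def \<phi>_def by (smt (verit) Diff_iff IntI Un_iff empty_iff imageI subsetD)
  have \<phi>S: "\<phi> ` X = X" if "X \<subseteq> S" for X using that by (auto simp: \<phi>_def image_iff subset_iff)
  have sub2: "\<phi> ` ?S' \<subseteq> S \<union> N" using g by (auto simp: \<phi>_def)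
  \<comment> \<open>The value zero outside the subsets of \<open>S \<union> N\<close> leaves only
    finitely many candidates for the rank function as a total function.\<close>
  define \<rho> where "\<rho> X = (if X \<subseteq> S \<union> N then pushforward \<phi> ?S' r' X else 0)" for X
  have push: "\<rho> (\<phi> ` X) = r' X" if "X \<subseteq> ?S'" for X
    unfolding \<rho>_def using pushforward_image[OF inj that, of r'] sub2 that by auto
  have bij: "bij_betw \<phi> ?S' (\<phi> ` ?S')" using inj by (simp add: bij_betw_def)
  have "one_step_extension (\<phi> ` S) r (\<phi> ` A) (\<phi> ` B) (\<phi> ` ?S') \<rho>"
    using one_step_extension_isomorphic[OF ext1 AB bij, of r \<rho>] push \<phi>S by simp
  then have 1: "one_step_extension S r A B (\<phi> ` ?S') \<rho>" using \<phi>S AB by simp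
  have 2: "modular_extendable k (\<phi> ` ?S') \<rho>"
    using modular_extendable_isomorphic[OF _ bij push k1] M1 matroid.finite_ground by blast
  have 3: "\<rho> X \<le> card (S \<union> N)" for X
  proof -
    have "r' (?S' \<inter> \<phi> -` X) \<le> r' ?S'" using matroid.rank_mono[OF M1] by simp
    then have "\<rho> X \<le> r S" using rS' by (simp add: \<rho>_def pushforward_def)
    also have "\<dots> \<le> card S" using rank_le_card by simp
    also have "\<dots> \<le> card (S \<union> N)" using N finite_ground by (intro card_mono) auto
    finally show ?thesis .
  qed
  show thesis
    by (rule that[OF sub2 3 _ 1 _ 2]) (use push[of ?S'] rS' in \<open>auto simp: \<rho>_def\<close>)
qed

text \<open>Up to renaming there are only finitely many minimal one-step extensions, so one of them works for all levels.\<close>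

lemma fully_modular_extendable_step:
  fixes S :: "'a::infinite set"
  assumes M: "matroid S r" and full: "fully_modular_extendable S r" and AB: "A \<subseteq> S" "B \<subseteq> S"
  obtains T r' where "one_step_extension S r A B T r'" "r' T = r S" "fully_modular_extendable T r'"
proof -
  have fS: "finite S" using M matroid.finite_ground by blast
  obtain g :: "'a \<Rightarrow> 'a" where g: "inj_on g S" "g ` S \<inter> S = {}" using fresh_injection[OF fS fS] by blast
  let ?N = "g ` S"
  have N: "finite ?N" "?N \<inter> S = {}" "card ?N = card S" using g fS by (auto simp: card_image)
  let ?F = "Pow (S \<union> ?N) \<times> {f. \<forall>X. (X \<in> Pow (S \<union> ?N) \<longrightarrow> f X \<in> {..card (S \<union> ?N)}) \<and> (X \<notin> Pow (S \<union> ?N) \<longrightarrow> f X = 0)}"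
  have "finite ?F" using N fS by (intro finite_cartesian_product finite_set_of_finite_funs) auto
  let ?Q = "\<lambda>k p. p \<in> ?F \<and> one_step_extension S r A B (fst p) (snd p) \<and> snd p (fst p) = r S \<and> modular_extendable k (fst p) (snd p)"
  have "\<exists>p. ?Q k p" for k
  proof -
    have "modular_extendable (Suc k) S r" using full unfolding fully_modular_extendable_iff ..
    from bounded_one_step_extension[OF M this AB N]
    obtain T r' where T: "T \<subseteq> S \<union> ?N" "\<And>X. r' X \<le> card (S \<union> ?N)" "\<And>X. \<not> X \<subseteq> S \<union> ?N \<Longrightarrow> r' X = 0"
      "one_step_extension S r A B T r'" "r' T = r S" "modular_extendable k T r'" by metis
    then have "(T, r') \<in> ?F" by auto
    then have "?Q k (T, r')" using T by simp
    then show ?thesis by blast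
  qed
  then have "\<exists>p. \<forall>k. ?Q k (p k)" by (intro choice) blast
  then obtain p where p: "\<And>k. ?Q k (p k)" by blast
  have "p ` UNIV \<subseteq> ?F" using p by blast
  then have "finite (p ` UNIV)" using \<open>finite ?F\<close> by (rule finite_subset)
  \<comment> \<open>Infinitely many depths share one extension, and every depth lies below one of
    them.\<close>
  then obtain k0 where k0: "infinite {k. p k = p k0}" using pigeonhole_infinite[of UNIV p] by auto
  have "modular_extendable k (fst (p k0)) (snd (p k0))" for k
  proof -
    obtain l where "l \<ge> k" "p l = p k0" using k0 unfolding infinite_nat_iff_unbounded_le by (metis mem_Collect_eq)
    then show ?thesis using p[of l] modular_extendable_antimono by metis
  qed
  then show thesis using that[of "fst (p k0)" "snd (p k0)"] p[of k0] fully_modular_extendable_iff by blast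
qed

text \<open>The clause \<open>r' S' = r S\<close> lets the rank of the limit stay that of the
  matroid at the start.\<close>

definition extends :: "'a set \<Rightarrow> ('a set \<Rightarrow> nat) \<Rightarrow> 'a set \<Rightarrow> ('a set \<Rightarrow> nat) \<Rightarrow> bool" where
  "extends S r S' r' \<longleftrightarrow> S \<subseteq> S' \<and> (\<forall>X\<subseteq>S. r' X = r X) \<and> r' S' = r S"

lemma extends_trans: "\<lbrakk>extends S r S' r'; extends S' r' S'' r''\<rbrakk> \<Longrightarrow> extends S r S'' r''"
  unfolding extends_def by (metis order_trans)

definition modular_pair :: "('a set \<Rightarrow> nat) \<Rightarrow> 'a set \<Rightarrow> 'a set \<Rightarrow> 'a set \<Rightarrow> bool" where
  "modular_pair r T A B \<longleftrightarrow> (\<exists>Z\<subseteq>T. r (A \<union> Z) = r A \<and> r (B \<union> Z) = r B \<and> r Z + r (A \<union> B) = r A + r B)"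

lemma modular_pair_extends:
  "\<lbrakk>modular_pair r S A B; extends S r S' r'; A \<subseteq> S; B \<subseteq> S\<rbrakk> \<Longrightarrow> modular_pair r' S' A B"
proof -
  assume a: "modular_pair r S A B" "extends S r S' r'" "A \<subseteq> S" "B \<subseteq> S"
  then obtain Z where Z: "Z \<subseteq> S" "r (A \<union> Z) = r A" "r (B \<union> Z) = r B" "r Z + r (A \<union> B) = r A + r B"
    by (auto simp: modular_pair_def)
  have "r' X = r X" if "X \<subseteq> S" for X using a that by (simp add: extends_def)
  then show ?thesis using a Z unfolding modular_pair_def extends_def by (intro exI[of _ Z]) auto
qed

text \<open>The finitely many pairs are treated one at a time. A pair once made modular stays so,
  because its witness and its ranks persist.\<close>

lemma fully_modular_extendable_all_pairs:
  fixes S :: "'a::infinite set"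
  assumes M: "matroid S r" and full: "fully_modular_extendable S r"
  obtains T r' where "matroid T r'" "fully_modular_extendable T r'" "extends S r T r'"
    "\<And>A B. A \<subseteq> S \<Longrightarrow> B \<subseteq> S \<Longrightarrow> modular_pair r' T A B"
proof -
  have "\<exists>T r'. matroid T r' \<and> fully_modular_extendable T r' \<and> extends S r T r' \<and> (\<forall>(A, B)\<in>F. modular_pair r' T A B)"
    if "finite F" "F \<subseteq> Pow S \<times> Pow S" for F
    using that
  proof (induction F)
    case empty
    then show ?case using M full by (intro exI[of _ S] exI[of _ r]) (simp add: extends_def)
  next
    case (insert p F)
    obtain A B where AB: "p = (A, B)" "A \<subseteq> S" "B \<subseteq> S" using insert.prems by (cases p) auto
    obtain T r' where T: "matroid T r'" "fully_modular_extendable T r'" "extends S r T r'" "\<forall>(A, B)\<in>F. modular_pair r' T A B"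
      using insert by auto
    have ST: "S \<subseteq> T" using T by (simp add: extends_def)
    then obtain U s where U: "one_step_extension T r' A B U s" "s U = r' T" "fully_modular_extendable U s"
      using fully_modular_extendable_step[OF T(1,2), of A B] AB by blast
    have e: "extends T r' U s" using U by (simp add: extends_def one_step_extension_def)
    have "modular_pair s U A B"
    proof -
      have "s X = r' X" if "X \<subseteq> T" for X using U(1) that by (simp add: one_step_extension_def)
      then have "s A = r' A" "s B = r' B" "s (A \<union> B) = r' (A \<union> B)" using AB ST by (simp_all add: subset_trans)
      then show ?thesis using U(1) unfolding one_step_extension_def modular_pair_def by metis
    qed
    moreover have "modular_pair s U A' B'" if "(A', B') \<in> F" for A' B'
    proof -
      have "A' \<subseteq> T" "B' \<subseteq> T" using that insert.prems ST by auto
      then show ?thesis using modular_pair_extends[OF _ e] T(4) that by blast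
    qed
    ultimately show ?case using extends_trans[OF T(3) e] U AB
      by (intro exI[of _ U] exI[of _ s]) (auto simp: one_step_extension_def)
  qed
  from this[of "Pow S \<times> Pow S"] show thesis using that M matroid.finite_ground by (fastforce simp: finite_cartesian_product)
qed

text \<open>A finitary matroid seen through its finite subsets: \<open>R\<close> is meaningful on
  finite sets only, and each of them is a matroid under it.\<close>

locale finite_rank_system =
  fixes E :: "'a set" and R :: "'a set \<Rightarrow> nat"
  assumes finite_matroid: "\<lbrakk>finite X; X \<subseteq> E\<rbrakk> \<Longrightarrow> matroid X R"

locale modular_rank_system = finite_rank_system +
  fixes n :: nat
  assumes modular: "\<lbrakk>finite A; finite B; A \<subseteq> E; B \<subseteq> E\<rbrakk> \<Longrightarrow> \<exists>Z\<subseteq>E. finite Z \<and>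
      R (A \<union> Z) = R A \<and> R (B \<union> Z) = R B \<and> R Z + R (A \<union> B) = R A + R B"
    and bounded: "\<lbrakk>finite X; X \<subseteq> E\<rbrakk> \<Longrightarrow> R X \<le> n"

text \<open>A pair of finite sets present at one stage is modular at the next, hence in the union.
  Countability comes from finite stages and is what later allows points to be named in any infinite
  type.\<close>

theorem modular_limit:
  fixes S :: "'a::infinite set"
  assumes M: "matroid S r" and full: "fully_modular_extendable S r"
  obtains E R where "countable E" "S \<subseteq> E" "\<And>X. X \<subseteq> S \<Longrightarrow> R X = r X" "modular_rank_system E R (r S)"
proof -
  let ?P = "\<lambda>p. matroid (fst p) (snd p) \<and> fully_modular_extendable (fst p) (snd p) \<and> extends S r (fst p) (snd p)"
  let ?Q = "\<lambda>p q. extends (fst p) (snd p) (fst q) (snd q) \<and>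
      (\<forall>A B. A \<subseteq> fst p \<longrightarrow> B \<subseteq> fst p \<longrightarrow> modular_pair (snd q) (fst q) A B)"
  have "\<exists>f. \<forall>n::nat. ?P (f n) \<and> ?Q (f n) (f (Suc n))"
  proof (rule dependent_nat_choice)
    show "\<exists>p. ?P p" using M full by (intro exI[of _ "(S, r)"]) (simp add: extends_def)
  next
    fix p and n :: nat assume p: "?P p"
    from fully_modular_extendable_all_pairs[of "fst p" "snd p"] p
    obtain T r' where "matroid T r'" "fully_modular_extendable T r'" "extends (fst p) (snd p) T r'"
      "\<And>A B. A \<subseteq> fst p \<Longrightarrow> B \<subseteq> fst p \<Longrightarrow> modular_pair r' T A B" by metis
    then show "\<exists>q. ?P q \<and> ?Q p q" using p extends_trans by (intro exI[of _ "(T, r')"]) auto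
  qed
  then obtain f where f: "\<And>n. ?P (f n)" "\<And>n. ?Q (f n) (f (Suc n))" by metis
  define T where "T n = fst (f n)" for n
  define \<rho> where "\<rho> n = snd (f n)" for n
  have Mn: "matroid (T n) (\<rho> n)" and Sn: "extends S r (T n) (\<rho> n)" for n using f(1) by (auto simp: T_def \<rho>_def)
  have ext: "extends (T m) (\<rho> m) (T (m + k)) (\<rho> (m + k))" for m k
  proof (induction k)
    case 0 then show ?case by (simp add: extends_def)
  next
    case (Suc k)
    then show ?case using f(2)[of "m + k"] extends_trans unfolding T_def \<rho>_def by (metis add_Suc_right)
  qed
  have coherent: "T m \<subseteq> T l \<and> (\<forall>X\<subseteq>T m. \<rho> l X = \<rho> m X)" if "m \<le> l" for m l
    using ext[of m "l - m"] that by (simp add: extends_def)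
  define E where "E = (\<Union>n. T n)"
  \<comment> \<open>By \<open>coherent\<close> all levels that contain \<open>X\<close> assign it
    the same rank; the least one is a convenient choice.\<close>
  define R where "R X = \<rho> (LEAST n. X \<subseteq> T n) X" for X
  have R: "R X = \<rho> n X" if "X \<subseteq> T n" for X n
  proof -
    let ?m = "LEAST n. X \<subseteq> T n"
    have "X \<subseteq> T ?m" "?m \<le> n" using that by (rule LeastI, intro Least_le) (rule that)
    then show ?thesis using coherent[of ?m n] by (simp add: R_def)
  qed
  have level: "\<exists>n. X \<subseteq> T n" if "finite X" "X \<subseteq> E" for X
    using that
  proof (induction X)
    case empty then show ?case by simp
  next
    case (insert x X)
    then obtain n m where "X \<subseteq> T n" "x \<in> T m" by (auto simp: E_def)
    then have "insert x X \<subseteq> T (max n m)" using coherent[of n "max n m"] coherent[of m "max n m"] by auto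
    then show ?case by blast
  qed
  have "matroid X R" if X: "finite X" "X \<subseteq> E" for X
  proof -
    obtain n where n: "X \<subseteq> T n" using level X by blast
    then have "matroid X (\<rho> n)" using matroid.matroid_restrict Mn by blast
    moreover have "R Y = \<rho> n Y" if "Y \<subseteq> X" for Y using R[of Y n] n that by blast
    ultimately show ?thesis using matroid_isomorphic[of X "\<rho> n" id X R] by simp
  qed
  moreover have "\<exists>Z\<subseteq>E. finite Z \<and> R (A \<union> Z) = R A \<and> R (B \<union> Z) = R B \<and> R Z + R (A \<union> B) = R A + R B"
    if AB: "finite A" "finite B" "A \<subseteq> E" "B \<subseteq> E" for A B
  proof -
    obtain n where n: "A \<union> B \<subseteq> T n" using level[of "A \<union> B"] AB by blast
    then have "modular_pair (\<rho> (Suc n)) (T (Suc n)) A B" using f(2)[of n] by (auto simp: T_def \<rho>_def)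
    then obtain Z where Z: "Z \<subseteq> T (Suc n)" "\<rho> (Suc n) (A \<union> Z) = \<rho> (Suc n) A" "\<rho> (Suc n) (B \<union> Z) = \<rho> (Suc n) B"
      "\<rho> (Suc n) Z + \<rho> (Suc n) (A \<union> B) = \<rho> (Suc n) A + \<rho> (Suc n) B" unfolding modular_pair_def by blast
    have "A \<subseteq> T (Suc n)" "B \<subseteq> T (Suc n)" using n coherent[of n "Suc n"] by auto
    moreover have "finite Z" using Z(1) Mn matroid.finite_ground finite_subset by metis
    ultimately show ?thesis using Z R[of _ "Suc n"] by (intro exI[of _ Z]) (auto simp: E_def)
  qed
  moreover have "R X \<le> r S" if X: "finite X" "X \<subseteq> E" for X
  proof -
    obtain n where n: "X \<subseteq> T n" using level X by blast
    then have "\<rho> n X \<le> \<rho> n (T n)" using matroid.rank_mono[OF Mn] by blast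
    then show ?thesis using R[OF n] Sn[of n] by (simp add: extends_def)
  qed
  ultimately have "modular_rank_system E R (r S)"
    by (simp add: modular_rank_system_def finite_rank_system_def modular_rank_system_axioms_def)
  moreover have "countable E" unfolding E_def using Mn matroid.finite_ground by (intro countable_UN) (auto intro: countable_finite)
  moreover have "S \<subseteq> E" using Sn[of 0] by (auto simp: E_def extends_def)
  moreover have "R X = r X" if "X \<subseteq> S" for X using R[of X 0] Sn[of 0] that by (auto simp: extends_def)
  ultimately show thesis using that by blast
qed

section \<open>The projective spaces of a modular matroid\<close>

context finite_rank_system
begin

lemma fin_rank:
  assumes "finite Y" "Y \<subseteq> E" "X \<subseteq> Y"
  shows fin_rank_mono: "R X \<le> R Y" and fin_rank_le_card: "R X \<le> card X"
  using matroid.rank_mono[OF finite_matroid[OF assms(1,2)], of X Y] matroid.rank_le_card[OF finite_matroid[OF assms(1,2)], of X]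
    assms by auto

lemma fin_rank_submodular:
  "\<lbrakk>finite X; finite Y; X \<subseteq> E; Y \<subseteq> E\<rbrakk> \<Longrightarrow> R (X \<union> Y) + R (X \<inter> Y) \<le> R X + R Y"
  using matroid.rank_submodular[OF finite_matroid, of "X \<union> Y" X Y] by auto

definition clo :: "'a set \<Rightarrow> 'a set" where
  "clo X = {z \<in> E. R (insert z X) = R X}"

lemma clo_subset: "X \<subseteq> E \<Longrightarrow> X \<subseteq> clo X"
  by (auto simp: clo_def insert_absorb)

lemma clo_E: "clo X \<subseteq> E"
  by (auto simp: clo_def)

lemma clo_mono: "\<lbrakk>finite Y; Y \<subseteq> E; X \<subseteq> Y\<rbrakk> \<Longrightarrow> clo X \<subseteq> clo Y"
proof
  fix z assume Y: "finite Y" "Y \<subseteq> E" "X \<subseteq> Y" and z: "z \<in> clo X"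
  then have "matroid (insert z Y) R" using finite_matroid by (simp add: clo_def)
  then show "z \<in> clo Y" using matroid.rank_insert_closure[of "insert z Y" R X Y z] Y z by (auto simp: clo_def)
qed

lemma rank_clo_Un: "\<lbrakk>finite X; X \<subseteq> E; finite Y; Y \<subseteq> clo X\<rbrakk> \<Longrightarrow> R (X \<union> Y) = R X"
  using matroid.rank_Un_closure[OF finite_matroid, of "X \<union> Y" X Y] by (auto simp: clo_def)

lemma clo_idem:
  assumes X: "finite X" "X \<subseteq> E" and Y: "finite Y" "Y \<subseteq> clo X"
  shows "clo Y \<subseteq> clo X"
proof
  fix z assume z: "z \<in> clo Y"
  have YE: "Y \<subseteq> E" using Y clo_E by blast
  have "z \<in> clo (X \<union> Y)" using clo_mono[of "X \<union> Y" Y] X Y YE z by auto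
  then have "z \<in> E" "R (insert z (X \<union> Y)) = R X" using rank_clo_Un[OF X Y] by (auto simp: clo_def)
  moreover have "R (insert z X) \<le> R (insert z (X \<union> Y))" "R X \<le> R (insert z X)"
    using fin_rank_mono[of "insert z (X \<union> Y)" "insert z X"] fin_rank_mono[of "insert z X" X] X Y YE \<open>z \<in> E\<close> by auto
  ultimately show "z \<in> clo X" by (simp add: clo_def)
qed

lemma rank_subset_clo: "\<lbrakk>finite X; X \<subseteq> E; finite Y; Y \<subseteq> clo X\<rbrakk> \<Longrightarrow> R Y \<le> R X"
  using rank_clo_Un[of X Y] fin_rank_mono[of "X \<union> Y" Y] clo_E[of X] by auto

lemma independent_iff:
  assumes X: "finite X" "X \<subseteq> E"
  shows "R X = card X \<longleftrightarrow> (\<forall>x\<in>X. x \<notin> clo (X - {x}))"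
proof
  interpret M: matroid X R using finite_matroid X .
  assume RX: "R X = card X"
  show "\<forall>x\<in>X. x \<notin> clo (X - {x})"
  proof (intro ballI notI)
    fix x assume x: "x \<in> X" "x \<in> clo (X - {x})"
    then have "R X = R (X - {x})" by (simp add: clo_def insert_absorb)
    also have "\<dots> \<le> card (X - {x})" using M.rank_le_card by blast
    also have "\<dots> < card X" by (rule psubset_card_mono) (use x X in auto)
    finally show False using RX by simp
  qed
next
  interpret M: matroid X R using finite_matroid X .
  assume n: "\<forall>x\<in>X. x \<notin> clo (X - {x})"
  show "R X = card X"
  proof (rule ccontr)
    assume "R X \<noteq> card X"
    then have "\<not> indep X R X" by (simp add: indep_def)
    then obtain C where C: "circuit X R C" "C \<subseteq> X" using M.circuit_subset by blast
    then obtain x where x: "x \<in> C" using M.circuit_nonempty by blast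
    have "R (insert x (C - {x})) = R (C - {x})" using M.circuit_closure[OF C(1) x] x by (simp add: insert_absorb)
    then have "x \<in> clo (C - {x})" using x C X by (auto simp: clo_def)
    then have "x \<in> clo (X - {x})" using clo_mono[of "X - {x}" "C - {x}"] C X by auto
    then show False using n x C by blast
  qed
qed

end

locale simple_modular_system = modular_rank_system +
  assumes simple: "\<lbrakk>x \<in> E; y \<in> E; x \<noteq> y\<rbrakk> \<Longrightarrow> R {x, y} = 2" and no_loops: "x \<in> E \<Longrightarrow> R {x} = 1"
begin

lemma rank_empty_set [simp]: "R {} = 0"
  using fin_rank_le_card[of "{}" "{}"] by simp

text \<open>The witness set has positive rank, so it has an element, and this lies in both closures.
  Geometrically: flats that are not skew have a common point.\<close>

lemma meet:
  assumes "finite A" "finite B" "A \<subseteq> E" "B \<subseteq> E" "R (A \<union> B) < R A + R B"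
  obtains z where "z \<in> clo A" "z \<in> clo B"
proof -
  obtain Z where Z: "Z \<subseteq> E" "finite Z" "R (A \<union> Z) = R A" "R (B \<union> Z) = R B" "R Z + R (A \<union> B) = R A + R B"
    using modular[OF assms(1-4)] by blast
  then have "R Z \<noteq> 0" using assms by linarith
  then obtain z where z: "z \<in> Z" using rank_empty_set by fastforce
  have zC: "z \<in> clo C" if C: "finite C" "C \<subseteq> E" "R (C \<union> Z) = R C" for C
  proof -
    have "matroid (C \<union> Z) R" using finite_matroid C Z by blast
    then show ?thesis using matroid.rank_insert_eq_Un[of "C \<union> Z" R C Z z] C Z z by (auto simp: clo_def)
  qed
  show thesis using that zC assms(1-4) Z(3,4) by metis
qed

definition line :: "'a \<Rightarrow> 'a \<Rightarrow> 'a set" where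
  "line x y = clo {x, y}"

lemma line_E: "line x y \<subseteq> E"
  by (simp add: line_def clo_E)

lemma line_mem: "\<lbrakk>x \<in> E; y \<in> E\<rbrakk> \<Longrightarrow> x \<in> line x y \<and> y \<in> line x y"
  using clo_subset[of "{x, y}"] by (auto simp: line_def)

lemma line_commute: "line x y = line y x"
  by (simp add: line_def insert_commute)

lemma line_eq:
  assumes xy: "x \<in> E" "y \<in> E" "x \<noteq> y" and pq: "p \<in> line x y" "q \<in> line x y" "p \<noteq> q"
  shows "line p q = line x y"
proof -
  have pqE: "p \<in> E" "q \<in> E" using pq line_E by blast+
  have sub: "line p q \<subseteq> line x y" using clo_idem[of "{x, y}" "{p, q}"] xy pq by (auto simp: line_def)
  have "R ({x, y} \<union> {p, q}) = 2" using rank_clo_Un[of "{x, y}" "{p, q}"] xy pq simple by (auto simp: line_def)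
  then have all: "R {x, y, p, q} = 2" by (simp add: insert_commute)
  have "z \<in> line p q" if z: "z \<in> {x, y}" for z
  proof -
    have "R {z, p, q} \<le> 2" using fin_rank_mono[of "{x, y, p, q}" "{z, p, q}"] all xy pqE z by auto
    moreover have "2 \<le> R {z, p, q}" using fin_rank_mono[of "{z, p, q}" "{p, q}"] simple[OF pqE pq(3)] xy pqE z by auto
    ultimately have "R {z, p, q} = R {p, q}" using simple[OF pqE pq(3)] by simp
    then show ?thesis using z xy by (auto simp: line_def clo_def)
  qed
  then have "line x y \<subseteq> line p q" using clo_idem[of "{p, q}" "{x, y}"] pqE by (auto simp: line_def)
  then show ?thesis using sub by blast
qed

definition linked :: "'a \<Rightarrow> 'a \<Rightarrow> bool" where
  "linked x y \<longleftrightarrow> x \<in> E \<and> y \<in> E \<and> (x = y \<or> (\<exists>z\<in>line x y. z \<noteq> x \<and> z \<noteq> y))"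

lemma linked_refl: "x \<in> E \<Longrightarrow> linked x x"
  by (simp add: linked_def)

lemma linked_sym: "linked x y \<Longrightarrow> linked y x"
  unfolding linked_def using line_commute by metis

lemma linked_line:
  assumes xy: "linked x y" "x \<noteq> y" and z: "z \<in> line x y"
  shows "linked x z"
proof (cases "z = x \<or> z = y")
  case True then show ?thesis using assms linked_refl unfolding linked_def by auto
next
  case False
  have E: "x \<in> E" "y \<in> E" "z \<in> E" using xy z line_E by (auto simp: linked_def)
  then have "line x z = line x y" using line_eq[of x y x z] line_mem xy z False by metis
  then show ?thesis using False E line_mem[of x y] xy unfolding linked_def by metis
qed

lemma rank_line: "\<lbrakk>x \<in> E; y \<in> E; x \<noteq> y; finite Y; Y \<subseteq> line x y\<rbrakk> \<Longrightarrow> R ({x, y} \<union> Y) = 2"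
  using rank_clo_Un[of "{x, y}" Y] simple by (auto simp: line_def)

text \<open>Take third points \<open>p\<close> on \<open>x y\<close> and \<open>q\<close> on
  \<open>y z\<close>. The lines \<open>p q\<close> and \<open>x z\<close> lie in one plane and meet,
  and the meeting point differs from \<open>x\<close> and \<open>z\<close> since otherwise the lines
  \<open>x y\<close> and \<open>y z\<close> would coincide.\<close>

lemma linked_trans:
  assumes xy: "linked x y" and yz: "linked y z"
  shows "linked x z"
proof (cases "x = y \<or> y = z \<or> x = z")
  case True then show ?thesis using xy yz linked_refl unfolding linked_def by metis
next
  case False
  then have ne: "x \<noteq> y" "y \<noteq> z" "x \<noteq> z" by auto
  have E: "x \<in> E" "y \<in> E" "z \<in> E" using xy yz by (auto simp: linked_def)
  show ?thesis
  proof (cases "z \<in> line x y")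
    case True then show ?thesis using linked_line xy ne by blast
  next
    case nz: False
    obtain p where p: "p \<in> line x y" "p \<noteq> x" "p \<noteq> y" using xy ne by (auto simp: linked_def)
    obtain q where q: "q \<in> line y z" "q \<noteq> y" "q \<noteq> z" using yz ne by (auto simp: linked_def)
    have pE: "p \<in> E" "q \<in> E" using p q line_E by blast+
    have yp: "line y p = line x y" using line_eq[of x y y p] E ne p line_mem by metis
    have yq: "line y q = line y z" using line_eq[of y z y q] E ne q line_mem by metis
    have qxy: "q \<notin> line x y"
    proof
      assume "q \<in> line x y"
      then have "line y q = line x y" using line_eq[of x y y q] E ne q line_mem by metis
      then show False using nz yq line_mem E by metis
    qed
    have xyz: "x \<notin> line y z"
    proof
      assume "x \<in> line y z"
      then have "line y x = line y z" using line_eq[of y z y x] E ne line_mem by metis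
      then show False using nz line_mem E line_commute by metis
    qed
    have pyz: "p \<notin> line y z"
    proof
      assume "p \<in> line y z"
      then have "line y p = line y z" using line_eq[of y z y p] E ne p line_mem by metis
      then show False using nz yp line_mem E by metis
    qed
    have pq: "p \<noteq> q" using p qxy by blast
    have sub: "{p, q} \<union> {x, z} \<subseteq> clo {x, y, z}"
    proof -
      have "line x y \<subseteq> clo {x, y, z}" "line y z \<subseteq> clo {x, y, z}"
        unfolding line_def using clo_mono[of "{x, y, z}"] E by auto
      then show ?thesis using p q clo_subset[of "{x, y, z}"] E by auto
    qed
    have "R {x, y, z} \<le> card {x, y, z}" using fin_rank_le_card[of "{x, y, z}" "{x, y, z}"] E by simp
    also have "\<dots> \<le> 3" by (simp add: card_insert_if)
    finally have "R ({p, q} \<union> {x, z}) \<le> 3"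
      using rank_subset_clo[of "{x, y, z}" "{p, q} \<union> {x, z}"] E sub by auto
    then have "R ({p, q} \<union> {x, z}) < R {p, q} + R {x, z}" using simple E pE pq ne by simp
    then obtain s where s: "s \<in> line p q" "s \<in> line x z"
      using meet[of "{p, q}" "{x, z}"] E pE unfolding line_def by auto
    have "s \<noteq> x"
    proof
      assume "s = x"
      then have "line x p = line p q" using line_eq[of p q x p] s pE pq p line_mem by metis
      moreover have "line x p = line x y" using line_eq[of x y x p] E ne p line_mem by metis
      ultimately show False using qxy line_mem pE by metis
    qed
    moreover have "s \<noteq> z"
    proof
      assume "s = z"
      then have "line z q = line p q" using line_eq[of p q z q] s pE pq q line_mem by metis
      moreover have "line z q = line y z" using line_eq[of y z z q] E ne q line_mem by metis
      ultimately show False using pyz line_mem pE by metis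
    qed
    ultimately show ?thesis using s E by (auto simp: linked_def)
  qed
qed

definition blocks :: "'a set set" where
  "blocks = E // {(x, y). linked x y}"

lemma equiv_linked: "equiv E {(x, y). linked x y}"
proof (rule equivI)
  show "{(x, y). linked x y} \<subseteq> E \<times> E" by (auto simp: linked_def)
  show "refl_on E {(x, y). linked x y}" using linked_refl by (auto simp: refl_on_def)
  show "sym {(x, y). linked x y}" using linked_sym by (auto simp: sym_def)
  show "trans {(x, y). linked x y}" using linked_trans by (auto simp: trans_def)
qed

lemma block_E: "C \<in> blocks \<Longrightarrow> C \<subseteq> E"
  unfolding blocks_def using in_quotient_imp_subset[OF equiv_linked] .

lemma block_linked: "\<lbrakk>C \<in> blocks; x \<in> C; y \<in> C\<rbrakk> \<Longrightarrow> linked x y"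
  unfolding blocks_def using quotient_eq_iff[OF equiv_linked, of C C x y] by auto

lemma block_closed: "\<lbrakk>C \<in> blocks; x \<in> C; linked x y\<rbrakk> \<Longrightarrow> y \<in> C"
  unfolding blocks_def using in_quotient_imp_closed[OF equiv_linked, of C x y] by auto

lemma block_disjoint: "\<lbrakk>C \<in> blocks; D \<in> blocks; x \<in> C; x \<in> D\<rbrakk> \<Longrightarrow> C = D"
  unfolding blocks_def using quotient_disj[OF equiv_linked] by blast

lemma Union_blocks: "\<Union> blocks = E"
  unfolding blocks_def using Union_quotient[OF equiv_linked] .

lemma block_line: "\<lbrakk>C \<in> blocks; x \<in> C; y \<in> C; x \<noteq> y\<rbrakk> \<Longrightarrow> line x y \<subseteq> C"
  using block_closed block_linked linked_line by blast

text \<open>A circuit has rank one less than its size, so the pair \<open>x\<close>,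
  \<open>y\<close> and the remaining elements, both independent, have a common point in their
  closures. It is neither \<open>x\<close> nor \<open>y\<close>, as adding one of them to the
  remaining elements gives a proper subset of the circuit.\<close>

lemma circuit_linked:
  assumes X: "finite X" "X \<subseteq> E" and C: "circuit X R C" and xy: "x \<in> C" "y \<in> C"
  shows "linked x y"
proof (cases "x = y")
  case True then show ?thesis using C xy X linked_refl unfolding circuit_def by blast
next
  case False
  interpret M: matroid X R using finite_matroid X .
  have CX: "C \<subseteq> X" "C \<subseteq> E" "finite C" using C X finite_subset unfolding circuit_def by blast+
  have E: "x \<in> E" "y \<in> E" using xy CX by auto
  let ?B = "C - {x, y}"
  have ind: "R D = card D" if "D \<subset> C" for D using C that by (auto simp: circuit_def indep_def)
  have "R C = R (C - {x})" using M.circuit_closure[OF C xy(1)] .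
  also have "\<dots> = card C - 1" using ind[of "C - {x}"] xy CX by (auto simp: card_Diff_singleton)
  finally have RC: "R C = card C - 1" .
  have cB: "card ?B = card C - 2" using card_Diff_subset[of "{x, y}" C] xy False by auto
  have "card C \<ge> 2" using card_mono[OF CX(3), of "{x, y}"] xy False by auto
  then have "R ({x, y} \<union> ?B) < R {x, y} + R ?B"
    using RC cB ind[of ?B] simple[OF E False] xy by (simp add: insert_absorb) force
  then obtain z where z: "z \<in> clo {x, y}" "z \<in> clo ?B" using meet[of "{x, y}" ?B] E CX by auto
  have "w \<notin> clo ?B" if w: "w \<in> {x, y}" for w
  proof
    assume "w \<in> clo ?B"
    then have "R (insert w ?B) = R ?B" by (simp add: clo_def)
    moreover have "R ?B = card ?B" using ind[of ?B] xy by auto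
    moreover have "insert w ?B \<subset> C" using w xy False by auto
    then have "R (insert w ?B) = card (insert w ?B)" using ind by blast
    moreover have "card (insert w ?B) = Suc (card ?B)" using w CX by (auto simp: card_insert_if)
    ultimately show False by simp
  qed
  then have "z \<noteq> x" "z \<noteq> y" using z by auto
  then show ?thesis using z E by (auto simp: linked_def line_def)
qed

lemma independent_blocks:
  assumes X: "finite X" "X \<subseteq> E"
  shows "R X = card X \<longleftrightarrow> (\<forall>C\<in>blocks. R (X \<inter> C) = card (X \<inter> C))"
proof
  interpret M: matroid X R using finite_matroid X .
  show "\<forall>C\<in>blocks. R (X \<inter> C) = card (X \<inter> C)" if "R X = card X"
    using M.indep_subset[of X "X \<inter> _"] that by (auto simp: indep_def)
next
  interpret M: matroid X R using finite_matroid X .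
  assume b: "\<forall>C\<in>blocks. R (X \<inter> C) = card (X \<inter> C)"
  show "R X = card X"
  proof (rule ccontr)
    assume "R X \<noteq> card X"
    then have "\<not> indep X R X" by (simp add: indep_def)
    then obtain D where D: "circuit X R D" "D \<subseteq> X" using M.circuit_subset by blast
    then obtain x where x: "x \<in> D" using M.circuit_nonempty by blast
    then obtain C where C: "C \<in> blocks" "x \<in> C" using Union_blocks D X by blast
    have "D \<subseteq> X \<inter> C" using D circuit_linked[OF X D(1) x] block_closed[OF C] by blast
    moreover have "indep X R (X \<inter> C)" using b C by (simp add: indep_def)
    ultimately have "indep X R D" using M.indep_subset by blast
    then show False using D by (simp add: circuit_def)
  qed
qed

text \<open>One point from each of \<open>n + 1\<close> blocks would form an independent set of rank
  above \<open>n\<close>.\<close>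

lemma finite_blocks: "finite blocks"
proof (rule ccontr)
  assume "infinite blocks"
  then obtain F where F: "F \<subseteq> blocks" "finite F" "card F = Suc n" using infinite_arbitrarily_large by blast
  have ne: "C \<noteq> {}" if "C \<in> blocks" for C
    using that in_quotient_imp_non_empty[OF equiv_linked] unfolding blocks_def by blast
  define g where "g C = (SOME x. x \<in> C)" for C :: "'a set"
  have g: "g C \<in> C" if "C \<in> blocks" for C unfolding g_def using ne[OF that] by (simp add: some_in_eq)
  have inj: "inj_on g F" unfolding inj_on_def using F g block_disjoint by (metis subsetD)
  have X: "finite (g ` F)" "g ` F \<subseteq> E" using F g block_E by blast+
  have "R (g ` F \<inter> C) = card (g ` F \<inter> C)" if C: "C \<in> blocks" for C
  proof (cases "g ` F \<inter> C = {}")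
    case True then show ?thesis by simp
  next
    case False
    then obtain x where x: "x \<in> g ` F \<inter> C" by blast
    have "g D = x" if "D \<in> F" "g D \<in> C" for D
    proof -
      obtain D' where "D' \<in> F" "x = g D'" using x by blast
      moreover have "D = C" "D' = C" using block_disjoint F g C that x calculation by (metis IntD2 subsetD)+
      ultimately show ?thesis by simp
    qed
    then have "g ` F \<inter> C = {x}" using x by auto
    moreover have "x \<in> E" using x X by blast
    ultimately show ?thesis using no_loops by simp
  qed
  then have "R (g ` F) = card (g ` F)" using independent_blocks X by blast
  then show False using bounded[OF X] F inj by (simp add: card_image)
qed

definition block_lines :: "'a set \<Rightarrow> 'a set set" where
  "block_lines C = {line x y | x y. x \<in> C \<and> y \<in> C \<and> x \<noteq> y}"

lemma block_line_unique:
  assumes C: "C \<in> blocks" and l: "l \<in> block_lines C" "p \<in> l" "q \<in> l" "p \<noteq> q"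
  shows "l = line p q"
proof -
  obtain x y where "x \<in> C" "y \<in> C" "x \<noteq> y" "l = line x y" using l by (auto simp: block_lines_def)
  then show ?thesis using line_eq[of x y p q] l block_E[OF C] by auto
qed

lemma line_through_block:
  assumes C: "C \<in> blocks" and pq: "p \<in> C" "q \<in> C" "p \<noteq> q"
  shows "line_through (block_lines C) p q = line p q"
  unfolding line_through_def
proof (rule the_equality)
  show "line p q \<in> block_lines C \<and> p \<in> line p q \<and> q \<in> line p q"
    using pq line_mem block_E[OF C] by (auto simp: block_lines_def)
  show "l = line p q" if "l \<in> block_lines C \<and> p \<in> l \<and> q \<in> l" for l
    using block_line_unique[OF C] that pq by blast
qed

lemma projective_space_block:
  assumes C: "C \<in> blocks"
  shows "projective_space C (block_lines C)"
proof
  fix l assume "l \<in> block_lines C"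
  then obtain x y where xy: "x \<in> C" "y \<in> C" "x \<noteq> y" "l = line x y" by (auto simp: block_lines_def)
  then show "l \<subseteq> C" using block_line C by blast
  obtain z where "z \<in> line x y" "z \<noteq> x" "z \<noteq> y" using block_linked[OF C xy(1,2)] xy by (auto simp: linked_def)
  then show "\<exists>x y z. {x, y, z} \<subseteq> l \<and> distinct [x, y, z]"
    using xy line_mem[of x y] block_E[OF C] by (intro exI[of _ x] exI[of _ y] exI[of _ z]) auto
next
  fix l m p q assume "l \<in> block_lines C" "m \<in> block_lines C" "l \<noteq> m" "p \<in> l \<inter> m" "q \<in> l \<inter> m"
  then show "p = q" using block_line_unique[OF C, of l p q] block_line_unique[OF C, of m p q] by blast
next
  fix p q assume pq: "p \<in> C" "q \<in> C" "p \<noteq> q"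
  then show "\<exists>!l. l \<in> block_lines C \<and> p \<in> l \<and> q \<in> l"
    using line_mem[of p q] block_E[OF C] block_line_unique[OF C _ _ _ pq(3)]
    by (intro ex1I[of _ "line p q"]) (auto simp: block_lines_def)
next
  fix a b c d assume C4: "{a, b, c, d} \<subseteq> C" and dist: "distinct [a, b, c, d]"
    and "line_through (block_lines C) a b \<inter> line_through (block_lines C) c d \<noteq> {}"
  then obtain e where e: "e \<in> line a b" "e \<in> line c d" using line_through_block[OF C] by auto
  have E: "a \<in> E" "b \<in> E" "c \<in> E" "d \<in> E" "e \<in> E" using C4 block_E[OF C] e line_E by blast+
  \<comment> \<open>Two lines through \<open>e\<close> have a union of rank at most
    \<open>2 + 2 - 1\<close>, so the lines \<open>a c\<close> and \<open>b d\<close> are not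
    skew.\<close>
  have "R {a, b, e} = 2" "R {c, d, e} = 2" using rank_line[of a b "{e}"] rank_line[of c d "{e}"] E e dist
    by (simp_all add: insert_commute)
  moreover have "R ({a, b, e} \<union> {c, d, e}) + R ({a, b, e} \<inter> {c, d, e}) \<le> R {a, b, e} + R {c, d, e}"
    using E by (intro fin_rank_submodular) auto
  moreover have "R {e} \<le> R ({a, b, e} \<inter> {c, d, e})" using E by (intro fin_rank_mono) auto
  moreover have "R ({a, c} \<union> {b, d}) \<le> R ({a, b, e} \<union> {c, d, e})" using E by (intro fin_rank_mono) auto
  ultimately have "R ({a, c} \<union> {b, d}) \<le> 3" using no_loops E by simp
  then have "R ({a, c} \<union> {b, d}) < R {a, c} + R {b, d}" using simple E dist by simp
  then obtain z where "z \<in> line a c" "z \<in> line b d" using meet[of "{a, c}" "{b, d}"] E unfolding line_def by auto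
  then show "line_through (block_lines C) a c \<inter> line_through (block_lines C) b d \<noteq> {}"
    using line_through_block[OF C] C4 dist by auto
qed

text \<open>The inclusion of the closure in the span goes by induction on the generating set: if
  \<open>q\<close> is in the closure of \<open>insert x Y'\<close>, the line \<open>q x\<close>
  meets the closure of \<open>Y'\<close> in some \<open>s\<close>, which is in the subspace by
  induction, and \<open>q\<close> is on the line \<open>s x\<close>.\<close>

lemma proj_span_block:
  assumes C: "C \<in> blocks" and Y: "finite Y" "Y \<subseteq> C"
  shows "proj_span C (block_lines C) Y = clo Y \<inter> C"
proof
  have CE: "C \<subseteq> E" using block_E C .
  have "proj_subspace C (block_lines C) (clo Y \<inter> C)"
    unfolding proj_subspace_def
  proof (intro conjI ballI impI)
    fix p q assume pq: "p \<in> clo Y \<inter> C" "q \<in> clo Y \<inter> C" "p \<noteq> q"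
    then have "line p q \<subseteq> clo Y" unfolding line_def using clo_idem[of Y "{p, q}"] Y CE by auto
    moreover have "line p q \<subseteq> C" using block_line C pq by blast
    ultimately show "line_through (block_lines C) p q \<subseteq> clo Y \<inter> C" using line_through_block[OF C] pq by auto
  qed auto
  moreover have "Y \<subseteq> clo Y \<inter> C" using clo_subset Y CE by blast
  ultimately show "proj_span C (block_lines C) Y \<subseteq> clo Y \<inter> C" unfolding proj_span_def by blast
  show "clo Y \<inter> C \<subseteq> proj_span C (block_lines C) Y"
  proof
    fix p assume p: "p \<in> clo Y \<inter> C"
    show "p \<in> proj_span C (block_lines C) Y"
      unfolding proj_span_def
    proof (intro InterI, clarify)
      fix W assume W: "proj_subspace C (block_lines C) W" "Y \<subseteq> W"
      have "q \<in> W" if "q \<in> clo Y'" "q \<in> C" "Y' \<subseteq> Y" for q Y'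
        using finite_subset[OF that(3) Y(1)] that
      proof (induction Y' arbitrary: q)
        case empty
        then show ?case using no_loops CE by (auto simp: clo_def)
      next
        case (insert x Y')
        have Y': "finite Y'" "Y' \<subseteq> E" "x \<in> C" "x \<in> E" "x \<in> W" "q \<in> E" using insert Y CE W by auto
        show ?case
        proof (cases "q \<in> clo Y' \<or> q = x")
          case True then show ?thesis using insert Y' by auto
        next
          case False
          have M: "matroid (insert q (insert x Y')) R" using Y' finite_matroid by simp
          have 1: "R ({q, x} \<union> Y') = R (insert x Y')" using insert.prems by (simp add: clo_def)
          also have "\<dots> \<le> Suc (R Y')" using matroid.rank_insert_le[OF M, of Y' x] by auto
          finally have "R ({q, x} \<union> Y') < R {q, x} + R Y'" using simple[of q x] Y' False by simp
          then obtain s where s: "s \<in> line q x" "s \<in> clo Y'" using meet[of "{q, x}" Y'] Y' unfolding line_def by auto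
          have "s \<noteq> x"
          proof
            assume "s = x"
            then have "insert x Y' \<subseteq> clo Y'" using s clo_subset Y' by blast
            then have "q \<in> clo Y'" using clo_idem[of Y' "insert x Y'"] Y' insert.prems by auto
            then show False using False by blast
          qed
          have sC: "s \<in> C" using block_line[OF C insert.prems(2) Y'(3)] s False by blast
          then have sW: "s \<in> W" using insert s by auto
          have sE: "s \<in> E" using sC CE by blast
          have "line s x = line q x" using line_eq[of q x s x] s Y' False \<open>s \<noteq> x\<close> line_mem by metis
          then have "q \<in> line_through (block_lines C) s x"
            using line_through_block[OF C sC Y'(3) \<open>s \<noteq> x\<close>] line_mem[of q x] Y' by simp
          then show ?thesis using W(1) sW Y'(5) \<open>s \<noteq> x\<close> unfolding proj_subspace_def by blast
        qed
      qed
      then show "p \<in> W" using p by blast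
    qed
  qed
qed

lemma block_independent:
  assumes C: "C \<in> blocks" and Y: "finite Y" "Y \<subseteq> C"
  shows "Y \<in> snd (proj_matroid C (block_lines C)) \<longleftrightarrow> R Y = card Y"
proof -
  have "p \<notin> proj_span C (block_lines C) (Y - {p}) \<longleftrightarrow> p \<notin> clo (Y - {p})" if "p \<in> Y" for p
    using proj_span_block[OF C, of "Y - {p}"] Y that by auto
  then show ?thesis using independent_iff[of Y] Y block_E[OF C] by (auto simp: proj_matroid_def)
qed

end

section \<open>Simplification of the countable modular matroid\<close>

context modular_rank_system
begin

definition points :: "'a set" where
  "points = {x \<in> E. R {x} = 1}"

lemma nonloops_eq: "\<lbrakk>finite X; X \<subseteq> E\<rbrakk> \<Longrightarrow> nonloops X R = X \<inter> points"
  using matroid.nonloops_rank[OF finite_matroid] by (auto simp: points_def)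

lemma parallel_points_trans:
  assumes "x \<in> points" "y \<in> points" "z \<in> points" "R {x, y} = 1" "R {y, z} = 1"
  shows "R {x, z} = 1"
proof -
  have "matroid {x, y, z} R" using finite_matroid assms by (simp add: points_def)
  from matroid.parallel_trans[OF this, of x y z] show ?thesis using assms by (simp add: points_def)
qed

text \<open>The limit may have loops and parallel elements, whereas a projective space has neither.
  Parallel classes become points, named in the type \<open>'p\<close> through an enumeration of
  representatives.\<close>

lemma simplification:
  assumes "countable E"
  obtains \<phi> :: "'a \<Rightarrow> 'p::infinite" and R' where "simple_modular_system (\<phi> ` points) R' n"
    "\<And>X. \<lbrakk>finite X; X \<subseteq> points\<rbrakk> \<Longrightarrow> R' (\<phi> ` X) = R X"
    "\<And>x y. \<lbrakk>x \<in> points; y \<in> points\<rbrakk> \<Longrightarrow> \<phi> x = \<phi> y \<longleftrightarrow> R {x, y} = 1"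
proof -
  have "countable points" using assms by (rule countable_subset[rotated]) (auto simp: points_def)
  obtain f :: "nat \<Rightarrow> 'p" where f: "inj f" using infinite_countable_subset[OF infinite_UNIV] by blast
  define rep where "rep x = (SOME y. y \<in> points \<and> R {x, y} = 1)" for x
  have rep: "rep x \<in> points \<and> R {x, rep x} = 1" if "x \<in> points" for x
    unfolding rep_def by (rule someI[of _ x]) (use that in \<open>simp add: points_def\<close>)
  define \<phi> where "\<phi> x = f (to_nat_on points (rep x))" for x
  have \<phi>: "\<phi> x = \<phi> y \<longleftrightarrow> R {x, y} = 1" if xy: "x \<in> points" "y \<in> points" for x y
  proof
    assume Rxy: "R {x, y} = 1"
    have "R {x, z} = 1 \<longleftrightarrow> R {y, z} = 1" if "z \<in> points" for z
      using parallel_points_trans[of x y z] parallel_points_trans[of y x z] xy that Rxy by (auto simp: insert_commute)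
    \<comment> \<open>Parallel elements define the same predicate, so \<open>SOME\<close> selects
      the same representative for both.\<close>
    then have "(\<lambda>z. z \<in> points \<and> R {x, z} = 1) = (\<lambda>z. z \<in> points \<and> R {y, z} = 1)" by blast
    then show "\<phi> x = \<phi> y" by (simp add: \<phi>_def rep_def)
  next
    assume "\<phi> x = \<phi> y"
    then have "to_nat_on points (rep x) = to_nat_on points (rep y)" using f by (simp add: \<phi>_def inj_eq)
    then have "rep x = rep y" using to_nat_on_inj[OF \<open>countable points\<close>] rep xy by metis
    then show "R {x, y} = 1"
      using parallel_points_trans[of x "rep x" y] rep[OF xy(1)] rep[OF xy(2)] xy by (simp add: insert_commute)
  qed
  define \<psi> where "\<psi> = inv_into points \<phi>"
  let ?P = "\<phi> ` points"
  have \<psi>: "\<psi> p \<in> points" "\<phi> (\<psi> p) = p" if "p \<in> ?P" for p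
    using that unfolding \<psi>_def by (auto intro: inv_into_into f_inv_into_f)
  have \<psi>inj: "inj_on \<psi> ?P" unfolding inj_on_def using \<psi>(2) by metis
  define R' where "R' Y = R (\<psi> ` Y)" for Y
  have \<psi>E: "\<psi> ` Y \<subseteq> E" "\<psi> ` Y \<subseteq> points" if "Y \<subseteq> ?P" for Y using \<psi>(1) that by (auto simp: points_def)
  have R': "R' (\<phi> ` X) = R X" if X: "finite X" "X \<subseteq> points" for X
  proof -
    let ?X = "X \<union> \<psi> ` \<phi> ` X"
    have X': "finite ?X" "?X \<subseteq> E" "?X \<subseteq> points" using X \<psi>E[of "\<phi> ` X"] by (auto simp: points_def)
    interpret M: matroid ?X R using finite_matroid[OF X'(1,2)] .
    have "R ((\<psi> \<circ> \<phi>) ` X) = R X"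
    proof (rule M.rank_parallel_image)
      show "X \<subseteq> nonloops ?X R" using nonloops_eq[OF X'(1,2)] X by blast
      fix x assume x: "x \<in> X"
      then have "\<psi> (\<phi> x) \<in> points" "\<phi> x = \<phi> (\<psi> (\<phi> x))" using \<psi> X by auto
      then show "(\<psi> \<circ> \<phi>) x \<in> nonloops ?X R \<and> R {x, (\<psi> \<circ> \<phi>) x} = 1"
        using \<phi>[of x "\<psi> (\<phi> x)"] x X nonloops_eq[OF X'(1,2)] by auto
    qed
    then show ?thesis by (simp add: R'_def image_comp)
  qed
  have loops: "R (X \<inter> points) = R X" if X: "finite X" "X \<subseteq> E" for X
  proof -
    interpret M: matroid X R using finite_matroid[OF X] .
    have "R ((X \<inter> points) \<union> (X - points)) = R (X \<inter> points)"
    proof (rule M.rank_Un_closure)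
      fix y assume y: "y \<in> X - points"
      then have "R {y} = 0" using M.rank_le_card[of "{y}"] X by (auto simp: points_def)
      then show "R (insert y (X \<inter> points)) = R (X \<inter> points)"
        using M.rank_insert_closure[of "{}" "X \<inter> points" y] y by auto
    qed auto
    then show ?thesis by (simp add: Int_Diff_Un)
  qed
  have "simple_modular_system ?P R' n"
  proof (intro simple_modular_system.intro modular_rank_system.intro finite_rank_system.intro
      simple_modular_system_axioms.intro modular_rank_system_axioms.intro, goal_cases)
    case (1 X)
    then have "matroid (\<psi> ` X) R" using finite_matroid \<psi>E by blast
    moreover have "bij_betw \<phi> (\<psi> ` X) X" using \<psi>(2) 1 by (intro bij_betw_byWitness[of _ \<psi>]) auto
    moreover have "R' (\<phi> ` Y) = R Y" if "Y \<subseteq> \<psi> ` X" for Y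
      using R'[of Y] that 1 \<psi>E[of X] finite_subset[of Y "\<psi> ` X"] by auto
    ultimately show ?case using matroid_isomorphic by blast
  next
    case (2 A B)
    obtain Z where Z: "Z \<subseteq> E" "finite Z" "R (\<psi> ` A \<union> Z) = R (\<psi> ` A)" "R (\<psi> ` B \<union> Z) = R (\<psi> ` B)"
      "R Z + R (\<psi> ` A \<union> \<psi> ` B) = R (\<psi> ` A) + R (\<psi> ` B)"
      using modular[OF finite_imageI[OF 2(1)] finite_imageI[OF 2(2)] \<psi>E(1)[OF 2(3)] \<psi>E(1)[OF 2(4)]] by blast
    \<comment> \<open>Loops in \<open>Z\<close> have no image; omitting them does not change the
      rank of \<open>Z\<close>.\<close>
    let ?Z = "\<phi> ` (Z \<inter> points)"
    have un: "R' (D \<union> ?Z) = R' D" if D: "finite D" "D \<subseteq> ?P" "R (\<psi> ` D \<union> Z) = R (\<psi> ` D)" for D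
    proof -
      have D': "finite (\<psi> ` D \<union> (Z \<inter> points))" "\<psi> ` D \<union> (Z \<inter> points) \<subseteq> points" using D Z \<psi>E by auto
      have "\<phi> ` (\<psi> ` D) = D" using \<psi>(2) D by (force simp: image_iff)
      then have "D \<union> ?Z = \<phi> ` (\<psi> ` D \<union> (Z \<inter> points))" by (simp add: image_Un)
      then have "R' (D \<union> ?Z) = R (\<psi> ` D \<union> (Z \<inter> points))" using R'[OF D'] by simp
      moreover have "R (\<psi> ` D \<union> (Z \<inter> points)) \<le> R (\<psi> ` D \<union> Z)" "R (\<psi> ` D) \<le> R (\<psi> ` D \<union> (Z \<inter> points))"
        using fin_rank_mono[of "\<psi> ` D \<union> Z" "\<psi> ` D \<union> (Z \<inter> points)"] D Z \<psi>E(1)[OF D(2)]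
          fin_rank_mono[of "\<psi> ` D \<union> (Z \<inter> points)" "\<psi> ` D"] by auto
      ultimately show ?thesis using D by (simp add: R'_def)
    qed
    have "R' ?Z = R Z" using R'[of "Z \<inter> points"] loops[of Z] Z by auto
    then have "R' ?Z + R' (A \<union> B) = R' A + R' B" using Z by (simp add: R'_def image_Un)
    then show ?case using un[of A] un[of B] 2 Z by (intro exI[of _ ?Z]) auto
  next
    case (3 X)
    then show ?case using bounded[of "\<psi> ` X"] \<psi>E by (simp add: R'_def)
  next
    case (4 p q)
    have pts: "\<psi> p \<in> points" "\<psi> q \<in> points" using \<psi> 4 by auto
    have E: "\<psi> p \<in> E" "\<psi> q \<in> E" using pts by (auto simp: points_def)
    have "R {\<psi> p, \<psi> q} \<noteq> 1" using \<phi>[OF pts] \<psi>(2) 4 by auto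
    moreover have "R {\<psi> p} \<le> R {\<psi> p, \<psi> q}" using E by (intro fin_rank_mono) auto
    moreover have "R {\<psi> p, \<psi> q} \<le> card {\<psi> p, \<psi> q}"
      using E by (intro fin_rank_le_card[of "{\<psi> p, \<psi> q}"]) auto
    then have "R {\<psi> p, \<psi> q} \<le> 2" by (simp add: card_insert_if split: if_splits)
    ultimately show ?case using pts by (simp add: R'_def points_def)
  next
    case (5 p)
    then show ?case using \<psi>(1)[of p] by (simp add: R'_def points_def)
  qed
  then show thesis using that R' \<phi> by blast
qed

end

theorem fully_modular_extendable_imp_projectively_embeddable:
  fixes S :: "'a::infinite set"
  assumes M: "matroid S r" and full: "fully_modular_extendable S r"
  shows "projectively_embeddable TYPE('p::infinite) S r"
proof -
  interpret M: matroid S r by (rule M)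
  obtain E R where E: "countable E" "S \<subseteq> E" and R: "\<And>X. X \<subseteq> S \<Longrightarrow> R X = r X" and "modular_rank_system E R (r S)"
    using modular_limit[OF M full] by blast
  interpret modular_rank_system E R "r S" by fact
  obtain \<phi> :: "'a \<Rightarrow> 'p" and R' where sms: "simple_modular_system (\<phi> ` points) R' (r S)"
    and R': "\<And>X. \<lbrakk>finite X; X \<subseteq> points\<rbrakk> \<Longrightarrow> R' (\<phi> ` X) = R X"
    and \<phi>: "\<And>x y. \<lbrakk>x \<in> points; y \<in> points\<rbrakk> \<Longrightarrow> \<phi> x = \<phi> y \<longleftrightarrow> R {x, y} = 1"
    using simplification[OF E(1)] by blast
  interpret P: simple_modular_system "\<phi> ` points" R' "r S" by (rule sms)
  let ?q = "card P.blocks"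
  obtain e where e: "bij_betw e {1..?q} P.blocks" using P.finite_blocks ex_bij_betw_nat_finite_1 by blast
  let ?L = "\<lambda>i. P.block_lines (e i)"
  let ?D = "direct_sum {1..?q} (\<lambda>i. proj_matroid (e i) (?L i))"
  have eb: "e i \<in> P.blocks" if "i \<in> {1..?q}" for i using e that by (auto simp: bij_betw_def)
  define G where "G = si_ground S r"
  have GS: "G \<subseteq> S" "G \<subseteq> nonloops S r" using M.si_ground_nonloops M.nonloops_rank by (auto simp: G_def)
  have Gp: "G \<subseteq> points"
  proof
    fix x assume "x \<in> G"
    then have "x \<in> S" "r {x} = 1" using GS M.nonloops_rank by auto
    then show "x \<in> points" using R[of "{x}"] E by (auto simp: points_def)
  qed
  have finG: "finite G" using GS M.finite_subset_ground by blast
  have ex: "\<exists>i. i \<in> {1..?q} \<and> \<phi> x \<in> e i" if x: "x \<in> points" for x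
  proof -
    have "\<phi> x \<in> \<Union> P.blocks" using P.Union_blocks x by blast
    then obtain C where "C \<in> P.blocks" "\<phi> x \<in> C" by blast
    then show ?thesis using e by (metis bij_betw_def imageE)
  qed
  define idx where "idx x = (SOME i. i \<in> {1..?q} \<and> \<phi> x \<in> e i)" for x
  have idx: "idx x \<in> {1..?q}" "\<phi> x \<in> e (idx x)" if "x \<in> points" for x
    using someI_ex[OF ex[OF that]] by (auto simp: idx_def)
  have idx_eq: "\<phi> x \<in> e i \<longleftrightarrow> idx x = i" if "x \<in> points" "i \<in> {1..?q}" for x i
  proof
    assume "\<phi> x \<in> e i"
    then have "e (idx x) = e i" using P.block_disjoint eb idx that by blast
    then show "idx x = i" using e idx that by (metis bij_betw_def inj_onD)
  qed (use idx that in blast)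
  \<comment> \<open>An element goes to the index of its block together with its point. Independence
    in the direct sum is tested block by block, which \<open>independent_blocks\<close> identifies
    with independence in the limit.\<close>
  define f where "f x = (idx x, \<phi> x)" for x
  have \<phi>inj: "inj_on \<phi> G"
  proof (rule inj_onI)
    fix x y assume xy: "x \<in> G" "y \<in> G" "\<phi> x = \<phi> y"
    then have "R {x, y} = 1" using \<phi> Gp by blast
    moreover have "R {x, y} = r {x, y}" using R[of "{x, y}"] xy GS by blast
    ultimately show "x = y" using M.si_ground_parallel xy by (simp add: G_def)
  qed
  then have inj: "inj_on f G" by (auto simp: f_def inj_on_def)
  have fS: "f ` G \<subseteq> fst ?D" using idx Gp by (auto simp: f_def direct_sum_def proj_matroid_def)
  have ind: "indep G r X \<longleftrightarrow> f ` X \<in> snd ?D" if X: "X \<subseteq> G" for X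
  proof -
    have fin: "finite X" "X \<subseteq> points" using X finG finite_subset Gp by auto
    have slice: "{p. (i, p) \<in> f ` X} = \<phi> ` X \<inter> e i" if "i \<in> {1..?q}" for i
      using idx_eq[OF _ that] fin(2) by (force simp: f_def image_iff)
    have "f ` X \<subseteq> fst ?D" using fS X by blast
    then have "f ` X \<in> snd ?D \<longleftrightarrow> (\<forall>i\<in>{1..?q}. {p. (i, p) \<in> f ` X} \<in> snd (proj_matroid (e i) (?L i)))"
      by (auto simp: direct_sum_def)
    also have "\<dots> \<longleftrightarrow> (\<forall>i\<in>{1..?q}. R' (\<phi> ` X \<inter> e i) = card (\<phi> ` X \<inter> e i))"
      using slice P.block_independent[OF eb, of _ "\<phi> ` X \<inter> e _"] fin by simp
    also have "\<dots> \<longleftrightarrow> (\<forall>C\<in>e ` {1..?q}. R' (\<phi> ` X \<inter> C) = card (\<phi> ` X \<inter> C))" by simp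
    also have "\<dots> \<longleftrightarrow> (\<forall>C\<in>P.blocks. R' (\<phi> ` X \<inter> C) = card (\<phi> ` X \<inter> C))"
    proof -
      have "e ` {1..?q} = P.blocks" using e by (simp add: bij_betw_def)
      then show ?thesis by simp
    qed
    also have "\<dots> \<longleftrightarrow> R' (\<phi> ` X) = card (\<phi> ` X)" using P.independent_blocks[of "\<phi> ` X"] fin by blast
    also have "\<dots> \<longleftrightarrow> r X = card X"
      using R'[OF fin] R[of X] X GS card_image[OF inj_on_subset[OF \<phi>inj X]] by auto
    finally show ?thesis using X by (simp add: indep_def)
  qed
  have "isomorphic (of_rank G r) (restrict_to ?D (f ` G))"
    unfolding isomorphic_def
  proof (intro exI[of _ f] conjI allI impI)
    show "bij_betw f (fst (of_rank G r)) (fst (restrict_to ?D (f ` G)))"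
      using inj by (simp add: bij_betw_def of_rank_def restrict_to_def)
    fix X assume "X \<subseteq> fst (of_rank G r)"
    then have "X \<subseteq> G" by (simp add: of_rank_def)
    then show "X \<in> snd (of_rank G r) \<longleftrightarrow> f ` X \<in> snd (restrict_to ?D (f ` G))"
      using ind by (auto simp: of_rank_def restrict_to_def)
  qed
  moreover have "\<forall>i\<in>{1..?q}. projective_space (e i) (?L i)" using P.projective_space_block eb by blast
  ultimately show ?thesis
    unfolding projectively_embeddable_def G_def[symmetric] using fS finG
    by (intro exI[of _ ?q] exI[of _ e] exI[of _ ?L] exI[of _ "f ` G"]) auto
qed

section \<open>Components as representable matroids\<close>

context concrete_right_vector_space
begin

text \<open>A point that represents two elements makes the family dependent, whence the injectivity.
  This carries independence of points over to elements of the matroid.\<close>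

lemma lin_indep_image:
  assumes X: "finite X" and f: "f \<in> p ` X \<rightarrow> carrier V"
  shows "lin_indep_family R V act (\<lambda>x. f (p x)) X \<longleftrightarrow> inj_on p X \<and> lin_indep_family R V act f (p ` X)"
proof (cases "inj_on p X")
  case False
  then obtain x y where xy: "x \<in> X" "y \<in> X" "x \<noteq> y" "p x = p y" by (auto simp: inj_on_def)
  have fX: "(\<lambda>x. f (p x)) \<in> X \<rightarrow> carrier V" using f by auto
  have "f (p y) \<in> lspan (\<lambda>x. f (p x)) (X - {x})" using lspan_base[of "X - {x}" "\<lambda>x. f (p x)" y] X fX xy by auto
  then show ?thesis using lin_indep_iff_lspan[OF X fX] xy False by metis
next
  case True
  have reindex: "lc f c (p ` X) = lc (\<lambda>x. f (p x)) (\<lambda>x. c (p x)) X" if "c \<in> p ` X \<rightarrow> carrier R" for c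
    unfolding lc_def using f that True by (intro V.finsum_reindex) (auto simp: act_closed Pi_iff)
  show ?thesis
  proof
    assume L: "lin_indep_family R V act (\<lambda>x. f (p x)) X"
    have "lin_indep_family R V act f (p ` X)"
      unfolding lin_indep_iff
    proof (intro ballI impI)
      fix c y assume c: "c \<in> p ` X \<rightarrow> carrier R" "lc f c (p ` X) = \<zero>\<^bsub>V\<^esub>" and y: "y \<in> p ` X"
      then have "lc (\<lambda>x. f (p x)) (\<lambda>x. c (p x)) X = \<zero>\<^bsub>V\<^esub>" "(\<lambda>x. c (p x)) \<in> X \<rightarrow> carrier R" using reindex by auto
      then have "\<forall>x\<in>X. c (p x) = \<zero>\<^bsub>R\<^esub>" using L unfolding lin_indep_iff by blast
      then show "c y = \<zero>\<^bsub>R\<^esub>" using y by blast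
    qed
    then show "inj_on p X \<and> lin_indep_family R V act f (p ` X)" using True by blast
  next
    assume L: "inj_on p X \<and> lin_indep_family R V act f (p ` X)"
    show "lin_indep_family R V act (\<lambda>x. f (p x)) X"
      unfolding lin_indep_iff
    proof (intro ballI impI)
      fix c x assume c: "c \<in> X \<rightarrow> carrier R" "lc (\<lambda>x. f (p x)) c X = \<zero>\<^bsub>V\<^esub>" and x: "x \<in> X"
      let ?c = "\<lambda>y. c (inv_into X p y)"
      have cX: "?c \<in> p ` X \<rightarrow> carrier R" using c True by (auto simp: inv_into_f_f)
      have "lc (\<lambda>x. f (p x)) (\<lambda>x. ?c (p x)) X = lc (\<lambda>x. f (p x)) c X"
        using f c True by (intro lc_cong) (auto simp: inv_into_f_f)
      then have "lc f ?c (p ` X) = \<zero>\<^bsub>V\<^esub>" using reindex[OF cX] c by simp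
      then have "?c (p x) = \<zero>\<^bsub>R\<^esub>" using L cX x unfolding lin_indep_iff by blast
      then show "c x = \<zero>\<^bsub>R\<^esub>" using x True by (simp add: inv_into_f_f)
    qed
  qed
qed

section \<open>Moving a representation to arbitrary infinite types\<close>

definition subfield_step :: "'f set \<Rightarrow> 'f set" where
  "subfield_step X = X \<union> {\<zero>\<^bsub>R\<^esub>, \<one>\<^bsub>R\<^esub>} \<union> (\<lambda>(a, b). a \<oplus>\<^bsub>R\<^esub> b) ` (X \<times> X) \<union> (\<lambda>(a, b). a \<otimes>\<^bsub>R\<^esub> b) ` (X \<times> X) \<union>
     (\<lambda>a. \<ominus>\<^bsub>R\<^esub> a) ` X \<union> (\<lambda>a. inv\<^bsub>R\<^esub> a) ` (X - {\<zero>\<^bsub>R\<^esub>})"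

text \<open>Countably many rounds of the field operations, each of which keeps the set countable.
  Finitely many elements always occur together in some round, so the union is closed.\<close>

lemma countable_subfield:
  assumes G: "countable G" "G \<subseteq> carrier R"
  obtains K where "countable K" "G \<subseteq> K" "K \<subseteq> carrier R" "\<zero>\<^bsub>R\<^esub> \<in> K" "\<one>\<^bsub>R\<^esub> \<in> K"
    "\<And>a b. \<lbrakk>a \<in> K; b \<in> K\<rbrakk> \<Longrightarrow> a \<oplus>\<^bsub>R\<^esub> b \<in> K" "\<And>a b. \<lbrakk>a \<in> K; b \<in> K\<rbrakk> \<Longrightarrow> a \<otimes>\<^bsub>R\<^esub> b \<in> K"
    "\<And>a. a \<in> K \<Longrightarrow> \<ominus>\<^bsub>R\<^esub> a \<in> K" "\<And>a. \<lbrakk>a \<in> K; a \<noteq> \<zero>\<^bsub>R\<^esub>\<rbrakk> \<Longrightarrow> inv\<^bsub>R\<^esub> a \<in> K"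
proof -
  define F where "F n = (subfield_step ^^ n) G" for n
  have step: "F (Suc n) = subfield_step (F n)" for n by (simp add: F_def)
  have count: "countable (F n)" for n
    by (induction n) (use G in \<open>auto simp: F_def subfield_step_def\<close>)
  have car: "F n \<subseteq> carrier R" for n
  proof (induction n)
    case 0 then show ?case using G by (simp add: F_def)
  next
    case (Suc n)
    have "inv\<^bsub>R\<^esub> a \<in> carrier R" if "a \<in> F n - {\<zero>\<^bsub>R\<^esub>}" for a
      using that Suc R.skew_field_Units R.Units_inv_closed by blast
    then show ?case unfolding step subfield_step_def using Suc by auto
  qed
  have mono: "F m \<subseteq> F n" if "m \<le> n" for m n
    using that by (rule lift_Suc_mono_le[rotated]) (auto simp: step subfield_step_def)
  have two: "\<exists>n. a \<in> F n \<and> b \<in> F n" if "a \<in> (\<Union>n. F n)" "b \<in> (\<Union>n. F n)" for a b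
    using that mono[OF max.cobounded1] mono[OF max.cobounded2] by blast
  show thesis
  proof
    show "countable (\<Union>n. F n)" using count by auto
    have "F 0 = G" by (simp add: F_def)
    then show "G \<subseteq> (\<Union>n. F n)" by blast
    show "(\<Union>n. F n) \<subseteq> carrier R" using car by blast
    have "\<zero>\<^bsub>R\<^esub> \<in> F (Suc 0)" "\<one>\<^bsub>R\<^esub> \<in> F (Suc 0)" by (auto simp: step subfield_step_def)
    then show "\<zero>\<^bsub>R\<^esub> \<in> (\<Union>n. F n)" "\<one>\<^bsub>R\<^esub> \<in> (\<Union>n. F n)" by blast+
    fix a assume a: "a \<in> (\<Union>n. F n)"
    then obtain n where n: "a \<in> F n" by blast
    then have "\<ominus>\<^bsub>R\<^esub> a \<in> F (Suc n)" "a \<noteq> \<zero>\<^bsub>R\<^esub> \<Longrightarrow> inv\<^bsub>R\<^esub> a \<in> F (Suc n)" by (auto simp: step subfield_step_def)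
    then show "\<ominus>\<^bsub>R\<^esub> a \<in> (\<Union>n. F n)" "a \<noteq> \<zero>\<^bsub>R\<^esub> \<Longrightarrow> inv\<^bsub>R\<^esub> a \<in> (\<Union>n. F n)" by blast+
    fix b assume "b \<in> (\<Union>n. F n)"
    then obtain n where n: "a \<in> F n" "b \<in> F n" using two a by blast
    then have "a \<oplus>\<^bsub>R\<^esub> b \<in> F (Suc n)" "a \<otimes>\<^bsub>R\<^esub> b \<in> F (Suc n)" by (auto simp: step subfield_step_def)
    then show "a \<oplus>\<^bsub>R\<^esub> b \<in> (\<Union>n. F n)" "a \<otimes>\<^bsub>R\<^esub> b \<in> (\<Union>n. F n)" by blast+
  qed
qed

end

text \<open>The structure on the subset \<open>K\<close>, copied along the injection
  \<open>i\<close> with left inverse \<open>j\<close>. It serves both the scalars and the additive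
  group of vectors.\<close>

definition transport_ring :: "('x \<Rightarrow> 'y) \<Rightarrow> ('y \<Rightarrow> 'x) \<Rightarrow> 'x set \<Rightarrow> 'x ring \<Rightarrow> 'y ring" where
  "transport_ring i j K R = \<lparr>carrier = i ` K, mult = (\<lambda>a b. i (j a \<otimes>\<^bsub>R\<^esub> j b)), one = i \<one>\<^bsub>R\<^esub>,
     zero = i \<zero>\<^bsub>R\<^esub>, add = (\<lambda>a b. i (j a \<oplus>\<^bsub>R\<^esub> j b))\<rparr>"

lemma transport_ring_simps [simp]: "carrier (transport_ring i j K R) = i ` K"
  "a \<otimes>\<^bsub>transport_ring i j K R\<^esub> b = i (j a \<otimes>\<^bsub>R\<^esub> j b)" "\<one>\<^bsub>transport_ring i j K R\<^esub> = i \<one>\<^bsub>R\<^esub>"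
  "\<zero>\<^bsub>transport_ring i j K R\<^esub> = i \<zero>\<^bsub>R\<^esub>" "a \<oplus>\<^bsub>transport_ring i j K R\<^esub> b = i (j a \<oplus>\<^bsub>R\<^esub> j b)"
  by (simp_all add: transport_ring_def)

lemma transport_abelian_group:
  assumes "abelian_group R" and K: "K \<subseteq> carrier R" "\<zero>\<^bsub>R\<^esub> \<in> K" "\<And>a b. \<lbrakk>a \<in> K; b \<in> K\<rbrakk> \<Longrightarrow> a \<oplus>\<^bsub>R\<^esub> b \<in> K"
    "\<And>a. a \<in> K \<Longrightarrow> \<ominus>\<^bsub>R\<^esub> a \<in> K" and j: "\<And>a. a \<in> K \<Longrightarrow> j (i a) = a"
  shows "abelian_group (transport_ring i j K R)"
proof -
  interpret abelian_group R by fact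
  show ?thesis
  proof (rule abelian_groupI, goal_cases)
    case (6 x)
    then obtain a where a: "a \<in> K" "x = i a" by auto
    then have "i (\<ominus>\<^bsub>R\<^esub> a) \<oplus>\<^bsub>transport_ring i j K R\<^esub> x = \<zero>\<^bsub>transport_ring i j K R\<^esub>"
      using K j l_neg by auto
    then show ?case using a K by (intro bexI[of _ "i (\<ominus>\<^bsub>R\<^esub> a)"]) auto
  next
    case (3 x y z)
    then obtain a b c where "a \<in> K" "x = i a" "b \<in> K" "y = i b" "c \<in> K" "z = i c" by auto
    then show ?case using K j a_assoc[of a b c] by (simp add: subset_eq)
  next
    case (4 x y)
    then obtain a b where "a \<in> K" "x = i a" "b \<in> K" "y = i b" by auto
    then show ?case using K j a_comm[of a b] by (simp add: subset_eq)
  qed (use K j in \<open>auto simp: subset_eq\<close>)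
qed

lemma transport_skew_field:
  assumes "skew_field R" and K: "K \<subseteq> carrier R" "\<zero>\<^bsub>R\<^esub> \<in> K" "\<one>\<^bsub>R\<^esub> \<in> K"
    "\<And>a b. \<lbrakk>a \<in> K; b \<in> K\<rbrakk> \<Longrightarrow> a \<oplus>\<^bsub>R\<^esub> b \<in> K" "\<And>a b. \<lbrakk>a \<in> K; b \<in> K\<rbrakk> \<Longrightarrow> a \<otimes>\<^bsub>R\<^esub> b \<in> K"
    "\<And>a. a \<in> K \<Longrightarrow> \<ominus>\<^bsub>R\<^esub> a \<in> K" "\<And>a. \<lbrakk>a \<in> K; a \<noteq> \<zero>\<^bsub>R\<^esub>\<rbrakk> \<Longrightarrow> inv\<^bsub>R\<^esub> a \<in> K"
    and j: "\<And>a. a \<in> K \<Longrightarrow> j (i a) = a"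
  shows "skew_field (transport_ring i j K R)"
proof -
  interpret skew_field R by fact
  let ?T = "transport_ring i j K R"
  have car: "a \<in> carrier R" if "a \<in> K" for a using K that by blast
  have pre: "\<exists>a\<in>K. x = i a" if "x \<in> carrier ?T" for x using that by auto
  have "abelian_group ?T" using transport_abelian_group[of R K j i] K j is_abelian_group by blast
  moreover have "Group.monoid ?T"
  proof (rule monoidI, goal_cases)
    case (3 x y z)
    then obtain a b c where "a \<in> K" "x = i a" "b \<in> K" "y = i b" "c \<in> K" "z = i c" by auto
    then show ?case using K j m_assoc[of a b c] car by simp
  qed (use K j car in auto)
  ultimately have "ring ?T"
  proof (rule ringI)
    fix x y z assume "x \<in> carrier ?T" "y \<in> carrier ?T" "z \<in> carrier ?T"
    then obtain a b c where abc: "a \<in> K" "x = i a" "b \<in> K" "y = i b" "c \<in> K" "z = i c" by auto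
    show "(x \<oplus>\<^bsub>?T\<^esub> y) \<otimes>\<^bsub>?T\<^esub> z = x \<otimes>\<^bsub>?T\<^esub> z \<oplus>\<^bsub>?T\<^esub> y \<otimes>\<^bsub>?T\<^esub> z"
      using abc K j l_distr[of a b c] car by simp
    show "z \<otimes>\<^bsub>?T\<^esub> (x \<oplus>\<^bsub>?T\<^esub> y) = z \<otimes>\<^bsub>?T\<^esub> x \<oplus>\<^bsub>?T\<^esub> z \<otimes>\<^bsub>?T\<^esub> y"
      using abc K j r_distr[of a b c] car by simp
  qed
  moreover have "Units ?T = carrier ?T - {\<zero>\<^bsub>?T\<^esub>}"
  proof (intro equalityI subsetI)
    fix x assume x: "x \<in> Units ?T"
    then obtain a b where ab: "a \<in> K" "x = i a" "b \<in> K" "i (b \<otimes>\<^bsub>R\<^esub> a) = i \<one>\<^bsub>R\<^esub>"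
      using j by (auto simp: Units_def)
    have "b \<otimes>\<^bsub>R\<^esub> a = \<one>\<^bsub>R\<^esub>" using j[OF K(5)[OF ab(3,1)]] j[OF K(3)] ab(4) by metis
    then have "a \<noteq> \<zero>\<^bsub>R\<^esub>" using skew_field_Units Units_one_closed r_null[OF car[OF ab(3)]] by force
    then have "x \<noteq> i \<zero>\<^bsub>R\<^esub>" using j[OF ab(1)] j[OF K(2)] ab by metis
    then show "x \<in> carrier ?T - {\<zero>\<^bsub>?T\<^esub>}" using ab by auto
  next
    fix x assume "x \<in> carrier ?T - {\<zero>\<^bsub>?T\<^esub>}"
    then obtain a where a: "a \<in> K" "x = i a" "a \<noteq> \<zero>\<^bsub>R\<^esub>" by auto
    then have "a \<in> Units R" using skew_field_Units car by blast
    then have "inv\<^bsub>R\<^esub> a \<otimes>\<^bsub>R\<^esub> a = \<one>\<^bsub>R\<^esub>" "a \<otimes>\<^bsub>R\<^esub> inv\<^bsub>R\<^esub> a = \<one>\<^bsub>R\<^esub>" by simp_all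
    then show "x \<in> Units ?T" using a K j by (auto simp: Units_def intro!: bexI[of _ "inv\<^bsub>R\<^esub> a"])
  qed
  ultimately show ?thesis by (simp add: skew_field_def skew_field_axioms_def)
qed

lemma countable_injection:
  assumes "countable K"
  obtains i :: "'x \<Rightarrow> 'y::infinite" where "inj_on i K"
proof -
  obtain f :: "nat \<Rightarrow> 'y" where "inj f" using infinite_countable_subset[OF infinite_UNIV] by blast
  moreover have "inj_on (to_nat_on K) K" using assms by (rule inj_on_to_nat_on)
  ultimately have "inj_on (f \<circ> to_nat_on K) K" by (intro comp_inj_on) (auto intro: inj_on_subset)
  then show thesis using that by blast
qed

text \<open>One dependence for each dependent subset is enough to generate a countable skew field with the same independent sets.\<close>

theorem skew_representable_transport:
  fixes R :: "'x ring" and V :: "'y ring" and f :: "'a \<Rightarrow> 'y"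
  assumes RV: "right_vector_space R V act" and rep: "representation_of R V act f S r" and S: "finite S"
  shows "skew_representable TYPE('f::infinite) TYPE('v::infinite) S r"
proof -
  interpret concrete_right_vector_space R V act using RV by (simp add: concrete_right_vector_space_def)
  have f: "f \<in> X \<rightarrow> carrier V" if "X \<subseteq> S" for X using rep that by (auto simp: representation_of_def)
  have fin: "finite X" if "X \<subseteq> S" for X using S that finite_subset by blast
  have "\<exists>c. c \<in> X \<rightarrow> carrier R \<and> (\<not> lin_indep_family R V act f X \<longrightarrow> lc f c X = \<zero>\<^bsub>V\<^esub> \<and> (\<exists>x\<in>X. c x \<noteq> \<zero>\<^bsub>R\<^esub>))" for X
    unfolding lin_indep_iff by (cases "lin_indep_family R V act f X") (auto simp: lin_indep_iff)
  then obtain dep where dep: "\<And>X. dep X \<in> X \<rightarrow> carrier R"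
    "\<And>X. \<not> lin_indep_family R V act f X \<Longrightarrow> lc f (dep X) X = \<zero>\<^bsub>V\<^esub> \<and> (\<exists>x\<in>X. dep X x \<noteq> \<zero>\<^bsub>R\<^esub>)" by metis
  let ?G = "\<Union>X\<in>Pow S. dep X ` X"
  have "finite ?G" using S fin by auto
  then have G: "countable ?G" "?G \<subseteq> carrier R" using dep(1) by (auto intro: countable_finite)
  obtain K where K: "countable K" "?G \<subseteq> K" "K \<subseteq> carrier R" "\<zero>\<^bsub>R\<^esub> \<in> K" "\<one>\<^bsub>R\<^esub> \<in> K"
    "\<And>a b. \<lbrakk>a \<in> K; b \<in> K\<rbrakk> \<Longrightarrow> a \<oplus>\<^bsub>R\<^esub> b \<in> K" "\<And>a b. \<lbrakk>a \<in> K; b \<in> K\<rbrakk> \<Longrightarrow> a \<otimes>\<^bsub>R\<^esub> b \<in> K"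
    "\<And>a. a \<in> K \<Longrightarrow> \<ominus>\<^bsub>R\<^esub> a \<in> K" "\<And>a. \<lbrakk>a \<in> K; a \<noteq> \<zero>\<^bsub>R\<^esub>\<rbrakk> \<Longrightarrow> inv\<^bsub>R\<^esub> a \<in> K"
    by (rule countable_subfield[OF G]) (rule that; assumption)
  have Kc: "c \<in> X \<rightarrow> carrier R" if "c \<in> X \<rightarrow> K" for c and X :: "'a set" using that K(3) by blast
  \<comment> \<open>The \<open>K\<close>-span of the representing vectors. It is countable, since
    \<open>S\<close> is finite and \<open>K\<close> countable.\<close>
  define W where "W = {lc f c S | c. c \<in> S \<rightarrow> K}"
  have WI: "lc f c X \<in> W" if X: "X \<subseteq> S" and c: "c \<in> X \<rightarrow> K" for c X
  proof -
    have "extend_zero X c \<in> S \<rightarrow> K" using c K(4) by (auto simp: extend_zero_def)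
    moreover have "lc f (extend_zero X c) S = lc f c X" using lc_extend_zero[OF S X f[OF subset_refl] Kc[OF c]] .
    ultimately show ?thesis unfolding W_def mem_Collect_eq by metis
  qed
  have WE: "\<exists>c. c \<in> S \<rightarrow> K \<and> w = lc f c S" if "w \<in> W" for w using that by (auto simp: W_def)
  have "countable {lc f c X | c. c \<in> X \<rightarrow> K}" if "X \<subseteq> S" for X
    using fin[OF that] that
  proof (induction X)
    case empty then show ?case by simp
  next
    case (insert x X)
    let ?W = "{lc f c X | c. c \<in> X \<rightarrow> K}"
    have "countable ((\<lambda>(a, v). act (f x) a \<oplus>\<^bsub>V\<^esub> v) ` (K \<times> ?W))" using insert K(1) by auto
    moreover have "{lc f c (insert x X) | c. c \<in> insert x X \<rightarrow> K} \<subseteq> (\<lambda>(a, v). act (f x) a \<oplus>\<^bsub>V\<^esub> v) ` (K \<times> ?W)"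
    proof clarify
      fix c assume c: "c \<in> insert x X \<rightarrow> K"
      have "lc f c (insert x X) = act (f x) (c x) \<oplus>\<^bsub>V\<^esub> lc f c X"
        using lc_insert[OF insert.hyps f[OF insert.prems] Kc[OF c]] .
      moreover have "c x \<in> K" "lc f c X \<in> ?W" using c by auto
      ultimately show "lc f c (insert x X) \<in> (\<lambda>(a, v). act (f x) a \<oplus>\<^bsub>V\<^esub> v) ` (K \<times> ?W)" by force
    qed
    ultimately show ?case by (rule countable_subset[rotated])
  qed
  then have "countable W" unfolding W_def by blast
  have WV: "W \<subseteq> carrier V"
  proof
    fix w assume "w \<in> W"
    then show "w \<in> carrier V" using WE lc_closed[OF f[OF subset_refl] Kc] by metis
  qed
  have W_add: "v \<oplus>\<^bsub>V\<^esub> w \<in> W" if vw: "v \<in> W" "w \<in> W" for v w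
  proof -
    obtain c c' where c: "c \<in> S \<rightarrow> K" "v = lc f c S" "c' \<in> S \<rightarrow> K" "w = lc f c' S" using WE[OF vw(1)] WE[OF vw(2)] by metis
    then have "v \<oplus>\<^bsub>V\<^esub> w = lc f (\<lambda>x. c x \<oplus>\<^bsub>R\<^esub> c' x) S" using lc_add[OF f[OF subset_refl] Kc Kc] by simp
    then show ?thesis using WI[of S "\<lambda>x. c x \<oplus>\<^bsub>R\<^esub> c' x"] c K(6) by (simp add: Pi_iff)
  qed
  have W_uminus: "\<ominus>\<^bsub>V\<^esub> v \<in> W" if vw: "v \<in> W" for v
  proof -
    obtain c where c: "c \<in> S \<rightarrow> K" "v = lc f c S" using WE[OF vw] by metis
    then have "\<ominus>\<^bsub>V\<^esub> v = lc f (\<lambda>x. \<ominus>\<^bsub>R\<^esub> c x) S" using lc_uminus[OF S f[OF subset_refl] Kc] by simp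
    then show ?thesis using WI[of S "\<lambda>x. \<ominus>\<^bsub>R\<^esub> c x"] c K(8) by (simp add: Pi_iff)
  qed
  have W_act: "act v a \<in> W" if vw: "v \<in> W" and a: "a \<in> K" for v a
  proof -
    obtain c where c: "c \<in> S \<rightarrow> K" "v = lc f c S" using WE[OF vw] by metis
    then have "act v a = lc f (\<lambda>x. c x \<otimes>\<^bsub>R\<^esub> a) S" using lc_scale[OF S f[OF subset_refl] Kc] a K(3) by blast
    then show ?thesis using WI[of S "\<lambda>x. c x \<otimes>\<^bsub>R\<^esub> a"] c K(7) a by (simp add: Pi_iff)
  qed
  have W_zero: "\<zero>\<^bsub>V\<^esub> \<in> W" using WI[of "{}" "\<lambda>_. \<zero>\<^bsub>R\<^esub>"] by simp
  have W_f: "f x \<in> W" if "x \<in> S" for x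
  proof -
    have "f x \<in> carrier V" using f[of S] that by blast
    then have "lc f (\<lambda>_. \<one>\<^bsub>R\<^esub>) {x} = f x" using lc_insert[of "{}" x f "\<lambda>_. \<one>\<^bsub>R\<^esub>"] by (simp add: act_one)
    then show ?thesis using WI[of "{x}" "\<lambda>_. \<one>\<^bsub>R\<^esub>"] that K(5) by simp
  qed
  obtain i :: "'x \<Rightarrow> 'f" where i: "inj_on i K" using countable_injection K(1) by blast
  obtain j :: "'y \<Rightarrow> 'v" where j: "inj_on j W" using countable_injection \<open>countable W\<close> by blast
  define i' where "i' = inv_into K i"
  define j' where "j' = inv_into W j"
  have i': "i' (i a) = a" if "a \<in> K" for a using i that by (simp add: i'_def)
  have j': "j' (j v) = v" if "v \<in> W" for v using j that by (simp add: j'_def)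
  let ?R = "transport_ring i i' K R" and ?V = "transport_ring j j' W V"
  let ?act = "\<lambda>v a. j (act (j' v) (i' a))"
  have skR: "skew_field ?R"
    by (rule transport_skew_field[OF R.skew_field_axioms]) (fact K i')+
  have agV: "abelian_group ?V"
    by (rule transport_abelian_group[OF V.abelian_group_axioms]) (fact WV W_zero W_add W_uminus j')+
  interpret V': abelian_group ?V by (rule agV)
  have Kcar: "a \<in> carrier R" if "a \<in> K" for a using K(3) that by blast
  have Wcar: "v \<in> carrier V" if "v \<in> W" for v using WV that by blast
  have rvs: "right_vector_space ?R ?V ?act"
  proof (intro right_vector_space.intro skR agV right_vector_space_axioms.intro, goal_cases)
    case (1 v a) then show ?case using W_act i' j' by auto
  next
    case (2 v a b)
    then obtain v0 a0 b0 where "v0 \<in> W" "v = j v0" "a0 \<in> K" "a = i a0" "b0 \<in> K" "b = i b0" by auto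
    then show ?case using i' j' K(6) W_act act_add_scalar[of v0 a0 b0] Kcar Wcar by simp
  next
    case (3 v w a)
    then obtain v0 w0 a0 where "v0 \<in> W" "v = j v0" "a0 \<in> K" "a = i a0" "w0 \<in> W" "w = j w0" by auto
    then show ?case using i' j' W_add W_act act_add_vector[of v0 w0 a0] Kcar Wcar by simp
  next
    case (4 v a b)
    then obtain v0 a0 b0 where "v0 \<in> W" "v = j v0" "a0 \<in> K" "a = i a0" "b0 \<in> K" "b = i b0" by auto
    then show ?case using i' j' K(7) W_act act_assoc[of v0 a0 b0] Kcar Wcar by simp
  next
    case (5 v)
    then show ?case using i' j' K(5) act_one Wcar by auto
  qed
  have sum: "finsum ?V (\<lambda>x. ?act (j (f x)) (i (c x))) X = j (lc f c X)" if "X \<subseteq> S" "c \<in> X \<rightarrow> K" for X c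
    using fin[OF that(1)] that
  proof (induction X)
    case empty then show ?case by simp
  next
    case (insert x X)
    then have X: "X \<subseteq> S" "c \<in> X \<rightarrow> K" "x \<in> S" "c x \<in> K" by auto
    have "?act (j (f y)) (i (c y)) \<in> carrier ?V" if "y \<in> insert x X" for y
    proof -
      have "f y \<in> W" "c y \<in> K" using that insert.prems W_f by auto
      then show ?thesis using W_act i' j' by simp
    qed
    then have "finsum ?V (\<lambda>x. ?act (j (f x)) (i (c x))) (insert x X) =
        ?act (j (f x)) (i (c x)) \<oplus>\<^bsub>?V\<^esub> finsum ?V (\<lambda>x. ?act (j (f x)) (i (c x))) X"
      using insert.hyps by (intro V'.finsum_insert) auto
    also have "\<dots> = j (act (f x) (c x) \<oplus>\<^bsub>V\<^esub> lc f c X)"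
      using insert.IH[OF X(1,2)] W_f[OF X(3)] X(4) i' j' W_act WI[OF X(1,2)] by simp
    also have "\<dots> = j (lc f c (insert x X))"
      using lc_insert[OF insert.hyps f[OF insert.prems(1)] Kc[OF insert.prems(2)]] by simp
    finally show ?case .
  qed
  have lin: "lin_indep_family ?R ?V ?act (\<lambda>x. j (f x)) X \<longleftrightarrow> lin_indep_family R V act f X" if X: "X \<subseteq> S" for X
  proof
    assume L: "lin_indep_family R V act f X"
    show "lin_indep_family ?R ?V ?act (\<lambda>x. j (f x)) X"
      unfolding lin_indep_family_def
    proof (intro ballI impI)
      fix c x assume c: "c \<in> X \<rightarrow> carrier ?R" "finsum ?V (\<lambda>x. ?act (j (f x)) (c x)) X = \<zero>\<^bsub>?V\<^esub>" and x: "x \<in> X"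
      let ?c = "\<lambda>x. i' (c x)"
      have cK: "?c \<in> X \<rightarrow> K" and ci: "\<And>x. x \<in> X \<Longrightarrow> i (?c x) = c x" using c(1) i' by (fastforce simp: Pi_iff)+
      have "finsum ?V (\<lambda>x. ?act (j (f x)) (i (?c x))) X = finsum ?V (\<lambda>x. ?act (j (f x)) (c x)) X"
      proof (rule V'.finsum_cong')
        show "(\<lambda>x. ?act (j (f x)) (c x)) \<in> X \<rightarrow> carrier ?V"
          using cK W_f W_act j' X by (auto simp: Pi_iff subset_eq)
      qed (use ci in auto)
      then have "j (lc f ?c X) = j \<zero>\<^bsub>V\<^esub>" using sum[OF X cK] c(2) by simp
      then have "lc f ?c X = \<zero>\<^bsub>V\<^esub>" using j'[OF WI[OF X cK]] j'[OF W_zero] by metis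
      then have "?c x = \<zero>\<^bsub>R\<^esub>" using L Kc[OF cK] x unfolding lin_indep_iff by blast
      then show "c x = \<zero>\<^bsub>?R\<^esub>" using ci[OF x] by simp
    qed
  next
    assume L: "lin_indep_family ?R ?V ?act (\<lambda>x. j (f x)) X"
    show "lin_indep_family R V act f X"
    proof (rule ccontr)
      assume "\<not> lin_indep_family R V act f X"
      \<comment> \<open>A dependent set keeps a relation over \<open>K\<close> because the
        coefficients of \<open>dep X\<close> were put into \<open>K\<close>. In the other direction
        an independent set stays so under restriction of scalars.\<close>
      then obtain x where d: "lc f (dep X) X = \<zero>\<^bsub>V\<^esub>" and x: "x \<in> X" "dep X x \<noteq> \<zero>\<^bsub>R\<^esub>" using dep(2) by blast
      have dK: "dep X \<in> X \<rightarrow> K" using K(2) X by blast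
      have z: "finsum ?V (\<lambda>x. ?act (j (f x)) (i (dep X x))) X = \<zero>\<^bsub>?V\<^esub>" using sum[OF X dK] d by simp
      have "(\<lambda>x. i (dep X x)) \<in> X \<rightarrow> carrier ?R" using dK by auto
      then have "\<forall>x\<in>X. i (dep X x) = \<zero>\<^bsub>?R\<^esub>"
        by (rule L[unfolded lin_indep_family_def, THEN bspec, THEN mp]) (rule z)
      then have "i (dep X x) = \<zero>\<^bsub>?R\<^esub>" using x(1) by blast
      then have "dep X x = \<zero>\<^bsub>R\<^esub>" using i'[OF K(4)] i'[of "dep X x"] dK x(1) by (metis PiE transport_ring_simps(4))
      then show False using x by blast
    qed
  qed
  have "representation_of ?R ?V ?act (\<lambda>x. j (f x)) S r"
    using rep lin W_f by (auto simp: representation_of_def)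
  then show ?thesis unfolding skew_representable_def representable_over_def using rvs skR by blast
qed

section \<open>Matroids of rank at most two over the rationals\<close>

definition rat_ring :: "rat ring" where
  "rat_ring = \<lparr>carrier = UNIV, mult = (*), one = 1, zero = 0, add = (+)\<rparr>"

definition rat_plane :: "(rat \<times> rat) ring" where
  "rat_plane = \<lparr>carrier = UNIV, mult = (\<lambda>_ _. (0, 0)), one = (0, 0), zero = (0, 0), add = (\<lambda>(a, b) (c, d). (a + c, b + d))\<rparr>"

definition rat_act :: "rat \<times> rat \<Rightarrow> rat \<Rightarrow> rat \<times> rat" where
  "rat_act = (\<lambda>(a, b) s. (a * s, b * s))"

lemma rat_simps [simp]: "carrier rat_ring = UNIV" "a \<otimes>\<^bsub>rat_ring\<^esub> b = a * b" "\<one>\<^bsub>rat_ring\<^esub> = 1" "\<zero>\<^bsub>rat_ring\<^esub> = 0"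
  "a \<oplus>\<^bsub>rat_ring\<^esub> b = a + b" "carrier rat_plane = UNIV" "\<zero>\<^bsub>rat_plane\<^esub> = (0, 0)"
  "(a, b) \<oplus>\<^bsub>rat_plane\<^esub> (c, d) = (a + c, b + d)" "rat_act (a, b) s = (a * s, b * s)"
  by (simp_all add: rat_ring_def rat_plane_def rat_act_def)

lemma rat_plane: "concrete_right_vector_space rat_ring rat_plane rat_act"
proof -
  have "abelian_group rat_ring"
    by (rule abelian_groupI) (auto intro: exI[of _ "- _"] simp: add.assoc add.commute)
  moreover have "Group.monoid rat_ring"
    by (rule monoidI) (auto simp: mult.assoc)
  ultimately have "ring rat_ring"
    by (rule ringI) (auto simp: algebra_simps)
  moreover have "Units rat_ring = carrier rat_ring - {\<zero>\<^bsub>rat_ring\<^esub>}"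
  proof -
    have "\<exists>y. y * x = 1 \<and> x * y = 1" if "x \<noteq> 0" for x :: rat
      by (rule exI[of _ "inverse x"]) (use that in simp)
    then show ?thesis by (auto simp: Units_def)
  qed
  ultimately have sk: "skew_field rat_ring"
    by (simp add: skew_field_def skew_field_axioms_def)
  have ag: "abelian_group rat_plane"
  proof (rule abelian_groupI, goal_cases)
    case (6 x)
    show ?case by (rule bexI[of _ "(- fst x, - snd x)"]; cases x) auto
  qed (auto simp: rat_plane_def)
  show ?thesis
    by (intro concrete_right_vector_space.intro right_vector_space.intro sk ag right_vector_space_axioms.intro)
      (auto simp: algebra_simps)
qed

text \<open>Loops become zero, and each parallel class gets its own vector \<open>(1, h)\<close>.
  Different such vectors are independent in pairs and dependent in triples; the rationals have
  enough slopes for every finite matroid.\<close>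

lemma skew_representable_rank_two:
  assumes M: "matroid K r" and r2: "r K \<le> 2"
  shows "skew_representable TYPE('f::infinite) TYPE('v::infinite) K r"
proof -
  interpret matroid K r by fact
  interpret Q: concrete_right_vector_space rat_ring rat_plane rat_act by (rule rat_plane)
  obtain \<sigma> where \<sigma>: "\<And>x. x \<in> nonloops K r \<Longrightarrow> \<sigma> x \<in> si_ground K r \<and> r {x, \<sigma> x} = 1"
    using si_ground_ex by metis
  have nl: "x \<in> K \<and> r {x} = 1" if "x \<in> nonloops K r" for x using nonloops_rank that by blast
  have \<sigma>_eq: "\<sigma> x = \<sigma> y \<longleftrightarrow> r {x, y} = 1" if xy: "x \<in> nonloops K r" "y \<in> nonloops K r" for x y
  proof -
    have s: "\<sigma> x \<in> nonloops K r" "\<sigma> y \<in> nonloops K r" using \<sigma> xy si_ground_nonloops by blast+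
    show ?thesis
    proof
      assume "\<sigma> x = \<sigma> y"
      then show "r {x, y} = 1"
        using parallel_trans[of x "\<sigma> x" y] \<sigma>[OF xy(1)] \<sigma>[OF xy(2)] nl xy s by (auto simp: insert_commute)
    next
      assume "r {x, y} = 1"
      then have "r {\<sigma> x, y} = 1"
        using parallel_trans[of "\<sigma> x" x y] \<sigma>[OF xy(1)] nl xy s by (auto simp: insert_commute)
      then have "r {\<sigma> x, \<sigma> y} = 1" using parallel_trans[of "\<sigma> x" y "\<sigma> y"] \<sigma>[OF xy(2)] nl xy s by auto
      then show "\<sigma> x = \<sigma> y" using si_ground_parallel \<sigma> xy by blast
    qed
  qed
  obtain e :: "'a \<Rightarrow> nat" where e: "inj_on e K" using finite_imp_inj_to_nat_seg[OF finite_ground] by blast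
  define h where "h x = (of_nat (e (\<sigma> x)) :: rat)" for x
  have h: "h x = h y \<longleftrightarrow> r {x, y} = 1" if xy: "x \<in> nonloops K r" "y \<in> nonloops K r" for x y
  proof -
    have "\<sigma> x \<in> K" "\<sigma> y \<in> K" using \<sigma> xy si_ground_nonloops nl by blast+
    then have "h x = h y \<longleftrightarrow> \<sigma> x = \<sigma> y" using e by (auto simp: h_def inj_on_def)
    then show ?thesis using \<sigma>_eq xy by blast
  qed
  define f where "f x = (if x \<in> nonloops K r then (1 :: rat, h x) else (0, 0))" for x
  have car: "f \<in> X \<rightarrow> carrier rat_plane" for X by simp
  have carc: "c \<in> X \<rightarrow> carrier rat_ring" for c and X :: "'a set" by simp
  let ?L = "lin_indep_family rat_ring rat_plane rat_act f"
  have dep3: "\<not> ?L {x, y, z}" if n: "x \<in> nonloops K r" "y \<in> nonloops K r" "z \<in> nonloops K r"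
    and d: "x \<noteq> y" "x \<noteq> z" "y \<noteq> z" for x y z
  proof (cases "h x = h y")
    case True
    then have "f x = f y" using n by (simp add: f_def)
    then have "f x \<in> Q.lspan f ({x, y, z} - {x})" using Q.lspan_base[of "{x, y, z} - {x}" f y] car d by auto
    then show ?thesis using Q.lin_indep_iff_lspan[of "{x, y, z}" f] car by auto
  next
    case False
    \<comment> \<open>Up to sign these are the minors of the two by three matrix with rows
      \<open>1, 1, 1\<close> and \<open>h x, h y, h z\<close>.\<close>
    define c where "c = (\<lambda>w. if w = x then h y - h z else if w = y then h z - h x else h x - h y)"
    have "Q.lc f c {x, y, z} = (0, 0)"
      using d n by (simp add: Q.lc_insert f_def c_def algebra_simps)
    moreover have "c z \<noteq> 0" using d False by (simp add: c_def)
    ultimately show ?thesis unfolding Q.lin_indep_iff using carc[of c "{x, y, z}"] by auto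
  qed
  have "indep K r X \<longleftrightarrow> ?L X" if X: "X \<subseteq> K" for X
  proof (cases "X \<subseteq> nonloops K r")
    case False
    then obtain x where x: "x \<in> X" "x \<notin> nonloops K r" by blast
    then have "r {x} = 0" using X by (auto simp: nonloops_def)
    then have "\<not> indep K r {x}" by (simp add: indep_def)
    then have "\<not> indep K r X" using indep_subset[of X "{x}"] x by blast
    moreover have "f x \<in> Q.lspan f (X - {x})"
      using Q.lspan_zero[OF car, of "X - {x}"] finite_subset_ground[OF X] x by (simp add: f_def)
    then have "\<not> ?L X" using Q.lin_indep_iff_lspan[OF finite_subset_ground[OF X] car] x by blast
    ultimately show ?thesis by blast
  next
    case n: True
    have fin: "finite X" using finite_subset_ground X by blast
    consider "card X = 0" | "card X = 1" | "card X = 2" | "card X \<ge> 3" by linarith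
    then show ?thesis
    proof cases
      case 1
      then show ?thesis using fin by (simp add: indep_def lin_indep_family_def)
    next
      case 2
      then obtain x where x: "X = {x}" by (auto simp: card_1_singleton_iff)
      then have "?L X" using n Q.lc_insert[of "{}" x f] by (auto simp: Q.lin_indep_iff f_def)
      then show ?thesis using x n nl by (auto simp: indep_def)
    next
      case 3
      then obtain x y where xy: "X = {x, y}" "x \<noteq> y" by (auto simp: card_2_iff)
      have xyn: "x \<in> nonloops K r" "y \<in> nonloops K r" using n xy by auto
      have "r X \<le> 2" "r {x} \<le> r X" using rank_le_card[OF X] 3 rank_mono[of "{x}" X] xy X by auto
      then have rX: "r X = 2 \<longleftrightarrow> h x \<noteq> h y" using h[OF xyn] nl[OF xyn(1)] xy by auto
      have "?L X \<longleftrightarrow> h x \<noteq> h y"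
      proof
        assume L: "?L X"
        show "h x \<noteq> h y"
        proof
          assume "h x = h y"
          then have "f x = f y" using xyn by (simp add: f_def)
          then have "f x \<in> Q.lspan f (X - {x})" using Q.lspan_base[of "X - {x}" f y] car xy fin by auto
          then show False using L Q.lin_indep_iff_lspan[OF fin car] xy by auto
        qed
      next
        assume ne: "h x \<noteq> h y"
        show "?L X"
          unfolding Q.lin_indep_iff
        proof (intro ballI impI)
          fix c w assume "Q.lc f c X = \<zero>\<^bsub>rat_plane\<^esub>" and w: "w \<in> X"
          then have eqs: "c x + c y = 0" "h x * c x + h y * c y = 0"
            using xy xyn by (simp_all add: Q.lc_insert f_def)
          then have "c y = - c x" by simp
          then have "(h x - h y) * c x = 0" using eqs(2) by (simp add: algebra_simps)
          then have "c x = 0" using ne by simp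
          then show "c w = \<zero>\<^bsub>rat_ring\<^esub>" using \<open>c y = - c x\<close> w xy by auto
        qed
      qed
      then show ?thesis using rX 3 X by (simp add: indep_def)
    next
      case 4
      have "r X \<le> 2" using rank_mono[of X K] X r2 by simp
      then have "\<not> indep K r X" using 4 by (simp add: indep_def)
      moreover obtain T where T: "T \<subseteq> X" "card T = 3" using obtain_subset_with_card_n[OF 4] by metis
      then obtain x y z where "T = {x, y, z}" "x \<noteq> y" "x \<noteq> z" "y \<noteq> z" by (auto simp: card_3_iff)
      then have "\<not> ?L T" using dep3 n T by auto
      then have "\<not> ?L X" using Q.lin_indep_subset[OF fin T(1) car] by blast
      ultimately show ?thesis by blast
    qed
  qed
  then have "representation_of rat_ring rat_plane rat_act f K r" by (simp add: representation_of_def)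
  then show ?thesis using skew_representable_transport[OF Q.right_vector_space_axioms _ finite_ground] by blast
qed

context matroid
begin

text \<open>A circuit through a loop has no other element, so a loop is a component by itself, of
  rank zero.\<close>

lemma component_nonloop:
  assumes K: "K \<in> components S r" and r: "r K \<noteq> 0" and x: "x \<in> K"
  shows "x \<in> nonloops S r"
proof (rule ccontr)
  assume n: "x \<notin> nonloops S r"
  have xS: "x \<in> S" using components_ground K x by blast
  then have r0: "r {x} = 0" using n by (simp add: nonloops_def)
  have "K = {x}"
  proof (rule ccontr)
    assume "K \<noteq> {x}"
    then obtain y where y: "y \<in> K" "y \<noteq> x" using x by blast
    have "(x, y) \<in> connected_rel"
      using K x y quotient_eq_iff[OF equiv_connected_rel, of K K x y] unfolding components_eq by blast
    then obtain C where C: "circuit S r C" "x \<in> C" "y \<in> C" using y by (auto simp: connected_rel_def)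
    then have "indep S r {x}" using y unfolding circuit_def by blast
    then show False using r0 by (simp add: indep_def)
  qed
  then show False using r0 r by simp
qed

lemma indep_parallel_image:
  assumes X: "X \<subseteq> nonloops S r" and \<sigma>: "\<And>x. x \<in> X \<Longrightarrow> \<sigma> x \<in> nonloops S r \<and> r {x, \<sigma> x} = 1"
  shows "indep S r X \<longleftrightarrow> inj_on \<sigma> X \<and> indep S r (\<sigma> ` X)"
proof -
  have S: "X \<subseteq> S" "\<sigma> ` X \<subseteq> S" "finite X" using X \<sigma> nonloops_rank finite_subset_ground by blast+
  have eq: "r (\<sigma> ` X) = r X" using rank_parallel_image[OF X \<sigma>] .
  have le: "r (\<sigma> ` X) \<le> card (\<sigma> ` X)" "card (\<sigma> ` X) \<le> card X" using rank_le_card S card_image_le by auto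
  show ?thesis
    using eq le S card_image[of \<sigma> X] eq_card_imp_inj_on[of X \<sigma>] by (auto simp: indep_def)
qed

end

text \<open>Rank at most two is representable over the rationals, and rank at least four provides
  the four independent points that \<open>veblen_young\<close> asks for. Rank three would yield
  points in a plane that may be non-Desarguesian.\<close>

theorem projectively_embeddable_imp_components:
  fixes S :: "'a set" and r :: "'a set \<Rightarrow> nat"
  assumes M: "matroid S r" and emb: "projectively_embeddable TYPE('p::infinite) S r"
    and K: "K \<in> components S r" and r3: "r K \<noteq> 3"
  shows "skew_representable TYPE('f::infinite) TYPE('v::infinite) K r"
proof (cases "r K \<le> 2")
  case True
  then show ?thesis
    using skew_representable_rank_two matroid.matroid_restrict[OF M] matroid.components_ground[OF M K] by blast
next
  case False
  then have r4: "r K \<ge> 4" using r3 by linarith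
  interpret matroid S r by fact
  obtain q and P :: "nat \<Rightarrow> 'p set" and L T where P: "\<And>i. i \<in> {1..q} \<Longrightarrow> projective_space (P i) (L i)"
    and T: "T \<subseteq> fst (direct_sum {1..q} (\<lambda>i. proj_matroid (P i) (L i)))"
    and iso: "isomorphic (of_rank (si_ground S r) r) (restrict_to (direct_sum {1..q} (\<lambda>i. proj_matroid (P i) (L i))) T)"
    using emb unfolding projectively_embeddable_def by (elim exE conjE) (rule that, blast+)
  let ?G = "si_ground S r" and ?D = "direct_sum {1..q} (\<lambda>i. proj_matroid (P i) (L i))"
  have GS: "?G \<subseteq> S" "?G \<subseteq> nonloops S r" using si_ground_nonloops nonloops_rank by auto
  obtain f where f: "bij_betw f ?G T" and fi: "\<And>X. X \<subseteq> ?G \<Longrightarrow> indep ?G r X \<longleftrightarrow> f ` X \<in> snd ?D \<and> f ` X \<subseteq> T"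
    using iso by (auto simp: isomorphic_def of_rank_def restrict_to_def)
  have fT: "f x \<in> T" if "x \<in> ?G" for x using f that by (auto simp: bij_betw_def)
  have ind: "indep S r X \<longleftrightarrow> f ` X \<in> snd ?D" if X: "X \<subseteq> ?G" for X
    using fi[OF X] fT X indep_restrict[OF GS(1) X] by blast
  have KS: "K \<subseteq> S" using components_ground K .
  have Kn: "x \<in> nonloops S r" if "x \<in> K" for x using component_nonloop[OF K _ that] r4 by simp
  obtain \<sigma> where \<sigma>: "\<And>x. x \<in> nonloops S r \<Longrightarrow> \<sigma> x \<in> ?G \<and> r {x, \<sigma> x} = 1" using si_ground_ex by metis
  have \<sigma>K: "\<sigma> x \<in> ?G" "\<sigma> x \<in> nonloops S r \<and> r {x, \<sigma> x} = 1" if "x \<in> K" for x using \<sigma>[OF Kn[OF that]] GS by auto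
  have ind\<sigma>: "indep S r X \<longleftrightarrow> inj_on \<sigma> X \<and> f ` \<sigma> ` X \<in> snd ?D" if X: "X \<subseteq> K" for X
  proof -
    have "\<sigma> ` X \<subseteq> ?G" using \<sigma>K X by blast
    then show ?thesis using indep_parallel_image[of X \<sigma>] ind[of "\<sigma> ` X"] Kn \<sigma>K X by blast
  qed
  define pt where "pt x = f (\<sigma> x)" for x
  have pt_D: "fst (pt x) \<in> {1..q} \<and> snd (pt x) \<in> P (fst (pt x))" if "x \<in> K" for x
    using fT[OF \<sigma>K(1)[OF that]] T by (force simp: pt_def direct_sum_def proj_matroid_def)
  have pt_\<sigma>: "pt x = pt y \<longleftrightarrow> \<sigma> x = \<sigma> y" if "x \<in> K" "y \<in> K" for x y
    using f \<sigma>K that unfolding pt_def bij_betw_def inj_on_def by metis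
  have D_iff: "pt ` X \<in> snd ?D \<longleftrightarrow> (\<forall>i\<in>{1..q}. {p. (i, p) \<in> pt ` X} \<in> snd (proj_matroid (P i) (L i)))" if X: "X \<subseteq> K" for X
  proof -
    have "pt ` X \<subseteq> fst ?D" using fT \<sigma>K(1) X T unfolding pt_def by blast
    then show ?thesis by (auto simp: direct_sum_def)
  qed
  have same: "fst (pt x) = fst (pt y)" if x: "x \<in> K" and y: "y \<in> K" for x y
  proof (rule ccontr)
    assume ne: "fst (pt x) \<noteq> fst (pt y)"
    have "(x, y) \<in> connected_rel"
      using K x y quotient_eq_iff[OF equiv_connected_rel, of K K x y] unfolding components_eq by blast
    then obtain C where C: "circuit S r C" "x \<in> C" "y \<in> C" using ne by (auto simp: connected_rel_def)
    have CK: "C \<subseteq> K" using circuit_in_component[OF C(1) K C(2) x] .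
    \<comment> \<open>If a circuit joined different summands, its elements in one summand and the
      others would be proper subsets, hence independent. In a direct sum this makes the whole
      circuit independent.\<close>
    let ?C1 = "{z \<in> C. fst (pt z) = fst (pt x)}" and ?C2 = "{z \<in> C. fst (pt z) \<noteq> fst (pt x)}"
    have "y \<notin> ?C1" "x \<notin> ?C2" using ne by auto
    then have "?C1 \<subset> C" "?C2 \<subset> C" using C by blast+
    then have "indep S r ?C1" "indep S r ?C2" using C(1) unfolding circuit_def by blast+
    then have i1: "inj_on \<sigma> ?C1" "pt ` ?C1 \<in> snd ?D" and i2: "inj_on \<sigma> ?C2" "pt ` ?C2 \<in> snd ?D"
      using ind\<sigma>[of ?C1] ind\<sigma>[of ?C2] CK by (auto simp: image_image pt_def)
    have "inj_on \<sigma> C"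
    proof (rule inj_onI)
      fix z w assume zw: "z \<in> C" "w \<in> C" "\<sigma> z = \<sigma> w"
      then have "fst (pt z) = fst (pt w)" by (simp add: pt_def)
      then show "z = w" using i1(1) i2(1) zw by (cases "fst (pt z) = fst (pt x)") (auto simp: inj_on_def)
    qed
    moreover have "pt ` C \<in> snd ?D"
      unfolding D_iff[OF CK]
    proof
      fix i assume i: "i \<in> {1..q}"
      show "{p. (i, p) \<in> pt ` C} \<in> snd (proj_matroid (P i) (L i))"
      proof (cases "i = fst (pt x)")
        case True
        then have "{p. (i, p) \<in> pt ` C} = {p. (i, p) \<in> pt ` ?C1}" by (auto simp: image_iff) (metis fst_conv)
        moreover have "?C1 \<subseteq> K" using CK by blast
        ultimately show ?thesis using D_iff[of ?C1] i1(2) i by simp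
      next
        case False
        then have "{p. (i, p) \<in> pt ` C} = {p. (i, p) \<in> pt ` ?C2}" by (auto simp: image_iff) (metis fst_conv)
        moreover have "?C2 \<subseteq> K" using CK by blast
        ultimately show ?thesis using D_iff[of ?C2] i2(2) i by simp
      qed
    qed
    ultimately have "indep S r C" using ind\<sigma>[OF CK] by (simp add: image_image pt_def)
    then show False using C(1) by (simp add: circuit_def)
  qed
  have "K \<noteq> {}" using r4 by auto
  then obtain x0 where x0: "x0 \<in> K" by blast
  define i where "i = fst (pt x0)"
  define p where "p x = snd (pt x)" for x
  have i: "i \<in> {1..q}" using pt_D x0 by (simp add: i_def)
  have pt_p: "pt x = (i, p x)" if "x \<in> K" for x using same[OF that x0] by (simp add: i_def p_def prod_eq_iff)
  have pP: "p x \<in> P i" if "x \<in> K" for x using pt_D[OF that] pt_p[OF that] by simp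
  interpret PS: projective_space "P i" "L i" using P i by blast
  have indp: "indep S r X \<longleftrightarrow> inj_on p X \<and> p ` X \<in> snd (proj_matroid (P i) (L i))" if X: "X \<subseteq> K" for X
  proof -
    have inj: "inj_on \<sigma> X \<longleftrightarrow> inj_on p X"
      using pt_\<sigma> pt_p X unfolding inj_on_def by (metis prod.inject subsetD)
    have slice: "{a. (k, a) \<in> pt ` X} = (if k = i then p ` X else {})" for k
      using pt_p X by (force simp: image_iff)
    have "{} \<in> snd (proj_matroid (P k) (L k))" for k by (simp add: proj_matroid_def)
    then have "pt ` X \<in> snd ?D \<longleftrightarrow> p ` X \<in> snd (proj_matroid (P i) (L i))"
      unfolding D_iff[OF X] slice using i by auto
    then show ?thesis using ind\<sigma>[OF X] inj by (simp add: image_image pt_def)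
  qed
  \<comment> \<open>Four independent elements of the component become four independent points, so
    the space has dimension at least three.\<close>
  obtain B where B: "B \<subseteq> K" "indep S r B" "card B = r K" using basis[OF KS] by metis
  then obtain B4 where B4: "B4 \<subseteq> B" "card B4 = 4" using r4 obtain_subset_with_card_n[of 4 B] by metis
  have "indep S r B4" using indep_subset B B4 by blast
  then have ip: "inj_on p B4" "p ` B4 \<in> snd (proj_matroid (P i) (L i))" using indp[of B4] B B4 by auto
  have "card (p ` B4) = 4" using card_image[OF ip(1)] B4 by simp
  then obtain b1 b2 b3 b4 where b: "p ` B4 = {b1, b2, b3, b4}" "distinct [b1, b2, b3, b4]"
    by (auto simp: card_Suc_eq numeral_eq_Suc)
  have "p ` B4 \<subseteq> P i" using pP B(1) B4(1) by blast
  then have bP: "{b1, b2, b3, b4} \<subseteq> P i" using b(1) by simp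
  have nspan: "b \<notin> proj_span (P i) (L i) ({b1, b2, b3, b4} - {b})" if "b \<in> {b1, b2, b3, b4}" for b
    using ip(2) that unfolding b(1) proj_matroid_def snd_conv by blast
  have 4: "b4 \<notin> proj_span (P i) (L i) {b1, b2, b3}"
  proof -
    have "{b1, b2, b3, b4} - {b4} = {b1, b2, b3}" using b(2) by auto
    then show ?thesis using nspan[of b4] by simp
  qed
  have 3: "b3 \<notin> PS.join b1 b2"
  proof
    assume j: "b3 \<in> PS.join b1 b2"
    have "b3 \<in> proj_span (P i) (L i) ({b1, b2, b3, b4} - {b3})"
      unfolding proj_span_def
    proof (intro InterI, clarify)
      fix W assume "proj_subspace (P i) (L i) W" "{b1, b2, b3, b4} - {b3} \<subseteq> W"
      then show "b3 \<in> W" using PS.subspace_join[of W b1 b2 b3] j b(2) by auto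
    qed
    then show False using nspan[of b3] by simp
  qed
  have "b1 \<noteq> b2" using b(2) by simp
  from PS.veblen_young[OF bP this 3 4]
  obtain R :: "('p \<Rightarrow> 'p) ring" and V :: "(('p \<Rightarrow> 'p) \<times> 'p) ring" and act g where RV: "right_vector_space R V act"
    and g: "g \<in> P i \<rightarrow> carrier V"
    and gY: "\<And>Y. \<lbrakk>Y \<subseteq> P i; finite Y\<rbrakk> \<Longrightarrow> (\<forall>p\<in>Y. p \<notin> proj_span (P i) (L i) (Y - {p})) \<longleftrightarrow> lin_indep_family R V act g Y"
    by metis
  interpret crvs: concrete_right_vector_space R V act using RV by (simp add: concrete_right_vector_space_def)
  have "indep K r X \<longleftrightarrow> lin_indep_family R V act (\<lambda>x. g (p x)) X" if X: "X \<subseteq> K" for X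
  proof -
    have fin: "finite X" "p ` X \<subseteq> P i" using finite_subset_ground X KS pP by blast+
    have "p ` X \<in> snd (proj_matroid (P i) (L i)) \<longleftrightarrow> lin_indep_family R V act g (p ` X)"
      using gY[of "p ` X"] fin by (simp add: proj_matroid_def)
    moreover have "g \<in> p ` X \<rightarrow> carrier V" using g fin by blast
    ultimately show ?thesis
      using indp[OF X] crvs.lin_indep_image[OF fin(1), of g p] indep_restrict[OF KS X] by blast
  qed
  moreover have "(\<lambda>x. g (p x)) \<in> K \<rightarrow> carrier V" using g pP by blast
  ultimately have "representation_of R V act (\<lambda>x. g (p x)) K r" by (simp add: representation_of_def)
  then show ?thesis using skew_representable_transport[OF RV] finite_subset_ground KS by blast
qed

section \<open>Extending matroids of rank three and representable matroids\<close>

lemma modular_extendable_cong: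
  fixes S :: "'a::infinite set"
  assumes "finite S" "\<And>X. X \<subseteq> S \<Longrightarrow> r' X = r X" "modular_extendable k S r"
  shows "modular_extendable k S r'"
  using modular_extendable_isomorphic[of S id S r' r k] assms by simp

text \<open>Keeps the new elements of one summand away from the other summand and from its new
  elements.\<close>

lemma one_step_extension_rename:
  fixes S :: "'a::infinite set"
  assumes ext: "one_step_extension S r A B S' r'" and k: "modular_extendable k S' r'"
    and AB: "A \<subseteq> S" "B \<subseteq> S" and F: "finite F"
  obtains T s where "one_step_extension S r A B T s" "modular_extendable k T s" "(T - S) \<inter> F = {}"
proof -
  have S': "finite S'" "S \<subseteq> S'" and r': "\<And>X. X \<subseteq> S \<Longrightarrow> r' X = r X"
    using ext matroid.finite_ground by (auto simp: one_step_extension_def)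
  obtain g :: "'a \<Rightarrow> 'a" where g: "inj_on g (S' - S)" "g ` (S' - S) \<inter> (F \<union> S) = {}"
    using fresh_injection[of "S' - S" "F \<union> S"] S' F finite_subset by (metis finite_Diff finite_UnI)
  define \<phi> where "\<phi> x = (if x \<in> S then x else g x)" for x
  have inj: "inj_on \<phi> S'"
    using g unfolding inj_on_def \<phi>_def by (smt (verit) Diff_iff IntI UnCI empty_iff imageI)
  have \<phi>S: "\<phi> ` X = X" if "X \<subseteq> S" for X using that by (auto simp: \<phi>_def image_iff subset_iff)
  have bij: "bij_betw \<phi> S' (\<phi> ` S')" using inj by (simp add: bij_betw_def)
  let ?s = "pushforward \<phi> S' r'"
  have push: "?s (\<phi> ` X) = r' X" if "X \<subseteq> S'" for X using pushforward_image inj that by blast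
  have "one_step_extension (\<phi> ` S) r (\<phi> ` A) (\<phi> ` B) (\<phi> ` S') ?s"
    using one_step_extension_isomorphic[OF ext AB bij, of r ?s] push \<phi>S by simp
  then have "one_step_extension S r A B (\<phi> ` S') ?s" using \<phi>S AB by simp
  moreover have "modular_extendable k (\<phi> ` S') ?s"
    using modular_extendable_isomorphic[OF S'(1) bij push k] by blast
  moreover have "(\<phi> ` S' - S) \<inter> F = {}" using g by (auto simp: \<phi>_def)
  ultimately show thesis using that by blast
qed

lemma matroid_direct_sum:
  assumes "matroid S1 r1" "matroid S2 r2" "S1 \<inter> S2 = {}"
  shows "matroid (S1 \<union> S2) (\<lambda>X. r1 (X \<inter> S1) + r2 (X \<inter> S2))"
proof -
  interpret M1: matroid S1 r1 by fact
  interpret M2: matroid S2 r2 by fact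
  show ?thesis
  proof
    show "finite (S1 \<union> S2)" using M1.finite_ground M2.finite_ground by blast
  next
    fix X assume X: "X \<subseteq> S1 \<union> S2"
    have "card X = card (X \<inter> S1) + card (X \<inter> S2)"
      using X assms(3) M1.finite_ground M2.finite_ground
      by (subst card_Un_disjoint[symmetric]) (auto intro: arg_cong[of _ _ card])
    then show "r1 (X \<inter> S1) + r2 (X \<inter> S2) \<le> card X"
      using M1.rank_le_card[of "X \<inter> S1"] M2.rank_le_card[of "X \<inter> S2"] by simp
  next
    fix X Y assume "X \<subseteq> Y" "Y \<subseteq> S1 \<union> S2"
    then have "X \<inter> S1 \<subseteq> Y \<inter> S1" "X \<inter> S2 \<subseteq> Y \<inter> S2" by auto
    then show "r1 (X \<inter> S1) + r2 (X \<inter> S2) \<le> r1 (Y \<inter> S1) + r2 (Y \<inter> S2)"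
      by (intro add_mono M1.rank_mono M2.rank_mono) auto
  next
    fix X Y
    show "r1 ((X \<union> Y) \<inter> S1) + r2 ((X \<union> Y) \<inter> S2) + (r1 (X \<inter> Y \<inter> S1) + r2 (X \<inter> Y \<inter> S2))
      \<le> r1 (X \<inter> S1) + r2 (X \<inter> S2) + (r1 (Y \<inter> S1) + r2 (Y \<inter> S2))"
    proof -
      have "(X \<union> Y) \<inter> T = X \<inter> T \<union> Y \<inter> T" "X \<inter> Y \<inter> T = (X \<inter> T) \<inter> (Y \<inter> T)" for T by auto
      then show ?thesis
        using M1.rank_submodular[of "X \<inter> S1" "Y \<inter> S1"] M2.rank_submodular[of "X \<inter> S2" "Y \<inter> S2"] by simp
    qed
  qed
qed

text \<open>The two summands are extended separately, each for its own parts of \<open>A\<close> and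
  \<open>B\<close>. The union of the witnesses serves the sum because all ranks involved are
  additive.\<close>

lemma modular_extendable_direct_sum:
  fixes S1 S2 :: "'a::infinite set"
  assumes "matroid S1 r1" "matroid S2 r2" "S1 \<inter> S2 = {}" "modular_extendable k S1 r1" "modular_extendable k S2 r2"
  shows "modular_extendable k (S1 \<union> S2) (\<lambda>X. r1 (X \<inter> S1) + r2 (X \<inter> S2))"
  using assms
proof (induction k arbitrary: S1 S2 r1 r2)
  case 0 then show ?case by simp
next
  case (Suc k)
  have fin: "finite S1" "finite S2" using matroid.finite_ground[OF Suc.prems(1)] matroid.finite_ground[OF Suc.prems(2)] .
  let ?r = "\<lambda>X. r1 (X \<inter> S1) + r2 (X \<inter> S2)"
  have "\<exists>S' r'. one_step_extension (S1 \<union> S2) ?r A B S' r' \<and> modular_extendable k S' r'"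
    if AB: "A \<subseteq> S1 \<union> S2" "B \<subseteq> S1 \<union> S2" for A B
  proof -
    obtain U1 q1 where "one_step_extension S1 r1 (A \<inter> S1) (B \<inter> S1) U1 q1" "modular_extendable k U1 q1"
      using modular_extendable_SucE[OF Suc.prems(4), of "A \<inter> S1" "B \<inter> S1"] by auto
    then obtain T1 s1 where e1: "one_step_extension S1 r1 (A \<inter> S1) (B \<inter> S1) T1 s1" "modular_extendable k T1 s1"
      "(T1 - S1) \<inter> (S1 \<union> S2) = {}"
      using one_step_extension_rename[of S1 r1 "A \<inter> S1" "B \<inter> S1" U1 q1 k "S1 \<union> S2"] fin by auto
    have M1: "matroid T1 s1" "S1 \<subseteq> T1" using e1 by (auto simp: one_step_extension_def)
    obtain U2 q2 where "one_step_extension S2 r2 (A \<inter> S2) (B \<inter> S2) U2 q2" "modular_extendable k U2 q2"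
      using modular_extendable_SucE[OF Suc.prems(5), of "A \<inter> S2" "B \<inter> S2"] by auto
    then obtain T2 s2 where e2: "one_step_extension S2 r2 (A \<inter> S2) (B \<inter> S2) T2 s2" "modular_extendable k T2 s2"
      "(T2 - S2) \<inter> T1 = {}"
      using one_step_extension_rename[of S2 r2 "A \<inter> S2" "B \<inter> S2" U2 q2 k T1] matroid.finite_ground[OF M1(1)] by auto
    have M2: "matroid T2 s2" "S2 \<subseteq> T2" using e2 by (auto simp: one_step_extension_def)
    have dis: "T1 \<inter> T2 = {}" using e1(3) e2(3) Suc.prems(3) M1(2) by blast
    let ?s = "\<lambda>X. s1 (X \<inter> T1) + s2 (X \<inter> T2)"
    have s: "s1 X = r1 X" if "X \<subseteq> S1" for X using e1 that by (simp add: one_step_extension_def)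
    have s': "s2 X = r2 X" if "X \<subseteq> S2" for X using e2 that by (simp add: one_step_extension_def)
    obtain Z1 where Z1: "Z1 \<subseteq> T1" "s1 ((A \<inter> S1) \<union> Z1) = r1 (A \<inter> S1)" "s1 ((B \<inter> S1) \<union> Z1) = r1 (B \<inter> S1)"
      "s1 Z1 + r1 ((A \<inter> S1) \<union> (B \<inter> S1)) = r1 (A \<inter> S1) + r1 (B \<inter> S1)"
      using e1 by (auto simp: one_step_extension_def)
    obtain Z2 where Z2: "Z2 \<subseteq> T2" "s2 ((A \<inter> S2) \<union> Z2) = r2 (A \<inter> S2)" "s2 ((B \<inter> S2) \<union> Z2) = r2 (B \<inter> S2)"
      "s2 Z2 + r2 ((A \<inter> S2) \<union> (B \<inter> S2)) = r2 (A \<inter> S2) + r2 (B \<inter> S2)"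
      using e2 by (auto simp: one_step_extension_def)
    have int: "(C \<union> (Z1 \<union> Z2)) \<inter> T1 = (C \<inter> S1) \<union> Z1" "(C \<union> (Z1 \<union> Z2)) \<inter> T2 = (C \<inter> S2) \<union> Z2"
      if "C \<subseteq> S1 \<union> S2" for C using that Z1(1) Z2(1) dis M1(2) M2(2) by blast+
    have int0: "(Z1 \<union> Z2) \<inter> T1 = Z1" "(Z1 \<union> Z2) \<inter> T2 = Z2" using Z1(1) Z2(1) dis by blast+
    have "one_step_extension (S1 \<union> S2) ?r A B (T1 \<union> T2) ?s"
      unfolding one_step_extension_def
    proof (intro conjI allI impI exI[of _ "Z1 \<union> Z2"])
      show "matroid (T1 \<union> T2) ?s" using matroid_direct_sum M1 M2 dis by blast
      show "S1 \<union> S2 \<subseteq> T1 \<union> T2" using M1 M2 by blast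
      fix X assume X: "X \<subseteq> S1 \<union> S2"
      have "X \<inter> T1 = X \<inter> S1" "X \<inter> T2 = X \<inter> S2" using X dis M1(2) M2(2) by blast+
      then show "?s X = ?r X" using s[of "X \<inter> S1"] s'[of "X \<inter> S2"] by simp
    next
      show "Z1 \<union> Z2 \<subseteq> T1 \<union> T2" using Z1 Z2 by blast
      show "?s (A \<union> (Z1 \<union> Z2)) = ?r A" "?s (B \<union> (Z1 \<union> Z2)) = ?r B" using int AB Z1 Z2 by simp_all
      show "?s (Z1 \<union> Z2) + ?r (A \<union> B) = ?r A + ?r B" using int0 Z1(4) Z2(4) by (simp add: Int_Un_distrib2)
    qed
    moreover have "modular_extendable k (T1 \<union> T2) ?s" using Suc.IH[OF M1(1) M2(1) dis e1(2) e2(2)] .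
    ultimately show ?thesis by blast
  qed
  then show ?case by simp
qed

lemma modular_extendable_Union:
  fixes F :: "'a::infinite set set"
  assumes "finite F" "\<And>K. K \<in> F \<Longrightarrow> matroid K r \<and> modular_extendable k K r"
    "\<And>K K'. \<lbrakk>K \<in> F; K' \<in> F; K \<noteq> K'\<rbrakk> \<Longrightarrow> K \<inter> K' = {}"
  shows "matroid (\<Union>F) (\<lambda>X. \<Sum>K\<in>F. r (X \<inter> K)) \<and> modular_extendable k (\<Union>F) (\<lambda>X. \<Sum>K\<in>F. r (X \<inter> K))"
  using assms
proof (induction F)
  case empty
  have "modular_extendable k {} (\<lambda>X::'a set. 0::nat)"
  proof (induction k)
    case (Suc k)
    have "one_step_extension {} (\<lambda>X::'a set. 0::nat) {} {} {} (\<lambda>X. 0)"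
      by (auto simp: one_step_extension_def intro!: matroid.intro)
    then show ?case using Suc by auto
  qed simp
  then show ?case by (auto intro!: matroid.intro)
next
  case (insert K F)
  let ?s = "\<lambda>X. \<Sum>K\<in>F. r (X \<inter> K)"
  have F: "matroid (\<Union>F) ?s" "modular_extendable k (\<Union>F) ?s" using insert by auto
  have K: "matroid K r" "modular_extendable k K r" using insert by auto
  have dis: "K \<inter> \<Union>F = {}" using insert.prems(2)[of K] insert.hyps(2) by blast
  have eq: "(\<lambda>X. \<Sum>K\<in>insert K F. r (X \<inter> K)) = (\<lambda>X. r (X \<inter> K) + ?s (X \<inter> \<Union>F))"
  proof
    fix X
    have "?s (X \<inter> \<Union>F) = ?s X" by (intro sum.cong refl arg_cong[of _ _ r]) auto
    then show "(\<Sum>K\<in>insert K F. r (X \<inter> K)) = r (X \<inter> K) + ?s (X \<inter> \<Union>F)" using insert.hyps by simp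
  qed
  show ?case
    unfolding eq using matroid_direct_sum[OF K(1) F(1) dis] modular_extendable_direct_sum[OF K(1) F(1) dis K(2) F(2)] by simp
qed

lemma modular_extendable_components:
  fixes S :: "'a::infinite set"
  assumes M: "matroid S r" and K: "\<And>K. K \<in> components S r \<Longrightarrow> modular_extendable k K r"
  shows "modular_extendable k S r"
proof -
  interpret matroid S r by fact
  have "modular_extendable k (\<Union> (components S r)) (\<lambda>X. \<Sum>K\<in>components S r. r (X \<inter> K))"
    using modular_extendable_Union[of "components S r" r k] K finite_components components_disjoint
      matroid_restrict components_ground by blast
  then show ?thesis
    using modular_extendable_cong[OF finite_ground rank_components] Union_components by simp
qed

section \<open>Extensions within rank three\<close>

lemma one_step_extensionI:
  assumes "matroid S' r'" "S \<subseteq> S'" "\<And>X. X \<subseteq> S \<Longrightarrow> r' X = r X" "Z \<subseteq> S'"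
    "r' (A \<union> Z) = r A" "r' (B \<union> Z) = r B" "r' Z + r (A \<union> B) = r A + r B"
  shows "one_step_extension S r A B S' r'"
  using assms unfolding one_step_extension_def by blast

text \<open>In rank at most three the only failure of modularity is a pair of lines without a common
  point. Adjoining their intersection repairs it and does not raise the rank, so the construction
  can be repeated.\<close>

lemma rank_three_one_step_extension:
  fixes S :: "'a::infinite set"
  assumes M: "matroid S r" and r3: "r S \<le> 3" and AB: "A \<subseteq> S" "B \<subseteq> S"
  shows "\<exists>S' r'. one_step_extension S r A B S' r' \<and> r' S' \<le> 3"
proof -
  interpret matroid S r by fact
  have trivial: ?thesis if "Z \<subseteq> S" "r (A \<union> Z) = r A" "r (B \<union> Z) = r B" "r Z + r (A \<union> B) = r A + r B" for Z
    using one_step_extensionI[OF M subset_refl _ that] r3 by blast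
  have rU: "r (A \<union> B) \<le> 3" "r A \<le> r (A \<union> B)" "r B \<le> r (A \<union> B)" "r (A \<union> B) + r (A \<inter> B) \<le> r A + r B"
    using rank_mono[of "A \<union> B" S] rank_mono[of A "A \<union> B"] rank_mono[of B "A \<union> B"] rank_submodular AB r3 by auto
  show ?thesis
  proof (cases "r (A \<union> B) = r A + r B \<or> r (A \<union> B) = r A \<or> r (A \<union> B) = r B")
    case True
    \<comment> \<open>If the ranks add up, the witness is empty. Otherwise one of the sets spans the
      other, and the spanned one is the witness.\<close>
    then show ?thesis using trivial[of "{}"] trivial[of A] trivial[of B] AB by (auto simp: Un_commute)
  next
    case False
    \<comment> \<open>The union has rank at most three, more than either set and less than the sum;
      this leaves only two lines in a plane.\<close>
    then have r2: "r A = 2" "r B = 2" "r (A \<union> B) = 3" using rU by auto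
    show ?thesis
    proof (cases "\<exists>z\<in>S. r {z} = 1 \<and> r (insert z A) = r A \<and> r (insert z B) = r B")
      case True
      then obtain z where "z \<in> S" "r {z} = 1" "r (insert z A) = r A" "r (insert z B) = r B" by blast
      then show ?thesis using trivial[of "{z}"] r2 by simp
    next
      case no: False
      obtain z where z: "z \<notin> S" using arb_element[OF finite_ground] by blast
      \<comment> \<open>The sets whose closure contains the line \<open>A\<close> or the line
        \<open>B\<close>. They form a modular cut exactly because the lines have no common point
        yet.\<close>
      define m where "m X \<longleftrightarrow> r (A \<union> X) = r X \<or> r (B \<union> X) = r X" for X
      have le2: "r X \<ge> 2" if "m X" "X \<subseteq> S" for X
        using that rank_mono[of A "A \<union> X"] rank_mono[of B "B \<union> X"] AB r2 by (auto simp: m_def)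
      have clA: "r (A \<union> X) = r A" if X: "X \<subseteq> S" "r X = 2" "r (A \<union> X) = r X" for X using that r2 by simp
      have "\<exists>r'. matroid (insert z S) r' \<and> (\<forall>X\<subseteq>S. r' X = r X \<and> r' (insert z X) = (if m X then r X else Suc (r X)))"
      proof (rule single_element_extension[OF z, of m])
        fix X Y assume "m X" "X \<subseteq> Y" "Y \<subseteq> S"
        then show "m Y" using rank_Un_mono_closure[of X Y A] rank_Un_mono_closure[of X Y B] AB
          by (auto simp: m_def Un_commute)
      next
        fix X Y assume Y: "m Y" "X \<subseteq> Y" "Y \<subseteq> S" "r X = r Y"
        have "r (C \<union> X) = r X" if "C \<subseteq> S" "r (C \<union> Y) = r Y" for C
          using rank_mono[of "C \<union> X" "C \<union> Y", OF Un_mono] rank_mono[of X "C \<union> X"] that Y by auto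
        then show "m X" using Y AB by (auto simp: m_def)
      next
        fix X Y assume XY: "m X" "m Y" "X \<subseteq> S" "Y \<subseteq> S" and mod: "r X + r Y = r (X \<union> Y) + r (X \<inter> Y)"
        have b: "r X \<ge> 2" "r Y \<ge> 2" "r X \<le> 3" "r Y \<le> 3" "r (X \<union> Y) \<le> 3"
          using le2 XY rank_mono[of X S] rank_mono[of Y S] rank_mono[of "X \<union> Y" S] r3 by auto
        have I: "X \<inter> Y \<subseteq> S" using XY by blast
        have mono: "r X \<le> r (X \<union> Y)" "r Y \<le> r (X \<union> Y)" using rank_mono[of X "X \<union> Y"] rank_mono[of Y "X \<union> Y"] XY by auto
        have sameX: "m (X \<inter> Y)" if eq: "r (X \<inter> Y) = r X"
        proof -
          have "r (C \<union> (X \<inter> Y)) = r (X \<inter> Y)" if "C \<subseteq> S" "r (C \<union> X) = r X" for C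
            using rank_mono[of "C \<union> (X \<inter> Y)" "C \<union> X", OF Un_mono] rank_mono[OF Un_upper2, of C "X \<inter> Y"] that XY I eq by auto
          then show ?thesis using XY AB by (auto simp: m_def)
        qed
        have sameY: "m (X \<inter> Y)" if eq: "r (X \<inter> Y) = r Y"
        proof -
          have "r (C \<union> (X \<inter> Y)) = r (X \<inter> Y)" if "C \<subseteq> S" "r (C \<union> Y) = r Y" for C
            using rank_mono[of "C \<union> (X \<inter> Y)" "C \<union> Y", OF Un_mono] rank_mono[OF Un_upper2, of C "X \<inter> Y"] that XY I eq by auto
          then show ?thesis using XY AB by (auto simp: m_def)
        qed
        show "m (X \<inter> Y)"
        proof (cases "r X = 3 \<or> r Y = 3 \<or> r (X \<union> Y) = 2")
          case True
          then show ?thesis using sameX sameY b mono mod by fastforce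
        next
          case False
          then have r22: "r X = 2" "r Y = 2" "r (X \<union> Y) = 3" "r (X \<inter> Y) = 1" using b mono mod by auto
          have C2: "r C = 2 \<and> C \<subseteq> S" if "C = A \<or> C = B" for C using that r2 AB by auto
          have abs: "r (C \<union> W) = r C" if "r (C \<union> W) = r W" "r W = 2" "C = A \<or> C = B" for C W using that r2 by auto
          \<comment> \<open>Two sets on the same line have a union of rank two, not three.\<close>
          have both: False if C: "C = A \<or> C = B" "r (C \<union> X) = r X" "r (C \<union> Y) = r Y" for C
          proof -
            have "r (C \<union> X) = r C" "r (C \<union> Y) = r C" using abs C r22 by auto
            then have "r (C \<union> X \<union> Y) = r (C \<union> X)" using rank_Un_mono_closure[of C "C \<union> X" Y] C2 C XY by auto
            moreover have "r (X \<union> Y) \<le> r (C \<union> X \<union> Y)" using C2[OF C(1)] XY by (intro rank_mono) auto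
            ultimately show False using r22 C by simp
          qed
          \<comment> \<open>If \<open>X\<close> is on one line and \<open>Y\<close> on the other, an
            element of rank one in \<open>X \<inter> Y\<close> is a common point of the lines,
            contrary to \<open>no\<close>.\<close>
          have split: False if C: "(C = A \<and> D = B) \<or> (C = B \<and> D = A)" "r (C \<union> X) = r X" "r (D \<union> Y) = r Y" for C D
          proof -
            obtain I where I': "I \<subseteq> X \<inter> Y" "indep S r I" "card I = 1" using basis[OF I] r22 by metis
            then obtain z where zI: "I = {z}" by (auto simp: card_1_singleton_iff)
            have z: "z \<in> X" "z \<in> Y" "z \<in> S" "r {z} = 1" using I' zI XY by (auto simp: indep_def)
            have "r (C \<union> X) = r C" "r (D \<union> Y) = r D" using abs C r22 by auto
            then have "r (insert z C) = r C" "r (insert z D) = r D"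
              using rank_insert_eq_Un[of C X z] rank_insert_eq_Un[of D Y z] C AB XY z by auto
            then show False using no z C by auto
          qed
          show ?thesis using XY(1,2) both[of A] both[of B] split[of A B] split[of B A] by (auto simp: m_def)
        qed
      qed
      then obtain r' where r': "matroid (insert z S) r'" "\<And>X. X \<subseteq> S \<Longrightarrow> r' X = r X"
        "\<And>X. X \<subseteq> S \<Longrightarrow> r' (insert z X) = (if m X then r X else Suc (r X))" by blast
      have "m A" "m B" "\<not> m {}" using r2 by (auto simp: m_def)
      moreover have "m S" using AB by (simp add: m_def Un_absorb1)
      ultimately have "r' (A \<union> {z}) = r A" "r' (B \<union> {z}) = r B" "r' {z} = 1" "r' (insert z S) \<le> 3"
        using r'(3)[of A] r'(3)[of B] r'(3)[of "{}"] r'(3)[of S] AB r3 by auto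
      then show ?thesis
        using one_step_extensionI[OF r'(1) subset_insertI r'(2), of "{z}" A B] r2 by (intro exI[of _ "insert z S"] exI[of _ r']) auto
    qed
  qed
qed

lemma modular_extendable_rank_three:
  fixes S :: "'a::infinite set"
  shows "\<lbrakk>matroid S r; r S \<le> 3\<rbrakk> \<Longrightarrow> modular_extendable k S r"
proof (induction k arbitrary: S r)
  case 0 then show ?case by simp
next
  case (Suc k)
  have "\<exists>S' r'. one_step_extension S r A B S' r' \<and> modular_extendable k S' r'" if AB: "A \<subseteq> S" "B \<subseteq> S" for A B
  proof -
    obtain S' r' where "one_step_extension S r A B S' r'" "r' S' \<le> 3"
      using rank_three_one_step_extension[OF Suc.prems AB] by blast
    then show ?thesis using Suc.IH[of S' r'] by (auto simp: one_step_extension_def)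
  qed
  then show ?case by simp
qed

section \<open>Extensions within a fixed vector space\<close>

locale represented_matroid = matroid S r + concrete_right_vector_space R V act
  for S :: "'a set" and r and R :: "'f ring" and V :: "'v ring" and act +
  fixes f :: "'a \<Rightarrow> 'v"
  assumes repr: "representation_of R V act f S r"
begin

lemma f_carrier: "X \<subseteq> S \<Longrightarrow> f \<in> X \<rightarrow> carrier V"
  using repr by (auto simp: representation_of_def)

lemma indep_repr: "X \<subseteq> S \<Longrightarrow> indep S r X \<longleftrightarrow> lin_indep_family R V act f X"
  using repr by (auto simp: representation_of_def)

lemma lspan_insert_indep:
  assumes "indep S r B" "x \<in> S"
  shows "f x \<in> lspan f B \<longleftrightarrow> r (insert x B) = r B"
proof (cases "x \<in> B")
  case True
  then show ?thesis using assms lspan_base[of B f x] f_carrier finite_subset_ground by (simp add: indep_def insert_absorb)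
next
  case False
  have B: "B \<subseteq> S" "finite B" using assms finite_subset_ground by (auto simp: indep_def)
  then have "indep S r (insert x B) \<longleftrightarrow> f x \<notin> lspan f B"
    using indep_repr[of "insert x B"] indep_repr[of B] lin_indep_insert[of B f x] f_carrier[of "insert x B"] assms False by simp
  moreover have "indep S r (insert x B) \<longleftrightarrow> r (insert x B) \<noteq> r B"
    using indep_insert[OF assms] B False assms by (auto simp: indep_def)
  ultimately show ?thesis by blast
qed

lemma lspan_basis:
  assumes B: "B \<subseteq> X" "indep S r B" "r B = r X" and X: "X \<subseteq> S"
  shows "lspan f X = lspan f B"
proof
  have fin: "finite X" "finite B" using X B finite_subset_ground finite_subset by blast+
  have car: "f \<in> X \<rightarrow> carrier V" "f \<in> B \<rightarrow> carrier V" using f_carrier X B by auto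
  show "lspan f B \<subseteq> lspan f X" using lspan_mono fin B car by blast
  have "f x \<in> lspan f B" if x: "x \<in> X" for x
  proof -
    have "r B \<le> r (insert x B)" "r (insert x B) \<le> r X"
      using rank_mono[of B "insert x B", OF subset_insertI] rank_mono[of "insert x B" X] B X x by auto
    then show ?thesis using lspan_insert_indep[OF B(2)] x X B by auto
  qed
  then show "lspan f X \<subseteq> lspan f B" using lspan_subset_lspan fin car by blast
qed

lemma lspan_closure:
  assumes "X \<subseteq> Y" "Y \<subseteq> S" "r X = r Y"
  shows "lspan f X = lspan f Y"
proof -
  obtain B where B: "B \<subseteq> X" "indep S r B" "r B = r X" using basis[of X] assms by (metis order_trans)
  then show ?thesis using lspan_basis[of B X] lspan_basis[of B Y] assms by auto
qed

text \<open>Extend a basis of \<open>X \<inter> Y\<close> to bases of \<open>X\<close> and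
  \<open>Y\<close>. For a modular pair their union is independent by counting, so
  \<open>lspan_Int\<close> applies and \<open>v\<close> is in the span of the common part.\<close>

lemma lspan_modular_cut:
  assumes X: "X \<subseteq> S" and Y: "Y \<subseteq> S" and mod: "r X + r Y = r (X \<union> Y) + r (X \<inter> Y)"
    and v: "v \<in> lspan f X" "v \<in> lspan f Y"
  shows "v \<in> lspan f (X \<inter> Y)"
proof -
  have I0: "X \<inter> Y \<subseteq> S" using X by blast
  obtain I where I: "I \<subseteq> X \<inter> Y" "indep S r I" "r I = r (X \<inter> Y)" using basis[OF I0] by metis
  obtain IX where IX: "I \<subseteq> IX" "IX \<subseteq> X" "indep S r IX" "r IX = r X" using basis_extension[OF I(2) _ X] I by auto
  obtain IY where IY: "I \<subseteq> IY" "IY \<subseteq> Y" "indep S r IY" "r IY = r Y" using basis_extension[OF I(2) _ Y] I by auto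
  have fin: "finite IX" "finite IY" using IX IY finite_subset_ground unfolding indep_def by auto
  have cards: "card IX = r X" "card IY = r Y" "card I = r (X \<inter> Y)" using I IX IY by (auto simp: indep_def)
  have "indep S r (IX \<inter> IY)" using indep_subset[OF IX(3)] by blast
  then have "card (IX \<inter> IY) = r (IX \<inter> IY)" by (simp add: indep_def)
  also have "\<dots> \<le> r (X \<inter> Y)" by (rule rank_mono) (use IX IY X in auto)
  finally have "I = IX \<inter> IY" using cards IX IY fin by (intro card_seteq) auto
  let ?J = "IX \<union> IY"
  have J: "?J \<subseteq> S" using IX IY X Y by blast
  have "card ?J + r (X \<inter> Y) = r X + r Y"
    using card_Un_Int[OF fin] cards \<open>I = IX \<inter> IY\<close> by simp
  then have cJ: "card ?J = r (X \<union> Y)" using mod by simp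
  have "r (IX \<union> X) = r IX" "r (IY \<union> Y) = r IY" using IX IY by (simp_all add: Un_absorb1)
  then have "r (?J \<union> X) = r ?J" "r (?J \<union> X \<union> Y) = r (?J \<union> X)"
    using rank_Un_mono_closure[of IX ?J X] rank_Un_mono_closure[of IY "?J \<union> X" Y] J X Y by auto
  moreover have "?J \<union> X \<union> Y = X \<union> Y" using IX IY by blast
  ultimately have "indep S r ?J" using cJ J by (simp add: indep_def)
  then have L: "lin_indep_family R V act f ?J" using indep_repr J by blast
  have "v \<in> lspan f IX" "v \<in> lspan f IY" using v lspan_basis[OF IX(2-4) X] lspan_basis[OF IY(2-4) Y] by auto
  then have "v \<in> lspan f (IX \<inter> IY)" using lspan_Int[OF _ f_carrier[OF J] L] fin by blast
  then show ?thesis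
    using \<open>I = IX \<inter> IY\<close> lspan_basis[OF I I0] by simp
qed

text \<open>Extend \<open>Z\<close> to bases of \<open>A \<union> Z\<close> and
  \<open>B \<union> Z\<close>. Either they share an element outside \<open>Z\<close>, whose vector
  is as required, or their union has \<open>r A + r B - card Z\<close> elements, more than its rank,
  and the dependence yields a vector by \<open>lspan_Int_larger\<close>.\<close>

lemma lspan_common:
  assumes A: "A \<subseteq> S" and B: "B \<subseteq> S" and Z: "indep S r Z" "r (A \<union> Z) = r A" "r (B \<union> Z) = r B"
    and less: "card Z + r (A \<union> B) < r A + r B"
  shows "\<exists>v. v \<in> lspan f A \<and> v \<in> lspan f B \<and> v \<notin> lspan f Z"
proof -
  have ZS: "Z \<subseteq> S" using Z by (simp add: indep_def)
  have AZ: "A \<union> Z \<subseteq> S" "B \<union> Z \<subseteq> S" using A B ZS by auto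
  obtain IA where IA: "Z \<subseteq> IA" "IA \<subseteq> A \<union> Z" "indep S r IA" "r IA = r (A \<union> Z)"
    using basis_extension[OF Z(1) _ AZ(1)] by blast
  obtain IB where IB: "Z \<subseteq> IB" "IB \<subseteq> B \<union> Z" "indep S r IB" "r IB = r (B \<union> Z)"
    using basis_extension[OF Z(1) _ AZ(2)] by blast
  have fin: "finite IA" "finite IB" "finite Z" "finite A" "finite B"
    using IA IB A B ZS finite_subset_ground unfolding indep_def by auto
  have LA: "lspan f (A \<union> Z) = lspan f A" "lspan f (B \<union> Z) = lspan f B"
    using lspan_closure[of A "A \<union> Z"] lspan_closure[of B "B \<union> Z"] AZ Z by auto
  let ?A = "IA - Z" and ?B = "IB - Z"
  have sub: "?A \<subseteq> A" "?B \<subseteq> B" "IA \<subseteq> S" "IB \<subseteq> S" using IA IB AZ by auto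
  show ?thesis
  proof (cases "?A \<inter> ?B = {}")
    case False
    then obtain x where x: "x \<in> ?A" "x \<in> ?B" by blast
    then have xS: "x \<in> A" "x \<in> B" "x \<in> S" "x \<notin> Z" using sub A by auto
    have "indep S r (insert x Z)" using indep_subset[OF IA(3)] IA x by blast
    then have "r (insert x Z) \<noteq> r Z" using Z(1) xS fin by (simp add: indep_def)
    then have "f x \<notin> lspan f Z" using lspan_insert_indep[OF Z(1)] xS by blast
    then show ?thesis using lspan_base[OF _ f_carrier[OF A]] lspan_base[OF _ f_carrier[OF B]] fin xS by blast
  next
    case True
    have eq: "Z \<union> ?A = IA" "Z \<union> ?B = IB" using IA IB by auto
    have "card (Z \<union> ?A \<union> ?B) = card Z + card ?A + card ?B"
      using True fin by (subst card_Un_disjoint; (subst card_Un_disjoint)?) auto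
    moreover have "card IA = card Z + card ?A" "card IB = card Z + card ?B"
      using card_Diff_subset[OF fin(3) IA(1)] card_Diff_subset[OF fin(3) IB(1)] card_mono[OF fin(1) IA(1)] card_mono[OF fin(2) IB(1)] by auto
    moreover have "card IA = r A" "card IB = r B" using IA IB Z by (auto simp: indep_def)
    ultimately have "card (Z \<union> ?A \<union> ?B) > r (A \<union> B)" using less by linarith
    moreover have "r (A \<union> B \<union> Z) = r (A \<union> B)"
      using rank_Un_mono_closure[of A "A \<union> B" Z] A B ZS Z by auto
    moreover have "r (Z \<union> ?A \<union> ?B) \<le> r (A \<union> B \<union> Z)" using A B ZS sub by (intro rank_mono) auto
    ultimately have "\<not> indep S r (Z \<union> ?A \<union> ?B)" by (simp add: indep_def)
    moreover have XS: "Z \<union> ?A \<union> ?B \<subseteq> S" using sub ZS by blast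
    ultimately have dep: "\<not> lin_indep_family R V act f (Z \<union> ?A \<union> ?B)" using indep_repr by blast
    have ind: "lin_indep_family R V act f (Z \<union> ?A)" "lin_indep_family R V act f (Z \<union> ?B)"
      using indep_repr IA IB sub unfolding eq by auto
    obtain v where v: "v \<in> lspan f ?A" "v \<in> lspan f (Z \<union> ?B)" "v \<notin> lspan f Z"
      using lspan_Int_larger[OF _ _ _ _ _ True f_carrier[OF XS] ind dep] fin by auto
    have "v \<in> lspan f A" using lspan_mono[OF fin(4) sub(1) f_carrier[OF A]] v by blast
    moreover have "v \<in> lspan f B" using v(2) lspan_basis[OF IB(2-4) AZ(2)] LA unfolding eq by simp
    ultimately show ?thesis using v by blast
  qed
qed

lemma lin_indep_cong:
  assumes "finite X" "\<And>x. x \<in> X \<Longrightarrow> f x = g x" "f \<in> X \<rightarrow> carrier V"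
  shows "lin_indep_family R V act f X \<longleftrightarrow> lin_indep_family R V act g X"
proof -
  have "lc f c X = lc g c X" if "c \<in> X \<rightarrow> carrier R" for c
    unfolding lc_def using assms that by (intro V.finsum_cong') (auto simp: act_closed Pi_iff)
  then show ?thesis unfolding lin_indep_iff by auto
qed

text \<open>The sets whose span contains \<open>v\<close> form a modular cut, so adding an element
  by this cut and representing it by \<open>v\<close> are the same extension.\<close>

lemma represented_extension:
  assumes z: "z \<notin> S" and v: "v \<in> carrier V"
  obtains r' where "represented_matroid (insert z S) r' R V act (f(z := v))" "\<And>X. X \<subseteq> S \<Longrightarrow> r' X = r X"
    "\<And>X. X \<subseteq> S \<Longrightarrow> r' (insert z X) = (if v \<in> lspan f X then r X else Suc (r X))"
proof -
  have "\<exists>r'. matroid (insert z S) r' \<and>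
    (\<forall>X\<subseteq>S. r' X = r X \<and> r' (insert z X) = (if v \<in> lspan f X then r X else Suc (r X)))"
  proof (rule single_element_extension[OF z, of "\<lambda>X. v \<in> lspan f X"])
    fix X Y assume "v \<in> lspan f X" "X \<subseteq> Y" "Y \<subseteq> S"
    then show "v \<in> lspan f Y" using lspan_mono[of Y X f] finite_subset_ground[of Y] f_carrier[of Y] by blast
  next
    fix X Y assume "v \<in> lspan f Y" "X \<subseteq> Y" "Y \<subseteq> S" "r X = r Y"
    then show "v \<in> lspan f X" using lspan_closure by blast
  next
    fix X Y assume "v \<in> lspan f X" "v \<in> lspan f Y" "X \<subseteq> S" "Y \<subseteq> S" "r X + r Y = r (X \<union> Y) + r (X \<inter> Y)"
    then show "v \<in> lspan f (X \<inter> Y)" using lspan_modular_cut by blast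
  qed
  then obtain r' where r': "matroid (insert z S) r'" "\<And>X. X \<subseteq> S \<Longrightarrow> r' X = r X"
    "\<And>X. X \<subseteq> S \<Longrightarrow> r' (insert z X) = (if v \<in> lspan f X then r X else Suc (r X))" by blast
  let ?f = "f(z := v)"
  have cong: "lin_indep_family R V act f X \<longleftrightarrow> lin_indep_family R V act ?f X" if "X \<subseteq> S" for X
    using that z finite_subset_ground f_carrier by (intro lin_indep_cong) auto
  have lspan_cong: "lspan ?f X = lspan f X" if "X \<subseteq> S" for X
  proof -
    have "lc ?f c X = lc f c X" if "c \<in> X \<rightarrow> carrier R" for c
      unfolding lc_def using f_carrier[OF \<open>X \<subseteq> S\<close>] that z \<open>X \<subseteq> S\<close>
      by (intro V.finsum_cong') (auto simp: act_closed Pi_iff)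
    then show ?thesis unfolding lspan_def by (intro Collect_cong) metis
  qed
  have "indep (insert z S) r' X \<longleftrightarrow> lin_indep_family R V act ?f X" if X: "X \<subseteq> insert z S" for X
  proof (cases "z \<in> X")
    case False
    then have "X \<subseteq> S" using X by blast
    then show ?thesis using r'(2)[of X] indep_repr[of X] cong[of X] by (auto simp: indep_def)
  next
    case True
    let ?Y = "X - {z}"
    have Y: "?Y \<subseteq> S" "insert z ?Y = X" using X True by auto
    have finY: "finite ?Y" using finite_subset_ground[OF Y(1)] .
    have car: "?f \<in> insert z ?Y \<rightarrow> carrier V" using f_carrier[OF Y(1)] v by auto
    have "r ?Y \<le> card ?Y" using rank_le_card Y by blast
    moreover have "card X = Suc (card ?Y)" using Y finY by (metis Diff_iff card_insert_disjoint singletonI)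
    ultimately have "indep (insert z S) r' X \<longleftrightarrow> v \<notin> lspan f ?Y \<and> indep S r ?Y"
      using r'(3)[OF Y(1)] Y X by (auto simp: indep_def)
    also have "\<dots> \<longleftrightarrow> lin_indep_family R V act ?f ?Y \<and> ?f z \<notin> lspan ?f ?Y"
      using indep_repr[OF Y(1)] cong[OF Y(1)] lspan_cong[OF Y(1)] by auto
    also have "\<dots> \<longleftrightarrow> lin_indep_family R V act ?f (insert z ?Y)"
      using lin_indep_insert[OF finY car] by blast
    finally show ?thesis using Y by simp
  qed
  then have "representation_of R V act ?f (insert z S) r'"
    using f_carrier[OF subset_refl] v by (auto simp: representation_of_def)
  then have "represented_matroid (insert z S) r' R V act ?f"
    using r'(1) concrete_right_vector_space_axioms
    by (simp add: represented_matroid_def represented_matroid_axioms_def)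
  then show thesis using that r' by blast
qed

end

text \<open>An independent set \<open>Z\<close> inside both closures grows one element at a time,
  each new element being represented by a vector common to the spans of \<open>A\<close> and
  \<open>B\<close> but outside that of \<open>Z\<close>. This continues until \<open>Z\<close>
  reaches the modular rank; the vector space stays the same, so the step can be iterated.\<close>

lemma represented_one_step_extension:
  fixes S :: "'a::infinite set" and R :: "'f ring" and V :: "'v ring"
  assumes "represented_matroid S r R V act f" and AB: "A \<subseteq> S" "B \<subseteq> S"
  shows "\<exists>S' r' f'. one_step_extension S r A B S' r' \<and> represented_matroid S' r' R V act f'"
proof -
  interpret M: represented_matroid S r R V act f by fact
  have le: "r (A \<union> B) \<le> r A + r B" using M.rank_submodular[OF AB] by simp
  have "\<exists>S' r' f' Z. represented_matroid S' r' R V act f' \<and> S \<subseteq> S' \<and> (\<forall>X\<subseteq>S. r' X = r X) \<and>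
      indep S' r' Z \<and> card Z = n \<and> r' (A \<union> Z) = r A \<and> r' (B \<union> Z) = r B"
    if "n + r (A \<union> B) \<le> r A + r B" for n
    using that
  proof (induction n)
    case 0
    then show ?case using assms(1)
      by (intro exI[of _ S] exI[of _ r] exI[of _ f] exI[of _ "{}"]) (auto simp: indep_def)
  next
    case (Suc n)
    then obtain S' r' f' Z where rep: "represented_matroid S' r' R V act f'" and S': "S \<subseteq> S'" "\<forall>X\<subseteq>S. r' X = r X"
      and Z: "indep S' r' Z" "card Z = n" "r' (A \<union> Z) = r A" "r' (B \<union> Z) = r B" by auto
    interpret M': represented_matroid S' r' R V act f' by fact
    have AB': "A \<subseteq> S'" "B \<subseteq> S'" "r' A = r A" "r' B = r B" "r' (A \<union> B) = r (A \<union> B)" using AB S' by auto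
    obtain v where v: "v \<in> M.lspan f' A" "v \<in> M.lspan f' B" "v \<notin> M.lspan f' Z"
      using M'.lspan_common[OF AB'(1,2) Z(1)] Z AB' Suc.prems by auto
    have ZS: "Z \<subseteq> S'" "r' Z = n" "finite Z" using Z M'.finite_subset_ground[of Z] by (auto simp: indep_def)
    have vV: "v \<in> carrier V" using v M.lspan_carrier[OF M'.f_carrier[OF AB'(1)]] by blast
    obtain z where z: "z \<notin> S'" using arb_element[OF M'.finite_ground] by blast
    obtain s where s: "represented_matroid (insert z S') s R V act (f'(z := v))" "\<And>X. X \<subseteq> S' \<Longrightarrow> s X = r' X"
      "\<And>X. X \<subseteq> S' \<Longrightarrow> s (insert z X) = (if v \<in> M.lspan f' X then r' X else Suc (r' X))"
      using M'.represented_extension[OF z vV] by blast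
    have vin: "v \<in> M.lspan f' (C \<union> Z)" if "C \<subseteq> S'" "v \<in> M.lspan f' C" for C
      using M.lspan_mono[of "C \<union> Z" C f'] M'.f_carrier[of "C \<union> Z"] M'.finite_subset_ground[of "C \<union> Z"] that ZS by auto
    have "s (insert z (A \<union> Z)) = r A" "s (insert z (B \<union> Z)) = r B" "s (insert z Z) = Suc n"
      using s(3)[of "A \<union> Z"] s(3)[of "B \<union> Z"] s(3)[of Z] vin AB' v Z ZS by auto
    moreover have "z \<notin> Z" using z ZS by blast
    then have "card (insert z Z) = Suc n" using ZS Z by simp
    moreover have "s X = r X" if "X \<subseteq> S" for X using s(2)[of X] S' that by auto
    moreover have "indep (insert z S') s (insert z Z)"
      using calculation ZS(1) by (auto simp: indep_def)
    ultimately have "represented_matroid (insert z S') s R V act (f'(z := v)) \<and> S \<subseteq> insert z S' \<and> (\<forall>X\<subseteq>S. s X = r X) \<and>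
        indep (insert z S') s (insert z Z) \<and> card (insert z Z) = Suc n \<and> s (A \<union> insert z Z) = r A \<and> s (B \<union> insert z Z) = r B"
      using s(1) S'(1) by (simp del: fun_upd_apply add: subset_insertI2)
    then show ?case by blast
  qed
  from this[of "r A + r B - r (A \<union> B)"] le obtain S' r' f' Z where *: "represented_matroid S' r' R V act f'" "S \<subseteq> S'"
    "\<forall>X\<subseteq>S. r' X = r X" "indep S' r' Z" "card Z = r A + r B - r (A \<union> B)" "r' (A \<union> Z) = r A" "r' (B \<union> Z) = r B"
    by auto
  have "r' Z + r (A \<union> B) = r A + r B" "Z \<subseteq> S'" using *(4,5) le by (auto simp: indep_def)
  then have "one_step_extension S r A B S' r'"
    using * by (intro one_step_extensionI[of S' r' S r Z]) (auto simp: represented_matroid_def)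
  then show ?thesis using *(1) by blast
qed

lemma modular_extendable_represented:
  fixes S :: "'a::infinite set"
  shows "represented_matroid S r R V act f \<Longrightarrow> modular_extendable k S r"
proof (induction k arbitrary: S r f)
  case 0 then show ?case by simp
next
  case (Suc k)
  have "\<exists>S' r'. one_step_extension S r A B S' r' \<and> modular_extendable k S' r'" if "A \<subseteq> S" "B \<subseteq> S" for A B
    using represented_one_step_extension[OF Suc.prems that] Suc.IH by blast
  then show ?case by simp
qed

theorem components_imp_fully_modular_extendable:
  fixes S :: "'a::infinite set"
  assumes M: "matroid S r"
    and K: "\<forall>K\<in>components S r. r K = 3 \<or> skew_representable TYPE('f::infinite) TYPE('v::infinite) K r"
  shows "fully_modular_extendable S r"
  unfolding fully_modular_extendable_def
proof (intro allI impI modular_extendable_components[OF M])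
  fix k K assume C: "K \<in> components S r"
  then have MK: "matroid K r" using matroid.matroid_restrict[OF M] matroid.components_ground[OF M] by blast
  show "modular_extendable k K r"
  proof (cases "r K = 3")
    case True then show ?thesis using modular_extendable_rank_three[OF MK] by simp
  next
    case False
    then obtain R :: "'f ring" and V :: "'v ring" and act f where
      "right_vector_space R V act" "representation_of R V act f K r"
      using K C unfolding skew_representable_def representable_over_def by blast
    then have "represented_matroid K r R V act f"
      using MK by (simp add: represented_matroid_def represented_matroid_axioms_def concrete_right_vector_space_def)
    then show ?thesis by (rule modular_extendable_represented)
  qed
qed

theorem theorem3p4:
  fixes S :: "'a::infinite set" and r :: "'a set \<Rightarrow> nat"
  assumes "matroid S r"
  shows "(fully_modular_extendable S r \<longleftrightarrow> projectively_embeddable TYPE('p::infinite) S r) \<and>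
         (fully_modular_extendable S r \<longleftrightarrow>
            (\<forall>K \<in> components S r.
               r K = 3 \<or> skew_representable TYPE('f::infinite) TYPE('v::infinite) K r))"
proof -
  have "projectively_embeddable TYPE('p) S r" if "fully_modular_extendable S r"
    using fully_modular_extendable_imp_projectively_embeddable[OF assms that] .
  moreover have "\<forall>K \<in> components S r. r K = 3 \<or> skew_representable TYPE('f) TYPE('v) K r"
    if "projectively_embeddable TYPE('p) S r"
    using projectively_embeddable_imp_components[OF assms that] by blast
  moreover have "fully_modular_extendable S r"
    if "\<forall>K \<in> components S r. r K = 3 \<or> skew_representable TYPE('f) TYPE('v) K r"
    using components_imp_fully_modular_extendable[OF assms that] .
  ultimately show ?thesis by blast
qed

end
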